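(* Let $A$ be a large and connected multicomplex. Then $A$ is complete, minimal and aspherical if and only if the following conditions hold: (1) For every pair of distinct vertices $v_0,v_1$ of $A$ and every continuous path $\gamma\colon[0,1]\to|A|$ with $\gamma(0)=v_0$, $\gamma(1)=v_1$, there exists a unique simplicial embedding $\gamma'\colon\Delta^1\to A$ which is homotopic to $\gamma$ relative to the endpoints. (2) Let $n\geq 2$, let $(\Delta^n)^1$ be the $1$-skeleton of $\Delta^n$ and let $f\colon(\Delta^n)^1\to A$ be a simplicial embedding such that the restriction of $f$ to each triangular loop is null-homotopic. Then there exists a unique simplicial embedding $\overline{f}\colon\Delta^n\to A$ extending $f$.
   Context: **Multicomplexes.** A multicomplex is a triple $K=(V,I,\Omega)$, where $V$ is a set (the vertices), $I=\bigcup_B I_B$ with $B$ ranging over the finite subsets of $V$, each $I_B$ is a (possibly empty) set (the simplices with vertex set $B$), $I_B$ is a singleton when $B$ is a singleton, and $\Omega$ is a family of maps $\partial_{B,C}\colon I_B\to I_C$ (for $B\supseteq C$) such that $\partial_{B,B}=\mathrm{Id}$ and $\partial_{C,D}\circ\partial_{B,C}=\partial_{B,D}$ for $B\supseteq C\supseteq D$. A simplex in $I_B$ has dimension $|B|-1$. A simplicial map $K\to K'$ consists of a map $f\colon V\to V'$ and maps $f_B\colon I_B\to I'_{f(B)}$ commuting with the boundary maps; it is a simplicial embedding if $f$ and all the $f_B$ are injective. The geometric realization $|K|$ is the CW complex obtained by taking one affine simplex with vertex set $B$ for every $\sigma\in I_B$ and gluing the face spanned by $C\subseteq B$ to the simplex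 corresponding to $\partial_{B,C}\sigma$ via the affine map that is the identity on $C$, with the weak topology. Simplicial maps induce continuous maps on geometric realizations; the standard simplex $\Delta^n$, its boundary and its skeleta are regarded as multicomplexes. A triangular loop in $(\Delta^n)^1$ is the boundary of a $2$-dimensional face of $\Delta^n$. **Large.** Every connected component contains infinitely many vertices. **Complete / minimal.** $K$ is complete (resp. minimal) if every continuous map $f\colon|\Delta^n|\to|K|$ ($n\geq 1$) whose restriction to $\partial|\Delta^n|$ is (induced by) a simplicial embedding is homotopic relative to $\partial|\Delta^n|$ to at least one (resp. at most one) simplicial embedding $\Delta^n\to K$. **Aspherical.** $K$ is aspherical if $|K|$ is an Eilenberg–MacLane space of type $(\pi_1(|K|),1)$. *)

theory Defs
  imports "HOL-Analysis.Analysis" "HOL-Algebra.Group"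
begin

section \<open>Multicomplexes and simplicial maps\<close>

record ('v, 's) premulticomplex =
  verts :: "'v set"
  simplices :: "'v set \<Rightarrow> 's set"
  bdry :: "'v set \<Rightarrow> 'v set \<Rightarrow> 's \<Rightarrow> 's"

text \<open>The sets \<open>I\<^sub>B\<close> live in one type and need not be disjoint for different \<open>B\<close>; a simplex is
  therefore always treated as a pair \<open>(B, \<sigma>)\<close>, so that the union of the \<open>I\<^sub>B\<close> is a disjoint one.
  The first conjunct encodes that \<open>B\<close> only ranges over the finite subsets of the vertex set.
  The empty set is allowed for \<open>B\<close>; it contributes nothing to the realization, since there is no
  point in an affine simplex without vertices.\<close>

definition multicomplex :: "('v, 's) premulticomplex \<Rightarrow> bool" where
  "multicomplex K \<longleftrightarrow>
     (\<forall>B. simplices K B \<noteq> {} \<longrightarrow> finite B \<and> B \<subseteq> verts K) \<and>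
     (\<forall>v\<in>verts K. is_singleton (simplices K {v})) \<and>
     (\<forall>B C. C \<subseteq> B \<longrightarrow> bdry K B C \<in> simplices K B \<rightarrow> simplices K C) \<and>
     (\<forall>B. \<forall>\<sigma>\<in>simplices K B. bdry K B B \<sigma> = \<sigma>) \<and>
     (\<forall>B C D. \<forall>\<sigma>\<in>simplices K B. C \<subseteq> B \<longrightarrow> D \<subseteq> C \<longrightarrow>
        bdry K C D (bdry K B C \<sigma>) = bdry K B D \<sigma>)"

type_synonym ('v, 's, 'w, 't) smap = "('v \<Rightarrow> 'w) \<times> ('v set \<Rightarrow> 's \<Rightarrow> 't)"

text \<open>All component functions are extensional (undefined outside their domains), so that equality
  of simplicial maps is equality in HOL. If \<open>B\<close> is not the vertex set of a simplex, then
  \<^term>\<open>simplices K B\<close> is empty and the second conjunct pins down the component at \<open>B\<close>.\<close>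

definition simplicial_map ::
  "('v, 's) premulticomplex \<Rightarrow> ('w, 't) premulticomplex \<Rightarrow> ('v, 's, 'w, 't) smap \<Rightarrow> bool" where
  "simplicial_map K L \<phi> \<longleftrightarrow>
     fst \<phi> \<in> verts K \<rightarrow>\<^sub>E verts L \<and>
     (\<forall>B. snd \<phi> B \<in> simplices K B \<rightarrow>\<^sub>E simplices L (fst \<phi> ` B)) \<and>
     (\<forall>B C. \<forall>\<sigma>\<in>simplices K B. C \<subseteq> B \<longrightarrow>
        snd \<phi> C (bdry K B C \<sigma>) = bdry L (fst \<phi> ` B) (fst \<phi> ` C) (snd \<phi> B \<sigma>))"

definition simplicial_embedding ::
  "('v, 's) premulticomplex \<Rightarrow> ('w, 't) premulticomplex \<Rightarrow> ('v, 's, 'w, 't) smap \<Rightarrow> bool" where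
  "simplicial_embedding K L \<phi> \<longleftrightarrow>
     simplicial_map K L \<phi> \<and> inj_on (fst \<phi>) (verts K) \<and>
     (\<forall>B. inj_on (snd \<phi> B) (simplices K B))"

text \<open>The identity of \<open>L\<close>, used as the inclusion of \<open>L\<close> into any multicomplex containing it.\<close>

definition inclusion :: "('v, 's) premulticomplex \<Rightarrow> ('v, 's, 'v, 's) smap" where
  "inclusion L = ((\<lambda>v\<in>verts L. v), (\<lambda>B. \<lambda>\<sigma>\<in>simplices L B. \<sigma>))"

definition extends_smap ::
  "('v, 's) premulticomplex \<Rightarrow> ('v, 's, 'w, 't) smap \<Rightarrow> ('v, 's, 'w, 't) smap \<Rightarrow> bool" where
  "extends_smap L \<phi> \<psi> \<longleftrightarrow>
     (\<forall>v\<in>verts L. fst \<psi> v = fst \<phi> v) \<and>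
     (\<forall>B. \<forall>\<sigma>\<in>simplices L B. snd \<psi> B \<sigma> = snd \<phi> B \<sigma>)"

section \<open>Simplices, boundaries and skeleta as multicomplexes\<close>

definition full_simplex :: "'v set \<Rightarrow> ('v, unit) premulticomplex" where
  "full_simplex V = \<lparr>verts = V,
     simplices = (\<lambda>B. if B \<subseteq> V then {()} else {}),
     bdry = (\<lambda>B C \<sigma>. \<sigma>)\<rparr>"

text \<open>For a finite vertex set \<open>V\<close> with at least two elements.\<close>

definition simplex_boundary :: "'v set \<Rightarrow> ('v, unit) premulticomplex" where
  "simplex_boundary V = \<lparr>verts = V,
     simplices = (\<lambda>B. if B \<subset> V then {()} else {}),
     bdry = (\<lambda>B C \<sigma>. \<sigma>)\<rparr>"

abbreviation std_simplex :: "nat \<Rightarrow> (nat, unit) premulticomplex" (\<open>\<Delta>\<close>) where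
  "std_simplex n \<equiv> full_simplex {..n}"

abbreviation std_simplex_boundary :: "nat \<Rightarrow> (nat, unit) premulticomplex" (\<open>\<partial>\<Delta>\<close>) where
  "std_simplex_boundary n \<equiv> simplex_boundary {..n}"

definition skeleton :: "nat \<Rightarrow> ('v, 's) premulticomplex \<Rightarrow> ('v, 's) premulticomplex" where
  "skeleton k K = K\<lparr>simplices := (\<lambda>B. if card B \<le> Suc k then simplices K B else {})\<rparr>"

lemma multicomplex_full_simplex: "finite V \<Longrightarrow> multicomplex (full_simplex V)"
  by (auto simp: multicomplex_def full_simplex_def is_singleton_def finite_subset)

lemma multicomplex_simplex_boundary:
  assumes "finite V" "card V \<ge> 2"
  shows "multicomplex (simplex_boundary V)"
proof -
  have "{v} \<subset> V" if "v \<in> V" for v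
    using assms that by (auto simp: psubset_eq)
  then show ?thesis
    using assms
    by (auto simp: multicomplex_def simplex_boundary_def is_singleton_def
        intro: finite_subset dest: psubset_imp_subset subset_psubset_trans)
qed

lemma multicomplex_skeleton:
  assumes K: "multicomplex K"
  shows "multicomplex (skeleton k K)"
proof -
  have "card C \<le> Suc k" if "simplices K B \<noteq> {}" "C \<subseteq> B" "card B \<le> Suc k" for B C
    using that K card_mono[of B C] unfolding multicomplex_def by fastforce
  then show ?thesis
    using K unfolding multicomplex_def skeleton_def Pi_def
    by (simp split: if_split) (metis empty_iff)
qed

lemma simplicial_embedding_inclusion_boundary:
  "simplicial_embedding (\<partial>\<Delta> n) (\<Delta> n) (inclusion (\<partial>\<Delta> n))"
proof -
  have *: "(\<lambda>v\<in>A. v) ` B = B" if "B \<subseteq> A" for A B :: "nat set"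
    using that by (force simp: image_iff)
  show ?thesis
    by (auto simp: simplicial_embedding_def simplicial_map_def inclusion_def full_simplex_def
        simplex_boundary_def inj_on_def * psubset_imp_subset)
qed

lemma simplicial_embedding_inclusion_triangle:
  assumes "T \<subseteq> {..n}" "card T = 3"
  shows "simplicial_embedding (simplex_boundary T) (skeleton 1 (\<Delta> n))
           (inclusion (simplex_boundary T))"
proof -
  have T: "finite T"
    using assms(1) finite_subset by blast
  have id: "(\<lambda>v\<in>T. v) ` B = B" if "B \<subseteq> T" for B
    using that by (force simp: image_iff)
  have sub: "() \<in> simplices (skeleton 1 (\<Delta> n)) B" if "B \<subset> T" for B
    using psubset_card_mono[OF T that] assms that by (auto simp: skeleton_def full_simplex_def)
  have "snd (inclusion (simplex_boundary T)) B \<in>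
      simplices (simplex_boundary T) B \<rightarrow>\<^sub>E simplices (skeleton 1 (\<Delta> n)) ((\<lambda>v\<in>T. v) ` B)" for B
    using sub[of B] id[of B] by (auto simp: inclusion_def simplex_boundary_def)
  moreover have "(\<lambda>v\<in>T. v) \<in> T \<rightarrow>\<^sub>E {..n}"
    using assms by auto
  ultimately show ?thesis
    unfolding simplicial_embedding_def simplicial_map_def
    by (simp add: inclusion_def simplex_boundary_def full_simplex_def skeleton_def inj_on_def)
qed

section \<open>Geometric realization\<close>

text \<open>Points are given by barycentric coordinates. For finite \<open>B\<close> the product topology induces the
  usual topology of an affine simplex.\<close>

definition affine_simplex :: "'v set \<Rightarrow> ('v \<Rightarrow> real) set" where
  "affine_simplex B = {t. (\<forall>v. 0 \<le> t v) \<and> (\<forall>v. v \<notin> B \<longrightarrow> t v = 0) \<and> sum t B = 1}"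

type_synonym ('v, 's) cell_point = "('v set \<times> 's) \<times> ('v \<Rightarrow> real)"

definition cells :: "('v, 's) premulticomplex \<Rightarrow> ('v set \<times> 's) set" where
  "cells K = {(B, \<sigma>). \<sigma> \<in> simplices K B}"

definition disjoint_cells :: "('v, 's) premulticomplex \<Rightarrow> ('v, 's) cell_point topology" where
  "disjoint_cells K =
     sum_topology (\<lambda>(B, \<sigma>). subtopology (powertop_real UNIV) (affine_simplex B)) (cells K)"

text \<open>The affine map that is the identity on \<open>C\<close> does not change barycentric coordinates.\<close>

definition glue :: "('v, 's) premulticomplex \<Rightarrow> ('v, 's) cell_point rel" where
  "glue K = {(((B, \<sigma>), t), ((C, bdry K B C \<sigma>), t)) | B C \<sigma> t.
     \<sigma> \<in> simplices K B \<and> C \<subseteq> B \<and> t \<in> affine_simplex C}"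

definition rpoint :: "('v, 's) premulticomplex \<Rightarrow> ('v, 's) cell_point \<Rightarrow> ('v, 's) cell_point set" where
  "rpoint K x = (glue K \<union> (glue K)\<inverse>)\<^sup>* `` {x}"

definition realization :: "('v, 's) premulticomplex \<Rightarrow> ('v, 's) cell_point set topology" where
  "realization K = topology (\<lambda>U.
     U \<subseteq> rpoint K ` topspace (disjoint_cells K) \<and>
     openin (disjoint_cells K) {x \<in> topspace (disjoint_cells K). rpoint K x \<in> U})"

lemma openin_realization:
  "openin (realization K) U \<longleftrightarrow>
     U \<subseteq> rpoint K ` topspace (disjoint_cells K) \<and>
     openin (disjoint_cells K) {x \<in> topspace (disjoint_cells K). rpoint K x \<in> U}"
proof -
  let ?X = "topspace (disjoint_cells K)"
  have 1: "{x \<in> ?X. rpoint K x \<in> S \<inter> T} =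
      {x \<in> ?X. rpoint K x \<in> S} \<inter> {x \<in> ?X. rpoint K x \<in> T}" for S T
    by auto
  have 2: "{x \<in> ?X. rpoint K x \<in> \<Union>\<K>} = (\<Union>S\<in>\<K>. {x \<in> ?X. rpoint K x \<in> S})" for \<K>
    by auto
  have "istopology (\<lambda>U. U \<subseteq> rpoint K ` ?X \<and>
      openin (disjoint_cells K) {x \<in> ?X. rpoint K x \<in> U})"
    unfolding istopology_def 1 2 by blast
  then show ?thesis
    by (simp add: realization_def)
qed

lemma topspace_realization: "topspace (realization K) = rpoint K ` topspace (disjoint_cells K)"
proof
  show "topspace (realization K) \<subseteq> rpoint K ` topspace (disjoint_cells K)"
    using openin_realization openin_topspace by blast
  have "{x \<in> topspace (disjoint_cells K). rpoint K x \<in> rpoint K ` topspace (disjoint_cells K)}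
      = topspace (disjoint_cells K)"
    by auto
  then show "rpoint K ` topspace (disjoint_cells K) \<subseteq> topspace (realization K)"
    by (intro openin_subset) (simp add: openin_realization)
qed

lemma quotient_map_rpoint: "quotient_map (disjoint_cells K) (realization K) (rpoint K)"
  by (auto simp: quotient_map_def topspace_realization openin_realization)

lemma rpoint_eq_iff:
  "rpoint K x = rpoint K y \<longleftrightarrow> (x, y) \<in> (glue K \<union> (glue K)\<inverse>)\<^sup>*"
proof -
  have "equiv UNIV ((glue K \<union> (glue K)\<inverse>)\<^sup>*)"
    by (intro equivI refl_rtrancl trans_rtrancl sym_rtrancl) (auto intro: symI)
  then show ?thesis
    unfolding rpoint_def by (simp add: eq_equiv_class_iff)
qed

definition vertex_point :: "('v, 's) premulticomplex \<Rightarrow> 'v \<Rightarrow> ('v, 's) cell_point set" where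
  "vertex_point K v = rpoint K (({v}, the_elem (simplices K {v})), indicator {v})"

definition cell_map :: "('v, 's, 'w, 't) smap \<Rightarrow> ('v, 's) cell_point \<Rightarrow> ('w, 't) cell_point" where
  "cell_map \<phi> = (\<lambda>((B, \<sigma>), t).
     ((fst \<phi> ` B, snd \<phi> B \<sigma>), (\<lambda>w. \<Sum>v\<in>{v\<in>B. fst \<phi> v = w}. t v)))"

definition realization_map ::
  "('w, 't) premulticomplex \<Rightarrow> ('v, 's, 'w, 't) smap \<Rightarrow>
     ('v, 's) cell_point set \<Rightarrow> ('w, 't) cell_point set" where
  "realization_map L \<phi> p = (\<Union>x\<in>p. rpoint L (cell_map \<phi> x))"

text \<open>For a simplicial map this is well defined on the quotient.\<close>

lemma realization_map_rpoint:
  assumes K: "multicomplex K" and \<phi>: "simplicial_map K L \<phi>"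
  shows "realization_map L \<phi> (rpoint K x) = rpoint L (cell_map \<phi> x)"
proof -
  have glue: "(cell_map \<phi> y, cell_map \<phi> z) \<in> glue L" if rel: "(y, z) \<in> glue K" for y z
  proof -
    obtain B C \<sigma> t where yz: "y = ((B, \<sigma>), t)" "z = ((C, bdry K B C \<sigma>), t)"
      and B: "\<sigma> \<in> simplices K B" "C \<subseteq> B" "t \<in> affine_simplex C"
      using rel by (auto simp: glue_def)
    have fin: "finite B" "finite C"
    proof -
      show "finite B"
        using K B(1) unfolding multicomplex_def by auto
      then show "finite C"
        using B(2) finite_subset by blast
    qed
    let ?t = "\<lambda>w. \<Sum>v\<in>{v\<in>C. fst \<phi> v = w}. t v"
    have t: "(\<lambda>w. \<Sum>v\<in>{v\<in>B. fst \<phi> v = w}. t v) = ?t"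
      using B fin by (intro ext sum.mono_neutral_right) (auto simp: affine_simplex_def)
    have "sum ?t (fst \<phi> ` C) = sum t C"
      using sum.image_gen[OF fin(2), of t "fst \<phi>"] by simp
    moreover have "?t w = 0" if "w \<notin> fst \<phi> ` C" for w
      using that by (intro sum.neutral) auto
    ultimately have "?t \<in> affine_simplex (fst \<phi> ` C)"
      using B by (auto simp: affine_simplex_def intro: sum_nonneg)
    moreover have "snd \<phi> C (bdry K B C \<sigma>) = bdry L (fst \<phi> ` B) (fst \<phi> ` C) (snd \<phi> B \<sigma>)"
      and "snd \<phi> B \<sigma> \<in> simplices L (fst \<phi> ` B)"
      using \<phi> B by (auto simp: simplicial_map_def)
    ultimately show ?thesis
      using B by (auto simp: glue_def yz cell_map_def t)
  qed
  have "(cell_map \<phi> x, cell_map \<phi> y) \<in> (glue L \<union> (glue L)\<inverse>)\<^sup>*" if "y \<in> rpoint K x" for y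
  proof -
    have "(x, y) \<in> (glue K \<union> (glue K)\<inverse>)\<^sup>*"
      using that by (simp add: rpoint_def)
    then show ?thesis
      by induction (auto intro: rtrancl_into_rtrancl dest: glue)
  qed
  then have "rpoint L (cell_map \<phi> y) = rpoint L (cell_map \<phi> x)" if "y \<in> rpoint K x" for y
    using that by (metis rpoint_eq_iff)
  moreover have "x \<in> rpoint K x"
    by (simp add: rpoint_def)
  ultimately show ?thesis
    unfolding realization_map_def by blast
qed

text \<open>The affine parametrization of \<open>|\<Delta>\<^sup>1|\<close> by the unit interval, from vertex 0 to vertex 1.\<close>

definition edge_param :: "real \<Rightarrow> (nat, unit) cell_point set" where
  "edge_param s = rpoint (\<Delta> 1) (({..1}, ()), (\<lambda>_. 0)(0 := 1 - s, 1 := s))"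

lemma edge_param_vertex:
  "edge_param 0 = vertex_point (\<Delta> 1) 0" "edge_param 1 = vertex_point (\<Delta> 1) 1"
proof -
  have 0: "(\<lambda>_. 0)(0 := 1 - 0, 1 := 0) = (indicator {0} :: nat \<Rightarrow> real)"
    and 1: "(\<lambda>_. 0)(0 := 1 - 1, 1 := 1) = (indicator {1} :: nat \<Rightarrow> real)"
    by (auto simp: indicator_def fun_eq_iff)
  have "((({..1}, ()), indicator {i}), (({i}, ()), indicator {i})) \<in> glue (\<Delta> 1)"
    if "i \<le> 1" for i
  proof -
    have "indicator {i} \<in> affine_simplex {i}"
      by (simp add: affine_simplex_def)
    with that show ?thesis
      by (simp add: glue_def full_simplex_def)
  qed
  note glue = this
  have "rpoint (\<Delta> 1) (({..1}, ()), indicator {i}) = vertex_point (\<Delta> 1) i" if "i \<le> 1" for i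
  proof -
    have "the_elem (simplices (\<Delta> 1) {i}) = ()"
      by simp
    then show ?thesis
      unfolding vertex_point_def rpoint_eq_iff
      using glue[OF that] by (simp add: r_into_rtrancl)
  qed
  then show "edge_param 0 = vertex_point (\<Delta> 1) 0" "edge_param 1 = vertex_point (\<Delta> 1) 1"
    unfolding edge_param_def 0 1 by simp_all
qed

section \<open>Homotopies and homotopy groups\<close>

definition homotopic_rel ::
  "'a set \<Rightarrow> 'a topology \<Rightarrow> 'b topology \<Rightarrow> ('a \<Rightarrow> 'b) \<Rightarrow> ('a \<Rightarrow> 'b) \<Rightarrow> bool" where
  "homotopic_rel S X Y f g \<longleftrightarrow> homotopic_with (\<lambda>h. \<forall>x\<in>S. h x = f x) X Y f g"

definition null_homotopic :: "'a topology \<Rightarrow> 'b topology \<Rightarrow> ('a \<Rightarrow> 'b) \<Rightarrow> bool" where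
  "null_homotopic X Y f \<longleftrightarrow> (\<exists>c. homotopic_with (\<lambda>_. True) X Y f (\<lambda>_. c))"

definition cube :: "nat \<Rightarrow> (nat \<Rightarrow> real) set" where
  "cube n = {s. (\<forall>i. 0 \<le> s i \<and> s i \<le> 1) \<and> (\<forall>i\<ge>n. s i = 0)}"

definition cube_boundary :: "nat \<Rightarrow> (nat \<Rightarrow> real) set" where
  "cube_boundary n = {s \<in> cube n. \<exists>i<n. s i = 0 \<or> s i = 1}"

abbreviation cube_topology :: "nat \<Rightarrow> (nat \<Rightarrow> real) topology" where
  "cube_topology n \<equiv> subtopology (powertop_real UNIV) (cube n)"

definition spheroids :: "'a topology \<Rightarrow> 'a \<Rightarrow> nat \<Rightarrow> ((nat \<Rightarrow> real) \<Rightarrow> 'a) set" where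
  "spheroids X x n =
     {f. continuous_map (cube_topology n) X f \<and> (\<forall>s\<in>cube_boundary n. f s = x)}"

definition spheroid_class ::
  "'a topology \<Rightarrow> nat \<Rightarrow> ((nat \<Rightarrow> real) \<Rightarrow> 'a) \<Rightarrow> ((nat \<Rightarrow> real) \<Rightarrow> 'a) set" where
  "spheroid_class X n f = {g. homotopic_rel (cube_boundary n) (cube_topology n) X f g}"

definition spheroid_join ::
  "((nat \<Rightarrow> real) \<Rightarrow> 'a) \<Rightarrow> ((nat \<Rightarrow> real) \<Rightarrow> 'a) \<Rightarrow> (nat \<Rightarrow> real) \<Rightarrow> 'a" where
  "spheroid_join f g = (\<lambda>s. if s 0 \<le> 1/2 then f (s(0 := 2 * s 0)) else g (s(0 := 2 * s 0 - 1)))"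

text \<open>The group \<open>\<pi>\<^sub>n(X, x)\<close>, for \<open>n \<ge> 1\<close>.\<close>

definition homotopy_group :: "'a topology \<Rightarrow> 'a \<Rightarrow> nat \<Rightarrow> ((nat \<Rightarrow> real) \<Rightarrow> 'a) set monoid" where
  "homotopy_group X x n =
     \<lparr>carrier = spheroid_class X n ` spheroids X x n,
      monoid.mult = (\<lambda>P Q. \<Union>f\<in>P. \<Union>g\<in>Q. spheroid_class X n (spheroid_join f g)),
      one = spheroid_class X n (\<lambda>_. x)\<rparr>"

definition eilenberg_maclane ::
  "'a topology \<Rightarrow> 'a \<Rightarrow> ('g, 'm) monoid_scheme \<Rightarrow> nat \<Rightarrow> bool" where
  "eilenberg_maclane X x G n \<longleftrightarrow>
     x \<in> topspace X \<and> path_connected_space X \<and>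
     homotopy_group X x n \<cong> G \<and>
     (\<forall>m\<ge>1. m \<noteq> n \<longrightarrow> carrier (homotopy_group X x m) = {\<one>\<^bsub>homotopy_group X x m\<^esub>})"

section \<open>Large, complete, minimal and aspherical multicomplexes\<close>

definition large :: "('v, 's) premulticomplex \<Rightarrow> bool" where
  "large K \<longleftrightarrow>
     (\<forall>C\<in>connected_components_of (realization K). infinite {v \<in> verts K. vertex_point K v \<in> C})"

text \<open>The boundary of the realized simplex is the image of the realization of the multicomplex
  \<^term>\<open>\<partial>\<Delta> n\<close> under the inclusion.\<close>

definition realized_boundary :: "nat \<Rightarrow> (nat, unit) cell_point set set" where
  "realized_boundary n =
     realization_map (\<Delta> n) (inclusion (\<partial>\<Delta> n)) ` topspace (realization (\<partial>\<Delta> n))"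

definition simplicial_on_boundary ::
  "('v, 's) premulticomplex \<Rightarrow> nat \<Rightarrow> ((nat, unit) cell_point set \<Rightarrow> ('v, 's) cell_point set) \<Rightarrow> bool"
  where
  "simplicial_on_boundary K n f \<longleftrightarrow>
     (\<exists>\<phi>. simplicial_embedding (\<partial>\<Delta> n) K \<phi> \<and>
        (\<forall>p\<in>topspace (realization (\<partial>\<Delta> n)).
           f (realization_map (\<Delta> n) (inclusion (\<partial>\<Delta> n)) p) = realization_map K \<phi> p))"

definition complete_multicomplex :: "('v, 's) premulticomplex \<Rightarrow> bool" where
  "complete_multicomplex K \<longleftrightarrow>
     (\<forall>n\<ge>1. \<forall>f. continuous_map (realization (\<Delta> n)) (realization K) f \<longrightarrow>
        simplicial_on_boundary K n f \<longrightarrow>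
        (\<exists>\<phi>. simplicial_embedding (\<Delta> n) K \<phi> \<and>
           homotopic_rel (realized_boundary n) (realization (\<Delta> n)) (realization K)
             f (realization_map K \<phi>)))"

definition minimal_multicomplex :: "('v, 's) premulticomplex \<Rightarrow> bool" where
  "minimal_multicomplex K \<longleftrightarrow>
     (\<forall>n\<ge>1. \<forall>f. continuous_map (realization (\<Delta> n)) (realization K) f \<longrightarrow>
        simplicial_on_boundary K n f \<longrightarrow>
        (\<exists>\<^sub>\<le>\<^sub>1\<phi>. simplicial_embedding (\<Delta> n) K \<phi> \<and>
           homotopic_rel (realized_boundary n) (realization (\<Delta> n)) (realization K)
             f (realization_map K \<phi>)))"

definition aspherical :: "('v, 's) premulticomplex \<Rightarrow> bool" where
  "aspherical K \<longleftrightarrow>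
     (\<forall>x\<in>topspace (realization K).
        eilenberg_maclane (realization K) x (homotopy_group (realization K) x 1) 1)"

end

theory Submission
  imports Defs
begin

text \<open>A simplicial embedding of the \<open>n\<close>-simplex into \<open>A\<close> is a labelling of
  the vertices together with one simplex of \<open>A\<close> on the set of labels. All
  conditions can therefore be read as statements about finite sets \<open>W\<close> of vertices
  of \<open>A\<close>: condition (1) becomes \<open>unique_edges\<close>, condition (2) becomes
  \<open>unique_fillings\<close>, and completeness together with minimality says that every map
  of the affine simplex on \<open>W\<close> that is simplicial on the frontier is homotopic,
  relative to the frontier, to exactly one simplex on \<open>W\<close>
  (\<open>straightened\<close>).

  Suppose that \<open>A\<close> is complete, minimal and aspherical. Condition (1) is the case of
  one-dimensional simplices. Asphericity says that spheroids contract, and this makes any two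
  maps of a simplex of dimension at least 2 with the same frontier values homotopic relative to
  the frontier (\<open>unique_cube_filling_if_spheroids_trivial\<close>,
  \<open>unique_simplex_filling_if_cube\<close>). The simplices required in (2) are built by
  induction over the faces (\<open>unique_filling_step\<close>): once the proper faces of
  \<open>W\<close> are there, they define a map on the frontier, which extends to the simplex,
  by hypothesis if \<open>W\<close> is a triangle and by \<open>frontier_extension\<close>
  otherwise; completeness straightens the extension. Two solutions have the same faces, hence
  are homotopic relative to the frontier, hence equal by minimality.

  Suppose conversely that (1) and (2) hold. The heart of the matter is that maps of cubes of
  dimension at least 2 with the same boundary values are homotopic relative to the boundary
  (\<open>unique_cube_filling_if_unique_edges_fillings\<close>). The image of such a map
  \<open>f\<close> is compact, so it involves finitely many vertices, and since \<open>A\<close>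
  is large there is a vertex \<open>a\<close> away from all of them. For a point
  \<open>u\<close> of the cube and a vertex \<open>v\<close> of the simplex that carries
  \<open>f u\<close>, go from \<open>a\<close> to the image of the base point, follow the image
  of the segment from the base point to \<open>u\<close>, and slide inside the carrier to
  \<open>v\<close>. By (1) this path determines an edge from \<open>a\<close> to
  \<open>v\<close>. The triangles formed by two such edges and an edge of the carrier are
  filled, so by (2) there is a simplex that is the cone with apex \<open>a\<close> over the
  carrier (\<open>cone_simplex_exists\<close>); it is determined by any one of its edges at
  \<open>a\<close> (\<open>cone_simplex_unique\<close>). Pushing \<open>f u\<close> to
  \<open>a\<close> inside this cone is a continuous contraction of \<open>f\<close>
  (\<open>continuous_map_cone_homotopy\<close>). At a boundary point the segment may be replaced
  by a path in the boundary, so there the contraction depends only on the boundary values of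
  \<open>f\<close> (\<open>cone_homotopy_boundary\<close>). Two maps with the same boundary
  values thus have contractions that agree on the boundary and at the apex, which gives the
  homotopy. Asphericity is the case of constant boundary values. For completeness and
  minimality, a map of a simplex that is simplicial on the frontier has a unique candidate by
  (1) or (2), which has the right frontier values, and the uniqueness of fillings yields the
  homotopy (\<open>straightening_if_unique_edges_fillings\<close>).\<close>

section \<open>Homotopies relative to a subspace\<close>

abbreviation interval :: "real topology" (\<open>\<I>\<close>) where
  "\<I> \<equiv> top_of_set {0..1}"

lemma homotopic_relI:
  assumes "continuous_map (prod_topology \<I> X) Y h" "S \<subseteq> topspace X"
    and "\<And>x. x \<in> topspace X \<Longrightarrow> h (0, x) = f x"
    and "\<And>x. x \<in> topspace X \<Longrightarrow> h (1, x) = g x"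
    and "\<And>s x. 0 \<le> s \<Longrightarrow> s \<le> 1 \<Longrightarrow> x \<in> S \<Longrightarrow> h (s, x) = f x"
  shows "homotopic_rel S X Y f g"
proof -
  have "homotopic_with (\<lambda>h. \<forall>x\<in>S. h x = f x) X Y f g"
    using assms by (subst homotopic_with) (auto simp: subset_iff intro!: exI[of _ h])
  then show ?thesis
    unfolding homotopic_rel_def .
qed

lemma homotopic_relE:
  assumes "homotopic_rel S X Y f g"
  obtains h where "continuous_map (prod_topology \<I> X) Y h"
    and "\<And>x. h (0, x) = f x" and "\<And>x. h (1, x) = g x"
    and "\<And>s x. 0 \<le> s \<Longrightarrow> s \<le> 1 \<Longrightarrow> x \<in> S \<Longrightarrow> h (s, x) = f x"
  using assms unfolding homotopic_rel_def homotopic_with_def by fastforce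

lemma homotopic_rel_imp_continuous:
  assumes "homotopic_rel S X Y f g"
  shows "continuous_map X Y f" "continuous_map X Y g"
  using assms homotopic_with_imp_continuous_maps unfolding homotopic_rel_def by blast+

lemma homotopic_rel_agree: "homotopic_rel S X Y f g \<Longrightarrow> x \<in> S \<Longrightarrow> g x = f x"
  by (elim homotopic_relE) (metis zero_le_one order_refl)

lemma homotopic_rel_refl: "continuous_map X Y f \<Longrightarrow> homotopic_rel S X Y f f"
  by (simp add: homotopic_rel_def)

lemma homotopic_rel_sym:
  assumes "homotopic_rel S X Y f g" shows "homotopic_rel S X Y g f"
proof -
  have "homotopic_with (\<lambda>h. \<forall>x\<in>S. h x = f x) X Y g f"
    using assms unfolding homotopic_rel_def by (simp add: homotopic_with_sym)
  then show ?thesis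
    unfolding homotopic_rel_def
    by (rule homotopic_with_mono) (simp add: homotopic_rel_agree[OF assms])
qed

lemma homotopic_rel_trans:
  assumes "homotopic_rel S X Y f g" "homotopic_rel S X Y g k"
  shows "homotopic_rel S X Y f k"
proof -
  have "homotopic_with (\<lambda>h. \<forall>x\<in>S. h x = f x) X Y g k"
    using assms(2) unfolding homotopic_rel_def
    by (rule homotopic_with_mono) (simp add: homotopic_rel_agree[OF assms(1)])
  then show ?thesis
    using assms(1) homotopic_with_trans unfolding homotopic_rel_def by blast
qed

text \<open>The conclusion allows any \<open>f'\<close> and \<open>g'\<close> that agree with the composites
  on the space, since maps between subspaces matter only there.\<close>

lemma homotopic_rel_compose_right:
  assumes "homotopic_rel S X Y f g" "continuous_map W X k" "k ` T \<subseteq> S" "T \<subseteq> topspace W"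
    and "\<And>x. x \<in> topspace W \<Longrightarrow> f (k x) = f' x" "\<And>x. x \<in> topspace W \<Longrightarrow> g (k x) = g' x"
  shows "homotopic_rel T W Y f' g'"
proof -
  obtain h where h: "continuous_map (prod_topology \<I> X) Y h"
    "\<And>x. h (0, x) = f x" "\<And>x. h (1, x) = g x"
    "\<And>s x. 0 \<le> s \<Longrightarrow> s \<le> 1 \<Longrightarrow> x \<in> S \<Longrightarrow> h (s, x) = f x"
    using homotopic_relE[OF assms(1)] by metis
  have "continuous_map (prod_topology \<I> W) (prod_topology \<I> X) (\<lambda>(s, x). (s, k x))"
    unfolding case_prod_unfold
    by (intro continuous_map_pairedI continuous_map_fst
        continuous_map_compose[OF continuous_map_snd assms(2), unfolded o_def])
  note continuous_map_compose[OF this h(1)]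
  then show ?thesis
    using h(2,3) assms(4-)
  proof (intro homotopic_relI[where h="h \<circ> (\<lambda>(s, x). (s, k x))"])
    fix s :: real and x assume "0 \<le> s" "s \<le> 1" "x \<in> T"
    then show "(h \<circ> (\<lambda>(s, x). (s, k x))) (s, x) = f' x"
      using h(4)[of s "k x"] assms(3-5) by (auto simp: image_subset_iff subset_iff)
  qed auto
qed

lemma homotopic_rel_cong:
  assumes "homotopic_rel S X Y f g" "S \<subseteq> topspace X"
    and "\<And>x. x \<in> topspace X \<Longrightarrow> f x = f' x" "\<And>x. x \<in> topspace X \<Longrightarrow> g x = g' x"
  shows "homotopic_rel S X Y f' g'"
  using homotopic_rel_compose_right[OF assms(1) continuous_map_id, of S f' g'] assms(2-) by simp

lemma compact_Hausdorff_quotient_map: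
  assumes "compact_space X" "Hausdorff_space Y" "continuous_map X Y f" "f ` topspace X = topspace Y"
  shows "quotient_map X Y f"
  using assms by (intro continuous_closed_imp_quotient_map continuous_imp_closed_map) auto

section \<open>Affine simplices\<close>

definition seg :: "real \<Rightarrow> ('v \<Rightarrow> real) \<Rightarrow> ('v \<Rightarrow> real) \<Rightarrow> 'v \<Rightarrow> real" where
  "seg s a b = (\<lambda>v. (1 - s) * a v + s * b v)"

definition simplex_frontier :: "'v set \<Rightarrow> ('v \<Rightarrow> real) set" where
  "simplex_frontier B = {t \<in> affine_simplex B. \<exists>v\<in>B. t v = 0}"

definition supp :: "('v \<Rightarrow> real) \<Rightarrow> 'v set" where
  "supp t = {v. t v \<noteq> 0}"

lemma seg_0 [simp]: "seg 0 a b = a" and seg_1 [simp]: "seg 1 a b = b"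
  and seg_same [simp]: "seg s a a = a"
  by (auto simp: seg_def algebra_simps)

lemma simplex_frontier_subset: "simplex_frontier B \<subseteq> affine_simplex B"
  by (auto simp: simplex_frontier_def)

lemma affine_simplex_nonneg: "t \<in> affine_simplex B \<Longrightarrow> 0 \<le> t v"
  by (auto simp: affine_simplex_def)

lemma affine_simplex_outside: "t \<in> affine_simplex B \<Longrightarrow> v \<notin> B \<Longrightarrow> t v = 0"
  by (auto simp: affine_simplex_def)

lemma affine_simplex_finite: "t \<in> affine_simplex B \<Longrightarrow> finite B"
  by (rule ccontr) (simp add: affine_simplex_def)

lemma affine_simplex_empty [simp]: "affine_simplex {} = {}"
  by (auto simp: affine_simplex_def)

lemma affine_simplex_le_1: "t \<in> affine_simplex B \<Longrightarrow> t v \<le> 1"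
proof (cases "v \<in> B")
  assume t: "t \<in> affine_simplex B" and "v \<in> B"
  then have "t v \<le> sum t B"
    using affine_simplex_finite[OF t] by (intro member_le_sum) (auto simp: affine_simplex_def)
  then show ?thesis
    using t by (simp add: affine_simplex_def)
next
  assume "t \<in> affine_simplex B" "v \<notin> B"
  then show ?thesis
    using affine_simplex_outside[of t B v] by simp
qed

lemma supp_subset: "t \<in> affine_simplex B \<Longrightarrow> supp t \<subseteq> B"
  by (auto simp: supp_def affine_simplex_def)

lemma affine_simplex_mono: "C \<subseteq> B \<Longrightarrow> finite B \<Longrightarrow> affine_simplex C \<subseteq> affine_simplex B"
proof
  fix t :: "'a \<Rightarrow> real" assume "C \<subseteq> B" "finite B" "t \<in> affine_simplex C"
  moreover from this have "sum t C = sum t B"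
    by (intro sum.mono_neutral_left) (auto simp: affine_simplex_def)
  ultimately show "t \<in> affine_simplex B"
    by (auto simp: affine_simplex_def)
qed

lemma affine_simplex_supp: "t \<in> affine_simplex B \<Longrightarrow> supp t \<subseteq> C \<Longrightarrow> finite C \<Longrightarrow> t \<in> affine_simplex C"
proof -
  assume t: "t \<in> affine_simplex B" and C: "supp t \<subseteq> C" "finite C"
  have B: "finite B" "supp t \<subseteq> B"
    using affine_simplex_finite[OF t] supp_subset[OF t] by auto
  have "sum t C = sum t (supp t)"
    using C by (intro sum.mono_neutral_right) (auto simp: supp_def)
  also have "\<dots> = sum t B"
    using B by (intro sum.mono_neutral_left) (auto simp: supp_def)
  finally show ?thesis
    using t C by (auto simp: affine_simplex_def supp_def)
qed

text \<open>Faces are cut out by the vanishing of coordinates; this makes them closed and lets frontier maps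
  be pasted along them.\<close>

lemma affine_simplex_restrict_iff:
  assumes "C \<subseteq> B" "finite B"
  shows "t \<in> affine_simplex C \<longleftrightarrow> t \<in> affine_simplex B \<and> (\<forall>v\<in>B - C. t v = 0)"
proof
  assume "t \<in> affine_simplex C"
  then show "t \<in> affine_simplex B \<and> (\<forall>v\<in>B - C. t v = 0)"
    using affine_simplex_mono[OF assms] by (auto intro: affine_simplex_outside)
next
  assume t: "t \<in> affine_simplex B \<and> (\<forall>v\<in>B - C. t v = 0)"
  show "t \<in> affine_simplex C"
    by (rule affine_simplex_supp[of t B])
      (use t assms in \<open>auto simp: supp_def affine_simplex_def intro: finite_subset\<close>)
qed

lemma supp_nonempty: "t \<in> affine_simplex B \<Longrightarrow> supp t \<noteq> {}"
proof
  assume "t \<in> affine_simplex B" "supp t = {}"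
  then show False
    by (simp add: supp_def affine_simplex_def)
qed

lemma finite_supp: "t \<in> affine_simplex B \<Longrightarrow> finite (supp t)"
  using supp_subset affine_simplex_finite finite_subset by metis

lemma affine_simplex_self_supp: "t \<in> affine_simplex B \<Longrightarrow> t \<in> affine_simplex (supp t)"
  by (rule affine_simplex_supp) (auto simp: finite_supp)

lemma seg_in_affine_simplex:
  assumes "a \<in> affine_simplex B" "b \<in> affine_simplex B" "0 \<le> s" "s \<le> 1"
  shows "seg s a b \<in> affine_simplex B"
proof -
  have "sum (seg s a b) B = (1 - s) * sum a B + s * sum b B"
    by (simp add: seg_def sum.distrib sum_distrib_left)
  then show ?thesis
    using assms by (simp add: seg_def affine_simplex_def)
qed

lemma indicator_in_affine_simplex:
  assumes "v \<in> B" "finite B"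
  shows "indicator {v} \<in> affine_simplex B"
proof -
  have "sum (indicator {v}) B = (1::real)"
    using assms by (simp add: indicator_def)
  moreover have "indicator {v} x = (0::real)" if "x \<notin> B" for x
    using assms(1) that by (auto split: split_indicator)
  ultimately show ?thesis
    unfolding affine_simplex_def by simp
qed

lemma affine_simplex_singleton: "affine_simplex {v} = {indicator {v}}"
proof -
  have "t = indicator {v}" if "t \<in> affine_simplex {v}" for t :: "'a \<Rightarrow> real"
    using that by (auto simp: affine_simplex_def fun_eq_iff split: split_indicator)
  moreover have "indicator {v} \<in> affine_simplex {v}"
    by (rule indicator_in_affine_simplex) auto
  ultimately show ?thesis
    by blast
qed

lemma supp_indicator [simp]: "supp (indicator {v} :: _ \<Rightarrow> real) = {v}"
  by (auto simp: supp_def indicator_def)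

lemma affine_simplex_edge:
  assumes "t \<in> affine_simplex {v, w}" "v \<noteq> w"
  shows "t = seg (t w) (indicator {v}) (indicator {w})"
proof
  fix x
  have "t v + t w = 1"
    using assms by (simp add: affine_simplex_def)
  then show "t x = seg (t w) (indicator {v}) (indicator {w}) x"
    using assms affine_simplex_outside[OF assms(1), of x]
    by (cases "x = v"; cases "x = w") (simp_all add: seg_def)
qed

lemma simplex_frontier_iff:
  assumes "finite B"
  shows "t \<in> simplex_frontier B \<longleftrightarrow> (\<exists>C. C \<subset> B \<and> t \<in> affine_simplex C)"
proof
  assume "t \<in> simplex_frontier B"
  then have t: "t \<in> affine_simplex B" and "\<exists>v\<in>B. v \<notin> supp t"
    by (auto simp: simplex_frontier_def supp_def)
  then have "supp t \<subset> B" "t \<in> affine_simplex (supp t)"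
    using supp_subset[OF t] affine_simplex_self_supp[OF t] by auto
  then show "\<exists>C. C \<subset> B \<and> t \<in> affine_simplex C"
    by blast
next
  assume "\<exists>C. C \<subset> B \<and> t \<in> affine_simplex C"
  then obtain C v where C: "C \<subset> B" "t \<in> affine_simplex C" "v \<in> B" "v \<notin> C"
    by blast
  then have "t \<in> affine_simplex B" "t v = 0"
    using affine_simplex_mono[of C B] assms affine_simplex_outside[of t C v] by auto
  then show "t \<in> simplex_frontier B"
    using C by (auto simp: simplex_frontier_def)
qed

lemma Hausdorff_function_space: "Hausdorff_space (top_of_set (S :: ('v \<Rightarrow> real) set))"
  by (metis Hausdorff_space_product_topology Hausdorff_space_euclidean euclidean_product_topology
      Hausdorff_space_subtopology)

text \<open>This rule applies to every function valued in functions and would preempt the rules for \<open>seg\<close> below.\<close>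

declare continuous_on_coordinatewise_then_product [continuous_intros del]

lemma continuous_on_apply:
  fixes f :: "'a::topological_space \<Rightarrow> 'v \<Rightarrow> real"
  shows "continuous_on S f \<Longrightarrow> continuous_on S (\<lambda>x. f x v)"
  by (rule continuous_on_product_then_coordinatewise)

lemma continuous_on_seg [continuous_intros]:
  fixes f g :: "'a::topological_space \<Rightarrow> 'v \<Rightarrow> real"
  assumes "continuous_on S k" "continuous_on S f" "continuous_on S g"
  shows "continuous_on S (\<lambda>x. seg (k x) (f x) (g x))"
  unfolding seg_def
  by (intro continuous_on_coordinatewise_then_product continuous_intros assms
      assms(2,3)[THEN continuous_on_apply])

lemma compact_box: "compact {t :: 'v \<Rightarrow> real. \<forall>v. 0 \<le> t v \<and> t v \<le> 1}"
proof -
  have "{t :: 'v \<Rightarrow> real. \<forall>v. 0 \<le> t v \<and> t v \<le> 1} = (\<Pi>\<^sub>E v\<in>UNIV. {0..1})"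
    by auto
  moreover have "compactin (powertop_real UNIV) (\<Pi>\<^sub>E v\<in>(UNIV::'v set). {0..1})"
    by (subst compactin_PiE) auto
  ultimately show ?thesis
    by (simp add: euclidean_product_topology)
qed

lemma closed_affine_simplex_conditions:
  assumes "finite B"
  shows "closed {t :: 'v \<Rightarrow> real. (\<forall>v. v \<notin> B \<longrightarrow> t v = 0) \<and> sum t B = 1}"
proof -
  have *: "{t :: 'v \<Rightarrow> real. (\<forall>v. v \<notin> B \<longrightarrow> t v = 0) \<and> sum t B = 1} =
      (\<Inter>v\<in>-B. {t. t v = 0}) \<inter> {t. sum t B = 1}"
    by auto
  show ?thesis
    unfolding *
    by (intro closed_Int closed_INT ballI closed_Collect_eq continuous_intros
        continuous_on_product_coordinates)
qed

text \<open>A closed subset of a cube, which is compact by the Tychonoff theorem even if there are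
  infinitely many vertices outside \<open>B\<close>.\<close>

lemma compact_affine_simplex: "finite B \<Longrightarrow> compact (affine_simplex B)"
proof -
  assume "finite B"
  have *: "affine_simplex B = {t. \<forall>v. 0 \<le> t v \<and> t v \<le> 1} \<inter>
      {t. (\<forall>v. v \<notin> B \<longrightarrow> t v = 0) \<and> sum t B = 1}"
  proof -
    have "t \<in> affine_simplex B \<longleftrightarrow> t \<in> {t. \<forall>v. 0 \<le> t v \<and> t v \<le> 1} \<inter>
        {t. (\<forall>v. v \<notin> B \<longrightarrow> t v = 0) \<and> sum t B = 1}" for t
      using affine_simplex_le_1[of t B] unfolding affine_simplex_def by blast
    then show ?thesis
      by blast
  qed
  show ?thesis
    unfolding * using compact_box closed_affine_simplex_conditions[OF \<open>finite B\<close>] by (rule compact_Int_closed)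
qed

lemma compact_simplex_frontier: "finite B \<Longrightarrow> compact (simplex_frontier B)"
proof -
  assume "finite B"
  have *: "simplex_frontier B = affine_simplex B \<inter> (\<Union>v\<in>B. {t. t v = 0})"
    by (auto simp: simplex_frontier_def)
  show ?thesis
    unfolding * using \<open>finite B\<close>
    by (intro compact_Int_closed compact_affine_simplex closed_UN[OF _ ballI] closed_Collect_eq
        continuous_on_const continuous_on_product_coordinates)
qed

lemma continuous_on_Max_image:
  fixes f :: "'i \<Rightarrow> 'a::topological_space \<Rightarrow> real"
  assumes "finite I" "I \<noteq> {}" "\<And>i. i \<in> I \<Longrightarrow> continuous_on S (f i)"
  shows "continuous_on S (\<lambda>x. Max ((\<lambda>i. f i x) ` I))"
  using assms by (induction I rule: finite_ne_induct) (auto intro!: continuous_on_max)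

lemma continuous_on_Min_image:
  fixes f :: "'i \<Rightarrow> 'a::topological_space \<Rightarrow> real"
  assumes "finite I" "I \<noteq> {}" "\<And>i. i \<in> I \<Longrightarrow> continuous_on S (f i)"
  shows "continuous_on S (\<lambda>x. Min ((\<lambda>i. f i x) ` I))"
  using assms by (induction I rule: finite_ne_induct) (auto intro!: continuous_on_min)

section \<open>Points of the realization\<close>

abbreviation pt :: "('v, 's) premulticomplex \<Rightarrow> 'v set \<Rightarrow> 's \<Rightarrow> ('v \<Rightarrow> real) \<Rightarrow> ('v, 's) cell_point set" where
  "pt K B \<sigma> t \<equiv> rpoint K ((B, \<sigma>), t)"

text \<open>The normal form of a representative: glueing only changes the face in which a point is seen, so
  passing to the face spanned by the support removes the ambiguity.\<close>

definition carrier_form :: "('v, 's) premulticomplex \<Rightarrow> ('v, 's) cell_point \<Rightarrow> ('v, 's) cell_point" where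
  "carrier_form K = (\<lambda>((B, \<sigma>), t). ((supp t, bdry K B (supp t) \<sigma>), t))"

definition coord :: "('v, 's) cell_point set \<Rightarrow> 'v \<Rightarrow> real" where
  "coord p = snd (SOME x. x \<in> p)"

definition carrier_simplex :: "('v, 's) premulticomplex \<Rightarrow> ('v, 's) cell_point set \<Rightarrow> 's" where
  "carrier_simplex K p = snd (fst (carrier_form K (SOME x. x \<in> p)))"

lemma simplex_finite: "multicomplex K \<Longrightarrow> \<sigma> \<in> simplices K B \<Longrightarrow> finite B"
  unfolding multicomplex_def by (metis empty_iff)

lemma simplex_verts: "multicomplex K \<Longrightarrow> \<sigma> \<in> simplices K B \<Longrightarrow> B \<subseteq> verts K"
  unfolding multicomplex_def by (metis empty_iff)

lemma bdry_simplex: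
  assumes "multicomplex K" "\<sigma> \<in> simplices K B" "C \<subseteq> B"
  shows "bdry K B C \<sigma> \<in> simplices K C"
proof -
  have "bdry K B C \<in> simplices K B \<rightarrow> simplices K C"
    using assms(1,3) unfolding multicomplex_def by simp
  then show ?thesis
    using assms(2) by blast
qed

lemma bdry_self: "multicomplex K \<Longrightarrow> \<sigma> \<in> simplices K B \<Longrightarrow> bdry K B B \<sigma> = \<sigma>"
  unfolding multicomplex_def by simp

lemma bdry_bdry:
  "multicomplex K \<Longrightarrow> \<sigma> \<in> simplices K B \<Longrightarrow> C \<subseteq> B \<Longrightarrow> D \<subseteq> C \<Longrightarrow>
    bdry K C D (bdry K B C \<sigma>) = bdry K B D \<sigma>"
  unfolding multicomplex_def by simp

lemma vertex_simplex_unique: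
  assumes "multicomplex K" "\<sigma> \<in> simplices K {v}"
  shows "\<sigma> = the_elem (simplices K {v})"
proof -
  have "v \<in> verts K"
    using simplex_verts[OF assms] by simp
  then have "is_singleton (simplices K {v})"
    using assms unfolding multicomplex_def by simp
  then show ?thesis
    using assms(2) by (metis is_singleton_the_elem singletonD)
qed

lemma vertex_simplex:
  assumes "multicomplex K" "v \<in> verts K"
  shows "the_elem (simplices K {v}) \<in> simplices K {v}"
proof -
  have "is_singleton (simplices K {v})"
    using assms unfolding multicomplex_def by simp
  then show ?thesis
    by (metis is_singleton_the_elem singletonI)
qed

text \<open>Glueing keeps the coordinates, hence the support, and functoriality of the boundary maps
  identifies the two simplices carried by the support.\<close>

lemma glue_carrier_form:
  assumes K: "multicomplex K" and "(x, y) \<in> glue K"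
  shows "carrier_form K x = carrier_form K y"
proof -
  obtain B C \<sigma> t where x: "x = ((B, \<sigma>), t)" "y = ((C, bdry K B C \<sigma>), t)"
    and B: "\<sigma> \<in> simplices K B" "C \<subseteq> B" "t \<in> affine_simplex C"
    using assms(2) by (auto simp: glue_def)
  then show ?thesis
    using bdry_bdry[OF K B(1,2) supp_subset[OF B(3)]] by (simp add: carrier_form_def)
qed

lemma rpoint_eq_carrier_form:
  assumes K: "multicomplex K" and "rpoint K x = rpoint K y"
  shows "carrier_form K x = carrier_form K y"
proof -
  have "(x, y) \<in> (glue K \<union> (glue K)\<inverse>)\<^sup>*"
    using assms(2) by (simp add: rpoint_eq_iff)
  then show ?thesis
    by induction (use glue_carrier_form[OF K] in \<open>metis UnE converseD\<close>)+
qed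

lemma rpoint_self: "x \<in> rpoint K x"
  by (simp add: rpoint_def)

lemma rpoint_some: "rpoint K (SOME x. x \<in> rpoint K y) = rpoint K y"
proof -
  have "(SOME x. x \<in> rpoint K y) \<in> rpoint K y"
    by (rule someI[of _ y]) (rule rpoint_self)
  then have "(y, SOME x. x \<in> rpoint K y) \<in> (glue K \<union> (glue K)\<inverse>)\<^sup>*"
    by (simp add: rpoint_def)
  then show ?thesis
    by (metis rpoint_eq_iff)
qed

lemma coord_pt [simp]: "multicomplex K \<Longrightarrow> coord (pt K B \<sigma> t) = t"
  using rpoint_eq_carrier_form[OF _ rpoint_some[of K "((B, \<sigma>), t)"]]
  by (simp add: coord_def carrier_form_def split_beta)

lemma carrier_simplex_pt: "multicomplex K \<Longrightarrow> carrier_simplex K (pt K B \<sigma> t) = bdry K B (supp t) \<sigma>"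
  unfolding carrier_simplex_def
  by (simp only: rpoint_eq_carrier_form[OF _ rpoint_some[of K "((B, \<sigma>), t)"]])
    (simp add: carrier_form_def)

lemma pt_face:
  assumes "\<sigma> \<in> simplices K B" "C \<subseteq> B" "t \<in> affine_simplex C"
  shows "pt K B \<sigma> t = pt K C (bdry K B C \<sigma>) t"
proof -
  have "(((B, \<sigma>), t), ((C, bdry K B C \<sigma>), t)) \<in> glue K"
    using assms by (auto simp: glue_def)
  then show ?thesis
    by (auto simp: rpoint_eq_iff)
qed

lemma pt_carrier:
  assumes "\<sigma> \<in> simplices K B" "t \<in> affine_simplex B"
  shows "pt K B \<sigma> t = pt K (supp t) (bdry K B (supp t) \<sigma>) t"
  by (rule pt_face) (use assms supp_subset affine_simplex_self_supp in blast)+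

text \<open>The carrier form is constant on classes, and conversely every representative is glued to its
  carrier form.\<close>

lemma pt_eq_iff:
  assumes K: "multicomplex K" and "\<sigma> \<in> simplices K B" "\<tau> \<in> simplices K C"
    and "t \<in> affine_simplex B" "u \<in> affine_simplex C"
  shows "pt K B \<sigma> t = pt K C \<tau> u \<longleftrightarrow> t = u \<and> bdry K B (supp t) \<sigma> = bdry K C (supp t) \<tau>"
proof
  assume "pt K B \<sigma> t = pt K C \<tau> u"
  from rpoint_eq_carrier_form[OF K this]
  show "t = u \<and> bdry K B (supp t) \<sigma> = bdry K C (supp t) \<tau>"
    by (auto simp: carrier_form_def)
next
  assume "t = u \<and> bdry K B (supp t) \<sigma> = bdry K C (supp t) \<tau>"
  then show "pt K B \<sigma> t = pt K C \<tau> u"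
    using pt_carrier[of \<sigma> K B t] pt_carrier[of \<tau> K C u] assms by metis
qed

lemma topspace_disjoint_cells:
  "((B, \<sigma>), t) \<in> topspace (disjoint_cells K) \<longleftrightarrow> \<sigma> \<in> simplices K B \<and> t \<in> affine_simplex B"
  by (auto simp: disjoint_cells_def cells_def)

lemma pt_in_topspace:
  "\<sigma> \<in> simplices K B \<Longrightarrow> t \<in> affine_simplex B \<Longrightarrow> pt K B \<sigma> t \<in> topspace (realization K)"
  by (simp add: topspace_realization topspace_disjoint_cells)

lemma realization_cases:
  assumes "p \<in> topspace (realization K)"
  obtains B \<sigma> t where "\<sigma> \<in> simplices K B" "t \<in> affine_simplex B" "p = pt K B \<sigma> t"
proof -
  obtain x where "x \<in> topspace (disjoint_cells K)" "p = rpoint K x"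
    using assms by (auto simp: topspace_realization)
  then show ?thesis
    using that topspace_disjoint_cells by (metis surj_pair)
qed

lemma carrier_of_point:
  assumes K: "multicomplex K" and p: "p \<in> topspace (realization K)"
  shows "carrier_simplex K p \<in> simplices K (supp (coord p))"
    and "coord p \<in> affine_simplex (supp (coord p))"
    and "pt K (supp (coord p)) (carrier_simplex K p) (coord p) = p"
proof -
  obtain B \<sigma> t where B: "\<sigma> \<in> simplices K B" "t \<in> affine_simplex B" "p = pt K B \<sigma> t"
    using p by (rule realization_cases)
  then show "carrier_simplex K p \<in> simplices K (supp (coord p))"
    "coord p \<in> affine_simplex (supp (coord p))"
    "pt K (supp (coord p)) (carrier_simplex K p) (coord p) = p"
    using K bdry_simplex[OF K B(1) supp_subset[OF B(2)]] affine_simplex_self_supp[OF B(2)]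
      pt_carrier[OF B(1,2)]
    by (simp_all add: carrier_simplex_pt bdry_self)
qed

section \<open>Continuity on the realization, cell by cell\<close>

lemma continuous_map_cell:
  assumes "\<sigma> \<in> simplices K B"
  shows "continuous_map (top_of_set (affine_simplex B)) (realization K) (pt K B \<sigma>)"
proof -
  let ?X = "\<lambda>(B, \<sigma>). subtopology (powertop_real UNIV) (affine_simplex B)"
  have "continuous_map (?X (B, \<sigma>)) (sum_topology ?X (cells K)) (\<lambda>t. ((B, \<sigma>), t))"
    using assms by (intro continuous_map_component_injection) (simp add: cells_def)
  then have "continuous_map (top_of_set (affine_simplex B)) (disjoint_cells K) (\<lambda>t. ((B, \<sigma>), t))"
    by (simp add: disjoint_cells_def euclidean_product_topology)
  from continuous_map_compose[OF this quotient_imp_continuous_map[OF quotient_map_rpoint]]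
  show ?thesis
    by (simp add: o_def)
qed

lemma continuous_map_cell_compose:
  assumes "\<sigma> \<in> simplices K B" "continuous_map X (top_of_set (affine_simplex B)) f"
  shows "continuous_map X (realization K) (\<lambda>x. pt K B \<sigma> (f x))"
  using continuous_map_compose[OF assms(2) continuous_map_cell[OF assms(1)]] by (simp add: o_def)

lemma continuous_map_snd_component:
  assumes "i \<in> I"
  shows "continuous_map (subtopology (sum_topology X I) ({i} \<times> topspace (X i))) (X i) snd"
  unfolding continuous_map_def
proof (intro conjI allI impI)
  fix U assume U: "openin (X i) U"
  then have "openin (sum_topology X I) ((\<lambda>x. (i, x)) ` U)"
    using open_map_component_injection[OF assms, of X] by (simp add: open_map_def)
  moreover have "{x \<in> topspace (subtopology (sum_topology X I) ({i} \<times> topspace (X i))). snd x \<in> U} =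
      (\<lambda>x. (i, x)) ` U \<inter> ({i} \<times> topspace (X i))"
    using openin_subset[OF U] assms by auto
  ultimately show "openin (subtopology (sum_topology X I) ({i} \<times> topspace (X i)))
      {x \<in> topspace (subtopology (sum_topology X I) ({i} \<times> topspace (X i))). snd x \<in> U}"
    by (metis openin_subtopology_Int)
qed auto

text \<open>The summands are open, so the products with them form an open cover along which the map can be
  pasted.\<close>

lemma continuous_map_prod_from_sum:
  assumes "\<And>i. i \<in> I \<Longrightarrow> continuous_map (prod_topology Z (X i)) Y (\<lambda>(z, x). g (z, (i, x)))"
  shows "continuous_map (prod_topology Z (sum_topology X I)) Y g"
proof (rule pasting_lemma)
  let ?T = "\<lambda>i. topspace Z \<times> ({i} \<times> topspace (X i))"
  fix i assume i: "i \<in> I"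
  have "openin (sum_topology X I) ((\<lambda>x. (i, x)) ` topspace (X i))"
    using open_map_component_injection[OF i, of X] openin_topspace unfolding open_map_def by blast
  moreover have "(\<lambda>x. (i, x)) ` topspace (X i) = {i} \<times> topspace (X i)"
    by auto
  ultimately show "openin (prod_topology Z (sum_topology X I)) (?T i)"
    by (simp add: openin_prod_Times_iff)
  have eq: "subtopology (prod_topology Z (sum_topology X I)) (?T i) =
      prod_topology Z (subtopology (sum_topology X I) ({i} \<times> topspace (X i)))"
    by (simp add: subtopology_Times)
  have "continuous_map (prod_topology Z (subtopology (sum_topology X I) ({i} \<times> topspace (X i))))
      (prod_topology Z (X i)) (\<lambda>z. (fst z, snd (snd z)))"
    by (intro continuous_map_pairedI continuous_map_fst
        continuous_map_compose[OF continuous_map_snd continuous_map_snd_component[OF i], unfolded o_def])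
  from continuous_map_compose[OF this assms[OF i]]
  have "continuous_map (subtopology (prod_topology Z (sum_topology X I)) (?T i)) Y
      (\<lambda>z. g (fst z, (i, snd (snd z))))"
    by (simp add: eq o_def)
  then show "continuous_map (subtopology (prod_topology Z (sum_topology X I)) (?T i)) Y g"
    by (rule continuous_map_eq) auto
qed auto

text \<open>Products of quotient maps with a locally compact Hausdorff space are again quotient maps, so
  homotopies on the realization may be checked cell by cell. Locally closed subsets are included
  because saturated open and closed subsets inherit the quotient topology; below they are open
  stars cut down to the points that avoid a vertex.\<close>

lemma continuous_map_prod_from_realization:
  assumes Z: "locally_compact_space Z" "Hausdorff_space Z"
    and U: "openin (realization K) U" and C: "closedin (realization K) C"
    and cells: "\<And>B \<sigma>. \<sigma> \<in> simplices K B \<Longrightarrow>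
      continuous_map (prod_topology Z (top_of_set {t \<in> affine_simplex B. pt K B \<sigma> t \<in> U \<inter> C})) Y
        (\<lambda>(z, t). g (z, pt K B \<sigma> t))"
  shows "continuous_map (prod_topology Z (subtopology (realization K) (U \<inter> C))) Y g"
proof -
  let ?D = "disjoint_cells K" and ?R = "realization K"
  let ?W = "{x \<in> topspace ?D. rpoint K x \<in> U \<inter> C}"
  let ?X = "\<lambda>(B, \<sigma>). top_of_set (affine_simplex B)"
  have "quotient_map (subtopology ?D {x \<in> topspace ?D. rpoint K x \<in> U}) (subtopology ?R U) (rpoint K)"
    by (rule quotient_map_restriction[OF quotient_map_rpoint refl]) (use U in blast)
  from quotient_map_restriction[OF this refl, of "U \<inter> C"]
  have "quotient_map (subtopology (subtopology ?D {x \<in> topspace ?D. rpoint K x \<in> U}) ?W)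
      (subtopology (subtopology ?R U) (U \<inter> C)) (rpoint K)"
    using C by (simp add: closedin_subtopology_Int_closed conj_ac cong: conj_cong rev_conj_cong)
  moreover have "{x \<in> topspace ?D. rpoint K x \<in> U} \<inter> ?W = ?W" "U \<inter> (U \<inter> C) = U \<inter> C"
    by auto
  ultimately have "quotient_map (subtopology ?D ?W) (subtopology ?R (U \<inter> C)) (rpoint K)"
    by (simp add: subtopology_subtopology)
  then have q: "quotient_map (prod_topology Z (subtopology ?D ?W))
      (prod_topology Z (subtopology ?R (U \<inter> C))) (\<lambda>(z, x). (z, rpoint K x))"
    using Z by (intro quotient_map_prod_right) auto
  define S where "S = (\<lambda>(B, \<sigma>). {t \<in> affine_simplex B. pt K B \<sigma> t \<in> U \<inter> C})"
  have W: "?W = Sigma (cells K) S"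
    by (auto simp: S_def disjoint_cells_def)
  have "?D = sum_topology ?X (cells K)"
    by (simp add: disjoint_cells_def euclidean_product_topology)
  then have D: "subtopology ?D ?W = sum_topology (\<lambda>i. subtopology (?X i) (S i)) (cells K)"
    unfolding W by (simp add: subtopology_sum_topology)
  have "continuous_map (prod_topology Z (subtopology ?D ?W)) Y (g \<circ> (\<lambda>(z, x). (z, rpoint K x)))"
    unfolding D
  proof (rule continuous_map_prod_from_sum)
    fix i assume i: "i \<in> cells K"
    obtain B \<sigma> where [simp]: "i = (B, \<sigma>)"
      by fastforce
    have "affine_simplex B \<inter> S i = {t \<in> affine_simplex B. pt K B \<sigma> t \<in> U \<inter> C}"
      by (auto simp: S_def)
    then show "continuous_map (prod_topology Z (subtopology (?X i) (S i))) Y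
        (\<lambda>(z, x). (g \<circ> (\<lambda>(z, x). (z, rpoint K x))) (z, (i, x)))"
      using cells[of \<sigma> B] i by (simp add: cells_def subtopology_subtopology)
  qed
  then show ?thesis
    by (rule continuous_compose_quotient_map[OF q])
qed

lemma continuous_map_from_realization:
  assumes cells: "\<And>B \<sigma>. \<sigma> \<in> simplices K B \<Longrightarrow>
      continuous_map (top_of_set (affine_simplex B)) Y (\<lambda>t. g (pt K B \<sigma> t))"
  shows "continuous_map (realization K) Y g"
proof -
  let ?D = "disjoint_cells K"
  have D: "?D = sum_topology (\<lambda>(B, \<sigma>). top_of_set (affine_simplex B)) (cells K)"
    by (simp add: disjoint_cells_def euclidean_product_topology)
  have "continuous_map (prod_topology \<I> ?D) Y (\<lambda>(z, x). g (rpoint K x))"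
    unfolding D
  proof (rule continuous_map_prod_from_sum)
    fix i assume i: "i \<in> cells K"
    obtain B \<sigma> where [simp]: "i = (B, \<sigma>)"
      by fastforce
    have "continuous_map (top_of_set (affine_simplex B)) Y (\<lambda>t. g (pt K B \<sigma> t))"
      using cells[of \<sigma> B] i by (simp add: cells_def)
    from continuous_map_compose[OF continuous_map_snd[where X=\<I>] this]
    show "continuous_map (prod_topology \<I> (case i of (B, \<sigma>) \<Rightarrow> top_of_set (affine_simplex B))) Y
        (\<lambda>(z, x). case (z, (i, x)) of (z, x) \<Rightarrow> g (rpoint K x))"
      by (simp add: o_def case_prod_unfold)
  qed
  moreover have "continuous_map ?D (prod_topology \<I> ?D) (\<lambda>x. (0, x))"
    by (intro continuous_map_pairedI) auto
  ultimately have "continuous_map ?D Y ((\<lambda>(z, x). g (rpoint K x)) \<circ> (\<lambda>x. (0::real, x)))"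
    using continuous_map_compose by blast
  then show ?thesis
    using continuous_compose_quotient_map[OF quotient_map_rpoint] by (simp add: o_def)
qed

lemma continuous_map_coord_into:
  assumes K: "multicomplex K" and sub: "\<And>p. p \<in> topspace (realization K) \<Longrightarrow> coord p \<in> S"
  shows "continuous_map (realization K) (top_of_set S) coord"
proof -
  have "continuous_map (realization K) euclidean coord"
    by (rule continuous_map_from_realization) (simp add: K continuous_on_id)
  then show ?thesis
    using sub by (auto simp: continuous_map_in_subtopology)
qed

lemma openin_star:
  assumes K: "multicomplex K"
  shows "openin (realization K) {p \<in> topspace (realization K). 0 < coord p v}"
    and "closedin (realization K) {p \<in> topspace (realization K). coord p v = 0}"
proof -
  have "continuous_map (realization K) euclidean coord"
    using continuous_map_coord_into[OF K, of UNIV] by simp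
  moreover have "continuous_map euclidean euclideanreal (\<lambda>t. t v)"
    by (simp add: continuous_on_product_coordinates)
  ultimately have "continuous_map (realization K) euclideanreal ((\<lambda>t. t v) \<circ> coord)"
    by (rule continuous_map_compose)
  then have c: "continuous_map (realization K) euclideanreal (\<lambda>p. coord p v)"
    by (simp add: o_def)
  show "openin (realization K) {p \<in> topspace (realization K). 0 < coord p v}"
    using openin_continuous_map_preimage[OF c, of "{0<..}"] by simp
  show "closedin (realization K) {p \<in> topspace (realization K). coord p v = 0}"
    using closedin_continuous_map_preimage[OF c, of "{0}"] by simp
qed

section \<open>Connectedness\<close>

lemma openin_disjoint_cells:
  "openin (disjoint_cells K) U \<longleftrightarrow> U \<subseteq> topspace (disjoint_cells K) \<and>
    (\<forall>i\<in>cells K. openin (case i of (B, \<sigma>) \<Rightarrow> subtopology (powertop_real UNIV) (affine_simplex B))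
      {t. (i, t) \<in> U})"
  unfolding disjoint_cells_def openin_sum_topology topspace_sum_topology ..

lemma openin_realization_if_cellwise_constant:
  assumes "P \<subseteq> topspace (realization K)"
    and "\<And>B \<sigma> t u. \<sigma> \<in> simplices K B \<Longrightarrow> t \<in> affine_simplex B \<Longrightarrow> u \<in> affine_simplex B \<Longrightarrow>
      pt K B \<sigma> t \<in> P \<Longrightarrow> pt K B \<sigma> u \<in> P"
  shows "openin (realization K) P"
proof -
  let ?D = "disjoint_cells K"
  have "openin ?D {x \<in> topspace ?D. rpoint K x \<in> P}"
    unfolding openin_disjoint_cells
  proof (intro conjI ballI)
    fix i assume i: "i \<in> cells K"
    obtain B \<sigma> where [simp]: "i = (B, \<sigma>)"
      by fastforce
    have \<sigma>: "\<sigma> \<in> simplices K B"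
      using i by (simp add: cells_def)
    have eq: "{t. (i, t) \<in> {x \<in> topspace ?D. rpoint K x \<in> P}} = {t \<in> affine_simplex B. pt K B \<sigma> t \<in> P}"
      by (simp add: topspace_disjoint_cells \<sigma>)
    have "{t \<in> affine_simplex B. pt K B \<sigma> t \<in> P} = affine_simplex B \<or>
        {t \<in> affine_simplex B. pt K B \<sigma> t \<in> P} = {}"
    proof (cases "\<exists>t\<in>affine_simplex B. pt K B \<sigma> t \<in> P")
      case True
      then have "pt K B \<sigma> u \<in> P" if "u \<in> affine_simplex B" for u
        using assms(2)[OF \<sigma>] that by metis
      then show ?thesis
        by blast
    qed auto
    then have "openin (top_of_set (affine_simplex B)) {t \<in> affine_simplex B. pt K B \<sigma> t \<in> P}"
      by (rule disjE) (simp_all only: openin_empty openin_subtopology_self open_UNIV)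
    then show "openin (case i of (B, \<sigma>) \<Rightarrow> subtopology (powertop_real UNIV) (affine_simplex B))
        {t. (i, t) \<in> {x \<in> topspace ?D. rpoint K x \<in> P}}"
      unfolding eq by (simp add: euclidean_product_topology)
  qed blast
  then show ?thesis
    using assms(1) unfolding openin_realization topspace_realization by blast
qed

text \<open>The set where \<open>P\<close> holds and its complement are both unions of whole cells, hence
  open in every cell.\<close>

lemma connected_realization_cellwise_constant:
  assumes conn: "connected_space (realization K)"
    and const: "\<And>B \<sigma> t u. \<sigma> \<in> simplices K B \<Longrightarrow> t \<in> affine_simplex B \<Longrightarrow> u \<in> affine_simplex B \<Longrightarrow>
      P (pt K B \<sigma> t) \<Longrightarrow> P (pt K B \<sigma> u)"
    and p: "p \<in> topspace (realization K)" "P p" and q: "q \<in> topspace (realization K)"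
  shows "P q"
proof -
  let ?R = "realization K"
  let ?P = "{p \<in> topspace ?R. P p}"
  have "openin ?R ?P"
    by (rule openin_realization_if_cellwise_constant) (auto intro: const pt_in_topspace)
  moreover have "openin ?R (topspace ?R - ?P)"
    by (rule openin_realization_if_cellwise_constant) (auto intro: const pt_in_topspace)
  then have "closedin ?R ?P"
    by (auto simp: closedin_def)
  ultimately have "?P = {} \<or> ?P = topspace ?R"
    using conn by (auto simp: connected_space_clopen_in)
  then show ?thesis
    using p q by blast
qed

text \<open>Cells are path connected, so lying in a given path component is a property that is constant on
  cells.\<close>

lemma path_connected_realization:
  assumes conn: "connected_space (realization K)"
  shows "path_connected_space (realization K)"
proof -
  have "path_component_of (realization K) p q"
    if "p \<in> topspace (realization K)" "q \<in> topspace (realization K)" for p q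
  proof (rule connected_realization_cellwise_constant[OF conn, where P="path_component_of (realization K) p"])
    fix B \<sigma> t u
    assume \<sigma>: "\<sigma> \<in> simplices K B" and t: "t \<in> affine_simplex B" and u: "u \<in> affine_simplex B"
      and p: "path_component_of (realization K) p (pt K B \<sigma> t)"
    have "pathin (realization K) (\<lambda>s. pt K B \<sigma> (seg s t u))"
      unfolding pathin_def
      by (rule continuous_map_cell_compose[OF \<sigma>])
        (use t u seg_in_affine_simplex in \<open>auto intro!: continuous_intros\<close>)
    then have "path_component_of (realization K) (pt K B \<sigma> t) (pt K B \<sigma> u)"
      unfolding path_component_of_def by (intro exI[of _ "\<lambda>s. pt K B \<sigma> (seg s t u)"]) simp
    with p show "path_component_of (realization K) p (pt K B \<sigma> u)"
      by (rule path_component_of_trans)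
  qed (use that in \<open>auto simp: path_component_of_refl\<close>)
  then show ?thesis
    by (simp add: path_connected_space_iff_path_component)
qed

section \<open>Subcomplexes of a simplex and their realizations\<close>

text \<open>A common form for the simplex, its boundary and its skeleta: all of them have at most one
  simplex on each vertex set.\<close>

definition sub_simplex :: "'v set \<Rightarrow> 'v set set \<Rightarrow> ('v, unit) premulticomplex" where
  "sub_simplex V F = \<lparr>verts = V, simplices = (\<lambda>B. if B \<in> F then {()} else {}), bdry = (\<lambda>B C \<sigma>. \<sigma>)\<rparr>"

definition face_family :: "'v set \<Rightarrow> 'v set set \<Rightarrow> bool" where
  "face_family V F \<longleftrightarrow> finite V \<and> F \<subseteq> Pow V \<and> (\<forall>B\<in>F. Pow B \<subseteq> F) \<and> (\<forall>v\<in>V. {v} \<in> F)"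

lemma verts_sub_simplex [simp]: "verts (sub_simplex V F) = V"
  and simplices_sub_simplex [simp]: "simplices (sub_simplex V F) B = (if B \<in> F then {()} else {})"
  and bdry_sub_simplex [simp]: "bdry (sub_simplex V F) B C \<sigma> = \<sigma>"
  by (simp_all add: sub_simplex_def)

lemma full_simplex_eq: "full_simplex V = sub_simplex V (Pow V)"
  by (simp add: full_simplex_def sub_simplex_def)

lemma simplex_boundary_eq: "simplex_boundary V = sub_simplex V {B. B \<subset> V}"
  by (simp add: simplex_boundary_def sub_simplex_def)

lemma skeleton_full_simplex_eq:
  "skeleton 1 (full_simplex V) = sub_simplex V {B. B \<subseteq> V \<and> card B \<le> 2}"
  by (auto simp: skeleton_def full_simplex_def sub_simplex_def fun_eq_iff numeral_2_eq_2)

lemma face_family_full: "finite V \<Longrightarrow> face_family V (Pow V)"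
  by (auto simp: face_family_def)

lemma face_family_boundary: "finite V \<Longrightarrow> card V \<ge> 2 \<Longrightarrow> face_family V {B. B \<subset> V}"
  by (auto simp: face_family_def card_Suc_eq)

lemma face_family_skeleton: "finite V \<Longrightarrow> face_family V {B. B \<subseteq> V \<and> card B \<le> 2}"
  by (auto simp: face_family_def) (meson card_mono finite_subset order_trans)

lemma multicomplex_sub_simplex: "face_family V F \<Longrightarrow> multicomplex (sub_simplex V F)"
  unfolding multicomplex_def face_family_def
  by (auto simp: is_singleton_def intro: finite_subset split: if_splits)

lemma pt_sub_simplex_cong:
  assumes "face_family V F" "B \<in> F" "C \<in> F" "t \<in> affine_simplex B" "t \<in> affine_simplex C"
  shows "pt (sub_simplex V F) B () t = pt (sub_simplex V F) C () t"
  using assms by (subst pt_eq_iff[OF multicomplex_sub_simplex]) auto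

lemma sub_simplex_cases:
  assumes "face_family V F" "p \<in> topspace (realization (sub_simplex V F))"
  obtains B t where "B \<in> F" "B \<subseteq> V" "t \<in> affine_simplex B" "t \<in> affine_simplex V"
    "p = pt (sub_simplex V F) B () t"
proof -
  obtain B \<sigma> t where B: "\<sigma> \<in> simplices (sub_simplex V F) B" "t \<in> affine_simplex B"
    "p = pt (sub_simplex V F) B \<sigma> t"
    using assms(2) by (rule realization_cases)
  moreover have "B \<in> F"
    using B by (simp split: if_splits)
  moreover have "B \<subseteq> V" "finite V"
    using \<open>B \<in> F\<close> assms(1) by (auto simp: face_family_def)
  ultimately show ?thesis
    using that[of B t] affine_simplex_mono[of B V] by auto
qed

lemma pt_coord_sub_simplex:
  assumes "face_family V F" "p \<in> topspace (realization (sub_simplex V F))"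
  shows "pt (sub_simplex V F) (supp (coord p)) () (coord p) = p"
    and "supp (coord p) \<in> F" "coord p \<in> affine_simplex V"
proof -
  show "pt (sub_simplex V F) (supp (coord p)) () (coord p) = p"
    using carrier_of_point(3)[OF multicomplex_sub_simplex[OF assms(1)] assms(2)] by simp
  show "supp (coord p) \<in> F"
    using carrier_of_point(1)[OF multicomplex_sub_simplex[OF assms(1)] assms(2)]
    by (simp split: if_splits)
  show "coord p \<in> affine_simplex V"
    using assms multicomplex_sub_simplex[OF assms(1)] by (elim sub_simplex_cases) auto
qed

lemma continuous_map_full_simplex_pt:
  "finite V \<Longrightarrow> continuous_map (top_of_set (affine_simplex V)) (realization (full_simplex V))
    (pt (full_simplex V) V ())"
  by (rule continuous_map_cell) (simp add: full_simplex_def)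

lemma continuous_map_sub_simplex_coord:
  assumes "face_family V F"
  shows "continuous_map (realization (sub_simplex V F)) (top_of_set (affine_simplex V)) coord"
  using assms by (intro continuous_map_coord_into multicomplex_sub_simplex pt_coord_sub_simplex(3))

lemma pt_full_simplex_face:
  assumes "finite V" "B \<subseteq> V" "t \<in> affine_simplex B"
  shows "pt (full_simplex V) B () t = pt (full_simplex V) V () t"
  using assms affine_simplex_mono[of B V] unfolding full_simplex_eq
  by (intro pt_sub_simplex_cong face_family_full) auto

lemma pt_coord_full_simplex:
  assumes "finite V" "p \<in> topspace (realization (full_simplex V))"
  shows "pt (full_simplex V) V () (coord p) = p"
  using pt_coord_sub_simplex[OF face_family_full[OF assms(1)]] assms
    pt_full_simplex_face[OF assms(1), of "supp (coord p)" "coord p"]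
    affine_simplex_self_supp[of "coord p" V]
  by (auto simp: full_simplex_eq)

lemma continuous_map_simplex_boundary_pt:
  assumes V: "finite V" "card V \<ge> 2"
  shows "continuous_map (top_of_set (simplex_frontier V)) (realization (simplex_boundary V))
    (\<lambda>t. pt (simplex_boundary V) (supp t) () t)"
proof (rule pasting_lemma_closed[where I=V and T="\<lambda>v. {t \<in> simplex_frontier V. t v = 0}"
      and f="\<lambda>v. pt (simplex_boundary V) (V - {v}) ()"])
  fix v assume v: "v \<in> V"
  have "closed {t :: 'a \<Rightarrow> real. t v = 0}"
    by (intro closed_Collect_eq continuous_on_const continuous_on_product_coordinates)
  then have "closedin (top_of_set (simplex_frontier V)) (simplex_frontier V \<inter> {t. t v = 0})"
    by (rule closedin_closed_Int)
  then show "closedin (top_of_set (simplex_frontier V)) {t \<in> simplex_frontier V. t v = 0}"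
    by (simp add: Int_def)
  have "{t \<in> simplex_frontier V. t v = 0} = affine_simplex (V - {v})"
    using affine_simplex_restrict_iff[of "V - {v}" V] v V by (auto simp: simplex_frontier_def)
  moreover have "{t \<in> simplex_frontier V. t v = 0} \<subseteq> simplex_frontier V"
    by auto
  ultimately show "continuous_map (subtopology (top_of_set (simplex_frontier V)) {t \<in> simplex_frontier V. t v = 0})
      (realization (simplex_boundary V)) (pt (simplex_boundary V) (V - {v}) ())"
    using v by (auto simp: subtopology_subtopology Int_absorb1 simplex_boundary_def intro!: continuous_map_cell)
next
  fix v w t assume "v \<in> V" "w \<in> V" "t \<in> topspace (top_of_set (simplex_frontier V)) \<inter>
      {t \<in> simplex_frontier V. t v = 0} \<inter> {t \<in> simplex_frontier V. t w = 0}"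
  then show "pt (simplex_boundary V) (V - {v}) () t = pt (simplex_boundary V) (V - {w}) () t"
    using affine_simplex_restrict_iff[of "V - {v}" V] affine_simplex_restrict_iff[of "V - {w}" V] V
    unfolding simplex_boundary_eq
    by (intro pt_sub_simplex_cong face_family_boundary) (auto simp: simplex_frontier_def)
next
  fix t assume "t \<in> topspace (top_of_set (simplex_frontier V))"
  then obtain v where v: "v \<in> V" "t v = 0" "t \<in> simplex_frontier V"
    by (auto simp: simplex_frontier_def)
  then have t: "t \<in> affine_simplex V"
    by (simp add: simplex_frontier_def)
  have "supp t \<subset> V"
    using v supp_subset[OF t] by (auto simp: supp_def)
  moreover have "t \<in> affine_simplex (V - {v})"
    using affine_simplex_restrict_iff[of "V - {v}" V] v V t by auto
  ultimately have "pt (simplex_boundary V) (supp t) () t = pt (simplex_boundary V) (V - {v}) () t"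
    using V v affine_simplex_self_supp[OF t] unfolding simplex_boundary_eq
    by (intro pt_sub_simplex_cong face_family_boundary) auto
  then show "\<exists>j. j \<in> V \<and> t \<in> {t \<in> simplex_frontier V. t j = 0} \<and>
      pt (simplex_boundary V) (supp t) () t = pt (simplex_boundary V) (V - {j}) () t"
    using v by blast
qed (use V in auto)

lemma coord_simplex_boundary:
  assumes "finite V" "card V \<ge> 2" "p \<in> topspace (realization (simplex_boundary V))"
  shows "coord p \<in> simplex_frontier V"
proof -
  have "supp (coord p) \<subset> V" "coord p \<in> affine_simplex V"
    using pt_coord_sub_simplex(2,3)[OF face_family_boundary[OF assms(1,2)]] assms(3)
    unfolding simplex_boundary_eq by auto
  then show ?thesis
    unfolding simplex_frontier_def supp_def by blast
qed

section \<open>Renaming the vertices of a simplex\<close>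

text \<open>Inverse to each other on affine simplices when \<open>h\<close> is injective on
  \<open>V\<close>.\<close>

definition push :: "('v \<Rightarrow> 'w) \<Rightarrow> 'v set \<Rightarrow> ('v \<Rightarrow> real) \<Rightarrow> 'w \<Rightarrow> real" where
  "push h V t = (\<lambda>w. if w \<in> h ` V then t (inv_into V h w) else 0)"

definition pull :: "('v \<Rightarrow> 'w) \<Rightarrow> 'v set \<Rightarrow> ('w \<Rightarrow> real) \<Rightarrow> 'v \<Rightarrow> real" where
  "pull h V u = (\<lambda>v. if v \<in> V then u (h v) else 0)"

lemma push_apply: "inj_on h V \<Longrightarrow> v \<in> V \<Longrightarrow> push h V t (h v) = t v"
  by (simp add: push_def)

lemma push_in_affine_simplex:
  assumes "inj_on h V" "B \<subseteq> V" "t \<in> affine_simplex B"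
  shows "push h V t \<in> affine_simplex (h ` B)"
proof -
  have "sum (push h V t) (h ` B) = sum (push h V t \<circ> h) B"
    using assms inj_on_subset by (intro sum.reindex) blast
  also have "\<dots> = sum t B"
    by (rule sum.cong) (use assms push_apply in fastforce)+
  finally have "sum (push h V t) (h ` B) = 1"
    using assms(3) by (simp add: affine_simplex_def)
  moreover have "push h V t w = 0" if "w \<notin> h ` B" for w
  proof (cases "w \<in> h ` V")
    case True
    then obtain v where "v \<in> V" "w = h v" "v \<notin> B"
      using \<open>w \<notin> h ` B\<close> by blast
    then show ?thesis
      using affine_simplex_outside[OF assms(3)] assms(1) by (simp add: push_apply)
  qed (simp add: push_def)
  ultimately show ?thesis
    using affine_simplex_nonneg[OF assms(3)] by (auto simp: affine_simplex_def push_def)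
qed

lemma pull_in_affine_simplex:
  assumes "inj_on h V" "B \<subseteq> V" "u \<in> affine_simplex (h ` B)"
  shows "pull h V u \<in> affine_simplex B"
proof -
  have "sum u (h ` B) = sum (u \<circ> h) B"
    using assms inj_on_subset by (intro sum.reindex) blast
  also have "\<dots> = sum (pull h V u) B"
    by (rule sum.cong) (use assms in \<open>auto simp: pull_def\<close>)
  finally have "sum (pull h V u) B = 1"
    using assms(3) by (simp add: affine_simplex_def)
  moreover have "pull h V u v = 0" if "v \<notin> B" for v
  proof (cases "v \<in> V")
    case True
    then have "h v \<notin> h ` B"
      using assms(1,2) that by (metis inj_on_image_mem_iff)
    then show ?thesis
      using affine_simplex_outside[OF assms(3)] by (simp add: pull_def)
  qed (simp add: pull_def)
  ultimately show ?thesis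
    using affine_simplex_nonneg[OF assms(3)] by (auto simp: affine_simplex_def pull_def)
qed

lemma pull_push:
  assumes "inj_on h V" "t \<in> affine_simplex V"
  shows "pull h V (push h V t) = t"
proof
  fix v
  show "pull h V (push h V t) v = t v"
    using assms affine_simplex_outside[OF assms(2), of v] by (simp add: pull_def push_apply)
qed

lemma push_pull:
  assumes "inj_on h V" "u \<in> affine_simplex (h ` V)"
  shows "push h V (pull h V u) = u"
proof
  fix w
  show "push h V (pull h V u) w = u w"
  proof (cases "w \<in> h ` V")
    case True
    then show ?thesis
      using assms(1) by (auto simp: push_apply pull_def)
  next
    case False
    then show ?thesis
      using affine_simplex_outside[OF assms(2) False] by (simp add: push_def)
  qed
qed

lemma push_in_frontier:
  "inj_on h V \<Longrightarrow> t \<in> simplex_frontier V \<Longrightarrow> push h V t \<in> simplex_frontier (h ` V)"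
  using push_in_affine_simplex[of h V V t] by (auto simp: simplex_frontier_def push_apply)

lemma pull_in_frontier:
  "inj_on h V \<Longrightarrow> u \<in> simplex_frontier (h ` V) \<Longrightarrow> pull h V u \<in> simplex_frontier V"
  using pull_in_affine_simplex[of h V V u] by (auto simp: simplex_frontier_def pull_def)

lemma continuous_on_push: "continuous_on S (push h V)"
proof (rule continuous_on_coordinatewise_then_product)
  fix w
  show "continuous_on S (\<lambda>t. push h V t w)"
    by (cases "w \<in> h ` V")
      (simp_all add: push_def continuous_on_subset[OF continuous_on_product_coordinates])
qed

lemma continuous_on_pull: "continuous_on S (pull h V)"
proof (rule continuous_on_coordinatewise_then_product)
  fix v
  show "continuous_on S (\<lambda>t. pull h V t v)"
    by (cases "v \<in> V")
      (simp_all add: pull_def continuous_on_subset[OF continuous_on_product_coordinates])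
qed

lemma continuous_map_push:
  "inj_on h V \<Longrightarrow> continuous_map (top_of_set (affine_simplex V)) (top_of_set (affine_simplex (h ` V))) (push h V)"
  using push_in_affine_simplex[of h V V] by (auto simp: continuous_on_push)

lemma continuous_map_pull:
  "inj_on h V \<Longrightarrow> continuous_map (top_of_set (affine_simplex (h ` V))) (top_of_set (affine_simplex V)) (pull h V)"
  using pull_in_affine_simplex[of h V V] by (auto simp: continuous_on_pull)

section \<open>Simplicial embeddings of subcomplexes of a simplex\<close>

text \<open>A simplicial map out of a subcomplex of a simplex, given by its labels \<open>h\<close> and by
  the chosen simplices \<open>\<theta>\<close>. The latter are indexed by their vertex sets in
  the target, so that only \<open>h\<close> depends on the labelling.\<close>

definition mk_smap ::
  "'v set \<Rightarrow> 'v set set \<Rightarrow> ('v \<Rightarrow> 'w) \<Rightarrow> ('w set \<Rightarrow> 't) \<Rightarrow> ('v, unit, 'w, 't) smap" where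
  "mk_smap V F h \<theta> = (restrict h V, \<lambda>B. \<lambda>x\<in>simplices (sub_simplex V F) B. \<theta> (h ` B))"

lemma simplicial_embedding_mk_smap:
  assumes "face_family V F" "inj_on h V" "h ` V \<subseteq> verts A"
    and \<theta>: "\<And>B. B \<in> F \<Longrightarrow> \<theta> (h ` B) \<in> simplices A (h ` B)"
    and bdry: "\<And>B C. B \<in> F \<Longrightarrow> C \<subseteq> B \<Longrightarrow> bdry A (h ` B) (h ` C) (\<theta> (h ` B)) = \<theta> (h ` C)"
  shows "simplicial_embedding (sub_simplex V F) A (mk_smap V F h \<theta>)"
proof -
  have im: "restrict h V ` B = h ` B" if "B \<in> F" for B
    using that assms(1) by (intro image_cong) (auto simp: face_family_def)
  have sub: "C \<in> F" if "B \<in> F" "C \<subseteq> B" for B C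
    using that assms(1) by (auto simp: face_family_def)
  have "fst (mk_smap V F h \<theta>) \<in> verts (sub_simplex V F) \<rightarrow>\<^sub>E verts A"
    using assms(3) by (auto simp: mk_smap_def)
  moreover have "snd (mk_smap V F h \<theta>) B \<in> simplices (sub_simplex V F) B \<rightarrow>\<^sub>E
      simplices A (fst (mk_smap V F h \<theta>) ` B)" for B
    using \<theta> im by (auto simp: mk_smap_def)
  moreover have "snd (mk_smap V F h \<theta>) C (bdry (sub_simplex V F) B C \<sigma>) =
      bdry A (fst (mk_smap V F h \<theta>) ` B) (fst (mk_smap V F h \<theta>) ` C) (snd (mk_smap V F h \<theta>) B \<sigma>)"
    if "\<sigma> \<in> simplices (sub_simplex V F) B" "C \<subseteq> B" for B C \<sigma>
  proof -
    have "B \<in> F"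
      using that by (simp split: if_splits)
    then show ?thesis
      using bdry[of B C] that im[of B] im[of C] sub[of B C] by (simp add: mk_smap_def)
  qed
  moreover have "inj_on (fst (mk_smap V F h \<theta>)) (verts (sub_simplex V F))"
    using assms(2) by (simp add: mk_smap_def)
  moreover have "inj_on (snd (mk_smap V F h \<theta>) B) (simplices (sub_simplex V F) B)" for B
    by (auto simp: inj_on_def)
  ultimately show ?thesis
    unfolding simplicial_embedding_def simplicial_map_def by blast
qed

text \<open>Injectivity on vertices makes a face recoverable from its image, which is why the simplices can
  be indexed by vertex sets of the target.\<close>

lemma simplicial_embedding_eq_mk_smap:
  assumes F: "face_family V F" and emb: "simplicial_embedding (sub_simplex V F) A \<phi>"
  defines "h \<equiv> fst \<phi>" and "\<theta> \<equiv> \<lambda>E. snd \<phi> {v \<in> V. fst \<phi> v \<in> E} ()"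
  shows "\<phi> = mk_smap V F h \<theta>" "inj_on h V" "h ` V \<subseteq> verts A"
    "\<And>B. B \<in> F \<Longrightarrow> \<theta> (h ` B) = snd \<phi> B ()"
    "\<And>B. B \<in> F \<Longrightarrow> \<theta> (h ` B) \<in> simplices A (h ` B)"
    "\<And>B C. B \<in> F \<Longrightarrow> C \<subseteq> B \<Longrightarrow> bdry A (h ` B) (h ` C) (\<theta> (h ` B)) = \<theta> (h ` C)"
proof -
  have map: "fst \<phi> \<in> V \<rightarrow>\<^sub>E verts A"
    "\<And>B. snd \<phi> B \<in> simplices (sub_simplex V F) B \<rightarrow>\<^sub>E simplices A (fst \<phi> ` B)"
    "\<And>B C \<sigma>. \<sigma> \<in> simplices (sub_simplex V F) B \<Longrightarrow> C \<subseteq> B \<Longrightarrow>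
        snd \<phi> C (bdry (sub_simplex V F) B C \<sigma>) = bdry A (fst \<phi> ` B) (fst \<phi> ` C) (snd \<phi> B \<sigma>)"
    and inj: "inj_on (fst \<phi>) V"
    using emb by (simp_all add: simplicial_embedding_def simplicial_map_def)
  show "inj_on h V" "h ` V \<subseteq> verts A"
    using map inj by (auto simp: h_def)
  have sub: "C \<in> F" if "B \<in> F" "C \<subseteq> B" for B C
    using that F by (auto simp: face_family_def)
  show eq: "\<theta> (h ` B) = snd \<phi> B ()" if "B \<in> F" for B
  proof -
    have "B \<subseteq> V"
      using that F by (auto simp: face_family_def)
    then have "{v \<in> V. fst \<phi> v \<in> h ` B} = B"
      using inj unfolding h_def inj_on_def by blast
    then show ?thesis
      by (simp add: \<theta>_def)
  qed
  show "\<theta> (h ` B) \<in> simplices A (h ` B)" if "B \<in> F" for B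
    using map(2)[of B] that eq[OF that] by (auto simp: h_def)
  show "bdry A (h ` B) (h ` C) (\<theta> (h ` B)) = \<theta> (h ` C)" if "B \<in> F" "C \<subseteq> B" for B C
    using map(3)[of "()" B C] that eq sub[OF that] by (simp add: h_def)
  have "snd \<phi> B = snd (mk_smap V F h \<theta>) B" for B
  proof (rule extensionalityI)
    show "snd \<phi> B \<in> extensional (simplices (sub_simplex V F) B)"
      using map(2)[of B] by (auto simp: PiE_def)
    show "snd (mk_smap V F h \<theta>) B \<in> extensional (simplices (sub_simplex V F) B)"
      by (simp add: mk_smap_def)
    show "snd \<phi> B x = snd (mk_smap V F h \<theta>) B x" if "x \<in> simplices (sub_simplex V F) B" for x
      using that eq[of B] by (simp add: mk_smap_def split: if_splits)
  qed
  moreover have "fst \<phi> = restrict h V"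
    using map(1) by (auto simp: h_def PiE_restrict)
  ultimately show "\<phi> = mk_smap V F h \<theta>"
    by (auto simp: prod_eq_iff mk_smap_def)
qed

lemma realization_map_mk_smap:
  assumes F: "face_family V F" and emb: "simplicial_embedding (sub_simplex V F) A (mk_smap V F h \<theta>)"
    and B: "B \<in> F" "t \<in> affine_simplex B" and inj: "inj_on h V"
  shows "realization_map A (mk_smap V F h \<theta>) (pt (sub_simplex V F) B () t) =
    pt A (h ` B) (\<theta> (h ` B)) (push h V t)"
proof -
  have BV: "B \<subseteq> V"
    using F B by (auto simp: face_family_def)
  have im: "restrict h V ` B = h ` B"
    using BV by (intro image_cong) auto
  have "(\<lambda>w. \<Sum>v\<in>{v \<in> B. restrict h V v = w}. t v) = push h V t"
  proof
    fix w
    show "(\<Sum>v\<in>{v \<in> B. restrict h V v = w}. t v) = push h V t w"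
    proof (cases "w \<in> h ` B")
      case True
      then obtain v where v: "v \<in> B" "w = h v"
        by blast
      then have "{v \<in> B. restrict h V v = w} = {v}"
        using BV inj by (auto simp: inj_on_def subset_iff)
      then show ?thesis
        using v BV inj by (auto simp: push_apply)
    next
      case False
      then have empty: "{v \<in> B. restrict h V v = w} = {}"
        using BV by auto
      moreover have "push h V t w = 0"
        using affine_simplex_outside[OF push_in_affine_simplex[OF inj BV B(2)] False] .
      ultimately show ?thesis
        unfolding empty by simp
    qed
  qed
  then have "cell_map (mk_smap V F h \<theta>) ((B, ()), t) = ((h ` B, \<theta> (h ` B)), push h V t)"
    using im B(1) by (simp add: cell_map_def mk_smap_def)
  moreover have "simplicial_map (sub_simplex V F) A (mk_smap V F h \<theta>)"
    using emb by (simp add: simplicial_embedding_def)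
  ultimately show ?thesis
    by (simp add: realization_map_rpoint[OF multicomplex_sub_simplex[OF F]])
qed

lemma realization_map_inclusion:
  assumes F: "face_family V F" and sm: "simplicial_map (sub_simplex V F) L (inclusion (sub_simplex V F))"
    and B: "B \<in> F"
  shows "realization_map L (inclusion (sub_simplex V F)) (pt (sub_simplex V F) B () t) =
    pt L B () (\<lambda>w. if w \<in> B then t w else 0)"
proof -
  have BV: "B \<subseteq> V" and fin: "finite B"
    using F B by (auto simp: face_family_def intro: finite_subset)
  have "(\<Sum>v\<in>{v \<in> B. restrict (\<lambda>v. v) V v = w}. t v) = (if w \<in> B then t w else 0)" for w
  proof -
    have "{v \<in> B. restrict (\<lambda>v. v) V v = w} = (if w \<in> B then {w} else {})"
      using BV by auto
    then show ?thesis
      by simp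
  qed
  moreover have "restrict (\<lambda>v. v) V ` B = B"
    using BV by force
  ultimately have "cell_map (inclusion (sub_simplex V F)) ((B, ()), t) = ((B, ()), \<lambda>w. if w \<in> B then t w else 0)"
    using B by (simp add: cell_map_def inclusion_def)
  then show ?thesis
    by (simp add: realization_map_rpoint[OF multicomplex_sub_simplex[OF F] sm])
qed

lemma affine_simplex_restrict_self: "t \<in> affine_simplex B \<Longrightarrow> (\<lambda>w. if w \<in> B then t w else 0) = t"
  by (auto simp: affine_simplex_def)

lemma face_family_std_boundary: "n \<ge> 1 \<Longrightarrow> face_family {..n} {B. B \<subset> {..n::nat}}"
  by (rule face_family_boundary) auto

lemma realization_map_inclusion_boundary:
  assumes "n \<ge> 1" "B \<subset> {..n}" "t \<in> affine_simplex B"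
  shows "realization_map (\<Delta> n) (inclusion (\<partial>\<Delta> n)) (pt (\<partial>\<Delta> n) B () t) = pt (\<Delta> n) {..n} () t"
proof -
  have "simplicial_map (\<partial>\<Delta> n) (\<Delta> n) (inclusion (\<partial>\<Delta> n))"
    using simplicial_embedding_inclusion_boundary by (simp add: simplicial_embedding_def)
  then have "realization_map (\<Delta> n) (inclusion (\<partial>\<Delta> n)) (pt (\<partial>\<Delta> n) B () t) = pt (\<Delta> n) B () t"
    using realization_map_inclusion[OF face_family_std_boundary[OF assms(1)], of "\<Delta> n" B t] assms(2,3)
    by (simp add: simplex_boundary_eq affine_simplex_restrict_self)
  then show ?thesis
    using pt_full_simplex_face[of "{..n}" B t] assms by auto
qed

lemma realized_boundary_eq:
  assumes "n \<ge> 1"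
  shows "realized_boundary n = pt (\<Delta> n) {..n} () ` simplex_frontier {..n}"
proof
  show "realized_boundary n \<subseteq> pt (\<Delta> n) {..n} () ` simplex_frontier {..n}"
  proof
    fix q assume "q \<in> realized_boundary n"
    then obtain p where p: "p \<in> topspace (realization (\<partial>\<Delta> n))"
      "q = realization_map (\<Delta> n) (inclusion (\<partial>\<Delta> n)) p"
      by (auto simp: realized_boundary_def)
    obtain B t where B: "B \<in> {B. B \<subset> {..n}}" "t \<in> affine_simplex B" "p = pt (\<partial>\<Delta> n) B () t"
      using sub_simplex_cases[OF face_family_std_boundary[OF assms]] p(1)
      unfolding simplex_boundary_eq by metis
    then have "q = pt (\<Delta> n) {..n} () t"
      using p(2) realization_map_inclusion_boundary[OF assms, of B t] by simp
    moreover have "t \<in> simplex_frontier {..n}"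
      using B by (subst simplex_frontier_iff) auto
    ultimately show "q \<in> pt (\<Delta> n) {..n} () ` simplex_frontier {..n}"
      by blast
  qed
  show "pt (\<Delta> n) {..n} () ` simplex_frontier {..n} \<subseteq> realized_boundary n"
  proof
    fix q assume "q \<in> pt (\<Delta> n) {..n} () ` simplex_frontier {..n}"
    then obtain t where t: "t \<in> simplex_frontier {..n}" "q = pt (\<Delta> n) {..n} () t"
      by blast
    then obtain B where B: "B \<subset> {..n}" "t \<in> affine_simplex B"
      by (auto simp: simplex_frontier_iff)
    then have "pt (\<partial>\<Delta> n) B () t \<in> topspace (realization (\<partial>\<Delta> n))"
      by (intro pt_in_topspace) (auto simp: simplex_boundary_def)
    then show "q \<in> realized_boundary n"
      unfolding realized_boundary_def t(2) realization_map_inclusion_boundary[OF assms B, symmetric]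
      by (rule imageI)
  qed
qed

section \<open>Null-homotopic boundaries\<close>

definition barycentre :: "'v set \<Rightarrow> 'v \<Rightarrow> real" where
  "barycentre V = (\<lambda>v. if v \<in> V then 1 / card V else 0)"

lemma barycentre_in_affine_simplex: "finite V \<Longrightarrow> V \<noteq> {} \<Longrightarrow> barycentre V \<in> affine_simplex V"
  by (auto simp: barycentre_def affine_simplex_def)

lemma continuous_map_seg_compose:
  assumes "continuous_map X (top_of_set {0..1}) k" "continuous_map X (top_of_set (affine_simplex B)) f"
    "continuous_map X (top_of_set (affine_simplex B)) g"
  shows "continuous_map X (top_of_set (affine_simplex B)) (\<lambda>x. seg (k x) (f x) (g x))"
proof -
  let ?S = "{0..1} \<times> (affine_simplex B \<times> affine_simplex B)"
  have "continuous_map X (prod_topology (top_of_set {0..1}) (prod_topology (top_of_set (affine_simplex B))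
      (top_of_set (affine_simplex B)))) (\<lambda>x. (k x, (f x, g x)))"
    using assms by (intro continuous_map_pairedI)
  then have 1: "continuous_map X (top_of_set ?S) (\<lambda>x. (k x, (f x, g x)))"
    by simp
  have 2: "continuous_map (top_of_set ?S) (top_of_set (affine_simplex B))
      (\<lambda>z. seg (fst z) (fst (snd z)) (snd (snd z)))"
    by (auto intro!: continuous_intros seg_in_affine_simplex)
  show ?thesis
    using continuous_map_compose[OF 1 2] by (simp add: o_def)
qed

lemma Min_frontier:
  assumes "finite V" "t \<in> simplex_frontier V"
  shows "Min (t ` V) = 0"
proof -
  obtain v where "v \<in> V" "t v = 0" "t \<in> affine_simplex V"
    using assms(2) by (auto simp: simplex_frontier_def)
  then show ?thesis
    using assms(1) affine_simplex_nonneg[of t V] by (intro Min_eqI) (auto simp: image_iff intro: bexI[of _ v])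
qed

lemma Min_seg_barycentre:
  assumes "finite V" "t \<in> simplex_frontier V" "0 \<le> s" "s \<le> 1"
  shows "Min (seg s t (barycentre V) ` V) = s / card V"
proof -
  obtain v where v: "v \<in> V" "t v = 0" "t \<in> affine_simplex V"
    using assms(2) by (auto simp: simplex_frontier_def)
  show ?thesis
  proof (rule Min_eqI)
    show "s / card V \<in> seg s t (barycentre V) ` V"
      using v by (intro image_eqI[of _ _ v]) (auto simp: seg_def barycentre_def)
    show "s / card V \<le> y" if "y \<in> seg s t (barycentre V) ` V" for y
      using that assms(4) affine_simplex_nonneg[OF v(3)] by (auto simp: seg_def barycentre_def)
  qed (use assms in simp)
qed

text \<open>Radial coordinates about the barycentre: subtract the minimal coordinate and normalize.\<close>

lemma seg_barycentre_surj:
  assumes "finite V" "card V \<ge> 2" "a \<in> affine_simplex V"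
  obtains s t where "0 \<le> s" "s \<le> 1" "t \<in> simplex_frontier V" "a = seg s t (barycentre V)"
proof -
  let ?c = "real (card V)"
  define m where "m = Min (a ` V)"
  have V: "V \<noteq> {}" and c: "?c > 0"
    using assms by auto
  have mle: "m \<le> a v" if "v \<in> V" for v
    using that assms(1) by (simp add: m_def)
  have "m \<in> a ` V"
    unfolding m_def using assms(1) V by (intro Min_in) auto
  then obtain v0 where v0: "v0 \<in> V" "a v0 = m"
    by auto
  have m0: "0 \<le> m"
    using v0 affine_simplex_nonneg[OF assms(3), of v0] by simp
  have sum: "sum a V = 1"
    using assms(3) by (simp add: affine_simplex_def)
  have "?c * m \<le> sum a V"
    using sum_bounded_below[of V m a] mle by simp
  then have s1: "?c * m \<le> 1"
    using sum by simp
  show ?thesis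
  proof (cases "?c * m = 1")
    case True
    have "a v = m" if "v \<in> V" for v
    proof -
      have "(\<Sum>v\<in>V. a v - m) = 0"
        using sum True by (simp add: sum_subtractf)
      then have "\<forall>v\<in>V. a v - m = 0"
        using mle assms(1) by (subst (asm) sum_nonneg_eq_0_iff) auto
      then show ?thesis
        using that by auto
    qed
    moreover have "m = 1 / ?c"
      using True c by (simp add: field_simps)
    ultimately have "a = barycentre V"
      using affine_simplex_outside[OF assms(3)] by (intro ext) (simp add: barycentre_def)
    moreover have "indicator {v0} \<in> simplex_frontier V"
    proof -
      obtain w where "w \<in> V" "w \<noteq> v0"
        using assms(2) v0(1) by (metis card_le_Suc0_iff_eq assms(1) not_less_eq_eq numeral_2_eq_2)
      then show ?thesis
        using indicator_in_affine_simplex[OF v0(1) assms(1)] by (auto simp: simplex_frontier_def intro!: bexI[of _ w])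
    qed
    ultimately show ?thesis
      using that[of 1 "indicator {v0}"] by simp
  next
    case False
    define s where "s = ?c * m"
    define t where "t = (\<lambda>v. if v \<in> V then (a v - m) / (1 - s) else 0)"
    have s: "0 \<le> s" "s < 1"
      using False s1 m0 by (auto simp: s_def)
    have "sum t V = (\<Sum>v\<in>V. a v - m) / (1 - s)"
      by (simp add: t_def sum_divide_distrib)
    also have "\<dots> = 1"
      using s sum by (simp add: sum_subtractf s_def)
    finally have "t \<in> affine_simplex V"
      using s mle by (auto simp: affine_simplex_def t_def)
    then have "t \<in> simplex_frontier V"
      using v0 by (auto simp: simplex_frontier_def t_def intro!: bexI[of _ v0])
    moreover have "a = seg s t (barycentre V)"
    proof
      fix v
      show "a v = seg s t (barycentre V) v"
        using s c affine_simplex_outside[OF assms(3), of v]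
        by (auto simp: seg_def t_def barycentre_def s_def)
    qed
    ultimately show ?thesis
      using that s by simp
  qed
qed

text \<open>The simplex is the quotient of the product of an interval with its frontier that collapses the
  end \<open>s = 1\<close> to the barycentre. Since it is a quotient of a compact space,
  continuity at the barycentre is automatic.\<close>

lemma cone_extension:
  assumes V: "finite V" "card V \<ge> 2"
    and k: "continuous_map (prod_topology \<I> (top_of_set (simplex_frontier V))) X k"
    and const: "\<And>t. t \<in> simplex_frontier V \<Longrightarrow> k (1, t) = c"
  obtains G where "continuous_map (top_of_set (affine_simplex V)) X G"
    and "\<And>t. t \<in> simplex_frontier V \<Longrightarrow> G t = k (0, t)"
proof -
  let ?b = "barycentre V" and ?S = "{0..1::real} \<times> simplex_frontier V"
  let ?q = "\<lambda>z. seg (fst z) (snd z) ?b"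
  have b: "?b \<in> affine_simplex V"
    using V by (intro barycentre_in_affine_simplex) auto
  have quot: "quotient_map (top_of_set ?S) (top_of_set (affine_simplex V)) ?q"
  proof (rule compact_Hausdorff_quotient_map)
    show "compact_space (top_of_set ?S)"
      using V by (simp add: compact_space_subtopology compact_Times compact_simplex_frontier)
    show "Hausdorff_space (top_of_set (affine_simplex V))"
      by (rule Hausdorff_function_space)
    show "continuous_map (top_of_set ?S) (top_of_set (affine_simplex V)) ?q"
      using b simplex_frontier_subset[of V] by (auto intro!: continuous_intros seg_in_affine_simplex)
    show "?q ` topspace (top_of_set ?S) = topspace (top_of_set (affine_simplex V))"
    proof
      show "?q ` topspace (top_of_set ?S) \<subseteq> topspace (top_of_set (affine_simplex V))"
        using b simplex_frontier_subset[of V] by (auto intro!: seg_in_affine_simplex)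
      show "topspace (top_of_set (affine_simplex V)) \<subseteq> ?q ` topspace (top_of_set ?S)"
      proof
        fix a assume "a \<in> topspace (top_of_set (affine_simplex V))"
        then obtain s t where "0 \<le> s" "s \<le> 1" "t \<in> simplex_frontier V" "a = seg s t ?b"
          using seg_barycentre_surj[OF V, of a] by auto
        then show "a \<in> ?q ` topspace (top_of_set ?S)"
          by (intro image_eqI[of _ _ "(s, t)"]) auto
      qed
    qed
  qed
  have k': "continuous_map (top_of_set ?S) X k"
    using k by simp
  obtain G where G: "continuous_map (top_of_set (affine_simplex V)) X G"
    "\<And>z. z \<in> topspace (top_of_set ?S) \<Longrightarrow> G (?q z) = k z"
  proof (rule quotient_map_lift_exists[OF quot k'])
    fix z z' assume z: "z \<in> topspace (top_of_set ?S)" and z': "z' \<in> topspace (top_of_set ?S)"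
      and eq: "?q z = ?q z'"
    obtain s t s' t' where [simp]: "z = (s, t)" "z' = (s', t')"
      by fastforce
    have s: "s = s'"
      using Min_seg_barycentre[OF V(1), of t s] Min_seg_barycentre[OF V(1), of t' s'] z z' eq V by auto
    show "k z = k z'"
    proof (cases "s = 1")
      case True
      then show ?thesis
        using const z z' s by simp
    next
      case False
      have "t = t'"
        using fun_cong[OF eq] s False by (intro ext) (simp add: seg_def)
      then show ?thesis
        using s by simp
    qed
  qed (use that in blast)
  then show ?thesis
    using that[of G] by (metis G(2) SigmaI atLeastAtMost_iff fst_conv order_refl seg_0 snd_conv
        topspace_euclidean_subtopology zero_le_one)
qed

text \<open>A null-homotopy is a map on the cone over the boundary, and the simplex is this cone with the
  barycentre as apex. Conversely, a map on the simplex can be contracted along segments to the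
  barycentre.\<close>

lemma null_homotopic_simplex_boundary_iff:
  assumes V: "finite V" "card V \<ge> 2"
  shows "null_homotopic (realization (simplex_boundary V)) X f \<longleftrightarrow>
    (\<exists>G. continuous_map (top_of_set (affine_simplex V)) X G \<and>
      (\<forall>t\<in>simplex_frontier V. G t = f (pt (simplex_boundary V) (supp t) () t)))"
    (is "?lhs \<longleftrightarrow> ?rhs")
proof
  let ?D = "simplex_boundary V"
  assume ?lhs
  then obtain c where "homotopic_with (\<lambda>_. True) (realization ?D) X f (\<lambda>_. c)"
    by (auto simp: null_homotopic_def)
  then obtain h where h: "continuous_map (prod_topology \<I> (realization ?D)) X h"
    "\<And>x. h (0, x) = f x" "\<And>x. h (1, x) = c"
    unfolding homotopic_with_def by blast
  have "continuous_map (prod_topology \<I> (top_of_set (simplex_frontier V))) (prod_topology \<I> (realization ?D))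
      (\<lambda>z. (fst z, pt ?D (supp (snd z)) () (snd z)))"
    by (intro continuous_map_pairedI continuous_map_fst continuous_map_compose[OF continuous_map_snd
        continuous_map_simplex_boundary_pt[OF V], unfolded o_def])
  from continuous_map_compose[OF this h(1)]
  obtain G where "continuous_map (top_of_set (affine_simplex V)) X G"
    "\<And>t. t \<in> simplex_frontier V \<Longrightarrow> G t = h (0, pt ?D (supp t) () t)"
    by (rule cone_extension[OF V]) (auto simp: h(3))
  then show ?rhs
    using h(2) by metis
next
  let ?D = "simplex_boundary V" and ?b = "barycentre V"
  assume ?rhs
  then obtain G where G: "continuous_map (top_of_set (affine_simplex V)) X G"
    "\<And>t. t \<in> simplex_frontier V \<Longrightarrow> G t = f (pt ?D (supp t) () t)"
    by blast
  have b: "?b \<in> affine_simplex V"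
    using V by (intro barycentre_in_affine_simplex) auto
  have "continuous_map (realization ?D) (top_of_set (affine_simplex V)) coord"
    using continuous_map_sub_simplex_coord[OF face_family_boundary[OF V]] by (simp add: simplex_boundary_eq)
  then have "continuous_map (prod_topology \<I> (realization ?D)) (top_of_set (affine_simplex V))
      (\<lambda>z. seg (fst z) (coord (snd z)) ?b)"
    using b by (intro continuous_map_seg_compose continuous_map_fst
        continuous_map_compose[OF continuous_map_snd, unfolded o_def]) auto
  from continuous_map_compose[OF this G(1)]
  have "continuous_map (prod_topology \<I> (realization ?D)) X (\<lambda>z. G (seg (fst z) (coord (snd z)) ?b))"
    by (simp add: o_def)
  moreover have "G (coord p) = f p" if "p \<in> topspace (realization ?D)" for p
    using that G(2)[OF coord_simplex_boundary[OF V that]] pt_coord_sub_simplex(1)[OF face_family_boundary[OF V]]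
    by (simp add: simplex_boundary_eq)
  ultimately have "homotopic_with (\<lambda>_. True) (realization ?D) X f (\<lambda>_. G ?b)"
    by (subst homotopic_with) (auto intro!: exI[of _ "\<lambda>z. G (seg (fst z) (coord (snd z)) ?b)"])
  then show ?lhs
    by (auto simp: null_homotopic_def)
qed

section \<open>Conditions on vertex sets\<close>

definition edge_path :: "('v, 's) premulticomplex \<Rightarrow> 'v \<Rightarrow> 'v \<Rightarrow> 's \<Rightarrow> real \<Rightarrow> ('v, 's) cell_point set" where
  "edge_path A v w \<epsilon> s = pt A {v, w} \<epsilon> (seg s (indicator {v}) (indicator {w}))"

definition unique_edges :: "('v, 's) premulticomplex \<Rightarrow> bool" where
  "unique_edges A \<longleftrightarrow> (\<forall>v\<in>verts A. \<forall>w\<in>verts A. \<forall>\<gamma>. v \<noteq> w \<and> pathin (realization A) \<gamma> \<and>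
     \<gamma> 0 = vertex_point A v \<and> \<gamma> 1 = vertex_point A w \<longrightarrow>
     (\<exists>!\<epsilon>. \<epsilon> \<in> simplices A {v, w} \<and> homotopic_rel {0, 1} \<I> (realization A) \<gamma> (edge_path A v w \<epsilon>)))"

text \<open>The choice of simplices that underlies a simplicial embedding of the boundary of the simplex on
  \<open>W\<close>. The empty face is included, as multicomplexes may have simplices on the
  empty set.\<close>

definition face_system :: "('v, 's) premulticomplex \<Rightarrow> 'v set \<Rightarrow> ('v set \<Rightarrow> 's) \<Rightarrow> bool" where
  "face_system A W \<theta> \<longleftrightarrow>
     (\<forall>B. B \<subset> W \<longrightarrow> \<theta> B \<in> simplices A B \<and> (\<forall>C\<subseteq>B. bdry A B C (\<theta> B) = \<theta> C))"

definition extends_faces ::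
  "('v, 's) premulticomplex \<Rightarrow> 'v set \<Rightarrow> ('v set \<Rightarrow> 's) \<Rightarrow> (('v \<Rightarrow> real) \<Rightarrow> ('v, 's) cell_point set) \<Rightarrow> bool" where
  "extends_faces A W \<theta> F \<longleftrightarrow> continuous_map (top_of_set (affine_simplex W)) (realization A) F \<and>
     (\<forall>B. B \<subset> W \<longrightarrow> (\<forall>t\<in>affine_simplex B. F t = pt A B (\<theta> B) t))"

definition straightened :: "('v, 's) premulticomplex \<Rightarrow> 'v set \<Rightarrow> (('v \<Rightarrow> real) \<Rightarrow> ('v, 's) cell_point set) \<Rightarrow> 's \<Rightarrow> bool" where
  "straightened A W F \<sigma> \<longleftrightarrow> \<sigma> \<in> simplices A W \<and>
     homotopic_rel (simplex_frontier W) (top_of_set (affine_simplex W)) (realization A) F (pt A W \<sigma>)"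

definition edge_system :: "('v, 's) premulticomplex \<Rightarrow> 'v set \<Rightarrow> ('v set \<Rightarrow> 's) \<Rightarrow> bool" where
  "edge_system A W \<epsilon> \<longleftrightarrow> (\<forall>v\<in>W. \<forall>w\<in>W. v \<noteq> w \<longrightarrow> \<epsilon> {v, w} \<in> simplices A {v, w})"

text \<open>A null-homotopic triangular loop in the form in which it is used and produced below: the loop
  extends to a map on the triangle.\<close>

definition filled_triangle :: "('v, 's) premulticomplex \<Rightarrow> 'v set \<Rightarrow> ('v set \<Rightarrow> 's) \<Rightarrow> bool" where
  "filled_triangle A T \<epsilon> \<longleftrightarrow> (\<exists>G. continuous_map (top_of_set (affine_simplex T)) (realization A) G \<and>
     (\<forall>v\<in>T. \<forall>w\<in>T. v \<noteq> w \<longrightarrow> (\<forall>t\<in>affine_simplex {v, w}. G t = pt A {v, w} (\<epsilon> {v, w}) t)))"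

definition unique_fillings :: "('v, 's) premulticomplex \<Rightarrow> bool" where
  "unique_fillings A \<longleftrightarrow> (\<forall>W \<epsilon>. finite W \<and> W \<subseteq> verts A \<and> card W \<ge> 3 \<and> edge_system A W \<epsilon> \<and>
     (\<forall>T. T \<subseteq> W \<and> card T = 3 \<longrightarrow> filled_triangle A T \<epsilon>) \<longrightarrow>
     (\<exists>!\<sigma>. \<sigma> \<in> simplices A W \<and> (\<forall>v\<in>W. \<forall>w\<in>W. v \<noteq> w \<longrightarrow> bdry A W {v, w} \<sigma> = \<epsilon> {v, w})))"

lemma transfer_unique_existence:
  assumes "\<And>x. P x \<Longrightarrow> Q (k x) \<and> m (k x) = x" and "\<And>y. Q y \<Longrightarrow> P (m y) \<and> k (m y) = y"
  shows "(\<exists>x. P x) \<longleftrightarrow> (\<exists>y. Q y)" and "(\<exists>\<^sub>\<le>\<^sub>1x. P x) \<longleftrightarrow> (\<exists>\<^sub>\<le>\<^sub>1y. Q y)" and "(\<exists>!x. P x) \<longleftrightarrow> (\<exists>!y. Q y)"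
  using assms unfolding Uniq_def by metis+

lemma face_family_std: "face_family {..n::nat} (Pow {..n})"
  by (rule face_family_full) simp

lemma vertex_point_eq: "vertex_point A v = pt A {v} (the_elem (simplices A {v})) (indicator {v})"
  by (simp add: vertex_point_def)

section \<open>Completeness and minimality on vertex sets\<close>

definition simplex_chart :: "(nat \<Rightarrow> 'v) \<Rightarrow> nat \<Rightarrow> ('v \<Rightarrow> real) \<Rightarrow> (nat, unit) cell_point set" where
  "simplex_chart h n u = pt (\<Delta> n) {..n} () (pull h {..n} u)"

definition smap_of_simplex :: "('v, 's) premulticomplex \<Rightarrow> (nat \<Rightarrow> 'v) \<Rightarrow> nat \<Rightarrow> 's \<Rightarrow> (nat, unit, 'v, 's) smap" where
  "smap_of_simplex A h n \<sigma> = mk_smap {..n} (Pow {..n}) h (\<lambda>E. bdry A (h ` {..n}) E \<sigma>)"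

lemma continuous_map_simplex_chart:
  assumes "inj_on h {..n}"
  shows "continuous_map (top_of_set (affine_simplex (h ` {..n}))) (realization (\<Delta> n)) (simplex_chart h n)"
  using continuous_map_compose[OF continuous_map_pull[OF assms] continuous_map_full_simplex_pt[of "{..n}"]]
  by (simp add: o_def simplex_chart_def[abs_def])

lemma simplex_chart_inverse:
  assumes "inj_on h {..n}" "p \<in> topspace (realization (\<Delta> n))"
  shows "simplex_chart h n (push h {..n} (coord p)) = p"
proof -
  have "coord p \<in> affine_simplex {..n}"
    using pt_coord_sub_simplex(3)[OF face_family_std, of p n] assms(2) by (simp add: full_simplex_eq)
  then show ?thesis
    using pt_coord_full_simplex[of "{..n}" p] assms by (simp add: simplex_chart_def pull_push)
qed

lemma continuous_map_simplex_chart_inverse: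
  assumes "inj_on h {..n}"
  shows "continuous_map (realization (\<Delta> n)) (top_of_set (affine_simplex (h ` {..n})))
    (\<lambda>p. push h {..n} (coord p))"
  using continuous_map_compose[OF continuous_map_sub_simplex_coord[OF face_family_std] continuous_map_push[OF assms]]
  by (simp add: o_def full_simplex_eq)

text \<open>The chart is a homeomorphism that matches the frontier with the realized boundary.\<close>

lemma homotopic_rel_simplex_chart:
  assumes n: "n \<ge> 1" and inj: "inj_on h {..n}"
  shows "homotopic_rel (realized_boundary n) (realization (\<Delta> n)) X f g \<longleftrightarrow>
    homotopic_rel (simplex_frontier (h ` {..n})) (top_of_set (affine_simplex (h ` {..n}))) X
      (f \<circ> simplex_chart h n) (g \<circ> simplex_chart h n)"
proof
  have mc: "multicomplex (\<Delta> n)"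
    by (rule multicomplex_full_simplex) simp
  {
    assume "homotopic_rel (realized_boundary n) (realization (\<Delta> n)) X f g"
    then show "homotopic_rel (simplex_frontier (h ` {..n})) (top_of_set (affine_simplex (h ` {..n}))) X
      (f \<circ> simplex_chart h n) (g \<circ> simplex_chart h n)"
    proof (rule homotopic_rel_compose_right[OF _ continuous_map_simplex_chart[OF inj]])
      show "simplex_chart h n ` simplex_frontier (h ` {..n}) \<subseteq> realized_boundary n"
        unfolding realized_boundary_eq[OF n] simplex_chart_def using pull_in_frontier[OF inj] by blast
    qed (simp_all add: simplex_frontier_subset)
  }
  {
    assume "homotopic_rel (simplex_frontier (h ` {..n})) (top_of_set (affine_simplex (h ` {..n}))) X
      (f \<circ> simplex_chart h n) (g \<circ> simplex_chart h n)"
    then show "homotopic_rel (realized_boundary n) (realization (\<Delta> n)) X f g"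
    proof (rule homotopic_rel_compose_right[OF _ continuous_map_simplex_chart_inverse[OF inj]])
      show "(\<lambda>p. push h {..n} (coord p)) ` realized_boundary n \<subseteq> simplex_frontier (h ` {..n})"
        unfolding realized_boundary_eq[OF n] using push_in_frontier[OF inj] mc by auto
      show "realized_boundary n \<subseteq> topspace (realization (\<Delta> n))"
        unfolding realized_boundary_eq[OF n] using simplex_frontier_subset
        by (fastforce intro!: pt_in_topspace simp: full_simplex_def)
    qed (simp_all add: simplex_chart_inverse[OF inj])
  }
qed

lemma realization_map_embedding_chart:
  assumes emb: "simplicial_embedding (\<Delta> n) A \<phi>" and inj: "inj_on h {..n}"
    and B: "B \<subseteq> {..n}" and u: "u \<in> affine_simplex (h ` B)"
  shows "realization_map A \<phi> (simplex_chart h n u) =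
    pt A (fst \<phi> ` B) (snd \<phi> B ()) (push (fst \<phi>) {..n} (pull h {..n} u))"
proof -
  let ?F = "Pow {..n}"
  note e = simplicial_embedding_eq_mk_smap[OF face_family_std emb[unfolded full_simplex_eq]]
  have t: "pull h {..n} u \<in> affine_simplex B"
    using pull_in_affine_simplex[OF inj B u] .
  have "simplex_chart h n u = pt (\<Delta> n) B () (pull h {..n} u)"
    using pt_full_simplex_face[OF _ B t] by (simp add: simplex_chart_def)
  also have "realization_map A \<phi> \<dots> = pt A (fst \<phi> ` B) (snd \<phi> {v \<in> {..n}. fst \<phi> v \<in> fst \<phi> ` B} ())
      (push (fst \<phi>) {..n} (pull h {..n} u))"
    using realization_map_mk_smap[OF face_family_std, where \<theta>="\<lambda>E. snd \<phi> {v \<in> {..n}. fst \<phi> v \<in> E} ()"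
        and h="fst \<phi>" and A=A and B=B, OF _ _ t e(2)] emb B e(1)
    by (simp add: full_simplex_eq)
  also have "{v \<in> {..n}. fst \<phi> v \<in> fst \<phi> ` B} = B"
    using e(2) B unfolding inj_on_def by blast
  finally show ?thesis .
qed

text \<open>A simplex on the set of labels determines the simplices on all faces by its boundary maps.\<close>

lemma smap_of_simplex:
  assumes A: "multicomplex A" and inj: "inj_on h {..n}" and \<sigma>: "\<sigma> \<in> simplices A (h ` {..n})"
  shows "simplicial_embedding (\<Delta> n) A (smap_of_simplex A h n \<sigma>)"
    and "snd (smap_of_simplex A h n \<sigma>) {..n} () = \<sigma>"
    and "\<And>i. i \<le> n \<Longrightarrow> fst (smap_of_simplex A h n \<sigma>) i = h i"
    and "\<And>u. u \<in> affine_simplex (h ` {..n}) \<Longrightarrow>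
      realization_map A (smap_of_simplex A h n \<sigma>) (simplex_chart h n u) = pt A (h ` {..n}) \<sigma> u"
proof -
  have sub: "h ` B \<subseteq> h ` {..n}" if "B \<in> Pow {..n}" for B
    using that by blast
  show emb: "simplicial_embedding (\<Delta> n) A (smap_of_simplex A h n \<sigma>)"
    unfolding smap_of_simplex_def full_simplex_eq
  proof (rule simplicial_embedding_mk_smap[OF face_family_std inj])
    show "h ` {..n} \<subseteq> verts A"
      using simplex_verts[OF A \<sigma>] .
    show "bdry A (h ` {..n}) (h ` B) \<sigma> \<in> simplices A (h ` B)" if "B \<in> Pow {..n}" for B
      using bdry_simplex[OF A \<sigma> sub[OF that]] .
    show "bdry A (h ` B) (h ` C) (bdry A (h ` {..n}) (h ` B) \<sigma>) = bdry A (h ` {..n}) (h ` C) \<sigma>"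
      if "B \<in> Pow {..n}" "C \<subseteq> B" for B C
      using bdry_bdry[OF A \<sigma> sub[OF that(1)]] that(2) by blast
  qed
  show s: "snd (smap_of_simplex A h n \<sigma>) {..n} () = \<sigma>"
    using bdry_self[OF A \<sigma>] by (simp add: smap_of_simplex_def mk_smap_def)
  show f: "fst (smap_of_simplex A h n \<sigma>) i = h i" if "i \<le> n" for i
    using that by (simp add: smap_of_simplex_def mk_smap_def)
  show "realization_map A (smap_of_simplex A h n \<sigma>) (simplex_chart h n u) = pt A (h ` {..n}) \<sigma> u"
    if u: "u \<in> affine_simplex (h ` {..n})" for u
  proof -
    have im: "fst (smap_of_simplex A h n \<sigma>) ` {..n} = h ` {..n}"
      using f by (intro image_cong) auto
    have "push (fst (smap_of_simplex A h n \<sigma>)) {..n} t = push h {..n} t" for t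
    proof -
      have "inv_into {..n} (fst (smap_of_simplex A h n \<sigma>)) w = inv_into {..n} h w" for w
        using f by (simp add: inv_into_def) (metis (no_types, lifting) atMost_iff)
      then show ?thesis
        by (simp add: push_def im cong: if_cong)
    qed
    then show ?thesis
      using realization_map_embedding_chart[OF emb inj order_refl u] push_pull[OF inj u] by (simp add: im s)
  qed
qed

lemma simplex_of_embedding:
  assumes emb: "simplicial_embedding (\<Delta> n) A \<phi>" and h: "\<And>i. i \<le> n \<Longrightarrow> fst \<phi> i = h i"
  shows "snd \<phi> {..n} () \<in> simplices A (h ` {..n})" "smap_of_simplex A h n (snd \<phi> {..n} ()) = \<phi>"
    and "\<And>B. B \<subseteq> {..n} \<Longrightarrow> snd \<phi> B () = bdry A (h ` {..n}) (h ` B) (snd \<phi> {..n} ())"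
proof -
  note e = simplicial_embedding_eq_mk_smap[OF face_family_std emb[unfolded full_simplex_eq]]
  have im: "fst \<phi> ` B = h ` B" if "B \<subseteq> {..n}" for B
    using h that by (intro image_cong) auto
  show "snd \<phi> {..n} () \<in> simplices A (h ` {..n})"
    using e(5)[of "{..n}"] e(4)[of "{..n}"] im[of "{..n}"] by simp
  show b: "snd \<phi> B () = bdry A (h ` {..n}) (h ` B) (snd \<phi> {..n} ())" if "B \<subseteq> {..n}" for B
    using e(6)[of "{..n}" B] e(4)[of B] e(4)[of "{..n}"] im[of "{..n}"] im[of B] that by simp
  have "mk_smap {..n} (Pow {..n}) (fst \<phi>) (\<lambda>E. snd \<phi> {v \<in> {..n}. fst \<phi> v \<in> E} ()) =
      smap_of_simplex A h n (snd \<phi> {..n} ())"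
    unfolding mk_smap_def smap_of_simplex_def
  proof (intro arg_cong2[where f=Pair] ext)
    fix i show "restrict (fst \<phi>) {..n} i = restrict h {..n} i"
      using h by simp
  next
    fix B and x :: unit
    show "(\<lambda>x\<in>simplices (sub_simplex {..n} (Pow {..n})) B. snd \<phi> {v \<in> {..n}. fst \<phi> v \<in> fst \<phi> ` B} ()) x =
        (\<lambda>x\<in>simplices (sub_simplex {..n} (Pow {..n})) B. bdry A (h ` {..n}) (h ` B) (snd \<phi> {..n} ())) x"
    proof (cases "B \<subseteq> {..n}")
      case True
      then show ?thesis
        using b[OF True] e(4)[of B] by simp
    qed simp
  qed
  then show "smap_of_simplex A h n (snd \<phi> {..n} ()) = \<phi>"
    using e(1) by simp
qed

text \<open>A vertex of the realization remembers its name through the support of its coordinates.\<close>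

lemma realization_map_vertex_chart:
  assumes A: "multicomplex A" and emb: "simplicial_embedding (\<Delta> n) A \<phi>" and inj: "inj_on h {..n}"
    and i: "i \<le> n" and eq: "coord (realization_map A \<phi> (simplex_chart h n (indicator {h i}))) = indicator {h i}"
  shows "fst \<phi> i = h i"
proof -
  note e = simplicial_embedding_eq_mk_smap[OF face_family_std emb[unfolded full_simplex_eq]]
  have "push (fst \<phi>) {..n} (pull h {..n} (indicator {h i})) = indicator {h i}"
    using eq realization_map_embedding_chart[OF emb inj, of "{i}" "indicator {h i}"] i A
      indicator_in_affine_simplex[of "h i" "{h i}"] by simp
  from fun_cong[OF this, of "fst \<phi> i"] have "indicator {h i} (fst \<phi> i) = (1::real)"
    using e(2) i by (simp add: push_apply pull_def)
  then show ?thesis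
    by (auto split: split_indicator_asm)
qed

lemma proper_subset_of_image:
  assumes "inj_on h V" "B \<subset> h ` V"
  obtains B' where "B' \<subset> V" "B = h ` B'"
proof -
  obtain B' where "B' \<subseteq> V" "B = h ` B'"
    using assms(2) by (meson psubset_imp_subset subset_imageE)
  then show ?thesis
    using assms(2) that[of B'] by blast
qed

lemma image_psubset: "inj_on h V \<Longrightarrow> B \<subset> V \<Longrightarrow> h ` B \<subset> h ` V"
  unfolding inj_on_def by blast

lemma simplicial_embedding_cases:
  assumes F: "face_family V F" and emb: "simplicial_embedding (sub_simplex V F) A \<phi>"
  obtains h \<theta> where "\<phi> = mk_smap V F h \<theta>" "inj_on h V" "h ` V \<subseteq> verts A"
    "\<And>B. B \<in> F \<Longrightarrow> \<theta> (h ` B) \<in> simplices A (h ` B)"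
    "\<And>B C. B \<in> F \<Longrightarrow> C \<subseteq> B \<Longrightarrow> bdry A (h ` B) (h ` C) (\<theta> (h ` B)) = \<theta> (h ` C)"
proof (rule that[of "fst \<phi>" "\<lambda>E. snd \<phi> {v \<in> V. fst \<phi> v \<in> E} ()"])
  note e = simplicial_embedding_eq_mk_smap[OF F emb]
  show "\<phi> = mk_smap V F (fst \<phi>) (\<lambda>E. snd \<phi> {v \<in> V. fst \<phi> v \<in> E} ())"
    "inj_on (fst \<phi>) V" "fst \<phi> ` V \<subseteq> verts A"
    by (fact e(1-3))+
qed (erule simplicial_embedding_eq_mk_smap(5,6)[OF F emb]; assumption?)+

lemma simplicial_on_boundary_iff:
  assumes n: "n \<ge> 1"
  shows "simplicial_on_boundary A n f \<longleftrightarrow>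
    (\<exists>h \<theta>. inj_on h {..n} \<and> h ` {..n} \<subseteq> verts A \<and> face_system A (h ` {..n}) \<theta> \<and>
      (\<forall>B. B \<subset> h ` {..n} \<longrightarrow> (\<forall>u\<in>affine_simplex B. f (simplex_chart h n u) = pt A B (\<theta> B) u)))"
    (is "_ \<longleftrightarrow> (\<exists>h \<theta>. ?P h \<theta>)")
proof
  let ?F = "{B. B \<subset> {..n}}"
  note F = face_family_std_boundary[OF n]
  {
    assume "simplicial_on_boundary A n f"
    then obtain \<phi> where emb: "simplicial_embedding (sub_simplex {..n} ?F) A \<phi>"
      and f: "\<And>p. p \<in> topspace (realization (\<partial>\<Delta> n)) \<Longrightarrow>
        f (realization_map (\<Delta> n) (inclusion (\<partial>\<Delta> n)) p) = realization_map A \<phi> p"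
      unfolding simplicial_on_boundary_def by (auto simp: simplex_boundary_eq)
    obtain h \<theta> where e: "\<phi> = mk_smap {..n} ?F h \<theta>" "inj_on h {..n}" "h ` {..n} \<subseteq> verts A"
      "\<And>B. B \<in> ?F \<Longrightarrow> \<theta> (h ` B) \<in> simplices A (h ` B)"
      "\<And>B C. B \<in> ?F \<Longrightarrow> C \<subseteq> B \<Longrightarrow> bdry A (h ` B) (h ` C) (\<theta> (h ` B)) = \<theta> (h ` C)"
      by (rule simplicial_embedding_cases[OF F emb]) (rule that)
    have "face_system A (h ` {..n}) \<theta>"
      unfolding face_system_def
    proof (intro allI impI conjI)
      fix B assume "B \<subset> h ` {..n}"
      then obtain B' where B': "B' \<subset> {..n}" "B = h ` B'"
        by (rule proper_subset_of_image[OF e(2)])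
      then show "\<theta> B \<in> simplices A B"
        using e(4) by simp
      fix C assume "C \<subseteq> B"
      then obtain C' where "C' \<subseteq> B'" "C = h ` C'"
        unfolding B'(2) by (rule subset_imageE)
      then show "bdry A B C (\<theta> B) = \<theta> C"
        using e(5)[of B' C'] B' by simp
    qed
    moreover have "f (simplex_chart h n u) = pt A B (\<theta> B) u"
      if B: "B \<subset> h ` {..n}" and u: "u \<in> affine_simplex B" for B u
    proof -
      obtain B' where B': "B' \<subset> {..n}" "B = h ` B'"
        using B by (rule proper_subset_of_image[OF e(2)])
      then have t: "pull h {..n} u \<in> affine_simplex B'"
        using pull_in_affine_simplex[OF e(2)] u by blast
      have "simplex_chart h n u = realization_map (\<Delta> n) (inclusion (\<partial>\<Delta> n)) (pt (\<partial>\<Delta> n) B' () (pull h {..n} u))"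
        using realization_map_inclusion_boundary[OF n B'(1) t] by (simp add: simplex_chart_def)
      moreover have "pt (\<partial>\<Delta> n) B' () (pull h {..n} u) \<in> topspace (realization (\<partial>\<Delta> n))"
        using B' t by (intro pt_in_topspace) (auto simp: simplex_boundary_def)
      ultimately have "f (simplex_chart h n u) = realization_map A \<phi> (pt (\<partial>\<Delta> n) B' () (pull h {..n} u))"
        using f by metis
      also have "\<dots> = pt A B (\<theta> B) (push h {..n} (pull h {..n} u))"
        using realization_map_mk_smap[OF F, of A h \<theta> B' "pull h {..n} u"] e(1,2) emb B' t
        by (simp add: simplex_boundary_eq)
      also have "push h {..n} (pull h {..n} u) = u"
        using u B affine_simplex_mono[of B "h ` {..n}"] by (intro push_pull[OF e(2)]) auto
      finally show ?thesis .
    qed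
    ultimately show "\<exists>h \<theta>. ?P h \<theta>"
      using e(2,3) by blast
  }
  {
    assume "\<exists>h \<theta>. ?P h \<theta>"
    then obtain h \<theta> where inj: "inj_on h {..n}" and sub: "h ` {..n} \<subseteq> verts A"
      and fs: "face_system A (h ` {..n}) \<theta>"
      and f': "\<forall>B. B \<subset> h ` {..n} \<longrightarrow> (\<forall>u\<in>affine_simplex B. f (simplex_chart h n u) = pt A B (\<theta> B) u)"
      by (elim exE conjE) (rule that)
    have f: "f (simplex_chart h n u) = pt A B (\<theta> B) u" if "B \<subset> h ` {..n}" "u \<in> affine_simplex B" for B u
      by (rule bspec[OF mp[OF spec[OF f']]]) (fact that)+
    let ?\<phi> = "mk_smap {..n} ?F h \<theta>"
    have emb: "simplicial_embedding (sub_simplex {..n} ?F) A ?\<phi>"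
    proof (rule simplicial_embedding_mk_smap[OF F inj sub])
      show "\<theta> (h ` B) \<in> simplices A (h ` B)" if "B \<in> ?F" for B
        using fs image_psubset[OF inj, of B] that by (simp add: face_system_def)
      show "bdry A (h ` B) (h ` C) (\<theta> (h ` B)) = \<theta> (h ` C)" if "B \<in> ?F" "C \<subseteq> B" for B C
        using fs image_psubset[OF inj, of B] that image_mono[of C B h] by (simp add: face_system_def)
    qed
    have "f (realization_map (\<Delta> n) (inclusion (\<partial>\<Delta> n)) p) = realization_map A ?\<phi> p"
      if p: "p \<in> topspace (realization (\<partial>\<Delta> n))" for p
    proof -
      obtain B t where B: "B \<in> ?F" "t \<in> affine_simplex B" "t \<in> affine_simplex {..n}" "p = pt (\<partial>\<Delta> n) B () t"
        using sub_simplex_cases[OF F] p unfolding simplex_boundary_eq by metis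
      have u: "push h {..n} t \<in> affine_simplex (h ` B)"
        using push_in_affine_simplex[OF inj] B by blast
      have "realization_map (\<Delta> n) (inclusion (\<partial>\<Delta> n)) p = simplex_chart h n (push h {..n} t)"
        using realization_map_inclusion_boundary[OF n, of B t] B pull_push[OF inj B(3)] by (simp add: simplex_chart_def)
      then have "f (realization_map (\<Delta> n) (inclusion (\<partial>\<Delta> n)) p) = pt A (h ` B) (\<theta> (h ` B)) (push h {..n} t)"
        using f[OF image_psubset[OF inj] u] B by simp
      also have "\<dots> = realization_map A ?\<phi> p"
        using realization_map_mk_smap[OF F emb B(1,2) inj] B(4) by (simp add: simplex_boundary_eq)
      finally show ?thesis .
    qed
    with emb show "simplicial_on_boundary A n f"
      unfolding simplicial_on_boundary_def simplex_boundary_eq by blast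
  }
qed

lemma face_system_vertex:
  assumes "multicomplex A" "face_system A W \<theta>" "extends_faces A W \<theta> F" "finite W" "card W \<ge> 2" "v \<in> W"
  shows "coord (F (indicator {v})) = indicator {v}"
proof -
  have "{v} \<subset> W"
    using assms(4-6) by (auto simp: psubset_eq)
  then show ?thesis
    using assms(1,3) indicator_in_affine_simplex[of v "{v}"] by (simp add: extends_faces_def)
qed

lemma indicator_in_frontier:
  assumes "finite W" "card W \<ge> 2" "v \<in> W"
  shows "indicator {v} \<in> simplex_frontier W"
proof -
  have "{v} \<subset> W"
    using assms by (auto simp: psubset_eq)
  then show ?thesis
    using indicator_in_affine_simplex[of v "{v}"] assms(1) by (subst simplex_frontier_iff) auto
qed

text \<open>A homotopy relative to the boundary fixes the images of the vertices. So an embedding that is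
  homotopic to \<open>f\<close> has the labels \<open>h\<close>, and it is determined by the
  simplex in the top dimension.\<close>

lemma straightened_transfer:
  assumes A: "multicomplex A" and n: "n \<ge> 1" and inj: "inj_on h {..n}"
    and fs: "face_system A (h ` {..n}) \<theta>" and F: "extends_faces A (h ` {..n}) \<theta> F"
    and f: "\<And>u. u \<in> affine_simplex (h ` {..n}) \<Longrightarrow> f (simplex_chart h n u) = F u"
  defines "P \<equiv> \<lambda>\<phi>. simplicial_embedding (\<Delta> n) A \<phi> \<and>
    homotopic_rel (realized_boundary n) (realization (\<Delta> n)) (realization A) f (realization_map A \<phi>)"
  shows "(\<exists>\<phi>. P \<phi>) \<longleftrightarrow> (\<exists>\<sigma>. straightened A (h ` {..n}) F \<sigma>)"
    and "(\<exists>\<^sub>\<le>\<^sub>1\<phi>. P \<phi>) \<longleftrightarrow> (\<exists>\<^sub>\<le>\<^sub>1\<sigma>. straightened A (h ` {..n}) F \<sigma>)"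
proof -
  let ?W = "h ` {..n}"
  have W: "finite ?W" "card ?W \<ge> 2"
    using n inj by (auto simp: card_image)
  have 1: "straightened A ?W F (snd \<phi> {..n} ()) \<and> smap_of_simplex A h n (snd \<phi> {..n} ()) = \<phi>"
    if P: "P \<phi>" for \<phi>
  proof -
    have emb: "simplicial_embedding (\<Delta> n) A \<phi>"
      and hr: "homotopic_rel (simplex_frontier ?W) (top_of_set (affine_simplex ?W)) (realization A)
          (f \<circ> simplex_chart h n) (realization_map A \<phi> \<circ> simplex_chart h n)"
      using P unfolding P_def homotopic_rel_simplex_chart[OF n inj] by auto
    have v: "fst \<phi> i = h i" if i: "i \<le> n" for i
    proof (rule realization_map_vertex_chart[OF A emb inj i])
      have fr: "indicator {h i} \<in> simplex_frontier ?W"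
        using i by (intro indicator_in_frontier[OF W]) auto
      have "realization_map A \<phi> (simplex_chart h n (indicator {h i})) = F (indicator {h i})"
        using homotopic_rel_agree[OF hr fr] f[of "indicator {h i}"] fr simplex_frontier_subset[of ?W] by auto
      then show "coord (realization_map A \<phi> (simplex_chart h n (indicator {h i}))) = indicator {h i}"
        using face_system_vertex[OF A fs F W, of "h i"] i by simp
    qed
    note s = simplex_of_embedding[OF emb v]
    have "homotopic_rel (simplex_frontier ?W) (top_of_set (affine_simplex ?W)) (realization A) F
        (pt A ?W (snd \<phi> {..n} ()))"
      by (rule homotopic_rel_cong[OF hr])
        (use s(2) smap_of_simplex(4)[OF A inj s(1)] f simplex_frontier_subset[of ?W] in auto)
    then show ?thesis
      using s(1,2) by (simp add: straightened_def)
  qed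
  have 2: "P (smap_of_simplex A h n \<sigma>) \<and> snd (smap_of_simplex A h n \<sigma>) {..n} () = \<sigma>"
    if S: "straightened A ?W F \<sigma>" for \<sigma>
  proof -
    have \<sigma>: "\<sigma> \<in> simplices A ?W"
      and hr: "homotopic_rel (simplex_frontier ?W) (top_of_set (affine_simplex ?W)) (realization A) F (pt A ?W \<sigma>)"
      using S by (auto simp: straightened_def)
    have "homotopic_rel (simplex_frontier ?W) (top_of_set (affine_simplex ?W)) (realization A)
          (f \<circ> simplex_chart h n) (realization_map A (smap_of_simplex A h n \<sigma>) \<circ> simplex_chart h n)"
      by (rule homotopic_rel_cong[OF hr])
        (use smap_of_simplex(4)[OF A inj \<sigma>] f simplex_frontier_subset[of ?W] in auto)
    then show ?thesis
      unfolding P_def homotopic_rel_simplex_chart[OF n inj] using smap_of_simplex(1,2)[OF A inj \<sigma>] by blast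
  qed
  show "(\<exists>\<phi>. P \<phi>) \<longleftrightarrow> (\<exists>\<sigma>. straightened A ?W F \<sigma>)"
    "(\<exists>\<^sub>\<le>\<^sub>1\<phi>. P \<phi>) \<longleftrightarrow> (\<exists>\<^sub>\<le>\<^sub>1\<sigma>. straightened A ?W F \<sigma>)"
    by (rule transfer_unique_existence[where k="\<lambda>\<phi>. snd \<phi> {..n} ()" and m="smap_of_simplex A h n"]; fact 1 2)+
qed

text \<open>Completeness and minimality have the same shape: \<open>Q\<close> asserts the existence or the
  uniqueness of an embedding, and \<open>R\<close> is the same assertion for simplices on a
  fixed vertex set. Every finite vertex set occurs as a set of labels.\<close>

lemma boundary_problem_transfer:
  fixes A :: "('v, 's) premulticomplex"
    and Q :: "nat \<Rightarrow> ((nat, unit) cell_point set \<Rightarrow> ('v, 's) cell_point set) \<Rightarrow> bool"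
  assumes A: "multicomplex A"
    and R: "\<And>n h \<theta> F f. n \<ge> 1 \<Longrightarrow> inj_on h {..n} \<Longrightarrow> face_system A (h ` {..n}) \<theta> \<Longrightarrow>
      extends_faces A (h ` {..n}) \<theta> F \<Longrightarrow>
      (\<And>u. u \<in> affine_simplex (h ` {..n}) \<Longrightarrow> f (simplex_chart h n u) = F u) \<Longrightarrow>
      Q n f \<longleftrightarrow> R (h ` {..n}) F"
  shows "(\<forall>n\<ge>1. \<forall>f. continuous_map (realization (\<Delta> n)) (realization A) f \<longrightarrow>
        simplicial_on_boundary A n f \<longrightarrow> Q n f) \<longleftrightarrow>
     (\<forall>W \<theta> F. finite W \<and> card W \<ge> 2 \<and> W \<subseteq> verts A \<and> face_system A W \<theta> \<and> extends_faces A W \<theta> F \<longrightarrow> R W F)"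
    (is "?lhs \<longleftrightarrow> ?rhs")
proof
  assume lhs: ?lhs
  show ?rhs
  proof (intro allI impI, elim conjE)
    fix W \<theta> F
    assume W: "finite W" "card W \<ge> 2" "W \<subseteq> verts A" and fs: "face_system A W \<theta>" and F: "extends_faces A W \<theta> F"
    define n where "n = card W - 1"
    have n: "n \<ge> 1" and cn: "card W = Suc n"
      using W by (auto simp: n_def)
    obtain h where "bij_betw h {..n} W"
      using finite_same_card_bij[of "{..n}" W] W(1) cn by auto
    then have inj: "inj_on h {..n}" and im: "h ` {..n} = W"
      by (auto simp: bij_betw_def)
    define f where "f = (\<lambda>p :: (nat, unit) cell_point set. F (push h {..n} (coord p)))"
    have fF: "f (simplex_chart h n u) = F u" if "u \<in> affine_simplex W" for u
      using push_pull[OF inj, of u] that im multicomplex_full_simplex[of "{..n}"]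
      by (simp add: f_def simplex_chart_def)
    have "continuous_map (realization (\<Delta> n)) (realization A) f"
      using continuous_map_compose[OF continuous_map_simplex_chart_inverse[OF inj], of "realization A" F] F
      by (simp add: f_def extends_faces_def im o_def)
    moreover have "simplicial_on_boundary A n f"
      unfolding simplicial_on_boundary_iff[OF n]
    proof (intro exI conjI allI impI ballI)
      fix B u assume B: "B \<subset> h ` {..n}" "u \<in> affine_simplex B"
      then have "u \<in> affine_simplex W"
        using affine_simplex_mono[of B W] W(1) im by auto
      then show "f (simplex_chart h n u) = pt A B (\<theta> B) u"
        using fF F B im by (simp add: extends_faces_def)
    qed (use inj fs im W in auto)
    ultimately have "Q n f"
      using lhs n by blast
    then show "R W F"
      using R[OF n inj, of \<theta> F f] fs F fF im by simp
  qed
next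
  assume rhs: ?rhs
  show ?lhs
  proof (intro allI impI)
    fix n f assume n: "1 \<le> (n::nat)" and cont: "continuous_map (realization (\<Delta> n)) (realization A) f"
      and "simplicial_on_boundary A n f"
    then obtain h \<theta> where inj: "inj_on h {..n}" and sub: "h ` {..n} \<subseteq> verts A"
      and fs: "face_system A (h ` {..n}) \<theta>"
      and f': "\<forall>B. B \<subset> h ` {..n} \<longrightarrow> (\<forall>u\<in>affine_simplex B. f (simplex_chart h n u) = pt A B (\<theta> B) u)"
      unfolding simplicial_on_boundary_iff[OF n] by (elim exE conjE) (rule that)
    have f: "f (simplex_chart h n u) = pt A B (\<theta> B) u" if "B \<subset> h ` {..n}" "u \<in> affine_simplex B" for B u
      by (rule bspec[OF mp[OF spec[OF f']]]) (fact that)+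
    have "extends_faces A (h ` {..n}) \<theta> (f \<circ> simplex_chart h n)"
      using f continuous_map_compose[OF continuous_map_simplex_chart[OF inj] cont] by (simp add: extends_faces_def)
    moreover from this have "R (h ` {..n}) (f \<circ> simplex_chart h n)"
      using rhs sub fs n inj by (auto simp: card_image)
    ultimately show "Q n f"
      using R[OF n inj fs, of "f \<circ> simplex_chart h n" f] by simp
  qed
qed

lemma complete_multicomplex_iff:
  assumes A: "multicomplex A"
  shows "complete_multicomplex A \<longleftrightarrow> (\<forall>W \<theta> F. finite W \<and> card W \<ge> 2 \<and> W \<subseteq> verts A \<and> face_system A W \<theta> \<and>
    extends_faces A W \<theta> F \<longrightarrow> (\<exists>\<sigma>. straightened A W F \<sigma>))"
  unfolding complete_multicomplex_def
  by (rule boundary_problem_transfer[OF A]) (rule straightened_transfer(1)[OF A])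

lemma minimal_multicomplex_iff:
  assumes A: "multicomplex A"
  shows "minimal_multicomplex A \<longleftrightarrow> (\<forall>W \<theta> F. finite W \<and> card W \<ge> 2 \<and> W \<subseteq> verts A \<and> face_system A W \<theta> \<and>
    extends_faces A W \<theta> F \<longrightarrow> (\<exists>\<^sub>\<le>\<^sub>1\<sigma>. straightened A W F \<sigma>))"
  unfolding minimal_multicomplex_def
  by (rule boundary_problem_transfer[OF A]) (rule straightened_transfer(2)[OF A])

section \<open>Conditions on edges and one-skeleta on vertex sets\<close>

lemma edge_param_chart:
  assumes "v \<noteq> w" "h 0 = v" "h 1 = w" "0 \<le> s" "s \<le> 1"
  shows "edge_param s = simplex_chart h 1 (seg s (indicator {v}) (indicator {w}))"
proof -
  have "pull h {..1} (seg s (indicator {v}) (indicator {w})) = (\<lambda>_. 0)(0 := 1 - s, 1 := s)"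
    using assms by (auto simp: pull_def seg_def fun_eq_iff le_Suc_eq)
  then show ?thesis
    by (simp add: edge_param_def simplex_chart_def)
qed

text \<open>A homotopy relative to the endpoints fixes the images of both vertices, so the embedding of the
  interval is determined by its edge.\<close>

lemma unique_edges_iff:
  assumes A: "multicomplex A"
  shows "(\<forall>v\<^sub>0\<in>verts A. \<forall>v\<^sub>1\<in>verts A. \<forall>\<gamma>.
        v\<^sub>0 \<noteq> v\<^sub>1 \<and> pathin (realization A) \<gamma> \<and>
        \<gamma> 0 = vertex_point A v\<^sub>0 \<and> \<gamma> 1 = vertex_point A v\<^sub>1 \<longrightarrow>
        (\<exists>!\<gamma>'. simplicial_embedding (\<Delta> 1) A \<gamma>' \<and>
           homotopic_rel {0, 1} \<I> (realization A) \<gamma> (realization_map A \<gamma>' \<circ> edge_param))) \<longleftrightarrow>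
    unique_edges A"
proof -
  have "(\<exists>!\<phi>. simplicial_embedding (\<Delta> 1) A \<phi> \<and>
           homotopic_rel {0, 1} \<I> (realization A) \<gamma> (realization_map A \<phi> \<circ> edge_param)) \<longleftrightarrow>
     (\<exists>!\<epsilon>. \<epsilon> \<in> simplices A {v, w} \<and> homotopic_rel {0, 1} \<I> (realization A) \<gamma> (edge_path A v w \<epsilon>))"
    if vw: "v \<noteq> w" and \<gamma>: "\<gamma> 0 = vertex_point A v" "\<gamma> 1 = vertex_point A w" for v w \<gamma>
  proof -
    define h where "h = (\<lambda>i::nat. if i = 0 then v else w)"
    have inj: "inj_on h {..1}" and im: "h ` {..1} = {v, w}"
      using vw by (auto simp: h_def inj_on_def le_Suc_eq image_iff)
    have vw_in: "indicator {v} \<in> affine_simplex {v, w}" "indicator {w} \<in> affine_simplex {v, w}"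
      by (auto intro: indicator_in_affine_simplex)
    have ep: "edge_param s = simplex_chart h 1 (seg s (indicator {v}) (indicator {w}))"
      if "0 \<le> s" "s \<le> 1" for s
      using that by (intro edge_param_chart[OF vw]) (auto simp: h_def)
    have rm: "realization_map A (smap_of_simplex A h 1 \<epsilon>) (edge_param s) = edge_path A v w \<epsilon> s"
      if "\<epsilon> \<in> simplices A {v, w}" "0 \<le> s" "s \<le> 1" for \<epsilon> s
      using smap_of_simplex(4)[OF A inj, unfolded im, OF that(1) seg_in_affine_simplex[OF vw_in that(2,3)]]
      by (simp only: ep[OF that(2,3)] edge_path_def)
    show ?thesis
    proof (rule transfer_unique_existence(3)[where k="\<lambda>\<phi>. snd \<phi> {..1} ()" and m="smap_of_simplex A h 1"])
      fix \<phi> assume P: "simplicial_embedding (\<Delta> 1) A \<phi> \<and>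
           homotopic_rel {0, 1} \<I> (realization A) \<gamma> (realization_map A \<phi> \<circ> edge_param)"
      have hv: "fst \<phi> i = h i" if i: "i \<le> 1" for i
      proof (rule realization_map_vertex_chart[OF A _ inj i])
        have ends: "realization_map A \<phi> (edge_param s) = \<gamma> s" if "s \<in> {0, 1}" for s
          using homotopic_rel_agree[of "{0,1}" \<I> "realization A" \<gamma> _ s] P that by fastforce
        show "coord (realization_map A \<phi> (simplex_chart h 1 (indicator {h i}))) = indicator {h i}"
        proof (cases "i = 0")
          case True
          then show ?thesis
            using ends[of 0] ep[of 0] \<gamma> A by (simp add: h_def vertex_point_eq)
        next
          case False
          then show ?thesis
            using ends[of 1] ep[of 1] \<gamma> A by (simp add: h_def vertex_point_eq)
        qed
      qed (use P in blast)
      have s: "snd \<phi> {..1} () \<in> simplices A {v, w}" "smap_of_simplex A h 1 (snd \<phi> {..1} ()) = \<phi>"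
        using simplex_of_embedding(1,2)[OF conjunct1[OF P] hv] unfolding im by blast+
      have "homotopic_rel {0, 1} \<I> (realization A) \<gamma> (edge_path A v w (snd \<phi> {..1} ()))"
        by (rule homotopic_rel_cong[OF conjunct2[OF P]]) (use rm[OF s(1)] s(2) in auto)
      with s show "(snd \<phi> {..1} () \<in> simplices A {v, w} \<and>
          homotopic_rel {0, 1} \<I> (realization A) \<gamma> (edge_path A v w (snd \<phi> {..1} ()))) \<and>
          smap_of_simplex A h 1 (snd \<phi> {..1} ()) = \<phi>"
        by blast
    next
      fix \<epsilon> assume Q: "\<epsilon> \<in> simplices A {v, w} \<and> homotopic_rel {0, 1} \<I> (realization A) \<gamma> (edge_path A v w \<epsilon>)"
      have "homotopic_rel {0, 1} \<I> (realization A) \<gamma> (realization_map A (smap_of_simplex A h 1 \<epsilon>) \<circ> edge_param)"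
        by (rule homotopic_rel_cong[OF conjunct2[OF Q]]) (use rm Q in auto)
      then show "(simplicial_embedding (\<Delta> 1) A (smap_of_simplex A h 1 \<epsilon>) \<and>
          homotopic_rel {0, 1} \<I> (realization A) \<gamma> (realization_map A (smap_of_simplex A h 1 \<epsilon>) \<circ> edge_param)) \<and>
          snd (smap_of_simplex A h 1 \<epsilon>) {..1} () = \<epsilon>"
        using smap_of_simplex(1,2)[OF A inj, unfolded im, OF conjunct1[OF Q]] by blast
    qed
  qed
  then show ?thesis
    unfolding unique_edges_def by (intro ball_cong all_cong refl) auto
qed

lemma filled_triangleE:
  assumes "filled_triangle A T \<epsilon>"
  obtains G where "continuous_map (top_of_set (affine_simplex T)) (realization A) G"
    and "\<And>v w t. v \<in> T \<Longrightarrow> w \<in> T \<Longrightarrow> v \<noteq> w \<Longrightarrow> t \<in> affine_simplex {v, w} \<Longrightarrow>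
      G t = pt A {v, w} (\<epsilon> {v, w}) t"
proof -
  obtain G where G: "continuous_map (top_of_set (affine_simplex T)) (realization A) G"
    "\<forall>v\<in>T. \<forall>w\<in>T. v \<noteq> w \<longrightarrow> (\<forall>t\<in>affine_simplex {v, w}. G t = pt A {v, w} (\<epsilon> {v, w}) t)"
    using assms unfolding filled_triangle_def by (elim exE conjE) (rule that)
  show ?thesis
    by (rule that[OF G(1)]) (use G(2) in blast)
qed

text \<open>By the cone description of null-homotopies, after renaming the vertices of the triangle by
  \<open>h\<close>.\<close>

lemma filled_triangle_iff_null_homotopic:
  assumes A: "multicomplex A" and inj: "inj_on h {..n}"
    and \<theta>: "\<And>B. B \<in> {B. B \<subseteq> {..n} \<and> card B \<le> 2} \<Longrightarrow> \<theta> (h ` B) \<in> simplices A (h ` B)"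
    and bdry: "\<And>B C. B \<in> {B. B \<subseteq> {..n} \<and> card B \<le> 2} \<Longrightarrow> C \<subseteq> B \<Longrightarrow>
      bdry A (h ` B) (h ` C) (\<theta> (h ` B)) = \<theta> (h ` C)"
    and emb: "simplicial_embedding (sub_simplex {..n} {B. B \<subseteq> {..n} \<and> card B \<le> 2}) A
      (mk_smap {..n} {B. B \<subseteq> {..n} \<and> card B \<le> 2} h \<theta>)"
    and T: "T \<subseteq> {..n}" "card T = 3"
  shows "null_homotopic (realization (simplex_boundary T)) (realization A)
             (realization_map A (mk_smap {..n} {B. B \<subseteq> {..n} \<and> card B \<le> 2} h \<theta>) \<circ>
              realization_map (skeleton 1 (\<Delta> n)) (inclusion (simplex_boundary T))) \<longleftrightarrow>
    filled_triangle A (h ` T) \<theta>"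
    (is "null_homotopic _ _ ?f \<longleftrightarrow> _")
proof -
  let ?F = "{B. B \<subseteq> {..n} \<and> card B \<le> 2}"
  let ?p = "push h {..n}" and ?q = "pull h {..n}"
  have F: "face_family {..n} ?F"
    by (rule face_family_skeleton) simp
  have fT: "finite T" and cT: "2 \<le> card T"
    using T finite_subset by auto
  have FT: "face_family T {B. B \<subset> T}"
    by (rule face_family_boundary[OF fT cT])
  have small: "B \<in> ?F" if "B \<subset> T" for B
    using psubset_card_mono[OF fT that] that T by auto
  have incl: "simplicial_map (sub_simplex T {B. B \<subset> T}) (skeleton 1 (\<Delta> n)) (inclusion (sub_simplex T {B. B \<subset> T}))"
    using simplicial_embedding_inclusion_triangle[OF T] by (simp add: simplicial_embedding_def simplex_boundary_eq)
  have f: "?f (pt (simplex_boundary T) B () t) = pt A (h ` B) (\<theta> (h ` B)) (?p t)"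
    if B: "B \<subset> T" and t: "t \<in> affine_simplex B" for B t
  proof -
    have "realization_map (skeleton 1 (\<Delta> n)) (inclusion (simplex_boundary T)) (pt (simplex_boundary T) B () t) =
        pt (sub_simplex {..n} ?F) B () t"
      using realization_map_inclusion[OF FT incl, of B t] B affine_simplex_restrict_self[OF t]
      by (simp add: simplex_boundary_eq skeleton_full_simplex_eq del: One_nat_def)
    then show ?thesis
      using realization_map_mk_smap[OF F emb small[OF B] t inj] by simp
  qed
  have face: "pt A (h ` B) (\<theta> (h ` B)) u = pt A (h ` C) (\<theta> (h ` C)) u"
    if "B \<subseteq> C" "C \<in> ?F" "u \<in> affine_simplex (h ` B)" for B C u
    using pt_face[OF \<theta>[OF that(2)] image_mono[OF that(1), of h] that(3)] bdry[OF that(2,1)] by simp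
  have pull_T: "?q u \<in> affine_simplex T" if "u \<in> affine_simplex (h ` T)" for u
    using pull_in_affine_simplex[OF inj T(1) that] .
  have push_T: "?p t \<in> affine_simplex (h ` T)" if "t \<in> affine_simplex T" for t
    using push_in_affine_simplex[OF inj T(1) that] .
  have pair: "{i, j} \<subset> T" if "i \<in> T" "j \<in> T" for i j
  proof -
    have "card {i, j} < card T"
      using T(2) card_insert_le_m1[of 2 "{j}" i] by (auto simp: card_insert_if)
    then show ?thesis
      using that by blast
  qed
  show ?thesis
    unfolding null_homotopic_simplex_boundary_iff[OF fT cT]
  proof
    assume "\<exists>G. continuous_map (top_of_set (affine_simplex T)) (realization A) G \<and>
      (\<forall>t\<in>simplex_frontier T. G t = ?f (pt (simplex_boundary T) (supp t) () t))"
    then obtain G where G: "continuous_map (top_of_set (affine_simplex T)) (realization A) G"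
      "\<And>t. t \<in> simplex_frontier T \<Longrightarrow> G t = ?f (pt (simplex_boundary T) (supp t) () t)"
      by blast
    have "continuous_map (top_of_set (affine_simplex (h ` T))) (top_of_set (affine_simplex T)) ?q"
      using pull_T by (auto simp: continuous_on_pull)
    from continuous_map_compose[OF this G(1)]
    have "continuous_map (top_of_set (affine_simplex (h ` T))) (realization A) (G \<circ> ?q)" .
    moreover have "(G \<circ> ?q) u = pt A {v, w} (\<theta> {v, w}) u"
      if vw: "v \<in> h ` T" "w \<in> h ` T" "v \<noteq> w" and u: "u \<in> affine_simplex {v, w}" for v w u
    proof -
      obtain i j where ij: "i \<in> T" "j \<in> T" "v = h i" "w = h j"
        using vw by blast
      then have sub: "{i, j} \<subseteq> {..n}" "{i, j} \<subset> T" and im: "h ` {i, j} = {v, w}"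
        using T(1) pair by auto
      have t: "?q u \<in> affine_simplex {i, j}"
        using pull_in_affine_simplex[OF inj sub(1)] u im by simp
      have "?q u \<in> simplex_frontier T"
        using t sub(2) by (subst simplex_frontier_iff[OF fT]) blast
      moreover have "supp (?q u) \<subseteq> {i, j}"
        using supp_subset[OF t] .
      moreover from this have "supp (?q u) \<subset> T"
        using sub(2) by blast
      moreover have su: "?q u \<in> affine_simplex (supp (?q u))"
        using affine_simplex_self_supp[OF t] .
      moreover have pq: "?p (?q u) = u"
        using u im affine_simplex_mono[of "{v, w}" "h ` {..n}"] ij T(1) by (intro push_pull[OF inj]) auto
      ultimately have "(G \<circ> ?q) u = pt A (h ` supp (?q u)) (\<theta> (h ` supp (?q u))) u"
        using G(2) f by simp
      also have "\<dots> = pt A (h ` {i, j}) (\<theta> (h ` {i, j})) u"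
      proof (rule face[OF _ small[OF sub(2)]])
        show "supp (?q u) \<subseteq> {i, j}" by fact
        show "u \<in> affine_simplex (h ` supp (?q u))"
          using push_in_affine_simplex[OF inj _ su] pq supp_subset[OF t] sub(1) by auto
      qed
      finally show ?thesis
        unfolding im .
    qed
    ultimately show "filled_triangle A (h ` T) \<theta>"
      unfolding filled_triangle_def by blast
  next
    assume "filled_triangle A (h ` T) \<theta>"
    then obtain G where G: "continuous_map (top_of_set (affine_simplex (h ` T))) (realization A) G"
      "\<And>v w t. v \<in> h ` T \<Longrightarrow> w \<in> h ` T \<Longrightarrow> v \<noteq> w \<Longrightarrow> t \<in> affine_simplex {v, w} \<Longrightarrow> G t = pt A {v, w} (\<theta> {v, w}) t"
      by (rule filled_triangleE) (rule that)
    have "continuous_map (top_of_set (affine_simplex T)) (top_of_set (affine_simplex (h ` T))) ?p"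
      using push_T by (auto simp: continuous_on_push)
    from continuous_map_compose[OF this G(1)]
    have "continuous_map (top_of_set (affine_simplex T)) (realization A) (G \<circ> ?p)" .
    moreover have "(G \<circ> ?p) t = ?f (pt (simplex_boundary T) (supp t) () t)" if t: "t \<in> simplex_frontier T" for t
    proof -
      have tT: "t \<in> affine_simplex T"
        using t simplex_frontier_subset by blast
      have sT: "supp t \<subset> T"
        using t supp_subset[OF tT] by (auto simp: simplex_frontier_def supp_def)
      have "card (supp t) \<le> 2"
        using psubset_card_mono[OF fT sT] T(2) by simp
      then obtain C where C: "supp t \<subseteq> C" "C \<subseteq> T" "card C = 2"
        using exists_subset_between[of "supp t" 2 T] sT fT T(2) by auto
      then obtain i j where ij: "C = {i, j}" "i \<noteq> j"
        by (auto simp: card_2_iff)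
      have CT: "C \<subset> T"
        using ij C(2) pair by auto
      have st: "t \<in> affine_simplex (supp t)"
        using affine_simplex_self_supp[OF tT] .
      have ps: "?p t \<in> affine_simplex (h ` supp t)"
        using push_in_affine_simplex[OF inj _ st] sT T(1) by blast
      have "?p t \<in> affine_simplex (h ` C)"
        using ps affine_simplex_mono[of "h ` supp t" "h ` C"] C ij by auto
      moreover have "h i \<noteq> h j"
        using ij C(2) T(1) inj by (auto simp: inj_on_def subset_iff)
      ultimately have "G (?p t) = pt A (h ` C) (\<theta> (h ` C)) (?p t)"
        using G(2)[of "h i" "h j" "?p t"] ij C(2) by simp
      also have "\<dots> = pt A (h ` supp t) (\<theta> (h ` supp t)) (?p t)"
        using face[OF C(1) small[OF CT] ps] by simp
      also have "\<dots> = ?f (pt (simplex_boundary T) (supp t) () t)"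
        using f[OF sT st] by simp
      finally show ?thesis
        by simp
    qed
    ultimately show "\<exists>G. continuous_map (top_of_set (affine_simplex T)) (realization A) G \<and>
      (\<forall>t\<in>simplex_frontier T. G t = ?f (pt (simplex_boundary T) (supp t) () t))"
      by blast
  qed
qed

text \<open>An extension has the labels \<open>h\<close> and is determined by its simplex in the top
  dimension. It suffices to compare edges: the faces of the one-skeleton with fewer vertices are
  faces of edges, since \<open>n \<ge> 2\<close>.\<close>

lemma extension_transfer:
  assumes A: "multicomplex A" and n: "n \<ge> 2" and inj: "inj_on h {..n}"
    and bdry: "\<And>B C. B \<in> {B. B \<subseteq> {..n} \<and> card B \<le> 2} \<Longrightarrow> C \<subseteq> B \<Longrightarrow>
      bdry A (h ` B) (h ` C) (\<theta> (h ` B)) = \<theta> (h ` C)"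
  shows "(\<exists>!f'. simplicial_embedding (\<Delta> n) A f' \<and>
      extends_smap (skeleton 1 (\<Delta> n)) (mk_smap {..n} {B. B \<subseteq> {..n} \<and> card B \<le> 2} h \<theta>) f') \<longleftrightarrow>
    (\<exists>!\<sigma>. \<sigma> \<in> simplices A (h ` {..n}) \<and>
      (\<forall>v\<in>h ` {..n}. \<forall>w\<in>h ` {..n}. v \<noteq> w \<longrightarrow> bdry A (h ` {..n}) {v, w} \<sigma> = \<theta> {v, w}))"
proof -
  let ?F = "{B. B \<subseteq> {..n} \<and> card B \<le> 2}" and ?W = "h ` {..n}"
  let ?f = "mk_smap {..n} ?F h \<theta>"
  have ext: "extends_smap (skeleton 1 (\<Delta> n)) ?f f' \<longleftrightarrow>
      (\<forall>i\<le>n. fst f' i = h i) \<and> (\<forall>B\<in>?F. snd f' B () = \<theta> (h ` B))" for f'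
    unfolding skeleton_full_simplex_eq extends_smap_def mk_smap_def by auto
  show ?thesis
  proof (rule transfer_unique_existence(3)[where k="\<lambda>\<phi>. snd \<phi> {..n} ()" and m="smap_of_simplex A h n"])
    fix f' assume "simplicial_embedding (\<Delta> n) A f' \<and> extends_smap (skeleton 1 (\<Delta> n)) ?f f'"
    then have emb: "simplicial_embedding (\<Delta> n) A f'" and v: "\<And>i. i \<le> n \<Longrightarrow> fst f' i = h i"
      and e: "\<And>B. B \<in> ?F \<Longrightarrow> snd f' B () = \<theta> (h ` B)"
      unfolding ext by auto
    note s = simplex_of_embedding[OF emb v]
    have "bdry A ?W {v, w} (snd f' {..n} ()) = \<theta> {v, w}" if vw: "v \<in> ?W" "w \<in> ?W" "v \<noteq> w" for v w
    proof -
      obtain i j where ij: "i \<le> n" "j \<le> n" "v = h i" "w = h j"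
        using vw by blast
      then have "{i, j} \<in> ?F"
        by (auto simp: card_insert_if)
      then show ?thesis
        using s(3)[of "{i, j}"] e[of "{i, j}"] ij by simp
    qed
    with s(1,2) show "(snd f' {..n} () \<in> simplices A ?W \<and>
        (\<forall>v\<in>?W. \<forall>w\<in>?W. v \<noteq> w \<longrightarrow> bdry A ?W {v, w} (snd f' {..n} ()) = \<theta> {v, w})) \<and>
        smap_of_simplex A h n (snd f' {..n} ()) = f'"
      by blast
  next
    fix \<sigma> assume \<sigma>: "\<sigma> \<in> simplices A ?W \<and> (\<forall>v\<in>?W. \<forall>w\<in>?W. v \<noteq> w \<longrightarrow> bdry A ?W {v, w} \<sigma> = \<theta> {v, w})"
    note s = smap_of_simplex[OF A inj conjunct1[OF \<sigma>]]
    have "snd (smap_of_simplex A h n \<sigma>) B () = \<theta> (h ` B)" if B: "B \<in> ?F" for B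
    proof -
      obtain C where C: "B \<subseteq> C" "C \<subseteq> {..n}" "card C = 2"
        using exists_subset_between[of B 2 "{..n}"] B n by auto
      then obtain i j where ij: "C = {i, j}" "i \<noteq> j"
        by (auto simp: card_2_iff)
      have CF: "C \<in> ?F"
        using C by simp
      have "h i \<noteq> h j"
        using ij C(2) inj by (auto simp: inj_on_def)
      then have hC: "bdry A ?W (h ` C) \<sigma> = \<theta> (h ` C)"
        using \<sigma> ij C(2) by simp
      have sub: "h ` C \<subseteq> ?W" "h ` B \<subseteq> h ` C"
        using C by auto
      have "snd (smap_of_simplex A h n \<sigma>) B () = bdry A ?W (h ` B) \<sigma>"
        using simplex_of_embedding(3)[OF s(1) s(3), of B] B s(2) by simp
      also have "\<dots> = bdry A (h ` C) (h ` B) (bdry A ?W (h ` C) \<sigma>)"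
        using bdry_bdry[OF A conjunct1[OF \<sigma>] sub] by simp
      also have "\<dots> = \<theta> (h ` B)"
        using bdry[OF CF C(1)] hC by simp
      finally show ?thesis .
    qed
    then show "(simplicial_embedding (\<Delta> n) A (smap_of_simplex A h n \<sigma>) \<and>
        extends_smap (skeleton 1 (\<Delta> n)) ?f (smap_of_simplex A h n \<sigma>)) \<and>
        snd (smap_of_simplex A h n \<sigma>) {..n} () = \<sigma>"
      unfolding ext using s(1-3) by blast
  qed
qed

text \<open>The values on vertices and on the empty face are forced by the edges.\<close>

definition low_faces :: "('v, 's) premulticomplex \<Rightarrow> 'v \<Rightarrow> ('v set \<Rightarrow> 's) \<Rightarrow> 'v set \<Rightarrow> 's" where
  "low_faces A a \<epsilon> E = (if E = {} then bdry A {a} {} (the_elem (simplices A {a}))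
     else if is_singleton E then the_elem (simplices A E) else \<epsilon> E)"

lemma low_faces_system:
  assumes A: "multicomplex A" and W: "W \<subseteq> verts A" "a \<in> W" and \<epsilon>: "edge_system A W \<epsilon>"
    and E: "E \<subseteq> W" "finite E" "card E \<le> 2"
  shows "low_faces A a \<epsilon> E \<in> simplices A E"
    and "C \<subseteq> E \<Longrightarrow> bdry A E C (low_faces A a \<epsilon> E) = low_faces A a \<epsilon> C"
proof -
  let ?x = "\<lambda>v. the_elem (simplices A {v})"
  have edge: "bdry A {v, w} {v} (\<epsilon> {v, w}) = ?x v" "bdry A {v, w} {} (\<epsilon> {v, w}) = bdry A {v} {} (?x v)"
    if "v \<in> W" "w \<in> W" "v \<noteq> w" for v w
  proof -
    have e: "\<epsilon> {v, w} \<in> simplices A {v, w}"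
      using \<epsilon> that by (simp add: edge_system_def)
    show 1: "bdry A {v, w} {v} (\<epsilon> {v, w}) = ?x v"
      by (rule vertex_simplex_unique[OF A]) (rule bdry_simplex[OF A e]; blast)
    show "bdry A {v, w} {} (\<epsilon> {v, w}) = bdry A {v} {} (?x v)"
      using bdry_bdry[OF A e, of "{v}" "{}"] 1 by simp
  qed
  have empty: "bdry A {v} {} (?x v) = bdry A {a} {} (?x a)" if "v \<in> W" for v
  proof (cases "v = a")
    case False
    then show ?thesis
      using edge(2)[of v a] edge(2)[of a v] that W(2) by (simp add: insert_commute)
  qed simp
  have xv: "?x v \<in> simplices A {v}" if "v \<in> W" for v
    using vertex_simplex[OF A] W(1) that by blast
  consider "E = {}" | v where "E = {v}" "v \<in> W" | v w where "E = {v, w}" "v \<noteq> w" "v \<in> W" "w \<in> W"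
  proof -
    have "card E = 0 \<or> card E = 1 \<or> card E = 2"
      using E(3) by linarith
    then show ?thesis
      using that E(1,2) by (auto simp: card_1_singleton_iff card_2_iff)
  qed
  note cases = this
  have single [simp]: "low_faces A a \<epsilon> {v} = ?x v" for v
    by (simp add: low_faces_def)
  have two: "low_faces A a \<epsilon> {v, w} = \<epsilon> {v, w}" if "v \<noteq> w" for v w
    using that by (auto simp: low_faces_def is_singleton_def doubleton_eq_iff)
  have nil: "low_faces A a \<epsilon> {} = bdry A {a} {} (?x a)"
    by (simp add: low_faces_def)
  show mem: "low_faces A a \<epsilon> E \<in> simplices A E"
  proof (cases rule: cases)
    case 1
    then show ?thesis
      using bdry_simplex[OF A xv[OF W(2)], of "{}"] by (simp add: nil)
  next
    case (2 v)
    then show ?thesis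
      using xv by simp
  next
    case (3 v w)
    then show ?thesis
      using \<epsilon> by (simp add: two edge_system_def)
  qed
  assume C: "C \<subseteq> E"
  show "bdry A E C (low_faces A a \<epsilon> E) = low_faces A a \<epsilon> C"
  proof (cases "C = E")
    case True
    then show ?thesis
      using bdry_self[OF A mem] by simp
  next
    case ne: False
    show ?thesis
    proof (cases rule: cases)
      case 1
      then show ?thesis
        using C ne by simp
    next
      case (2 v)
      then have "C = {}"
        using C ne by blast
      then show ?thesis
        using 2 empty by (simp add: nil)
    next
      case (3 v w)
      then have "C = {} \<or> C = {v} \<or> C = {w}"
        using C ne by blast
      then show ?thesis
        using 3 edge[of v w] edge[of w v] empty[of v] by (auto simp: nil two insert_commute)
    qed
  qed
qed

lemma unique_fillingsD:
  assumes "unique_fillings A" "finite W" "W \<subseteq> verts A" "card W \<ge> 3" "edge_system A W \<epsilon>"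
    and "\<And>T. T \<subseteq> W \<Longrightarrow> card T = 3 \<Longrightarrow> filled_triangle A T \<epsilon>"
  shows "\<exists>!\<sigma>. \<sigma> \<in> simplices A W \<and> (\<forall>v\<in>W. \<forall>w\<in>W. v \<noteq> w \<longrightarrow> bdry A W {v, w} \<sigma> = \<epsilon> {v, w})"
  by (rule mp[OF spec[OF spec[OF assms(1)[unfolded unique_fillings_def]]]]) (use assms(2-) in blast)

text \<open>A set \<open>W\<close> with its edges is turned into an embedding of the one-skeleton by
  numbering the vertices. The simplices on the vertices and on the empty set have to be
  supplied, which \<open>low_faces\<close> does.\<close>

lemma unique_fillings_iff:
  assumes A: "multicomplex A"
  shows "(\<forall>n\<ge>2. \<forall>f.
        simplicial_embedding (skeleton 1 (\<Delta> n)) A f \<and>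
        (\<forall>T. T \<subseteq> {..n} \<and> card T = 3 \<longrightarrow>
           null_homotopic (realization (simplex_boundary T)) (realization A)
             (realization_map A f \<circ>
              realization_map (skeleton 1 (\<Delta> n)) (inclusion (simplex_boundary T)))) \<longrightarrow>
        (\<exists>!f'. simplicial_embedding (\<Delta> n) A f' \<and> extends_smap (skeleton 1 (\<Delta> n)) f f')) \<longleftrightarrow>
    unique_fillings A" (is "?lhs \<longleftrightarrow> _")
proof
  assume lhs: ?lhs
  show "unique_fillings A"
    unfolding unique_fillings_def
  proof (intro allI impI, elim conjE)
    fix W \<epsilon>
    assume W: "finite W" "W \<subseteq> verts A" "card W \<ge> 3" and \<epsilon>: "edge_system A W \<epsilon>"
      and tri: "\<forall>T. T \<subseteq> W \<and> card T = 3 \<longrightarrow> filled_triangle A T \<epsilon>"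
    define n where "n = card W - 1"
    have n: "n \<ge> 2" and cn: "card W = Suc n"
      using W by (auto simp: n_def)
    let ?F = "{B. B \<subseteq> {..n} \<and> card B \<le> 2}"
    obtain h where "bij_betw h {..n} W"
      using finite_same_card_bij[of "{..n}" W] W(1) cn by auto
    then have inj: "inj_on h {..n}" and im: "h ` {..n} = W"
      by (auto simp: bij_betw_def)
    obtain a where a: "a \<in> W"
      using W(3) by fastforce
    define \<theta> where "\<theta> = low_faces A a \<epsilon>"
    have low: "h ` B \<subseteq> W" "finite (h ` B)" "card (h ` B) \<le> 2" if "B \<in> ?F" for B
      using that im finite_subset[of B "{..n}"] by (auto simp: card_image inj_on_subset[OF inj])
    have mem: "\<theta> (h ` B) \<in> simplices A (h ` B)" if "B \<in> ?F" for B
      unfolding \<theta>_def by (rule low_faces_system(1)[OF A W(2) a \<epsilon> low[OF that]])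
    have bd: "bdry A (h ` B) (h ` C) (\<theta> (h ` B)) = \<theta> (h ` C)" if "B \<in> ?F" "C \<subseteq> B" for B C
      unfolding \<theta>_def by (rule low_faces_system(2)[OF A W(2) a \<epsilon> low[OF that(1)]]) (rule image_mono[OF that(2)])
    have \<theta>\<epsilon>: "\<theta> {v, w} = \<epsilon> {v, w}" if "v \<noteq> w" for v w
      using that by (auto simp: \<theta>_def low_faces_def is_singleton_def doubleton_eq_iff)
    have emb: "simplicial_embedding (sub_simplex {..n} ?F) A (mk_smap {..n} ?F h \<theta>)"
      by (rule simplicial_embedding_mk_smap[OF face_family_skeleton inj])
        (use mem bd im W in auto)
    have "null_homotopic (realization (simplex_boundary T)) (realization A)
             (realization_map A (mk_smap {..n} ?F h \<theta>) \<circ>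
              realization_map (skeleton 1 (\<Delta> n)) (inclusion (simplex_boundary T)))"
      if T: "T \<subseteq> {..n}" "card T = 3" for T
    proof -
      have "h ` T \<subseteq> W" "card (h ` T) = 3"
        using T im card_image[OF inj_on_subset[OF inj T(1)]] by auto
      then have "filled_triangle A (h ` T) \<epsilon>"
        using tri by blast
      then have "filled_triangle A (h ` T) \<theta>"
        unfolding filled_triangle_def by (simp add: \<theta>\<epsilon> cong: conj_cong)
      then show ?thesis
        using filled_triangle_iff_null_homotopic[OF A inj mem bd emb T] by simp
    qed
    note null = this
    have tr: "(\<exists>!f'. simplicial_embedding (\<Delta> n) A f' \<and> extends_smap (skeleton 1 (\<Delta> n)) (mk_smap {..n} ?F h \<theta>) f') \<longleftrightarrow>
        (\<exists>!\<sigma>. \<sigma> \<in> simplices A (h ` {..n}) \<and>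
          (\<forall>v\<in>h ` {..n}. \<forall>w\<in>h ` {..n}. v \<noteq> w \<longrightarrow> bdry A (h ` {..n}) {v, w} \<sigma> = \<theta> {v, w}))"
      by (rule extension_transfer[OF A n inj]) (rule bd)
    from null have "\<exists>!f'. simplicial_embedding (\<Delta> n) A f' \<and> extends_smap (skeleton 1 (\<Delta> n)) (mk_smap {..n} ?F h \<theta>) f'"
      using lhs n emb unfolding skeleton_full_simplex_eq by blast
    then have "\<exists>!\<sigma>. \<sigma> \<in> simplices A W \<and> (\<forall>v\<in>W. \<forall>w\<in>W. v \<noteq> w \<longrightarrow> bdry A W {v, w} \<sigma> = \<theta> {v, w})"
      unfolding tr im .
    then show "\<exists>!\<sigma>. \<sigma> \<in> simplices A W \<and> (\<forall>v\<in>W. \<forall>w\<in>W. v \<noteq> w \<longrightarrow> bdry A W {v, w} \<sigma> = \<epsilon> {v, w})"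
      by (simp add: \<theta>\<epsilon> cong: conj_cong)
  qed
next
  assume uf: "unique_fillings A"
  show ?lhs
  proof (intro allI impI, elim conjE)
    fix n f assume n: "2 \<le> (n::nat)" and emb: "simplicial_embedding (skeleton 1 (\<Delta> n)) A f"
      and tri: "\<forall>T. T \<subseteq> {..n} \<and> card T = 3 \<longrightarrow>
           null_homotopic (realization (simplex_boundary T)) (realization A)
             (realization_map A f \<circ>
              realization_map (skeleton 1 (\<Delta> n)) (inclusion (simplex_boundary T)))"
    let ?F = "{B. B \<subseteq> {..n} \<and> card B \<le> 2}"
    have F: "face_family {..n} ?F"
      by (rule face_family_skeleton) simp
    obtain h \<theta> where f: "f = mk_smap {..n} ?F h \<theta>" and inj: "inj_on h {..n}" and sub: "h ` {..n} \<subseteq> verts A"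
      and mem: "\<And>B. B \<in> ?F \<Longrightarrow> \<theta> (h ` B) \<in> simplices A (h ` B)"
      and bd: "\<And>B C. B \<in> ?F \<Longrightarrow> C \<subseteq> B \<Longrightarrow> bdry A (h ` B) (h ` C) (\<theta> (h ` B)) = \<theta> (h ` C)"
      by (rule simplicial_embedding_cases[OF F emb[unfolded skeleton_full_simplex_eq]]) (rule that)
    have es: "edge_system A (h ` {..n}) \<theta>"
      unfolding edge_system_def
    proof (intro ballI impI)
      fix v w assume "v \<in> h ` {..n}" "w \<in> h ` {..n}" "v \<noteq> w"
      then obtain i j where "i \<le> n" "j \<le> n" "v = h i" "w = h j"
        by blast
      then show "\<theta> {v, w} \<in> simplices A {v, w}"
        using mem[of "{i, j}"] by (simp add: card_insert_if)
    qed
    have tri': "filled_triangle A T \<theta>" if T: "T \<subseteq> h ` {..n}" "card T = 3" for T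
    proof -
      obtain T' where T': "T' \<subseteq> {..n}" "T = h ` T'"
        using T(1) by (rule subset_imageE)
      then have "card T' = 3"
        using T(2) card_image[OF inj_on_subset[OF inj T'(1)]] by simp
      then show ?thesis
        using filled_triangle_iff_null_homotopic[OF A inj mem bd emb[unfolded skeleton_full_simplex_eq f] T'(1)]
          tri T' f by simp
    qed
    have fc: "finite (h ` {..n})" "card (h ` {..n}) \<ge> 3"
      using n by (auto simp: card_image[OF inj])
    have \<sigma>: "\<exists>!\<sigma>. \<sigma> \<in> simplices A (h ` {..n}) \<and>
        (\<forall>v\<in>h ` {..n}. \<forall>w\<in>h ` {..n}. v \<noteq> w \<longrightarrow> bdry A (h ` {..n}) {v, w} \<sigma> = \<theta> {v, w})"
      by (rule unique_fillingsD[OF uf fc(1) sub fc(2) es tri'])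
    have tr: "(\<exists>!f'. simplicial_embedding (\<Delta> n) A f' \<and> extends_smap (skeleton 1 (\<Delta> n)) (mk_smap {..n} ?F h \<theta>) f') \<longleftrightarrow>
        (\<exists>!\<sigma>. \<sigma> \<in> simplices A (h ` {..n}) \<and>
          (\<forall>v\<in>h ` {..n}. \<forall>w\<in>h ` {..n}. v \<noteq> w \<longrightarrow> bdry A (h ` {..n}) {v, w} \<sigma> = \<theta> {v, w}))"
      by (rule extension_transfer[OF A n inj]) (rule bd)
    with \<sigma> show "\<exists>!f'. simplicial_embedding (\<Delta> n) A f' \<and> extends_smap (skeleton 1 (\<Delta> n)) f f'"
      unfolding f by simp
  qed
qed

section \<open>Unique fillings of cubes and simplices\<close>

definition unique_cube_filling :: "'a topology \<Rightarrow> nat \<Rightarrow> bool" where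
  "unique_cube_filling X m \<longleftrightarrow> (\<forall>f g. continuous_map (top_of_set (cube m)) X f \<longrightarrow>
     continuous_map (top_of_set (cube m)) X g \<longrightarrow> (\<forall>u\<in>cube_boundary m. f u = g u) \<longrightarrow>
     homotopic_rel (cube_boundary m) (top_of_set (cube m)) X f g)"

definition unique_simplex_filling :: "'a topology \<Rightarrow> 'v set \<Rightarrow> bool" where
  "unique_simplex_filling X B \<longleftrightarrow> (\<forall>f g. continuous_map (top_of_set (affine_simplex B)) X f \<longrightarrow>
     continuous_map (top_of_set (affine_simplex B)) X g \<longrightarrow> (\<forall>t\<in>simplex_frontier B. f t = g t) \<longrightarrow>
     homotopic_rel (simplex_frontier B) (top_of_set (affine_simplex B)) X f g)"

text \<open>The maximum norm about the centre of the cube, scaled so that the boundary is the unit sphere;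
  \<open>rescale\<close> is the homothety about the centre, which keeps the coordinates beyond
  \<open>m\<close> at zero.\<close>

definition cube_norm :: "nat \<Rightarrow> (nat \<Rightarrow> real) \<Rightarrow> real" where
  "cube_norm m u = Max ((\<lambda>i. \<bar>2 * u i - 1\<bar>) ` {..<m})"

definition rescale :: "nat \<Rightarrow> real \<Rightarrow> (nat \<Rightarrow> real) \<Rightarrow> nat \<Rightarrow> real" where
  "rescale m k u = (\<lambda>i. if i < m then 1 / 2 + k * (u i - 1 / 2) else 0)"

lemma cube_boundary_subset: "cube_boundary m \<subseteq> cube m"
  by (auto simp: cube_boundary_def)

lemma seg_in_cube:
  assumes "u \<in> cube m" "w \<in> cube m" "0 \<le> s" "s \<le> 1"
  shows "seg s u w \<in> cube m"
proof -
  have "0 \<le> seg s u w i \<and> seg s u w i \<le> 1" for i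
  proof -
    have "u i \<le> 1" "w i \<le> 1" "0 \<le> u i" "0 \<le> w i"
      using assms by (auto simp: cube_def)
    then show ?thesis
      using assms(3,4) convex_bound_le[of "u i" 1 "w i" "1 - s" s] by (simp add: seg_def)
  qed
  then show ?thesis
    using assms(1,2) by (auto simp: cube_def seg_def)
qed

lemma rescale_1: "u \<in> cube m \<Longrightarrow> rescale m 1 u = u"
  by (auto simp: rescale_def cube_def)

lemma rescale_0: "rescale m 0 u = rescale m 0 w"
  by (simp add: rescale_def cong: if_cong)

lemma rescale_rescale: "rescale m k (rescale m l u) = rescale m (k * l) u"
  by (auto simp: rescale_def)

lemma cube_norm_rescale:
  assumes "m \<ge> 1" "0 \<le> k"
  shows "cube_norm m (rescale m k u) = k * cube_norm m u"
proof -
  have "(\<lambda>i. \<bar>2 * rescale m k u i - 1\<bar>) ` {..<m} = (\<lambda>x. k * x) ` (\<lambda>i. \<bar>2 * u i - 1\<bar>) ` {..<m}"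
    unfolding image_image
  proof (rule image_cong)
    fix i assume "i \<in> {..<m}"
    then have "2 * rescale m k u i - 1 = k * (2 * u i - 1)"
      by (simp add: rescale_def algebra_simps)
    then show "\<bar>2 * rescale m k u i - 1\<bar> = k * \<bar>2 * u i - 1\<bar>"
      using assms(2) by (simp add: abs_mult)
  qed simp
  moreover have "Max ((\<lambda>x. k * x) ` (\<lambda>i. \<bar>2 * u i - 1\<bar>) ` {..<m}) = k * Max ((\<lambda>i. \<bar>2 * u i - 1\<bar>) ` {..<m})"
    using assms
    by (intro mono_Max_commute[symmetric] monoI mult_left_mono) (auto simp: lessThan_empty_iff)
  ultimately show ?thesis
    by (simp add: cube_norm_def)
qed

lemma cube_norm_nonneg:
  assumes "m \<ge> 1"
  shows "0 \<le> cube_norm m u"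
proof -
  have "\<bar>2 * u 0 - 1\<bar> \<le> cube_norm m u"
    unfolding cube_norm_def using assms by (intro Max_ge) auto
  then show ?thesis
    by linarith
qed

lemma cube_norm_le_1:
  assumes "m \<ge> 1" "u \<in> cube m"
  shows "cube_norm m u \<le> 1"
proof -
  have "\<bar>2 * u i - 1\<bar> \<le> 1" for i
  proof -
    have "0 \<le> u i" "u i \<le> 1"
      using assms(2) by (auto simp: cube_def)
    then show ?thesis
      by (simp add: abs_le_iff)
  qed
  then show ?thesis
    using assms(1) unfolding cube_norm_def by (subst Max_le_iff) (auto simp: lessThan_empty_iff)
qed

lemma rescale_in_cube:
  assumes "m \<ge> 1" "0 \<le> k" "k * cube_norm m u \<le> 1"
  shows "rescale m k u \<in> cube m"
proof -
  have "\<bar>2 * rescale m k u i - 1\<bar> \<le> 1" if "i < m" for i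
  proof -
    have "\<bar>2 * rescale m k u i - 1\<bar> \<le> cube_norm m (rescale m k u)"
      unfolding cube_norm_def using that by (intro Max_ge) auto
    then show ?thesis
      using assms by (simp add: cube_norm_rescale)
  qed
  then have "0 \<le> rescale m k u i \<and> rescale m k u i \<le> 1" if "i < m" for i
    using that by (fastforce simp: abs_le_iff)
  then show ?thesis
    by (auto simp: cube_def rescale_def)
qed

lemma cube_boundary_iff_norm:
  assumes "m \<ge> 1" "u \<in> cube m"
  shows "u \<in> cube_boundary m \<longleftrightarrow> cube_norm m u = 1"
proof -
  have "cube_norm m u = 1 \<longleftrightarrow> (\<exists>i<m. \<bar>2 * u i - 1\<bar> = 1)"
  proof
    assume "cube_norm m u = 1"
    moreover have "Max ((\<lambda>i. \<bar>2 * u i - 1\<bar>) ` {..<m}) \<in> (\<lambda>i. \<bar>2 * u i - 1\<bar>) ` {..<m}"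
      using assms(1) by (intro Max_in) (auto simp: lessThan_empty_iff)
    ultimately show "\<exists>i<m. \<bar>2 * u i - 1\<bar> = 1"
      by (auto simp: cube_norm_def)
  next
    assume "\<exists>i<m. \<bar>2 * u i - 1\<bar> = 1"
    then obtain i where i: "i < m" "\<bar>2 * u i - 1\<bar> = 1"
      by blast
    then have "\<bar>2 * u i - 1\<bar> \<le> cube_norm m u"
      unfolding cube_norm_def by (intro Max_ge) auto
    then have "1 \<le> cube_norm m u"
      using i(2) by simp
    then show "cube_norm m u = 1"
      using cube_norm_le_1[OF assms] by simp
  qed
  then show ?thesis
    using assms(2) by (auto simp: cube_boundary_def abs_if split: if_splits)
qed

lemma continuous_on_cube_norm [continuous_intros]:
  fixes f :: "'a::topological_space \<Rightarrow> nat \<Rightarrow> real"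
  assumes "m \<ge> 1" "continuous_on S f"
  shows "continuous_on S (\<lambda>x. cube_norm m (f x))"
  unfolding cube_norm_def using assms(1)
  by (intro continuous_on_Max_image continuous_intros continuous_on_apply[OF assms(2)])
    (auto simp: lessThan_empty_iff)

lemma continuous_on_rescale [continuous_intros]:
  fixes f :: "'a::topological_space \<Rightarrow> nat \<Rightarrow> real"
  assumes "continuous_on S k" "continuous_on S f"
  shows "continuous_on S (\<lambda>x. rescale m (k x) (f x))"
proof (rule continuous_on_coordinatewise_then_product)
  fix i
  show "continuous_on S (\<lambda>x. rescale m (k x) (f x) i)"
    by (cases "i < m")
      (auto simp: rescale_def intro!: continuous_intros assms(1) continuous_on_apply[OF assms(2)])
qed

text \<open>The cube is convex, so a change of the radius that fixes the boundary can be undone along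
  segments.\<close>

lemma homotopic_rel_stretch:
  assumes m: "m \<ge> 1" and f: "continuous_map (top_of_set (cube m)) X f"
    and k: "continuous_on {0..1} k" "\<And>\<rho>. 0 \<le> \<rho> \<Longrightarrow> \<rho> \<le> 1 \<Longrightarrow> 0 \<le> k \<rho> \<and> k \<rho> * \<rho> \<le> 1" "k 1 = 1"
  shows "homotopic_rel (cube_boundary m) (top_of_set (cube m)) X f (\<lambda>u. f (rescale m (k (cube_norm m u)) u))"
proof (rule homotopic_relI[where h="\<lambda>z. f (seg (fst z) (snd z) (rescale m (k (cube_norm m (snd z))) (snd z)))"])
  have N: "cube_norm m u \<in> {0..1}" if "u \<in> cube m" for u
    using cube_norm_nonneg[OF m] cube_norm_le_1[OF m that] by simp
  have sc: "rescale m (k (cube_norm m u)) u \<in> cube m" if "u \<in> cube m" for u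
    using k(2) N[OF that] by (intro rescale_in_cube[OF m]) auto
  have "continuous_on ({0..1::real} \<times> cube m) (\<lambda>z. cube_norm m (snd z))"
    by (intro continuous_on_cube_norm[OF m] continuous_on_snd continuous_on_id)
  then have "continuous_on ({0..1::real} \<times> cube m) (\<lambda>z. k (cube_norm m (snd z)))"
    by (rule continuous_on_compose2[OF k(1)]) (use N in auto)
  then have "continuous_on ({0..1::real} \<times> cube m) (\<lambda>z. seg (fst z) (snd z) (rescale m (k (cube_norm m (snd z))) (snd z)))"
    by (intro continuous_on_seg continuous_on_rescale continuous_on_fst continuous_on_snd continuous_on_id)
  then have "continuous_map (top_of_set ({0..1} \<times> cube m)) (top_of_set (cube m))
      (\<lambda>z. seg (fst z) (snd z) (rescale m (k (cube_norm m (snd z))) (snd z)))"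
    using sc by (simp add: Pi_iff seg_in_cube)
  from continuous_map_compose[OF this f]
  show "continuous_map (prod_topology \<I> (top_of_set (cube m))) X
      (\<lambda>z. f (seg (fst z) (snd z) (rescale m (k (cube_norm m (snd z))) (snd z))))"
    by (simp add: o_def)
  show "f (seg (fst (s, u)) (snd (s, u)) (rescale m (k (cube_norm m (snd (s, u)))) (snd (s, u)))) = f u"
    if "u \<in> cube_boundary m" for s u
    using that cube_boundary_subset[of m] cube_boundary_iff_norm[OF m, of u] rescale_1[of u m] k(3) by auto
qed (use cube_boundary_subset[of m] in auto)

text \<open>Glue \<open>g\<close> on the inner half of the cube to \<open>f\<close> turned inside out on the
  outer half. The result \<open>S\<close> is a spheroid, and a contraction of \<open>S\<close>
  unrolls to a homotopy from \<open>f\<close> to \<open>g\<close>.\<close>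

lemma unique_cube_filling_if_spheroids_trivial:
  assumes m: "m \<ge> 1"
    and triv: "\<And>x S. x \<in> topspace X \<Longrightarrow> S \<in> spheroids X x m \<Longrightarrow>
      homotopic_rel (cube_boundary m) (top_of_set (cube m)) X S (\<lambda>_. x)"
  shows "unique_cube_filling X m"
  unfolding unique_cube_filling_def
proof (intro allI impI)
  fix f g
  assume f: "continuous_map (top_of_set (cube m)) X f" and g: "continuous_map (top_of_set (cube m)) X g"
    and fg: "\<forall>u\<in>cube_boundary m. f u = g u"
  let ?N = "cube_norm m" and ?C = "top_of_set (cube m)"
  \<comment> \<open>The centre of the cube, whose image under \<open>f\<close> is the base point of the spheroid.\<close>
  define c where "c = rescale m 0 (\<lambda>_. 0)"
  have c: "rescale m 0 u = c" for u
    unfolding c_def by (rule rescale_0)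
  have c_cube: "c \<in> cube m"
    unfolding c_def by (rule rescale_in_cube[OF m]) auto
  have N0: "0 \<le> ?N u" for u
    by (rule cube_norm_nonneg[OF m])
  have N1: "?N u \<le> 1" if "u \<in> cube m" for u
    using cube_norm_le_1[OF m that] .
  have bdryI: "u \<in> cube_boundary m" if "u \<in> cube m" "?N u = 1" for u
    using cube_boundary_iff_norm[OF m that(1)] that(2) by simp
  define x where "x = f c"
  have x: "x \<in> topspace X"
    using continuous_map_funspace[OF f] c_cube by (auto simp: x_def)
  define S where "S = (\<lambda>u. if ?N u \<le> 1 / 2 then g (rescale m 2 u) else f (rescale m ((2 - 2 * ?N u) / ?N u) u))"
  have "continuous_map ?C X S"
    unfolding S_def
  proof (rule continuous_map_cases_le)
    show "continuous_map ?C euclideanreal ?N" "continuous_map ?C euclideanreal (\<lambda>u. 1 / 2)"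
      using m by (auto intro!: continuous_intros)
    let ?L = "{u \<in> topspace ?C. ?N u \<le> 1 / 2}" and ?U = "{u \<in> topspace ?C. 1 / 2 \<le> ?N u}"
    have "continuous_map (subtopology ?C ?L) ?C (rescale m 2)"
      unfolding subtopology_subtopology continuous_map_subtopology_eu
      using m by (auto intro!: continuous_intros rescale_in_cube)
    from continuous_map_compose[OF this g]
    show "continuous_map (subtopology ?C ?L) X (\<lambda>u. g (rescale m 2 u))"
      by (simp add: o_def)
    have "rescale m ((2 - 2 * ?N u) / ?N u) u \<in> cube m" if "u \<in> cube m" "1 / 2 \<le> ?N u" for u
      using that N1[of u] by (intro rescale_in_cube[OF m]) auto
    then have "continuous_map (subtopology ?C ?U) ?C (\<lambda>u. rescale m ((2 - 2 * ?N u) / ?N u) u)"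
      unfolding subtopology_subtopology continuous_map_subtopology_eu
      using m by (auto intro!: continuous_intros)
    from continuous_map_compose[OF this f]
    show "continuous_map (subtopology ?C ?U) X (\<lambda>u. f (rescale m ((2 - 2 * ?N u) / ?N u) u))"
      by (simp add: o_def)
    fix u assume u: "u \<in> topspace ?C" and half: "?N u = 1 / 2"
    then have "rescale m 2 u \<in> cube_boundary m"
      using m by (intro bdryI rescale_in_cube) (auto simp: cube_norm_rescale)
    moreover have "(2 - 2 * ?N u) / ?N u = 2"
      unfolding half by simp
    ultimately show "g (rescale m 2 u) = f (rescale m ((2 - 2 * ?N u) / ?N u) u)"
      using fg by simp
  qed
  moreover have "S u = x" if "u \<in> cube_boundary m" for u
    using that cube_boundary_subset[of m] cube_boundary_iff_norm[OF m, of u] by (auto simp: S_def x_def c)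
  ultimately have "S \<in> spheroids X x m"
    by (simp add: spheroids_def euclidean_product_topology)
  from triv[OF x this] obtain T where T: "continuous_map (prod_topology \<I> ?C) X T"
    and T0: "\<And>u. T (0, u) = S u" and T1: "\<And>u. T (1, u) = x"
    and Tb: "\<And>s u. 0 \<le> s \<Longrightarrow> s \<le> 1 \<Longrightarrow> u \<in> cube_boundary m \<Longrightarrow> T (s, u) = S u"
    by (rule homotopic_relE) (rule that)
  have Tx: "T (s, u) = x" if "0 \<le> s" "s \<le> 1" "u \<in> cube_boundary m" for s u
    using Tb[OF that] \<open>\<And>u. u \<in> cube_boundary m \<Longrightarrow> S u = x\<close>[OF that(3)] by simp
  \<comment> \<open>\<open>f'\<close> reparametrizes \<open>f\<close> so that the inner half of the cube is sent to the value at the centre.\<close>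
  define f' where "f' = (\<lambda>u. f (rescale m (max 0 (2 * ?N u - 1) / max (?N u) (1 / 2)) u))"
  have ff': "homotopic_rel (cube_boundary m) ?C X f f'"
    unfolding f'_def
  proof (rule homotopic_rel_stretch[OF m f, where k="\<lambda>\<rho>. max 0 (2 * \<rho> - 1) / max \<rho> (1 / 2)"])
    show "continuous_on {0..1} (\<lambda>\<rho>::real. max 0 (2 * \<rho> - 1) / max \<rho> (1 / 2))"
      by (intro continuous_intros) auto
    show "0 \<le> max 0 (2 * \<rho> - 1) / max \<rho> (1 / 2) \<and> max 0 (2 * \<rho> - 1) / max \<rho> (1 / 2) * \<rho> \<le> 1"
      if "0 \<le> \<rho>" "\<rho> \<le> 1" for \<rho> :: real
      using that by (auto simp: max_def field_simps)
  qed auto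
  \<comment> \<open>The graph of \<open>f'\<close> is traced by the curve in the (radius, time) square that runs along the
    base from radius 1/2 to 1, up the side and back along the top, where \<open>T\<close> is constant; contract
    it linearly to the curve on the base from radius 1/2 to 0, which traces \<open>g\<close>.\<close>
  define r where "r = (\<lambda>\<rho>::real. min 1 (3 / 2 - \<rho>) / max \<rho> (1 / 4))"
  define h where "h = (\<lambda>\<rho>::real. max 0 (min 1 (2 - 4 * \<rho>)))"
  define H where "H = (\<lambda>z. T ((1 - fst z) * h (?N (snd z)), rescale m ((1 - fst z) * r (?N (snd z)) + fst z / 2) (snd z)))"
  have r0: "0 \<le> r \<rho>" and r1: "r \<rho> * \<rho> \<le> 1" if "0 \<le> \<rho>" "\<rho> \<le> 1" for \<rho>
    using that by (auto simp: r_def max_def min_def field_simps)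
  have h01: "0 \<le> h \<rho>" "h \<rho> \<le> 1" for \<rho>
    by (auto simp: h_def)
  have h2: "0 \<le> (1 - s) * h \<rho>" "(1 - s) * h \<rho> \<le> 1" if "0 \<le> s" "s \<le> 1" for s \<rho>
    using that h01[of \<rho>] by (simp_all add: mult_le_one)
  have in_cube: "rescale m ((1 - s) * r (?N u) + s / 2) u \<in> cube m" if "u \<in> cube m" "0 \<le> s" "s \<le> 1" for s u
  proof (rule rescale_in_cube[OF m])
    show "0 \<le> (1 - s) * r (?N u) + s / 2"
      using r0[OF N0 N1] that by simp
    have "((1 - s) * r (?N u) + s / 2) * ?N u = (1 - s) * (r (?N u) * ?N u) + s * (?N u / 2)"
      by (simp add: algebra_simps)
    also have "\<dots> \<le> (1 - s) * 1 + s * 1"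
      using that N0[of u] N1[of u] r1[of "?N u"] by (intro add_mono mult_left_mono) auto
    finally show "((1 - s) * r (?N u) + s / 2) * ?N u \<le> 1"
      by simp
  qed
  have "homotopic_rel (cube_boundary m) ?C X f' g"
  proof (rule homotopic_relI[where h=H])
    let ?j = "\<lambda>z. ((1 - fst z) * h (?N (snd z)), rescale m ((1 - fst z) * r (?N (snd z)) + fst z / 2) (snd z))"
    have "continuous_on ({0..1} \<times> cube m) ?j"
      unfolding r_def h_def using m by (intro continuous_intros) auto
    moreover have "?j ` ({0..1} \<times> cube m) \<subseteq> {0..1} \<times> cube m"
      using in_cube h2 by auto
    ultimately have "continuous_map (prod_topology \<I> ?C) (prod_topology \<I> ?C) ?j"
      by (simp add: image_subset_iff Pi_iff)
    from continuous_map_compose[OF this T]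
    show "continuous_map (prod_topology \<I> ?C) X H"
      by (simp add: H_def o_def)
    show "H (1, u) = g u" if "u \<in> topspace ?C" for u
    proof -
      have "?N (rescale m (1 / 2) u) \<le> 1 / 2"
        using N1[of u] that m by (simp add: cube_norm_rescale)
      then show ?thesis
        using that by (simp add: H_def T0 S_def rescale_rescale rescale_1)
    qed
    have outer: "H (0, u) = f' u" if u: "u \<in> cube m" "1 / 2 \<le> ?N u" for u
    proof -
      let ?\<rho> = "?N u"
      have \<rho>: "1 / 2 \<le> ?\<rho>" "?\<rho> \<le> 1"
        using u N1 by auto
      have rr: "r ?\<rho> = (3 / 2 - ?\<rho>) / ?\<rho>" and hh: "h ?\<rho> = 0"
        using \<rho> by (auto simp: r_def h_def min_def max_def)
      have N: "?N (rescale m (r ?\<rho>) u) = 3 / 2 - ?\<rho>"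
        using \<rho> m r0[OF N0, of u] by (simp add: cube_norm_rescale rr)
      have "H (0, u) = S (rescale m (r ?\<rho>) u)"
        by (simp add: H_def hh T0)
      also have "\<dots> = f' u"
      proof (cases "?\<rho> = 1")
        case True
        then have "u \<in> cube_boundary m"
          using bdryI u by blast
        then show ?thesis
          using True N u fg by (simp add: S_def f'_def r_def rescale_rescale rescale_1)
      next
        case False
        then have "?N (rescale m (r ?\<rho>) u) > 1 / 2"
          using N \<rho> by simp
        moreover have "(2 - 2 * (3 / 2 - ?\<rho>)) / (3 / 2 - ?\<rho>) * r ?\<rho> = max 0 (2 * ?\<rho> - 1) / max ?\<rho> (1 / 2)"
          using \<rho> by (simp add: rr max_def)
        ultimately show ?thesis
          unfolding S_def f'_def N rescale_rescale by simp
      qed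
      finally show ?thesis .
    qed
    show "H (0, u) = f' u" if "u \<in> topspace ?C" for u
    proof -
      have u: "u \<in> cube m"
        using that by simp
      let ?\<rho> = "?N u"
      consider "?\<rho> \<le> 1 / 4" | "1 / 4 \<le> ?\<rho>" "?\<rho> \<le> 1 / 2" | "1 / 2 \<le> ?\<rho>"
        by linarith
      then show ?thesis
      proof cases
        case 1
        then have "h ?\<rho> = 1"
          by (simp add: h_def)
        then show ?thesis
          using 1 by (simp add: H_def T1 f'_def c x_def)
      next
        case 2
        then have "r ?\<rho> * ?\<rho> = 1"
          by (simp add: r_def min_def max_def)
        then have "rescale m (r ?\<rho>) u \<in> cube_boundary m"
          using r0[OF N0 N1[OF u]] m by (intro bdryI rescale_in_cube) (auto simp: cube_norm_rescale)
        then show ?thesis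
          using 2 Tx h01 by (simp add: H_def f'_def c x_def)
      next
        case 3
        then show ?thesis
          by (rule outer[OF u])
      qed
    qed
    show "H (s, u) = f' u" if s: "0 \<le> s" "s \<le> 1" and u: "u \<in> cube_boundary m" for s u
    proof -
      have u': "u \<in> cube m" "?N u = 1"
        using u cube_boundary_subset[of m] cube_boundary_iff_norm[OF m, of u] by auto
      have e: "(1 - s) / 2 + s / 2 = 1 / 2"
        by (simp add: field_simps)
      have "H (s, u) = H (0, u)"
        by (simp add: H_def u'(2) h_def r_def e)
      then show ?thesis
        using outer u' by simp
    qed
  qed (use cube_boundary_subset[of m] in auto)
  with ff' show "homotopic_rel (cube_boundary m) ?C X f g"
    by (rule homotopic_rel_trans)
qed

text \<open>The quotient is continuous even where \<open>c\<close> vanishes, because there it is squeezed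
  between \<open>0\<close> and \<open>b\<close>.\<close>

lemma continuous_on_product_quotient:
  fixes a b c :: "'a::topological_space \<Rightarrow> real"
  assumes "continuous_on S a" "continuous_on S b" "continuous_on S c"
    and le: "\<And>x. x \<in> S \<Longrightarrow> 0 \<le> a x \<and> a x \<le> c x \<and> 0 \<le> b x"
    and zero: "\<And>x. x \<in> S \<Longrightarrow> c x = 0 \<Longrightarrow> b x = 0"
  shows "continuous_on S (\<lambda>x. a x * b x / c x)"
  unfolding continuous_on_def
proof
  fix x assume x: "x \<in> S"
  have lim: "(a \<longlongrightarrow> a x) (at x within S)" "(b \<longlongrightarrow> b x) (at x within S)" "(c \<longlongrightarrow> c x) (at x within S)"
    using assms(1-3) x by (auto simp: continuous_on_def)
  show "((\<lambda>x. a x * b x / c x) \<longlongrightarrow> a x * b x / c x) (at x within S)"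
  proof (cases "c x = 0")
    case True
    have "0 \<le> a y * b y / c y" "a y * b y / c y \<le> b y" if y: "y \<in> S" for y
    proof -
      note l = le[OF y]
      show "0 \<le> a y * b y / c y"
        using l by simp
      show "a y * b y / c y \<le> b y"
      proof (cases "c y = 0")
        case False
        then have "c y > 0"
          using l by linarith
        then show ?thesis
          using l mult_right_mono[of "a y" "c y" "b y"] by (simp add: divide_le_eq mult.commute)
      qed (use l in simp)
    qed
    then have ev: "\<forall>\<^sub>F y in at x within S. 0 \<le> a y * b y / c y" "\<forall>\<^sub>F y in at x within S. a y * b y / c y \<le> b y"
      by (auto simp: eventually_at_filter)
    have "(b \<longlongrightarrow> 0) (at x within S)"
      using lim(2) zero[OF x True] by simp
    then have "((\<lambda>x. a x * b x / c x) \<longlongrightarrow> 0) (at x within S)"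
      by (rule tendsto_sandwich[OF ev tendsto_const])
    then show ?thesis
      using True by simp
  next
    case False
    then show ?thesis
      using lim by (intro tendsto_divide tendsto_mult)
  qed
qed

text \<open>Drop the last barycentric coordinate to see the simplex as the set of nonnegative vectors with
  sum at most 1. On each ray from the origin, the cube and this set are cut off by the maximum
  and by the sum of the coordinates; exchange the two by rescaling the ray.\<close>

definition cube_to_simplex :: "nat \<Rightarrow> (nat \<Rightarrow> real) \<Rightarrow> nat \<Rightarrow> real" where
  "cube_to_simplex m u = (\<lambda>i. if i < m then u i * Max (u ` {..<m}) / sum u {..<m}
     else if i = m then 1 - Max (u ` {..<m}) else 0)"

definition simplex_to_cube :: "nat \<Rightarrow> (nat \<Rightarrow> real) \<Rightarrow> nat \<Rightarrow> real" where
  "simplex_to_cube m t = (\<lambda>i. if i < m then t i * sum t {..<m} / Max (t ` {..<m}) else 0)"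

lemma Max_sum_facts:
  fixes u :: "nat \<Rightarrow> real"
  assumes "m \<ge> 1" "\<And>i. 0 \<le> u i"
  shows "0 \<le> Max (u ` {..<m})" "Max (u ` {..<m}) = 0 \<longleftrightarrow> sum u {..<m} = 0" "0 \<le> sum u {..<m}"
    "\<And>i. i < m \<Longrightarrow> u i \<le> Max (u ` {..<m})" "\<And>i. i < m \<Longrightarrow> u i \<le> sum u {..<m}"
    "\<exists>i<m. u i = Max (u ` {..<m})"
proof -
  show le: "u i \<le> Max (u ` {..<m})" if "i < m" for i
    using that by (intro Max_ge) auto
  have "u 0 \<le> Max (u ` {..<m})"
    using le[of 0] assms(1) by simp
  then show M0: "0 \<le> Max (u ` {..<m})"
    using assms(2)[of 0] by linarith
  show "0 \<le> sum u {..<m}"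
    using assms(2) by (simp add: sum_nonneg)
  show les: "u i \<le> sum u {..<m}" if "i < m" for i
    using that assms(2) by (intro member_le_sum) auto
  have "Max (u ` {..<m}) \<in> u ` {..<m}"
    using assms(1) by (intro Max_in) (auto simp: lessThan_empty_iff)
  then show ex: "\<exists>i<m. u i = Max (u ` {..<m})"
    by auto
  show "Max (u ` {..<m}) = 0 \<longleftrightarrow> sum u {..<m} = 0"
  proof
    assume "Max (u ` {..<m}) = 0"
    then have "u i = 0" if "i < m" for i
      using le[OF that] assms(2)[of i] by simp
    then show "sum u {..<m} = 0"
      by simp
  next
    assume "sum u {..<m} = 0"
    then show "Max (u ` {..<m}) = 0"
      using ex les M0 by force
  qed
qed

lemma cube_to_simplex_in:
  assumes m: "m \<ge> 1" and u: "u \<in> cube m"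
  shows "cube_to_simplex m u \<in> affine_simplex {..m}"
proof -
  let ?M = "Max (u ` {..<m})" and ?S = "sum u {..<m}"
  have u01: "0 \<le> u i" "u i \<le> 1" for i
    using u by (auto simp: cube_def)
  note f = Max_sum_facts[where u=u, OF m u01(1)]
  have M1: "?M \<le> 1"
    using f(6) u01(2) by metis
  have "sum (cube_to_simplex m u) {..m} = (\<Sum>i<m. u i * ?M / ?S) + (1 - ?M)"
    by (simp add: lessThan_Suc_atMost[symmetric] cube_to_simplex_def)
  also have "(\<Sum>i<m. u i * ?M / ?S) = ?S * ?M / ?S"
    by (simp add: sum_distrib_right sum_divide_distrib)
  also have "\<dots> = ?M"
    using f(2) by auto
  finally have "sum (cube_to_simplex m u) {..m} = 1"
    by simp
  then show ?thesis
    using u01 M1 f(1,3) by (auto simp: affine_simplex_def cube_to_simplex_def)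
qed

lemma simplex_to_cube_in:
  assumes m: "m \<ge> 1" and t: "t \<in> affine_simplex {..m}"
  shows "simplex_to_cube m t \<in> cube m"
proof -
  let ?M = "Max (t ` {..<m})" and ?S = "sum t {..<m}"
  have t0: "0 \<le> t i" for i
    using affine_simplex_nonneg[OF t] .
  note f = Max_sum_facts[where u=t, OF m t0]
  have "?S + t m = 1"
    using t by (simp add: affine_simplex_def lessThan_Suc_atMost[symmetric])
  then have S1: "?S \<le> 1"
    using t0[of m] by simp
  have "t i * ?S / ?M \<le> 1" if "i < m" for i
  proof (cases "?M = 0")
    case False
    then have "?M > 0"
      using f(1) by linarith
    then have "t i * ?S / ?M \<le> ?S"
      using f(3) f(4)[OF that] mult_right_mono[of "t i" ?M ?S] by (simp add: divide_le_eq mult.commute)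
    then show ?thesis
      using S1 by linarith
  qed simp
  then show ?thesis
    using t0 f(1,3) by (auto simp: cube_def simplex_to_cube_def)
qed

lemma cube_to_simplex_to_cube:
  assumes m: "m \<ge> 1" and t: "t \<in> affine_simplex {..m}"
  shows "cube_to_simplex m (simplex_to_cube m t) = t"
proof -
  let ?u = "simplex_to_cube m t"
  let ?M = "Max (t ` {..<m})" and ?S = "sum t {..<m}"
  have t0: "0 \<le> t i" for i
    using affine_simplex_nonneg[OF t] .
  note f = Max_sum_facts[where u=t, OF m t0]
  have tm: "t m = 1 - ?S"
    using t by (simp add: affine_simplex_def lessThan_Suc_atMost[symmetric])
  have "?u ` {..<m} = (\<lambda>x. x * ?S / ?M) ` t ` {..<m}"
    unfolding image_image by (rule image_cong) (auto simp: simplex_to_cube_def)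
  moreover have "Max ((\<lambda>x. x * ?S / ?M) ` t ` {..<m}) = ?M * ?S / ?M"
    using m f(1,3)
    by (intro mono_Max_commute[symmetric] monoI divide_right_mono mult_right_mono) (auto simp: lessThan_empty_iff)
  ultimately have Mu: "Max (?u ` {..<m}) = ?S"
    using f(2) by (cases "?M = 0") auto
  have Su: "sum ?u {..<m} = ?S * ?S / ?M"
    by (simp add: simplex_to_cube_def sum_distrib_right sum_divide_distrib)
  show ?thesis
  proof
    fix i
    consider "i < m" | "i = m" | "i > m"
      by linarith
    then show "cube_to_simplex m ?u i = t i"
    proof cases
      case 1
      show ?thesis
      proof (cases "?S = 0")
        case True
        then have "t i = 0"
          using f(5)[OF 1] t0[of i] by simp
        then show ?thesis
          using 1 by (simp add: cube_to_simplex_def simplex_to_cube_def)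
      next
        case False
        then have "?M \<noteq> 0"
          using f(2) by simp
        then show ?thesis
          using 1 False by (simp add: cube_to_simplex_def Mu Su) (simp add: simplex_to_cube_def)
      qed
    next
      case 2
      then show ?thesis
        by (simp add: cube_to_simplex_def Mu tm)
    next
      case 3
      then show ?thesis
        using affine_simplex_outside[OF t, of i] by (simp add: cube_to_simplex_def)
    qed
  qed
qed

lemma cube_to_simplex_frontier:
  assumes m: "m \<ge> 1" and u: "u \<in> cube_boundary m"
  shows "cube_to_simplex m u \<in> simplex_frontier {..m}"
proof -
  have u': "u \<in> cube m" and "\<exists>i<m. u i = 0 \<or> u i = 1"
    using u by (auto simp: cube_boundary_def)
  then obtain i where i: "i < m" "u i = 0 \<or> u i = 1"
    by blast
  have u01: "0 \<le> u i" "u i \<le> 1" for i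
    using u' by (auto simp: cube_def)
  note f = Max_sum_facts[where u=u, OF m u01(1)]
  have "cube_to_simplex m u i = 0 \<or> cube_to_simplex m u m = 0"
  proof (cases "u i = 0")
    case False
    then have "1 \<le> Max (u ` {..<m})"
      using i f(4)[of i] by simp
    moreover have "Max (u ` {..<m}) \<le> 1"
      using f(6) u01(2) by metis
    ultimately show ?thesis
      by (simp add: cube_to_simplex_def)
  qed (use i in \<open>simp add: cube_to_simplex_def\<close>)
  then show ?thesis
    using cube_to_simplex_in[OF m u'] i(1) by (auto simp: simplex_frontier_def)
qed

lemma simplex_to_cube_boundary:
  assumes m: "m \<ge> 1" and t: "t \<in> simplex_frontier {..m}"
  shows "simplex_to_cube m t \<in> cube_boundary m"
proof -
  have t': "t \<in> affine_simplex {..m}" and "\<exists>i\<le>m. t i = 0"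
    using t by (auto simp: simplex_frontier_def)
  then obtain i where i: "i \<le> m" "t i = 0"
    by blast
  have t0: "0 \<le> t i" for i
    using affine_simplex_nonneg[OF t'] .
  note f = Max_sum_facts[where u=t, OF m t0]
  have "\<exists>j<m. simplex_to_cube m t j = 0 \<or> simplex_to_cube m t j = 1"
  proof (cases "i = m")
    case True
    then have S: "sum t {..<m} = 1"
      using t' i by (simp add: affine_simplex_def lessThan_Suc_atMost[symmetric])
    then have "Max (t ` {..<m}) \<noteq> 0"
      using f(2) by simp
    moreover obtain j where "j < m" "t j = Max (t ` {..<m})"
      using f(6) by blast
    ultimately have "simplex_to_cube m t j = 1" "j < m"
      by (simp_all add: simplex_to_cube_def S)
    then show ?thesis
      by blast
  next
    case False
    then show ?thesis
      using i by (intro exI[of _ i]) (simp add: simplex_to_cube_def)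
  qed
  then show ?thesis
    using simplex_to_cube_in[OF m t'] by (auto simp: cube_boundary_def)
qed

lemma continuous_on_cube_to_simplex:
  assumes m: "m \<ge> 1"
  shows "continuous_on (cube m) (cube_to_simplex m)"
proof (rule continuous_on_coordinatewise_then_product)
  fix i
  have coord: "continuous_on (cube m) (\<lambda>u. u j)" for j
    by (rule continuous_on_subset[OF continuous_on_product_coordinates]) simp
  have u0: "0 \<le> u j" if "u \<in> cube m" for u j
    using that by (auto simp: cube_def)
  have M: "continuous_on (cube m) (\<lambda>u. Max (u ` {..<m}))"
    using m coord by (intro continuous_on_Max_image) (auto simp: lessThan_empty_iff)
  have S: "continuous_on (cube m) (\<lambda>u. sum u {..<m})"
    using coord by (intro continuous_on_sum) auto
  have "continuous_on (cube m) (\<lambda>u. u i * Max (u ` {..<m}) / sum u {..<m})" if "i < m"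
  proof (rule continuous_on_product_quotient[OF coord M S])
    fix u assume u: "u \<in> cube m"
    note f = Max_sum_facts[where u=u, OF m u0[OF u]]
    show "0 \<le> u i \<and> u i \<le> sum u {..<m} \<and> 0 \<le> Max (u ` {..<m})"
      using f(1) f(5)[OF that] u0[OF u] by simp
    show "sum u {..<m} = 0 \<Longrightarrow> Max (u ` {..<m}) = 0"
      using f(2) by simp
  qed
  moreover have "continuous_on (cube m) (\<lambda>u. 1 - Max (u ` {..<m}))"
    by (intro continuous_on_diff continuous_on_const M)
  ultimately show "continuous_on (cube m) (\<lambda>u. cube_to_simplex m u i)"
    unfolding cube_to_simplex_def by (cases "i < m"; cases "i = m") auto
qed

lemma continuous_on_simplex_to_cube:
  assumes m: "m \<ge> 1"
  shows "continuous_on (affine_simplex {..m}) (simplex_to_cube m)"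
proof (rule continuous_on_coordinatewise_then_product)
  fix i
  let ?A = "affine_simplex {..m}"
  have coord: "continuous_on ?A (\<lambda>u. u j)" for j
    by (rule continuous_on_subset[OF continuous_on_product_coordinates]) simp
  have M: "continuous_on ?A (\<lambda>u. Max (u ` {..<m}))"
    using m coord by (intro continuous_on_Max_image) (auto simp: lessThan_empty_iff)
  have S: "continuous_on ?A (\<lambda>u. sum u {..<m})"
    using coord by (intro continuous_on_sum) auto
  have "continuous_on ?A (\<lambda>u. u i * sum u {..<m} / Max (u ` {..<m}))" if "i < m"
  proof (rule continuous_on_product_quotient[OF coord S M])
    fix u assume u: "u \<in> ?A"
    note f = Max_sum_facts[where u=u, OF m affine_simplex_nonneg[OF u]]
    show "0 \<le> u i \<and> u i \<le> Max (u ` {..<m}) \<and> 0 \<le> sum u {..<m}"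
      using f(3) f(4)[OF that] affine_simplex_nonneg[OF u] by simp
    show "Max (u ` {..<m}) = 0 \<Longrightarrow> sum u {..<m} = 0"
      using f(2) by simp
  qed
  then show "continuous_on ?A (\<lambda>u. simplex_to_cube m u i)"
    unfolding simplex_to_cube_def by (cases "i < m") auto
qed

text \<open>The cube and the simplex of the same dimension are homeomorphic by a map that respects the
  boundaries.\<close>

lemma unique_simplex_filling_if_cube:
  assumes cube: "unique_cube_filling X m" and m: "m \<ge> 1" and B: "finite B" "card B = Suc m"
  shows "unique_simplex_filling X B"
  unfolding unique_simplex_filling_def
proof (intro allI impI)
  let ?A = "top_of_set (affine_simplex B)" and ?C = "top_of_set (cube m)"
  fix f g
  assume f: "continuous_map ?A X f" and g: "continuous_map ?A X g"
    and fg: "\<forall>t\<in>simplex_frontier B. f t = g t"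
  obtain h where "bij_betw h {..m} B"
    using finite_same_card_bij[of "{..m}" B] B by auto
  then have inj: "inj_on h {..m}" and im: "h ` {..m} = B"
    by (auto simp: bij_betw_def)
  define k where "k = (\<lambda>u. push h {..m} (cube_to_simplex m u))"
  define l where "l = (\<lambda>t. simplex_to_cube m (pull h {..m} t))"
  have c1: "continuous_map ?C (top_of_set (affine_simplex {..m})) (cube_to_simplex m)"
    using cube_to_simplex_in[OF m] continuous_on_cube_to_simplex[OF m] by auto
  have k: "continuous_map ?C ?A k"
    using continuous_map_compose[OF c1 continuous_map_push[OF inj]] im by (simp add: k_def o_def)
  have c2: "continuous_map (top_of_set (affine_simplex {..m})) ?C (simplex_to_cube m)"
    using simplex_to_cube_in[OF m] continuous_on_simplex_to_cube[OF m] by auto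
  have l: "continuous_map ?A ?C l"
    using continuous_map_compose[OF continuous_map_pull[OF inj] c2] im by (simp add: l_def o_def)
  have kl: "k (l t) = t" if "t \<in> affine_simplex B" for t
  proof -
    have "pull h {..m} t \<in> affine_simplex {..m}"
      using pull_in_affine_simplex[OF inj order_refl] that im by simp
    then show ?thesis
      using that im push_pull[OF inj, of t] by (simp add: k_def l_def cube_to_simplex_to_cube[OF m])
  qed
  have "f (k u) = g (k u)" if "u \<in> cube_boundary m" for u
    using fg push_in_frontier[OF inj cube_to_simplex_frontier[OF m that]] im by (simp add: k_def)
  then have "homotopic_rel (cube_boundary m) ?C X (f \<circ> k) (g \<circ> k)"
    using cube continuous_map_compose[OF k f] continuous_map_compose[OF k g]
    unfolding unique_cube_filling_def by simp
  then show "homotopic_rel (simplex_frontier B) ?A X f g"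
  proof (rule homotopic_rel_compose_right[OF _ l])
    show "l ` simplex_frontier B \<subseteq> cube_boundary m"
      using simplex_to_cube_boundary[OF m] pull_in_frontier[OF inj] im by (auto simp: l_def)
  qed (use kl simplex_frontier_subset[of B] in auto)
qed

section \<open>Extending maps from the frontier of a simplex\<close>

text \<open>Both maps move a point along the line whose direction adds \<open>card F\<close> to the
  coordinate \<open>b\<close> and subtracts 1 from every coordinate in \<open>F\<close>. Going
  forward until a coordinate in \<open>F\<close> vanishes retracts the simplex onto the horn of
  all facets other than \<open>F\<close>; going backward until the coordinate \<open>b\<close>
  vanishes (\<open>facet_projection\<close>) projects it to the facet \<open>F\<close>.\<close>

definition horn_retraction :: "'v \<Rightarrow> 'v set \<Rightarrow> ('v \<Rightarrow> real) \<Rightarrow> 'v \<Rightarrow> real" where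
  "horn_retraction b F t = (\<lambda>v. if v = b then t b + real (card F) * Min (t ` F)
     else if v \<in> F then t v - Min (t ` F) else 0)"

definition facet_projection :: "'v \<Rightarrow> 'v set \<Rightarrow> ('v \<Rightarrow> real) \<Rightarrow> 'v \<Rightarrow> real" where
  "facet_projection b F t = (\<lambda>v. if v \<in> F then t v + t b / real (card F) else 0)"

lemma simplex_sum_insert:
  assumes "t \<in> affine_simplex (insert b F)" "finite F" "b \<notin> F"
  shows "t b + sum t F = 1"
  using assms by (simp add: affine_simplex_def)

lemma Min_simplex_facts:
  assumes "finite F" "F \<noteq> {}" "t \<in> affine_simplex B"
  shows "0 \<le> Min (t ` F)" "\<And>v. v \<in> F \<Longrightarrow> Min (t ` F) \<le> t v" "\<exists>v\<in>F. t v = Min (t ` F)"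
proof -
  show "Min (t ` F) \<le> t v" if "v \<in> F" for v
    using that assms(1) by (intro Min_le) auto
  have "Min (t ` F) \<in> t ` F"
    using assms by (intro Min_in) auto
  then show ex: "\<exists>v\<in>F. t v = Min (t ` F)"
    by auto
  then show "0 \<le> Min (t ` F)"
    using affine_simplex_nonneg[OF assms(3)] by metis
qed

lemma horn_retraction_in:
  assumes F: "finite F" "F \<noteq> {}" "b \<notin> F" and t: "t \<in> affine_simplex (insert b F)"
  shows "horn_retraction b F t \<in> affine_simplex (insert b F)"
    and "\<exists>v\<in>F. horn_retraction b F t v = 0"
proof -
  note m = Min_simplex_facts[OF F(1,2) t]
  have "sum (horn_retraction b F t) F = (\<Sum>v\<in>F. t v - Min (t ` F))"
    by (rule sum.cong) (use F(3) in \<open>auto simp: horn_retraction_def\<close>)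
  then have "horn_retraction b F t b + sum (horn_retraction b F t) F = 1"
    using simplex_sum_insert[OF t F(1,3)] by (simp add: horn_retraction_def sum_subtractf)
  moreover have "0 \<le> horn_retraction b F t v" for v
    using m(1) m(2)[of v] affine_simplex_nonneg[OF t, of b] by (simp add: horn_retraction_def)
  ultimately show "horn_retraction b F t \<in> affine_simplex (insert b F)"
    using F by (simp add: affine_simplex_def) (simp add: horn_retraction_def)
  show "\<exists>v\<in>F. horn_retraction b F t v = 0"
    using m(3) F(3) by (auto simp: horn_retraction_def)
qed

lemma facet_projection_in:
  assumes F: "finite F" "F \<noteq> {}" "b \<notin> F" and t: "t \<in> affine_simplex (insert b F)"
  shows "facet_projection b F t \<in> affine_simplex F"
proof -
  have c: "real (card F) > 0"
    using F by (simp add: card_gt_0_iff)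
  have "sum (facet_projection b F t) F = (\<Sum>v\<in>F. t v + t b / real (card F))"
    by (rule sum.cong) (auto simp: facet_projection_def)
  also have "\<dots> = 1"
    using simplex_sum_insert[OF t F(1,3)] c by (simp add: sum.distrib)
  finally show ?thesis
    using affine_simplex_nonneg[OF t] by (simp add: affine_simplex_def) (simp add: facet_projection_def)
qed

lemma continuous_on_horn_retraction:
  assumes F: "finite F" "F \<noteq> {}"
  shows "continuous_on S (horn_retraction b F)"
proof (rule continuous_on_coordinatewise_then_product)
  fix v
  have coord: "continuous_on S (\<lambda>t. t w)" for w
    by (rule continuous_on_subset[OF continuous_on_product_coordinates]) simp
  have M: "continuous_on S (\<lambda>t. Min (t ` F))"
    using F coord by (intro continuous_on_Min_image) auto
  show "continuous_on S (\<lambda>t. horn_retraction b F t v)"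
    unfolding horn_retraction_def
    by (cases "v = b"; cases "v \<in> F")
      (simp_all add: continuous_on_add continuous_on_diff continuous_on_mult continuous_on_const coord M)
qed

text \<open>On the line through \<open>y\<close> the coordinate \<open>b\<close> determines the parameter,
  unless the line meets the simplex in \<open>y\<close> only.\<close>

lemma facet_seg_facts:
  assumes F: "finite F" "F \<noteq> {}" "b \<notin> F" and y: "y \<in> affine_simplex F"
  shows "facet_projection b F (seg s (horn_retraction b F y) y) = y"
    and "seg s (horn_retraction b F y) y b = (1 - s) * (real (card F) * Min (y ` F))"
proof -
  have c: "real (card F) > 0"
    using F by (simp add: card_gt_0_iff)
  have yb: "y b = 0"
    using affine_simplex_outside[OF y F(3)] .
  show b: "seg s (horn_retraction b F y) y b = (1 - s) * (real (card F) * Min (y ` F))"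
    by (simp add: seg_def horn_retraction_def yb)
  show "facet_projection b F (seg s (horn_retraction b F y) y) = y"
  proof
    fix v
    show "facet_projection b F (seg s (horn_retraction b F y) y) v = y v"
    proof (cases "v \<in> F")
      case True
      then have "seg s (horn_retraction b F y) y v = y v - (1 - s) * Min (y ` F)"
        using F(3) by (auto simp: seg_def horn_retraction_def algebra_simps)
      then show ?thesis
        using True c by (simp add: facet_projection_def b)
    next
      case False
      then show ?thesis
        using affine_simplex_outside[OF y False] by (simp add: facet_projection_def)
    qed
  qed
qed

lemma facet_seg_surj:
  assumes F: "finite F" "F \<noteq> {}" "b \<notin> F" and t: "t \<in> affine_simplex (insert b F)"
  obtains s where "0 \<le> s" "s \<le> 1" "t = seg s (horn_retraction b F (facet_projection b F t)) (facet_projection b F t)"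
proof -
  define n m where "n = real (card F)" and "m = Min (t ` F)"
  define y where "y = facet_projection b F t"
  note mf = Min_simplex_facts[OF F(1,2) t, folded m_def]
  have n: "n > 0"
    using F by (simp add: card_gt_0_iff n_def)
  have tb: "0 \<le> t b"
    using affine_simplex_nonneg[OF t] .
  have yF: "y v = t v + t b / n" if "v \<in> F" for v
    using that by (simp add: y_def facet_projection_def n_def)
  have yb: "y b = 0"
    using F(3) by (simp add: y_def facet_projection_def)
  have "Min (y ` F) = m + t b / n"
  proof (rule Min_eqI)
    show "m + t b / n \<le> z" if "z \<in> y ` F" for z
      using that yF mf(2) by fastforce
    show "m + t b / n \<in> y ` F"
      using mf(3) yF by force
  qed (use F in simp)
  then have r: "horn_retraction b F y v = (if v = b then n * m + t b else if v \<in> F then t v - m else 0)" for v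
    using n F(3) yF yb by (auto simp: horn_retraction_def n_def[symmetric] distrib_left)
  define s where "s = (if n * m + t b = 0 then 0 else n * m / (n * m + t b))"
  have nm: "0 \<le> n * m"
    using n mf(1) by simp
  have s: "0 \<le> s" "s \<le> 1"
    using nm tb by (auto simp: s_def divide_le_eq_1)
  have key: "s * (n * m + t b) = n * m"
  proof (cases "n * m + t b = 0")
    case True
    then have "n * m = 0"
      using nm tb by linarith
    then show ?thesis
      using True by simp
  qed (simp add: s_def)
  have "t = seg s (horn_retraction b F y) y"
  proof
    fix v
    consider "v = b" | "v \<in> F" | "v \<notin> insert b F"
      by blast
    then show "t v = seg s (horn_retraction b F y) y v"
    proof cases
      case 1
      then have "seg s (horn_retraction b F y) y v = (n * m + t b) - s * (n * m + t b)"
        by (simp add: seg_def r yb algebra_simps)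
      then show ?thesis
        using 1 key by simp
    next
      case 2
      then have "v \<noteq> b"
        using F(3) by blast
      then have "seg s (horn_retraction b F y) y v = t v - m + s * (n * m + t b) / n"
        using 2 n by (simp add: seg_def r yF field_simps)
      then show ?thesis
        using key n by simp
    next
      case 3
      then have "y v = 0" "t v = 0" "v \<noteq> b" "v \<notin> F"
        using affine_simplex_outside[OF t] by (auto simp: y_def facet_projection_def)
      then show ?thesis
        by (simp add: seg_def r)
    qed
  qed
  with s show ?thesis
    by (rule that[unfolded y_def[symmetric]])
qed

text \<open>The horn of the facets other than \<open>F\<close> is a retract of the simplex, so
  \<open>\<phi>\<close> on the horn extends. On the facet \<open>F\<close> this extension and
  \<open>\<phi>\<close> are two maps with the same frontier values, hence homotopic relative to
  the frontier. As the simplex is swept out by the segments from the horn to \<open>F\<close>,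
  running the homotopy along these segments corrects the extension on \<open>F\<close>.\<close>

lemma frontier_extension:
  assumes filling: "unique_simplex_filling X F" and F: "finite F" "F \<noteq> {}" "b \<notin> F"
    and \<phi>: "continuous_map (top_of_set (simplex_frontier (insert b F))) X \<phi>"
  obtains G where "continuous_map (top_of_set (affine_simplex (insert b F))) X G"
    and "\<And>t. t \<in> simplex_frontier (insert b F) \<Longrightarrow> G t = \<phi> t"
proof -
  let ?B = "insert b F" and ?r = "horn_retraction b F"
  let ?A = "top_of_set (affine_simplex F)"
  have FB: "affine_simplex F \<subseteq> affine_simplex ?B"
    using affine_simplex_mono[of F ?B] F by blast
  have FfB: "affine_simplex F \<subseteq> simplex_frontier ?B"
    using FB affine_simplex_outside F(3) by (fastforce simp: simplex_frontier_def)
  have rB: "?r y \<in> simplex_frontier ?B" if "y \<in> affine_simplex ?B" for y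
    using horn_retraction_in[OF F that] by (auto simp: simplex_frontier_def)
  have r_id: "?r y = y" if "y \<in> affine_simplex ?B" "Min (y ` F) = 0" for y
    using that affine_simplex_outside[OF that(1)] by (auto simp: horn_retraction_def fun_eq_iff)
  have "continuous_map ?A (top_of_set (simplex_frontier ?B)) ?r"
    using rB FB by (auto simp: continuous_on_horn_retraction[OF F(1,2)])
  from continuous_map_compose[OF this \<phi>] have c1: "continuous_map ?A X (\<lambda>y. \<phi> (?r y))"
    by (simp add: o_def)
  have c2: "continuous_map ?A X \<phi>"
    using continuous_map_from_subtopology_mono[OF \<phi> FfB] .
  have "\<phi> (?r y) = \<phi> y" if "y \<in> simplex_frontier F" for y
    using r_id[of y] Min_frontier[OF F(1) that] FB that by (auto simp: simplex_frontier_def)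
  then have "homotopic_rel (simplex_frontier F) ?A X (\<lambda>y. \<phi> (?r y)) \<phi>"
    using filling c1 c2 unfolding unique_simplex_filling_def by simp
  then obtain k where k: "continuous_map (prod_topology \<I> ?A) X k"
    and k0: "\<And>y. k (0, y) = \<phi> (?r y)" and k1: "\<And>y. k (1, y) = \<phi> y"
    and kf: "\<And>s y. 0 \<le> s \<Longrightarrow> s \<le> 1 \<Longrightarrow> y \<in> simplex_frontier F \<Longrightarrow> k (s, y) = \<phi> (?r y)"
    by (rule homotopic_relE) (rule that)
  let ?S = "{0..1::real} \<times> affine_simplex F"
  let ?q = "\<lambda>z. seg (fst z) (?r (snd z)) (snd z)"
  have qin: "?q z \<in> affine_simplex ?B" if "z \<in> ?S" for z
    using that FB horn_retraction_in(1)[OF F] by (intro seg_in_affine_simplex) auto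
  have quot: "quotient_map (top_of_set ?S) (top_of_set (affine_simplex ?B)) ?q"
  proof (rule compact_Hausdorff_quotient_map)
    show "compact_space (top_of_set ?S)"
      using F by (simp add: compact_space_subtopology compact_Times compact_affine_simplex)
    show "Hausdorff_space (top_of_set (affine_simplex ?B))"
      by (rule Hausdorff_function_space)
    have "continuous_on ?S (\<lambda>z. ?r (snd z))"
      by (rule continuous_on_compose2[OF continuous_on_horn_retraction[OF F(1,2), of UNIV]])
        (auto intro: continuous_intros)
    then have "continuous_on ?S ?q"
      by (intro continuous_on_seg continuous_on_fst continuous_on_snd continuous_on_id)
    then show "continuous_map (top_of_set ?S) (top_of_set (affine_simplex ?B)) ?q"
      using qin by auto
    show "?q ` topspace (top_of_set ?S) = topspace (top_of_set (affine_simplex ?B))"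
    proof
      show "?q ` topspace (top_of_set ?S) \<subseteq> topspace (top_of_set (affine_simplex ?B))"
        using qin by auto
      show "topspace (top_of_set (affine_simplex ?B)) \<subseteq> ?q ` topspace (top_of_set ?S)"
      proof
        fix t assume "t \<in> topspace (top_of_set (affine_simplex ?B))"
        then have t: "t \<in> affine_simplex ?B"
          by simp
        obtain s where "0 \<le> s" "s \<le> 1" "t = seg s (?r (facet_projection b F t)) (facet_projection b F t)"
          by (rule facet_seg_surj[OF F t])
        then show "t \<in> ?q ` topspace (top_of_set ?S)"
          using facet_projection_in[OF F t] by (intro image_eqI[of _ _ "(s, facet_projection b F t)"]) auto
      qed
    qed
  qed
  have k': "continuous_map (top_of_set ?S) X k"
    using k by simp
  obtain G where G: "continuous_map (top_of_set (affine_simplex ?B)) X G"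
    "\<And>z. z \<in> topspace (top_of_set ?S) \<Longrightarrow> G (?q z) = k z"
  proof (rule quotient_map_lift_exists[OF quot k'])
    fix z z' assume z: "z \<in> topspace (top_of_set ?S)" and z': "z' \<in> topspace (top_of_set ?S)"
      and eq: "?q z = ?q z'"
    obtain s y s' y' where [simp]: "z = (s, y)" "z' = (s', y')"
      by fastforce
    have y: "y \<in> affine_simplex F" and y': "y' \<in> affine_simplex F"
      and s: "0 \<le> s" "s \<le> 1" "0 \<le> s'" "s' \<le> 1"
      using z z' by auto
    have eq': "seg s (?r y) y = seg s' (?r y') y'"
      using eq by simp
    have yy: "y = y'"
      using facet_seg_facts(1)[OF F y, of s] facet_seg_facts(1)[OF F y', of s'] eq' by simp
    show "k z = k z'"
    proof (cases "Min (y ` F) = 0")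
      case True
      then obtain v where "v \<in> F" "y v = 0"
        using Min_simplex_facts(3)[OF F(1,2) y] by auto
      then have "y \<in> simplex_frontier F"
        using y by (auto simp: simplex_frontier_def)
      then show ?thesis
        using kf s yy by simp
    next
      case False
      have "(1 - s) * (real (card F) * Min (y ` F)) = (1 - s') * (real (card F) * Min (y ` F))"
        unfolding facet_seg_facts(2)[OF F y, symmetric] using fun_cong[OF eq', of b] by (simp only: yy[symmetric])
      then have "s = s'"
        using False F by (simp add: card_gt_0_iff)
      then show ?thesis
        using yy by simp
    qed
  qed (use that in blast)
  have "G t = \<phi> t" if t: "t \<in> simplex_frontier ?B" for t
  proof (cases "t b = 0")
    case True
    then have tF: "t \<in> affine_simplex F"
      using affine_simplex_restrict_iff[of F ?B t] t F by (auto simp: simplex_frontier_def)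
    then show ?thesis
      using G(2)[of "(1, t)"] k1 by simp
  next
    case False
    then obtain v where v: "v \<in> F" "t v = 0" and tB: "t \<in> affine_simplex ?B"
      using t by (auto simp: simplex_frontier_def)
    let ?y = "facet_projection b F t"
    have y: "?y \<in> affine_simplex F"
      by (rule facet_projection_in[OF F tB])
    obtain s where s: "0 \<le> s" "s \<le> 1" "t = seg s (?r ?y) ?y"
      by (rule facet_seg_surj[OF F tB])
    have "Min (t ` F) = 0"
      using v F affine_simplex_nonneg[OF tB] by (intro Min_eqI) (auto simp: image_iff intro: bexI[of _ v])
    have "?y v = t b / real (card F)"
      using v by (simp add: facet_projection_def)
    have "Min (?y ` F) = t b / real (card F)"
      using v F affine_simplex_nonneg[OF tB]
      by (intro Min_eqI) (auto simp: image_iff facet_projection_def intro: bexI[of _ v])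
    then have "t b = (1 - s) * t b"
      using facet_seg_facts(2)[OF F y, of s] s(3) F by (simp add: card_gt_0_iff)
    then have "s = 0"
      using False by simp
    then have "t = ?r ?y"
      using s(3) by simp
    then show ?thesis
      using G(2)[of "(0, ?y)"] y k0[of ?y] by simp
  qed
  with G(1) show ?thesis
    by (rule that)
qed

section \<open>Compact sets meet finitely many open stars\<close>

lemma closedin_realization:
  "closedin (realization K) T \<longleftrightarrow> T \<subseteq> topspace (realization K) \<and>
    closedin (disjoint_cells K) {x \<in> topspace (disjoint_cells K). rpoint K x \<in> T}"
  using quotient_map_rpoint[of K] closedin_subset[of "realization K" T] unfolding quotient_map_closedin by auto

text \<open>A set is closed if its trace on every cell is, and finite subsets of cells are closed.\<close>

lemma closedin_realization_if_finite_in_cells: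
  assumes "T \<subseteq> topspace (realization K)"
    and fin: "\<And>B \<sigma>. \<sigma> \<in> simplices K B \<Longrightarrow> finite {t \<in> affine_simplex B. pt K B \<sigma> t \<in> T}"
  shows "closedin (realization K) T"
proof -
  let ?W = "{x \<in> topspace (disjoint_cells K). rpoint K x \<in> T}"
  have "closedin (sum_topology (\<lambda>(B, \<sigma>). subtopology (powertop_real UNIV) (affine_simplex B)) (cells K)) ?W"
    unfolding closedin_sum_topology
  proof (intro conjI ballI)
    fix i assume i: "i \<in> cells K"
    obtain B \<sigma> where [simp]: "i = (B, \<sigma>)"
      by fastforce
    have \<sigma>: "\<sigma> \<in> simplices K B"
      using i by (simp add: cells_def)
    have "{t. (i, t) \<in> ?W} = {t \<in> affine_simplex B. pt K B \<sigma> t \<in> T}"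
      by (simp add: topspace_disjoint_cells \<sigma>)
    moreover have "closedin (top_of_set (affine_simplex B)) {t \<in> affine_simplex B. pt K B \<sigma> t \<in> T}"
      using fin[OF \<sigma>] by (intro closedin_Hausdorff_finite Hausdorff_function_space) auto
    ultimately show "closedin (case i of (B, \<sigma>) \<Rightarrow> subtopology (powertop_real UNIV) (affine_simplex B)) {t. (i, t) \<in> ?W}"
      by (simp add: euclidean_product_topology)
  qed (auto simp: disjoint_cells_def)
  then show ?thesis
    unfolding closedin_realization using assms(1) by (simp add: disjoint_cells_def)
qed

text \<open>Otherwise choose for every vertex that occurs a point whose carrier contains it. Every cell has
  finitely many vertices, so it contains finitely many of the chosen points; hence every set of
  chosen points is closed, and an infinite one cannot lie in a compact set.\<close>

lemma finite_support_of_compact: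
  assumes A: "multicomplex A" and C: "compactin (realization A) C"
  shows "finite (\<Union>p\<in>C. supp (coord p))"
proof (rule ccontr)
  let ?X = "realization A"
  define W where "W = (\<Union>p\<in>C. supp (coord p))"
  assume "infinite (\<Union>p\<in>C. supp (coord p))"
  then have inf: "infinite W"
    by (simp add: W_def)
  have "\<forall>v\<in>W. \<exists>p\<in>C. v \<in> supp (coord p)"
    by (simp add: W_def)
  then obtain q where q: "\<And>v. v \<in> W \<Longrightarrow> q v \<in> C" "\<And>v. v \<in> W \<Longrightarrow> v \<in> supp (coord (q v))"
    by metis
  have CX: "C \<subseteq> topspace ?X"
    using C by (simp add: compactin_def)
  define S where "S = q ` W"
  have SC: "S \<subseteq> C"
    using q(1) by (auto simp: S_def)
  have "infinite S"
  proof
    assume "finite S"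
    moreover have "finite (supp (coord p))" if "p \<in> S" for p
      using finite_supp[OF carrier_of_point(2)[OF A]] that SC CX by blast
    ultimately have "finite (\<Union>p\<in>S. supp (coord p))"
      by blast
    moreover have "W \<subseteq> (\<Union>p\<in>S. supp (coord p))"
      using q(2) by (auto simp: S_def)
    ultimately show False
      using inf finite_subset by blast
  qed
  then have "C \<inter> ?X derived_set_of S \<noteq> {}"
    using compactin_imp_Bolzano_Weierstrass[OF C] SC by blast
  then obtain x where x: "x \<in> ?X derived_set_of S"
    by blast
  have "closedin ?X (S - {x})"
  proof (rule closedin_realization_if_finite_in_cells)
    show "S - {x} \<subseteq> topspace ?X"
      using SC CX by blast
    fix B \<sigma> assume \<sigma>: "\<sigma> \<in> simplices A B"
    have "{t \<in> affine_simplex B. pt A B \<sigma> t \<in> S - {x}} \<subseteq> coord ` q ` B"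
    proof
      fix t assume t: "t \<in> {t \<in> affine_simplex B. pt A B \<sigma> t \<in> S - {x}}"
      then obtain v where v: "v \<in> W" "pt A B \<sigma> t = q v"
        by (auto simp: S_def)
      then have t': "coord (q v) = t"
        using coord_pt[OF A, of B \<sigma> t] by simp
      then have "v \<in> B"
        using q(2)[OF v(1)] supp_subset[of t B] t by auto
      then show "t \<in> coord ` q ` B"
        using t' by blast
    qed
    then show "finite {t \<in> affine_simplex B. pt A B \<sigma> t \<in> S - {x}}"
      by (rule finite_subset) (use simplex_finite[OF A \<sigma>] in simp)
  qed
  then have "openin ?X (topspace ?X - (S - {x}))"
    by (simp add: closedin_def)
  moreover have "x \<in> topspace ?X - (S - {x})"
    using x by (simp add: in_derived_set_of)
  moreover note mp[OF spec[OF conjunct2[OF x[unfolded in_derived_set_of]]]]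
  ultimately have "\<exists>y\<noteq>x. y \<in> S \<and> y \<in> topspace ?X - (S - {x})"
    by (metis (no_types))
  then show False
    by blast
qed

section \<open>Sliding towards a vertex\<close>

text \<open>The move from \<open>p\<close> to \<open>v\<close> along a segment inside the carrier of
  \<open>p\<close>; meaningful on the open star of \<open>v\<close>.\<close>

definition slide :: "('v, 's) premulticomplex \<Rightarrow> 'v \<Rightarrow> ('v, 's) cell_point set \<Rightarrow> real \<Rightarrow> ('v, 's) cell_point set" where
  "slide A v p r = pt A (supp (coord p)) (carrier_simplex A p) (seg r (coord p) (indicator {v}))"

definition star :: "('v, 's) premulticomplex \<Rightarrow> 'v \<Rightarrow> ('v, 's) cell_point set set" where
  "star A v = {p \<in> topspace (realization A). 0 < coord p v}"

lemma slide_pt: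
  assumes A: "multicomplex A" and \<sigma>: "\<sigma> \<in> simplices A B" and t: "t \<in> affine_simplex B" "0 < t v"
    and r: "0 \<le> r" "r \<le> 1"
  shows "slide A v (pt A B \<sigma> t) r = pt A B \<sigma> (seg r t (indicator {v}))"
proof -
  have "v \<in> supp t"
    using t(2) by (simp add: supp_def)
  then have "seg r t (indicator {v}) \<in> affine_simplex (supp t)"
    using r affine_simplex_self_supp[OF t(1)] finite_supp[OF t(1)]
    by (intro seg_in_affine_simplex indicator_in_affine_simplex)
  then show ?thesis
    using pt_face[OF \<sigma> supp_subset[OF t(1)]] by (simp add: slide_def carrier_simplex_pt A)
qed

text \<open>The segment can be taken in any cell that contains \<open>p\<close> and \<open>v\<close>, so on
  each cell the map is given by one formula.\<close>

lemma continuous_map_slide: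
  assumes A: "multicomplex A"
  shows "continuous_map (prod_topology \<I> (subtopology (realization A) (star A v))) (realization A)
    (\<lambda>(r, p). slide A v p r)"
proof -
  let ?X = "realization A"
  have "continuous_map (prod_topology \<I> (subtopology ?X (star A v \<inter> topspace ?X))) ?X (\<lambda>(r, p). slide A v p r)"
  proof (rule continuous_map_prod_from_realization)
    show "locally_compact_space \<I>" "Hausdorff_space \<I>"
      by (simp_all add: Hausdorff_space_subtopology compact_imp_locally_compact_space compact_space_subtopology)
    show "openin ?X (star A v)"
      unfolding star_def by (rule openin_star(1)[OF A])
    fix B \<sigma> assume \<sigma>: "\<sigma> \<in> simplices A B"
    let ?T = "{t \<in> affine_simplex B. pt A B \<sigma> t \<in> star A v \<inter> topspace ?X}"
    have fB: "finite B"
      by (rule simplex_finite[OF A \<sigma>])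
    have T: "0 < t v" "v \<in> B" if "t \<in> ?T" for t
    proof -
      show "0 < t v"
        using that by (simp add: star_def A)
      then show "v \<in> B"
        using that affine_simplex_outside[of t B v] by force
    qed
    have "continuous_on ({0..1} \<times> ?T) (\<lambda>z. seg (fst z) (snd z) (indicator {v}))"
      by (intro continuous_on_seg continuous_on_fst continuous_on_snd continuous_on_id continuous_on_const)
    moreover have "seg (fst z) (snd z) (indicator {v}) \<in> affine_simplex B" if "z \<in> {0..1} \<times> ?T" for z
      using that T(2)[of "snd z"] fB by (intro seg_in_affine_simplex indicator_in_affine_simplex) auto
    ultimately have "continuous_map (top_of_set ({0..1} \<times> ?T)) (top_of_set (affine_simplex B))
        (\<lambda>z. seg (fst z) (snd z) (indicator {v}))"
      by auto
    from continuous_map_cell_compose[OF \<sigma> this]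
    have "continuous_map (top_of_set ({0..1} \<times> ?T)) ?X (\<lambda>z. pt A B \<sigma> (seg (fst z) (snd z) (indicator {v})))" .
    then have "continuous_map (top_of_set ({0..1} \<times> ?T)) ?X
        (\<lambda>(z, t). (case (z, pt A B \<sigma> t) of (r, p) \<Rightarrow> slide A v p r))"
      by (rule continuous_map_eq) (use T(1) slide_pt[OF A \<sigma>] in auto)
    then show "continuous_map (prod_topology \<I> (top_of_set ?T)) ?X
        (\<lambda>(z, t). (case (z, pt A B \<sigma> t) of (r, p) \<Rightarrow> slide A v p r))"
      by simp
  qed auto
  moreover have "star A v \<inter> topspace ?X = star A v"
    by (auto simp: star_def)
  ultimately show ?thesis
    by simp
qed

lemma vertex_point_of_simplex:
  assumes A: "multicomplex A" and \<sigma>: "\<sigma> \<in> simplices A B" and v: "v \<in> B"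
  shows "pt A B \<sigma> (indicator {v}) = vertex_point A v"
proof -
  have "bdry A B {v} \<sigma> = the_elem (simplices A {v})"
    using v by (intro vertex_simplex_unique[OF A] bdry_simplex[OF A \<sigma>]) auto
  then show ?thesis
    using pt_face[OF \<sigma>, of "{v}" "indicator {v}"] v indicator_in_affine_simplex[of v "{v}"]
    by (simp add: vertex_point_eq)
qed

lemma edge_path_ends:
  assumes A: "multicomplex A" and "\<epsilon> \<in> simplices A {v, w}"
  shows "edge_path A v w \<epsilon> 0 = vertex_point A v" "edge_path A v w \<epsilon> 1 = vertex_point A w"
  using vertex_point_of_simplex[OF assms] by (simp_all add: edge_path_def)

lemma continuous_map_edge_path:
  assumes "\<epsilon> \<in> simplices A {v, w}"
  shows "continuous_map \<I> (realization A) (edge_path A v w \<epsilon>)"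
proof -
  have "continuous_on {0..1} (\<lambda>s. seg s (indicator {v}) (indicator {w}))"
    by (intro continuous_on_seg continuous_on_id continuous_on_const)
  then have "continuous_map \<I> (top_of_set (affine_simplex {v, w})) (\<lambda>s. seg s (indicator {v}) (indicator {w}))"
    by (auto intro!: seg_in_affine_simplex indicator_in_affine_simplex)
  then show ?thesis
    unfolding edge_path_def[abs_def] by (rule continuous_map_cell_compose[OF assms])
qed

section \<open>Filling triangles\<close>

lemma filled_triangle_face:
  assumes A: "multicomplex A" and \<sigma>: "\<sigma> \<in> simplices A B" and T: "T \<subseteq> B"
    and \<epsilon>: "\<And>v w. v \<in> T \<Longrightarrow> w \<in> T \<Longrightarrow> v \<noteq> w \<Longrightarrow> \<epsilon> {v, w} = bdry A B {v, w} \<sigma>"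
  shows "filled_triangle A T \<epsilon>"
  unfolding filled_triangle_def
proof (intro exI conjI ballI impI)
  have "affine_simplex T \<subseteq> affine_simplex B"
    by (rule affine_simplex_mono[OF T simplex_finite[OF A \<sigma>]])
  then show "continuous_map (top_of_set (affine_simplex T)) (realization A) (pt A B \<sigma>)"
    using continuous_map_cell[OF \<sigma>] continuous_map_from_subtopology_mono by blast
  fix v w t assume vw: "v \<in> T" "w \<in> T" "v \<noteq> w" and t: "t \<in> affine_simplex {v, w}"
  then show "pt A B \<sigma> t = pt A {v, w} (\<epsilon> {v, w}) t"
    using pt_face[OF \<sigma>, of "{v, w}" t] T \<epsilon>[OF vw] by auto
qed

text \<open>The homotopies along the two edges, together with the constant one along the third, fill a
  collar around the triangle on which \<open>G0\<close> is given.\<close>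

lemma filled_triangle_if_homotopic:
  assumes A: "multicomplex A" and distinct: "a \<noteq> v" "a \<noteq> w" "v \<noteq> w"
    and e: "\<epsilon> {a, v} \<in> simplices A {a, v}" "\<epsilon> {a, w} \<in> simplices A {a, w}" "\<epsilon> {v, w} \<in> simplices A {v, w}"
    and G0: "continuous_map (top_of_set (affine_simplex {a, v, w})) (realization A) G0"
    and hv: "homotopic_rel {0, 1} \<I> (realization A) (edge_path A a v (\<epsilon> {a, v}))
      (\<lambda>s. G0 (seg s (indicator {a}) (indicator {v})))"
    and hw: "homotopic_rel {0, 1} \<I> (realization A) (edge_path A a w (\<epsilon> {a, w}))
      (\<lambda>s. G0 (seg s (indicator {a}) (indicator {w})))"
    and vw: "\<And>t. t \<in> affine_simplex {v, w} \<Longrightarrow> G0 t = pt A {v, w} (\<epsilon> {v, w}) t"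
  shows "filled_triangle A {a, v, w} \<epsilon>"
proof -
  let ?X = "realization A" and ?T = "{a, v, w}"
  let ?P = "prod_topology \<I> (top_of_set (simplex_frontier ?T))"
  have cT: "finite ?T" "card ?T \<ge> 2"
    using distinct by auto
  obtain kv where kv: "continuous_map (prod_topology \<I> \<I>) ?X kv"
    "\<And>s. kv (0, s) = edge_path A a v (\<epsilon> {a, v}) s"
    "\<And>s. kv (1, s) = G0 (seg s (indicator {a}) (indicator {v}))"
    "\<And>\<mu> s. 0 \<le> \<mu> \<Longrightarrow> \<mu> \<le> 1 \<Longrightarrow> s \<in> {0, 1} \<Longrightarrow> kv (\<mu>, s) = edge_path A a v (\<epsilon> {a, v}) s"
    by (rule homotopic_relE[OF hv]) (rule that)
  obtain kw where kw: "continuous_map (prod_topology \<I> \<I>) ?X kw"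
    "\<And>s. kw (0, s) = edge_path A a w (\<epsilon> {a, w}) s"
    "\<And>s. kw (1, s) = G0 (seg s (indicator {a}) (indicator {w}))"
    "\<And>\<mu> s. 0 \<le> \<mu> \<Longrightarrow> \<mu> \<le> 1 \<Longrightarrow> s \<in> {0, 1} \<Longrightarrow> kw (\<mu>, s) = edge_path A a w (\<epsilon> {a, w}) s"
    by (rule homotopic_relE[OF hw]) (rule that)
  have edge: "t \<in> affine_simplex (?T - {x})" if "t \<in> simplex_frontier ?T" "x \<in> ?T" "t x = 0" for t x
    using affine_simplex_restrict_iff[of "?T - {x}" ?T t] that cT(1) by (auto simp: simplex_frontier_def)
  have av: "t = seg (t v) (indicator {a}) (indicator {v})" if "t \<in> simplex_frontier ?T" "t w = 0" for t
    using affine_simplex_edge[of t a v] edge[OF that(1) _ that(2)] distinct by (simp add: insert_Diff_if)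
  have aw: "t = seg (t w) (indicator {a}) (indicator {w})" if "t \<in> simplex_frontier ?T" "t v = 0" for t
    using affine_simplex_edge[of t a w] edge[OF that(1) _ that(2)] distinct by (simp add: insert_Diff_if)
  have vw': "t \<in> affine_simplex {v, w}" if "t \<in> simplex_frontier ?T" "t a = 0" for t
    using edge[OF that(1) _ that(2)] distinct by (simp add: insert_Diff_if)
  have t01: "0 \<le> t x" "t x \<le> 1" if "t \<in> simplex_frontier ?T" for t x
    using that affine_simplex_nonneg[of t ?T] affine_simplex_le_1[of t ?T] by (auto simp: simplex_frontier_def)
  define K where "K = (\<lambda>z. if snd z w = 0 then kv (fst z, snd z v) else if snd z v = 0 then kw (fst z, snd z w)
    else pt A {v, w} (\<epsilon> {v, w}) (snd z))"
  define f where "f = (\<lambda>x z. if x = w then kv (fst z, snd z v) else if x = v then kw (fst z, snd z w)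
    else pt A {v, w} (\<epsilon> {v, w}) (snd z))"
  let ?Z = "\<lambda>x. {z \<in> {0..1::real} \<times> simplex_frontier ?T. snd z x = 0}"
  have ends: "edge_path A a v (\<epsilon> {a, v}) 0 = vertex_point A a" "edge_path A a v (\<epsilon> {a, v}) 1 = vertex_point A v"
    "edge_path A a w (\<epsilon> {a, w}) 0 = vertex_point A a" "edge_path A a w (\<epsilon> {a, w}) 1 = vertex_point A w"
    using edge_path_ends[OF A e(1)] edge_path_ends[OF A e(2)] by auto
  have agree: "f x z = f y z" if z: "z \<in> {0..1::real} \<times> simplex_frontier ?T" and xy: "x \<in> ?T" "y \<in> ?T"
    "snd z x = 0" "snd z y = 0" for x y z
  proof -
    obtain \<mu> t where [simp]: "z = (\<mu>, t)"
      by fastforce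
    have \<mu>: "0 \<le> \<mu>" "\<mu> \<le> 1" and t: "t \<in> simplex_frontier ?T"
      using z by auto
    have sum: "t a + t v + t w = 1"
      using t distinct by (auto simp: simplex_frontier_def affine_simplex_def)
    have 1: "f w z = f v z" if "t w = 0" "t v = 0"
      using that distinct kv(4)[OF \<mu>, of 0] kw(4)[OF \<mu>, of 0] ends by (simp add: f_def)
    have 2: "f w z = f a z" if 0: "t w = 0" "t a = 0"
    proof -
      have one: "t v = 1"
        using sum 0 by simp
      have "t = indicator {v}"
        using av[OF t 0(1), unfolded one seg_1] .
      then show ?thesis
        using one distinct kv(4)[OF \<mu>, of 1] ends vertex_point_of_simplex[OF A e(3), of v]
        by (simp add: f_def)
    qed
    have 3: "f v z = f a z" if 0: "t v = 0" "t a = 0"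
    proof -
      have one: "t w = 1"
        using sum 0 by simp
      have "t = indicator {w}"
        using aw[OF t 0(1), unfolded one seg_1] .
      then show ?thesis
        using one distinct kw(4)[OF \<mu>, of 1] ends vertex_point_of_simplex[OF A e(3), of w]
        by (simp add: f_def)
    qed
    show ?thesis
      using xy 1 2 3 by auto
  qed
  have K_eq: "K z = f x z" if z: "z \<in> {0..1::real} \<times> simplex_frontier ?T" and x: "x \<in> ?T" "snd z x = 0" for x z
  proof -
    have "K z = f w z \<and> snd z w = 0 \<or> K z = f v z \<and> snd z v = 0 \<or> K z = f a z \<and> snd z a = 0"
      using x distinct by (auto simp: K_def f_def)
    then show ?thesis
      using agree[OF z _ x(1) _ x(2)] by auto
  qed
  have "continuous_map (top_of_set ({0..1::real} \<times> simplex_frontier ?T)) ?X K"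
  proof (rule pasting_lemma_closed[where I="?T" and T="?Z" and f=f])
    show "finite ?T"
      by simp
  next
    fix x assume x: "x \<in> ?T"
    have "continuous_on UNIV (\<lambda>z::real \<times> ('a \<Rightarrow> real). snd z x)"
      by (intro continuous_on_apply continuous_on_snd continuous_on_id)
    then have "closed {z::real \<times> ('a \<Rightarrow> real). snd z x = 0}"
      by (intro closed_Collect_eq continuous_on_const)
    then have "closedin (top_of_set ({0..1::real} \<times> simplex_frontier ?T))
        ({0..1::real} \<times> simplex_frontier ?T \<inter> {z. snd z x = 0})"
      by (rule closedin_closed_Int)
    then show "closedin (top_of_set ({0..1::real} \<times> simplex_frontier ?T)) (?Z x)"
      by (simp add: Int_def)
    have sub: "subtopology (top_of_set ({0..1::real} \<times> simplex_frontier ?T)) (?Z x) = top_of_set (?Z x)"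
      by (simp add: subtopology_subtopology) (metis (no_types, lifting) inf.absorb_iff2 mem_Collect_eq subsetI)
    have k: "continuous_map (top_of_set (?Z x)) ?X (\<lambda>z. k (fst z, snd z y))"
      if "continuous_map (prod_topology \<I> \<I>) ?X k" for k y
    proof -
      have "continuous_on (?Z x) (\<lambda>z. (fst z, snd z y))"
        by (intro continuous_on_Pair continuous_on_fst continuous_on_apply continuous_on_snd continuous_on_id)
      then have "continuous_map (top_of_set (?Z x)) (prod_topology \<I> \<I>) (\<lambda>z. (fst z, snd z y))"
        using t01 by auto
      from continuous_map_compose[OF this that] show ?thesis
        by (simp add: o_def)
    qed
    have "continuous_map (top_of_set (?Z a)) ?X (\<lambda>z. pt A {v, w} (\<epsilon> {v, w}) (snd z))"
      by (rule continuous_map_cell_compose[OF e(3)]) (auto intro!: vw' continuous_on_snd continuous_on_id)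
    then show "continuous_map (subtopology (top_of_set ({0..1::real} \<times> simplex_frontier ?T)) (?Z x)) ?X (f x)"
      unfolding sub using x k[OF kv(1)] k[OF kw(1)] distinct by (auto simp: f_def)
  next
    fix z assume "z \<in> topspace (top_of_set ({0..1::real} \<times> simplex_frontier ?T))"
    then have z: "z \<in> {0..1::real} \<times> simplex_frontier ?T"
      by simp
    then have "snd z \<in> simplex_frontier ?T"
      by auto
    then have "\<exists>x\<in>?T. snd z x = 0"
      unfolding simplex_frontier_def by blast
    then obtain x where x: "x \<in> ?T" "snd z x = 0"
      by (rule bexE)
    then show "\<exists>x. x \<in> ?T \<and> z \<in> ?Z x \<and> K z = f x z"
      using z K_eq[OF z x] by blast
  next
    fix x y z assume "x \<in> ?T" "y \<in> ?T"
      "z \<in> topspace (top_of_set ({0..1::real} \<times> simplex_frontier ?T)) \<inter> ?Z x \<inter> ?Z y"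
    then show "f x z = f y z"
      by (intro agree) blast+
  qed
  then have K: "continuous_map ?P ?X K"
    by simp
  have K0: "K (0, t) = pt A {x, y} (\<epsilon> {x, y}) t"
    if t: "t \<in> affine_simplex {x, y}" and xy: "{x, y} = {a, v} \<or> {x, y} = {a, w} \<or> {x, y} = {v, w}" for t x y
  proof -
    have fr: "t \<in> simplex_frontier ?T"
    proof -
      have "{x, y} \<subset> ?T"
        using xy distinct by auto
      then show ?thesis
        using t unfolding simplex_frontier_iff[OF cT(1)] by blast
    qed
    show ?thesis
    proof (rule disjE[OF xy])
      assume e: "{x, y} = {a, v}"
      then have "t w = 0"
        using affine_simplex_outside[OF t, of w] distinct by auto
      then show ?thesis
        using K_eq[of "(0, t)" w] fr kv(2) av[OF fr, symmetric] e by (simp add: f_def edge_path_def)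
    next
      assume "{x, y} = {a, w} \<or> {x, y} = {v, w}"
      then show ?thesis
      proof
        assume e: "{x, y} = {a, w}"
        then have "t v = 0"
          using affine_simplex_outside[OF t, of v] distinct by auto
        then show ?thesis
          using K_eq[of "(0, t)" v] fr kw(2) aw[OF fr, symmetric] e distinct by (simp add: f_def edge_path_def)
      next
        assume e: "{x, y} = {v, w}"
        then have "t a = 0"
          using affine_simplex_outside[OF t, of a] distinct by auto
        then show ?thesis
          using K_eq[of "(0, t)" a] fr e distinct by (simp add: f_def)
      qed
    qed
  qed
  have K1: "K (1, t) = G0 t" if t: "t \<in> simplex_frontier ?T" for t
  proof -
    consider "t w = 0" | "t v = 0" | "t a = 0"
      using t by (auto simp: simplex_frontier_def)
    then show ?thesis
    proof cases
      case 1
      then show ?thesis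
        using K_eq[of "(1, t)" w] t kv(3) av[OF t, symmetric] by (simp add: f_def)
    next
      case 2
      then show ?thesis
        using K_eq[of "(1, t)" v] t kw(3) aw[OF t, symmetric] distinct by (simp add: f_def)
    next
      case 3
      then show ?thesis
        using K_eq[of "(1, t)" a] t distinct vw[OF vw'[OF t]] by (simp add: f_def)
    qed
  qed
  let ?b = "barycentre ?T"
  define L where "L = (\<lambda>z. if fst z \<le> 1 / 2 then K (2 * fst z, snd z) else G0 (seg (2 * fst z - 1) (snd z) ?b))"
  have b: "?b \<in> affine_simplex ?T"
    by (rule barycentre_in_affine_simplex) auto
  have "continuous_map (top_of_set ({0..1::real} \<times> simplex_frontier ?T)) ?X L"
    unfolding L_def
  proof (rule continuous_map_cases_le)
    let ?Q = "top_of_set ({0..1::real} \<times> simplex_frontier ?T)"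
    show "continuous_map ?Q euclideanreal fst" "continuous_map ?Q euclideanreal (\<lambda>z. 1 / 2)"
      by (auto intro: continuous_on_fst continuous_on_id)
    let ?L = "{z \<in> topspace ?Q. fst z \<le> 1 / 2}" and ?U = "{z \<in> topspace ?Q. 1 / 2 \<le> fst z}"
    have "continuous_on ({0..1::real} \<times> simplex_frontier ?T \<inter> ?L) (\<lambda>z. (2 * fst z, snd z))"
      by (intro continuous_intros)
    then have "continuous_map (subtopology ?Q ?L) ?P (\<lambda>z. (2 * fst z, snd z))"
      by (auto simp: subtopology_subtopology)
    from continuous_map_compose[OF this K]
    show "continuous_map (subtopology ?Q ?L) ?X (\<lambda>z. K (2 * fst z, snd z))"
      by (simp add: o_def)
    have "continuous_on ({0..1::real} \<times> simplex_frontier ?T \<inter> ?U) (\<lambda>z. seg (2 * fst z - 1) (snd z) ?b)"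
      by (intro continuous_on_seg continuous_intros)
    moreover have "seg (2 * fst z - 1) (snd z) ?b \<in> affine_simplex ?T" if "z \<in> ?U" for z
      using that b simplex_frontier_subset[of ?T] by (intro seg_in_affine_simplex) auto
    ultimately have "continuous_map (subtopology ?Q ?U) (top_of_set (affine_simplex ?T)) (\<lambda>z. seg (2 * fst z - 1) (snd z) ?b)"
      unfolding subtopology_subtopology by auto
    from continuous_map_compose[OF this G0]
    show "continuous_map (subtopology ?Q ?U) ?X (\<lambda>z. G0 (seg (2 * fst z - 1) (snd z) ?b))"
      by (simp add: o_def)
    show "K (2 * fst z, snd z) = G0 (seg (2 * fst z - 1) (snd z) ?b)"
      if "z \<in> topspace ?Q" "fst z = 1 / 2" for z
    proof -
      have "2 * fst z = 1" "2 * fst z - 1 = 0" "snd z \<in> simplex_frontier ?T"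
        using that by auto
      then show ?thesis
        using K1[of "snd z"] by (simp only: seg_0)
    qed
  qed
  then have "continuous_map ?P ?X L"
    by simp
  then obtain G where G: "continuous_map (top_of_set (affine_simplex ?T)) ?X G"
    "\<And>t. t \<in> simplex_frontier ?T \<Longrightarrow> G t = L (0, t)"
    by (rule cone_extension[OF cT, where c="G0 ?b"]) (simp add: L_def, rule that)
  show ?thesis
    unfolding filled_triangle_def
  proof (intro exI conjI ballI impI)
    fix x y t assume xy: "x \<in> ?T" "y \<in> ?T" "x \<noteq> y" and t: "t \<in> affine_simplex {x, y}"
    have c: "{x, y} = {a, v} \<or> {x, y} = {a, w} \<or> {x, y} = {v, w}"
      using xy by auto
    then have "{x, y} \<subset> ?T"
      using distinct by auto
    then have "t \<in> simplex_frontier ?T"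
      using t unfolding simplex_frontier_iff[OF cT(1)] by blast
    then show "G t = pt A {x, y} (\<epsilon> {x, y}) t"
      using G(2) K0[OF t c] by (simp add: L_def)
  qed (rule G(1))
qed

section \<open>Cones over simplices\<close>

lemma continuous_map_split:
  fixes k :: "'a::topological_space \<Rightarrow> real"
  assumes "continuous_on S k"
    and "continuous_map (top_of_set (S \<inter> {x. k x \<le> c})) X f"
    and "continuous_map (top_of_set (S \<inter> {x. c \<le> k x})) X g"
    and "\<And>x. x \<in> S \<Longrightarrow> k x = c \<Longrightarrow> f x = g x"
  shows "continuous_map (top_of_set S) X (\<lambda>x. if k x \<le> c then f x else g x)"
proof (rule continuous_map_cases_le)
  show "continuous_map (top_of_set S) euclideanreal k"
    using assms(1) by simp
  have eq: "{x \<in> topspace (top_of_set S). k x \<le> c} = S \<inter> {x. k x \<le> c}"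
    "{x \<in> topspace (top_of_set S). c \<le> k x} = S \<inter> {x. c \<le> k x}"
    by auto
  have sub: "subtopology (top_of_set S) (S \<inter> T) = top_of_set (S \<inter> T)" for T
    by (simp add: subtopology_subtopology)
  show "continuous_map (subtopology (top_of_set S) {x \<in> topspace (top_of_set S). k x \<le> c}) X f"
    unfolding eq sub by (rule assms(2))
  show "continuous_map (subtopology (top_of_set S) {x \<in> topspace (top_of_set S). c \<le> k x}) X g"
    unfolding eq sub by (rule assms(3))
qed (use assms(4) in auto)

lemma continuous_map_on_compose:
  assumes "continuous_map (top_of_set T) X f" "continuous_on S k" "\<And>x. x \<in> S \<Longrightarrow> k x \<in> T"
  shows "continuous_map (top_of_set S) X (\<lambda>x. f (k x))"
proof -
  have "continuous_map (top_of_set S) (top_of_set T) k"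
    using assms(2,3) by auto
  from continuous_map_compose[OF this assms(1)] show ?thesis
    by (simp add: o_def)
qed

lemma unique_edgesD:
  assumes "unique_edges A" "v \<in> verts A" "w \<in> verts A" "v \<noteq> w"
    and "continuous_map \<I> (realization A) \<gamma>" "\<gamma> 0 = vertex_point A v" "\<gamma> 1 = vertex_point A w"
  shows "\<exists>!\<epsilon>. \<epsilon> \<in> simplices A {v, w} \<and> homotopic_rel {0, 1} \<I> (realization A) \<gamma> (edge_path A v w \<epsilon>)"
  using assms unfolding unique_edges_def pathin_def by blast

text \<open>First \<open>\<beta>\<close> and then a segment in the simplex \<open>\<sigma>\<close>. Any
  break strictly between 0 and 1 would do; it keeps the second part away from the corner in the
  polar coordinates used for filling triangles.\<close>

definition corner_path ::
  "('v, 's) premulticomplex \<Rightarrow> 'v set \<Rightarrow> 's \<Rightarrow> ('v \<Rightarrow> real) \<Rightarrow> (real \<Rightarrow> ('v, 's) cell_point set) \<Rightarrow> 'v \<Rightarrow>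
    real \<Rightarrow> ('v, 's) cell_point set" where
  "corner_path A B \<sigma> t \<beta> v s =
     (if s \<le> 2 / 3 then \<beta> (3 / 2 * s) else pt A B \<sigma> (seg (3 * s - 2) t (indicator {v})))"

lemma corner_path:
  assumes A: "multicomplex A" and \<sigma>: "\<sigma> \<in> simplices A B" and t: "t \<in> affine_simplex B"
    and \<beta>: "continuous_map \<I> (realization A) \<beta>" "\<beta> 1 = pt A B \<sigma> t" and v: "v \<in> B"
  shows "continuous_map \<I> (realization A) (corner_path A B \<sigma> t \<beta> v)"
    and "corner_path A B \<sigma> t \<beta> v 0 = \<beta> 0" "corner_path A B \<sigma> t \<beta> v 1 = vertex_point A v"
proof -
  have iv: "indicator {v} \<in> affine_simplex B"
    by (rule indicator_in_affine_simplex[OF v simplex_finite[OF A \<sigma>]])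
  show "continuous_map \<I> (realization A) (corner_path A B \<sigma> t \<beta> v)"
    unfolding corner_path_def[abs_def]
  proof (rule continuous_map_split)
    show "continuous_map (top_of_set ({0..1} \<inter> {x. x \<le> 2 / 3})) (realization A) (\<lambda>s. \<beta> (3 / 2 * s))"
      by (rule continuous_map_on_compose[OF \<beta>(1)]) (auto intro!: continuous_intros)
    show "continuous_map (top_of_set ({0..1} \<inter> {x. 2 / 3 \<le> x})) (realization A)
        (\<lambda>s. pt A B \<sigma> (seg (3 * s - 2) t (indicator {v})))"
      by (rule continuous_map_on_compose[OF continuous_map_cell[OF \<sigma>]])
        (use seg_in_affine_simplex[OF t iv] in \<open>auto intro!: continuous_on_seg continuous_intros\<close>)
    show "\<beta> (3 / 2 * s) = pt A B \<sigma> (seg (3 * s - 2) t (indicator {v}))" if "s = 2 / 3" for s :: real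
      using \<beta>(2) by (simp add: that)
  qed (intro continuous_on_id)
  show "corner_path A B \<sigma> t \<beta> v 0 = \<beta> 0"
    by (simp add: corner_path_def)
  show "corner_path A B \<sigma> t \<beta> v 1 = vertex_point A v"
    using vertex_point_of_simplex[OF A \<sigma> v] by (simp add: corner_path_def)
qed

text \<open>In polar coordinates about the corner \<open>a\<close>, the ray towards a point \<open>y\<close>
  of the opposite edge runs along \<open>\<beta>\<close> up to radius 2/3 and then along the
  segment in \<open>\<sigma>\<close> from \<open>t\<close> to \<open>y\<close>. Along the two
  sides these rays are the corner paths, which are homotopic to the given edges.\<close>

lemma filled_cone_triangle:
  assumes A: "multicomplex A" and \<sigma>: "\<sigma> \<in> simplices A B" and t: "t \<in> affine_simplex B"
    and \<beta>: "continuous_map \<I> (realization A) \<beta>" "\<beta> 1 = pt A B \<sigma> t"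
    and vw: "v \<in> B" "w \<in> B" "v \<noteq> w" and a: "a \<notin> B"
    and e: "\<epsilon> {a, v} \<in> simplices A {a, v}" "\<epsilon> {a, w} \<in> simplices A {a, w}" "\<epsilon> {v, w} = bdry A B {v, w} \<sigma>"
    and hv: "homotopic_rel {0, 1} \<I> (realization A) (edge_path A a v (\<epsilon> {a, v})) (corner_path A B \<sigma> t \<beta> v)"
    and hw: "homotopic_rel {0, 1} \<I> (realization A) (edge_path A a w (\<epsilon> {a, w})) (corner_path A B \<sigma> t \<beta> w)"
  shows "filled_triangle A {a, v, w} \<epsilon>"
proof -
  let ?T = "{a, v, w}"
  have dist: "a \<noteq> v" "a \<noteq> w"
    using vw a by auto
  \<comment> \<open>The denominator is the distance from the corner, bounded below where the formula is used.\<close>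
  define y where "y = (\<lambda>\<alpha>. \<lambda>x. if x \<in> {v, w} then \<alpha> x / max (1 - \<alpha> a) (2 / 3) else 0 :: real)"
  define G where "G = (\<lambda>\<alpha>. if 1 - \<alpha> a \<le> 2 / 3 then \<beta> (3 / 2 * (1 - \<alpha> a))
    else pt A B \<sigma> (seg (3 * (1 - \<alpha> a) - 2) t (y \<alpha>)))"
  have sum: "\<alpha> v + \<alpha> w = 1 - \<alpha> a" if "\<alpha> \<in> affine_simplex ?T" for \<alpha>
  proof -
    have "\<alpha> a + (\<alpha> v + \<alpha> w) = 1"
      using that dist vw(3) by (simp add: affine_simplex_def)
    then show ?thesis
      by simp
  qed
  have y: "y \<alpha> \<in> affine_simplex {v, w}" if \<alpha>: "\<alpha> \<in> affine_simplex ?T" and s: "2 / 3 \<le> 1 - \<alpha> a" for \<alpha>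
  proof -
    have m: "max (1 - \<alpha> a) (2 / 3) = 1 - \<alpha> a"
      using s by simp
    have "y \<alpha> v + y \<alpha> w = (\<alpha> v + \<alpha> w) / (1 - \<alpha> a)"
      unfolding y_def m by (simp add: add_divide_distrib)
    also have "\<dots> = 1"
      using s sum[OF \<alpha>] by simp
    finally have "y \<alpha> v + y \<alpha> w = 1" .
    moreover have "0 \<le> y \<alpha> x" for x
      using affine_simplex_nonneg[OF \<alpha>, of x] s by (simp add: y_def)
    ultimately show ?thesis
      using vw(3) by (simp add: affine_simplex_def) (simp add: y_def)
  qed
  have vwB: "affine_simplex {v, w} \<subseteq> affine_simplex B"
    using vw by (intro affine_simplex_mono simplex_finite[OF A \<sigma>]) auto
  have coord: "continuous_on S (\<lambda>\<alpha>::'a \<Rightarrow> real. \<alpha> x)" for S x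
    by (rule continuous_on_subset[OF continuous_on_product_coordinates]) simp
  have cy: "continuous_on S y" for S
  proof (rule continuous_on_coordinatewise_then_product)
    fix x
    have "continuous_on S (\<lambda>\<alpha>. \<alpha> x / max (1 - \<alpha> a) (2 / 3))"
      by (intro continuous_on_divide continuous_on_max continuous_on_diff continuous_on_const coord)
        (simp add: max_def)
    then show "continuous_on S (\<lambda>\<alpha>. y \<alpha> x)"
      by (cases "x \<in> {v, w}") (simp_all add: y_def)
  qed
  have G: "continuous_map (top_of_set (affine_simplex ?T)) (realization A) G"
    unfolding G_def
  proof (rule continuous_map_split)
    show "continuous_on (affine_simplex ?T) (\<lambda>\<alpha>. 1 - \<alpha> a)"
      by (intro continuous_on_diff continuous_on_const coord)
    show "continuous_map (top_of_set (affine_simplex ?T \<inter> {\<alpha>. 1 - \<alpha> a \<le> 2 / 3})) (realization A)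
        (\<lambda>\<alpha>. \<beta> (3 / 2 * (1 - \<alpha> a)))"
    proof (rule continuous_map_on_compose[OF \<beta>(1)])
      show "continuous_on (affine_simplex ?T \<inter> {\<alpha>. 1 - \<alpha> a \<le> 2 / 3}) (\<lambda>\<alpha>. 3 / 2 * (1 - \<alpha> a))"
        by (intro continuous_on_mult continuous_on_diff continuous_on_const coord)
      show "3 / 2 * (1 - \<alpha> a) \<in> {0..1}" if "\<alpha> \<in> affine_simplex ?T \<inter> {\<alpha>. 1 - \<alpha> a \<le> 2 / 3}" for \<alpha>
        using that affine_simplex_le_1[of \<alpha> ?T a] by simp
    qed
    let ?U = "affine_simplex ?T \<inter> {\<alpha>. 2 / 3 \<le> 1 - \<alpha> a}"
    show "continuous_map (top_of_set ?U) (realization A) (\<lambda>\<alpha>. pt A B \<sigma> (seg (3 * (1 - \<alpha> a) - 2) t (y \<alpha>)))"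
    proof (rule continuous_map_on_compose[OF continuous_map_cell[OF \<sigma>]])
      show "continuous_on ?U (\<lambda>\<alpha>. seg (3 * (1 - \<alpha> a) - 2) t (y \<alpha>))"
        by (intro continuous_on_seg continuous_on_mult continuous_on_diff continuous_on_const coord cy)
      show "seg (3 * (1 - \<alpha> a) - 2) t (y \<alpha>) \<in> affine_simplex B" if "\<alpha> \<in> ?U" for \<alpha>
        using that y[of \<alpha>] vwB t affine_simplex_nonneg[of \<alpha> ?T a] by (intro seg_in_affine_simplex) auto
    qed
    show "\<beta> (3 / 2 * (1 - \<alpha> a)) = pt A B \<sigma> (seg (3 * (1 - \<alpha> a) - 2) t (y \<alpha>))"
      if "1 - \<alpha> a = 2 / 3" for \<alpha>
      unfolding that using \<beta>(2) by simp
  qed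
  have corner: "G (seg s (indicator {a}) (indicator {x})) = corner_path A B \<sigma> t \<beta> x s"
    if s: "0 \<le> s" "s \<le> 1" and x: "x \<in> {v, w}" for s x
  proof -
    have sa: "1 - seg s (indicator {a}) (indicator {x}) a = s"
      using x dist by (auto simp: seg_def)
    have "y (seg s (indicator {a}) (indicator {x})) = indicator {x}" if "2 / 3 < s"
    proof
      fix z
      show "y (seg s (indicator {a}) (indicator {x})) z = indicator {x} z"
      proof (cases "z = x")
        case True
        then have "seg s (indicator {a}) (indicator {x}) z = s"
          using x dist by (auto simp: seg_def)
        then show ?thesis
          using that True x unfolding y_def sa by simp
      next
        case False
        then have "z \<in> {v, w} \<Longrightarrow> seg s (indicator {a}) (indicator {x}) z = 0"
          using dist by (auto simp: seg_def)
        then show ?thesis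
          using False unfolding y_def sa by simp
      qed
    qed
    then show ?thesis
      unfolding G_def corner_path_def sa by simp
  qed
  have face: "G \<alpha> = pt A {v, w} (\<epsilon> {v, w}) \<alpha>" if \<alpha>: "\<alpha> \<in> affine_simplex {v, w}" for \<alpha>
  proof -
    have a0: "\<alpha> a = 0"
      using affine_simplex_outside[OF \<alpha>, of a] dist by simp
    have "y \<alpha> = \<alpha>"
      using affine_simplex_outside[OF \<alpha>] by (intro ext) (simp add: y_def a0)
    then have "G \<alpha> = pt A B \<sigma> \<alpha>"
      by (simp add: G_def a0)
    then show ?thesis
      using pt_face[OF \<sigma> _ \<alpha>] vw e(3) by simp
  qed
  have e3: "\<epsilon> {v, w} \<in> simplices A {v, w}"
    unfolding e(3) using vw by (intro bdry_simplex[OF A \<sigma>]) auto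
  have hr: "homotopic_rel {0, 1} \<I> (realization A) (edge_path A a x (\<epsilon> {a, x}))
      (\<lambda>s. G (seg s (indicator {a}) (indicator {x})))"
    if "homotopic_rel {0, 1} \<I> (realization A) (edge_path A a x (\<epsilon> {a, x})) (corner_path A B \<sigma> t \<beta> x)"
      "x \<in> {v, w}" for x
    by (rule homotopic_rel_cong[OF that(1)]) (use corner that(2) in auto)
  show ?thesis
    by (rule filled_triangle_if_homotopic[OF A dist vw(3) e(1,2) e3 G hr[OF hv] hr[OF hw] face]) auto
qed

text \<open>The triangles with corner \<open>a\<close> are filled because the given edges are homotopic to
  paths that all start with the same \<open>\<beta>\<close>, and the other triangles are faces
  of \<open>\<sigma>\<close>; so the edges extend to a simplex. Its face opposite to
  \<open>a\<close> is \<open>\<sigma>\<close> because both have the same edges.\<close>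

lemma cone_simplex_exists:
  assumes A: "multicomplex A" and E2: "unique_fillings A" and \<sigma>: "\<sigma> \<in> simplices A B"
    and t: "t \<in> affine_simplex B" and \<beta>: "continuous_map \<I> (realization A) \<beta>" "\<beta> 1 = pt A B \<sigma> t"
    and a: "a \<notin> B" "a \<in> verts A"
    and e: "\<And>v. v \<in> B \<Longrightarrow> e v \<in> simplices A {a, v}"
    and he: "\<And>v. v \<in> B \<Longrightarrow>
      homotopic_rel {0, 1} \<I> (realization A) (edge_path A a v (e v)) (corner_path A B \<sigma> t \<beta> v)"
  shows "\<exists>\<tau>\<in>simplices A (insert a B). bdry A (insert a B) B \<tau> = \<sigma> \<and>
    (\<forall>v\<in>B. bdry A (insert a B) {a, v} \<tau> = e v)"
proof -
  let ?W = "insert a B"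
  have fB: "finite B"
    by (rule simplex_finite[OF A \<sigma>])
  have B0: "B \<noteq> {}"
    using t by auto
  have c0: "card B \<noteq> 0"
    using fB B0 by simp
  show ?thesis
  proof (cases "card B = 1")
    case True
    then obtain v where v: "B = {v}"
      by (auto simp: card_1_singleton_iff)
    have ev: "e v \<in> simplices A {a, v}"
      using e v by simp
    have "bdry A {a, v} {v} (e v) \<in> simplices A {v}"
      by (rule bdry_simplex[OF A ev]) simp
    then have "bdry A {a, v} {v} (e v) = \<sigma>"
      using vertex_simplex_unique[OF A] \<sigma> v by metis
    then show ?thesis
      using ev bdry_self[OF A ev] v by auto
  next
    case False
    then have c2: "card B \<ge> 2"
      using c0 by simp
    define \<epsilon> where "\<epsilon> = (\<lambda>E. if a \<in> E then e (the_elem (E - {a})) else bdry A B E \<sigma>)"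
    have \<epsilon>a: "\<epsilon> {a, v} = e v" if "v \<in> B" for v
    proof -
      have "{a, v} - {a} = {v}"
        using that a(1) by auto
      then show ?thesis
        by (simp add: \<epsilon>_def)
    qed
    have \<epsilon>a': "\<epsilon> {v, a} = e v" if "v \<in> B" for v
      using \<epsilon>a[OF that] by (simp add: insert_commute)
    have \<epsilon>B: "\<epsilon> {v, w} = bdry A B {v, w} \<sigma>" if "v \<in> B" "w \<in> B" for v w
      using that a(1) by (auto simp: \<epsilon>_def)
    have \<epsilon>Bin: "\<epsilon> {v, w} \<in> simplices A {v, w}" if "v \<in> B" "w \<in> B" for v w
      unfolding \<epsilon>B[OF that] by (rule bdry_simplex[OF A \<sigma>]) (use that in auto)
    have es: "edge_system A ?W \<epsilon>"
      unfolding edge_system_def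
    proof (intro ballI impI)
      fix v w assume vw: "v \<in> ?W" "w \<in> ?W" "v \<noteq> w"
      then consider "v = a" "w \<in> B" | "w = a" "v \<in> B" | "v \<in> B" "w \<in> B"
        by blast
      then show "\<epsilon> {v, w} \<in> simplices A {v, w}"
      proof cases
        case 1
        then show ?thesis
          using e \<epsilon>a by simp
      next
        case 2
        then show ?thesis
          using e[of v] \<epsilon>a'[of v] by (simp add: insert_commute)
      next
        case 3
        then show ?thesis
          by (rule \<epsilon>Bin)
      qed
    qed
    have faceT: "filled_triangle A T \<epsilon>" if "T \<subseteq> B" for T
      by (rule filled_triangle_face[OF A \<sigma> that]) (use \<epsilon>B that in auto)
    have tri: "filled_triangle A T \<epsilon>" if T: "T \<subseteq> ?W" "card T = 3" for T
    proof (cases "a \<in> T")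
      case True
      then have "card (T - {a}) = 2"
        using T by (simp add: card_Diff_singleton)
      then obtain v w where vw: "T - {a} = {v, w}" "v \<noteq> w"
        by (auto simp: card_2_iff)
      then have T': "T = {a, v, w}" and B: "v \<in> B" "w \<in> B"
        using True T(1) by auto
      show ?thesis
        unfolding T'
        by (rule filled_cone_triangle[OF A \<sigma> t \<beta> B vw(2) a(1)])
          (simp_all add: \<epsilon>a \<epsilon>B B e he)
    next
      case False
      then show ?thesis
        using T(1) by (intro faceT) auto
    qed
    have W: "finite ?W" "?W \<subseteq> verts A" "card ?W \<ge> 3"
      using fB simplex_verts[OF A \<sigma>] a c2 by auto
    have "\<exists>!\<tau>. \<tau> \<in> simplices A ?W \<and> (\<forall>v\<in>?W. \<forall>w\<in>?W. v \<noteq> w \<longrightarrow> bdry A ?W {v, w} \<tau> = \<epsilon> {v, w})"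
      by (rule unique_fillingsD[OF E2 W es tri])
    from ex1_implies_ex[OF this] obtain \<tau> where \<tau>: "\<tau> \<in> simplices A ?W"
      and \<tau>e: "\<forall>v\<in>?W. \<forall>w\<in>?W. v \<noteq> w \<longrightarrow> bdry A ?W {v, w} \<tau> = \<epsilon> {v, w}"
      by (elim exE conjE) (rule that)
    have BW: "B \<subseteq> ?W"
      by blast
    have \<tau>B: "bdry A ?W B \<tau> \<in> simplices A B"
      by (rule bdry_simplex[OF A \<tau> BW])
    have edges: "bdry A B {v, w} (bdry A ?W B \<tau>) = \<epsilon> {v, w}" if "v \<in> B" "w \<in> B" "v \<noteq> w" for v w
    proof -
      have "bdry A B {v, w} (bdry A ?W B \<tau>) = bdry A ?W {v, w} \<tau>"
        by (rule bdry_bdry[OF A \<tau> BW]) (use that in auto)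
      then show ?thesis
        using \<tau>e that by simp
    qed
    have "bdry A ?W B \<tau> = \<sigma>"
    proof (cases "card B = 2")
      case True
      then obtain v w where vw: "B = {v, w}" "v \<noteq> w"
        by (auto simp: card_2_iff)
      have "bdry A B B (bdry A ?W B \<tau>) = bdry A B B \<sigma>"
        using edges[of v w] \<epsilon>B[of v w] vw by simp
      then show ?thesis
        using bdry_self[OF A \<tau>B] bdry_self[OF A \<sigma>] by simp
    next
      case False
      then have c3: "card B \<ge> 3"
        using c2 by simp
      have esB: "edge_system A B \<epsilon>"
        using \<epsilon>Bin by (simp add: edge_system_def)
      have "\<exists>!\<rho>. \<rho> \<in> simplices A B \<and> (\<forall>v\<in>B. \<forall>w\<in>B. v \<noteq> w \<longrightarrow> bdry A B {v, w} \<rho> = \<epsilon> {v, w})"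
        by (rule unique_fillingsD[OF E2 fB simplex_verts[OF A \<sigma>] c3 esB faceT])
      then show ?thesis
        by (rule ex1E) (use \<tau>B \<sigma> edges \<epsilon>B in metis)
    qed
    moreover have "bdry A ?W {a, v} \<tau> = e v" if v: "v \<in> B" for v
    proof -
      have "a \<noteq> v"
        using v a(1) by blast
      then show ?thesis
        using \<tau>e v \<epsilon>a[OF v] by simp
    qed
    ultimately show ?thesis
      using \<tau> by blast
  qed
qed

text \<open>The third edge of a triangle is homotopic to the path along the other two edges, which
  \<open>\<tau>\<close> and \<open>\<tau>'\<close> have in common.\<close>

lemma cone_edge_unique:
  assumes A: "multicomplex A" and E1: "unique_edges A"
    and \<tau>: "\<tau> \<in> simplices A W" "\<tau>' \<in> simplices A W" and avw: "a \<in> W" "v \<in> W" "w \<in> W" "a \<noteq> w"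
    and av: "bdry A W {a, v} \<tau> = bdry A W {a, v} \<tau>'" and vw: "bdry A W {v, w} \<tau> = bdry A W {v, w} \<tau>'"
  shows "bdry A W {a, w} \<tau> = bdry A W {a, w} \<tau>'"
proof -
  let ?i = "\<lambda>x. indicator {x} :: 'a \<Rightarrow> real"
  have fW: "finite W"
    by (rule simplex_finite[OF A \<tau>(1)])
  have i: "?i x \<in> affine_simplex {x, y}" "?i x \<in> affine_simplex {y, x}" "x \<in> W \<Longrightarrow> ?i x \<in> affine_simplex W" for x y
    using fW by (auto intro: indicator_in_affine_simplex)
  define c where "c = (\<lambda>s. if s \<le> 1 / 2 then seg (2 * s) (?i a) (?i v) else seg (2 * s - 1) (?i v) (?i w))"
  have cW: "c s \<in> affine_simplex W" if "s \<in> {0..1}" for s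
    using that avw i by (auto simp: c_def intro!: seg_in_affine_simplex)
  have "continuous_map (top_of_set {0..1}) (top_of_set UNIV) c"
    unfolding c_def
  proof (rule continuous_map_split)
    show "seg (2 * s) (?i a) (?i v) = seg (2 * s - 1) (?i v) (?i w)" if "s = 1 / 2" for s
      unfolding that by simp
  qed (auto intro!: continuous_on_seg continuous_intros)
  then have cc: "continuous_on {0..1} c"
    by simp
  define \<gamma> where "\<gamma> = (\<lambda>\<rho> s. pt A W \<rho> (c s))"
  have hr: "homotopic_rel {0, 1} \<I> (realization A) (\<gamma> \<rho>) (edge_path A a w (bdry A W {a, w} \<rho>))"
    if \<rho>: "\<rho> \<in> simplices A W" for \<rho>
  proof (rule homotopic_relI[where h="\<lambda>z. pt A W \<rho> (seg (fst z) (c (snd z)) (seg (snd z) (?i a) (?i w)))"])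
    have "continuous_on ({0..1} \<times> {0..1}) (\<lambda>z. c (snd z))"
      by (rule continuous_on_compose2[OF cc]) (auto intro!: continuous_intros)
    then have "continuous_on ({0..1::real} \<times> {0..1}) (\<lambda>z. seg (fst z) (c (snd z)) (seg (snd z) (?i a) (?i w)))"
      by (intro continuous_on_seg continuous_intros)
    then have "continuous_map (top_of_set ({0..1::real} \<times> {0..1})) (realization A)
        (\<lambda>z. pt A W \<rho> (seg (fst z) (c (snd z)) (seg (snd z) (?i a) (?i w))))"
      by (rule continuous_map_on_compose[OF continuous_map_cell[OF \<rho>]])
        (use cW i avw in \<open>auto intro!: seg_in_affine_simplex\<close>)
    then show "continuous_map (prod_topology \<I> \<I>) (realization A)
        (\<lambda>z. pt A W \<rho> (seg (fst z) (c (snd z)) (seg (snd z) (?i a) (?i w))))"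
      by simp
    show "pt A W \<rho> (seg (fst (0, s)) (c (snd (0, s))) (seg (snd (0, s)) (?i a) (?i w))) = \<gamma> \<rho> s" for s
      by (simp add: \<gamma>_def)
    show "pt A W \<rho> (seg (fst (1, s)) (c (snd (1, s))) (seg (snd (1, s)) (?i a) (?i w))) =
        edge_path A a w (bdry A W {a, w} \<rho>) s" if "s \<in> topspace \<I>" for s
      using that pt_face[OF \<rho>, of "{a, w}" "seg s (?i a) (?i w)"] avw i
      by (simp add: edge_path_def seg_in_affine_simplex)
    show "pt A W \<rho> (seg (fst (\<mu>, s)) (c (snd (\<mu>, s))) (seg (snd (\<mu>, s)) (?i a) (?i w))) = \<gamma> \<rho> s"
      if "s \<in> {0, 1}" for \<mu> s :: real
      using that by (auto simp: \<gamma>_def c_def)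
  qed auto
  have face: "pt A W \<rho> (c s) = (if s \<le> 1 / 2 then pt A {a, v} (bdry A W {a, v} \<rho>) (c s)
      else pt A {v, w} (bdry A W {v, w} \<rho>) (c s))" if \<rho>: "\<rho> \<in> simplices A W" and s: "s \<in> {0..1}" for \<rho> s
  proof (cases "s \<le> 1 / 2")
    case True
    then have "c s \<in> affine_simplex {a, v}"
      using s i by (simp add: c_def seg_in_affine_simplex)
    then show ?thesis
      using pt_face[OF \<rho>, of "{a, v}" "c s"] avw True by simp
  next
    case False
    then have "c s \<in> affine_simplex {v, w}"
      using s i by (simp add: c_def seg_in_affine_simplex)
    then show ?thesis
      using pt_face[OF \<rho>, of "{v, w}" "c s"] avw False by simp
  qed
  have eq: "\<gamma> \<tau>' s = \<gamma> \<tau> s" if "s \<in> {0..1}" for s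
    unfolding \<gamma>_def face[OF \<tau>(1) that] face[OF \<tau>(2) that] av vw ..
  have h1: "homotopic_rel {0, 1} \<I> (realization A) (\<gamma> \<tau>) (edge_path A a w (bdry A W {a, w} \<tau>))"
    by (rule hr[OF \<tau>(1)])
  have h2: "homotopic_rel {0, 1} \<I> (realization A) (\<gamma> \<tau>) (edge_path A a w (bdry A W {a, w} \<tau>'))"
    by (rule homotopic_rel_cong[OF hr[OF \<tau>(2)]]) (use eq in auto)
  have aw: "{a, w} \<subseteq> W"
    using avw by blast
  have v: "a \<in> verts A" "w \<in> verts A"
    using simplex_verts[OF A \<tau>(1)] avw by auto
  have ends: "\<gamma> \<tau> 0 = vertex_point A a" "\<gamma> \<tau> 1 = vertex_point A w"
    using vertex_point_of_simplex[OF A \<tau>(1)] avw by (simp_all add: \<gamma>_def c_def)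
  have "\<exists>!\<epsilon>. \<epsilon> \<in> simplices A {a, w} \<and> homotopic_rel {0, 1} \<I> (realization A) (\<gamma> \<tau>) (edge_path A a w \<epsilon>)"
    by (rule unique_edgesD[OF E1 v avw(4) homotopic_rel_imp_continuous(1)[OF h1] ends])
  then show ?thesis
    by (rule ex1E) (use h1 h2 bdry_simplex[OF A \<tau>(1) aw] bdry_simplex[OF A \<tau>(2) aw] in metis)
qed

text \<open>One edge at \<open>a\<close> and the face opposite to \<open>a\<close> determine all other
  edges, and the edges determine the simplex.\<close>

lemma cone_simplex_unique:
  assumes A: "multicomplex A" and E1: "unique_edges A" and E2: "unique_fillings A"
    and \<tau>: "\<tau> \<in> simplices A (insert a B)" "\<tau>' \<in> simplices A (insert a B)" and a: "a \<notin> B" and v: "v \<in> B"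
    and face: "bdry A (insert a B) B \<tau> = bdry A (insert a B) B \<tau>'"
    and edge: "bdry A (insert a B) {a, v} \<tau> = bdry A (insert a B) {a, v} \<tau>'"
  shows "\<tau> = \<tau>'"
proof -
  let ?W = "insert a B"
  have W: "finite ?W" "?W \<subseteq> verts A"
    using simplex_finite[OF A \<tau>(1)] simplex_verts[OF A \<tau>(1)] by auto
  have BW: "B \<subseteq> ?W"
    by blast
  have inB: "bdry A ?W {x, y} \<tau> = bdry A ?W {x, y} \<tau>'" if "x \<in> B" "y \<in> B" for x y
    using bdry_bdry[OF A \<tau>(1) BW, of "{x, y}"] bdry_bdry[OF A \<tau>(2) BW, of "{x, y}"] face that by simp
  have ina: "bdry A ?W {a, y} \<tau> = bdry A ?W {a, y} \<tau>'" if "y \<in> B" for y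
    by (rule cone_edge_unique[OF A E1 \<tau> _ _ _ _ edge inB[OF v that]]) (use a v that in auto)
  have all: "bdry A ?W {x, y} \<tau>' = bdry A ?W {x, y} \<tau>" if "x \<in> ?W" "y \<in> ?W" "x \<noteq> y" for x y
  proof -
    have "x = a \<and> y \<in> B \<or> y = a \<and> x \<in> B \<or> x \<in> B \<and> y \<in> B"
      using that by auto
    then consider "x = a" "y \<in> B" | "y = a" "x \<in> B" | "x \<in> B" "y \<in> B"
      by (elim disjE conjE)
    then show ?thesis
    proof cases
      case 2
      then show ?thesis
        using ina[of x] by (simp add: insert_commute)
    qed (use ina[of y] inB in simp_all)
  qed
  have c0: "card B \<noteq> 0"
    using v W(1) by auto
  show ?thesis
  proof (cases "card B = 1")
    case True
    then have "?W = {a, v}"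
      using v by (auto simp: card_1_singleton_iff)
    then show ?thesis
      using edge bdry_self[OF A \<tau>(1)] bdry_self[OF A \<tau>(2)] by simp
  next
    case False
    then have c3: "card ?W \<ge> 3"
      using c0 a W(1) by simp
    define \<epsilon> where "\<epsilon> = (\<lambda>E. bdry A ?W E \<tau>)"
    have es: "edge_system A ?W \<epsilon>"
      unfolding edge_system_def \<epsilon>_def by (intro ballI impI bdry_simplex[OF A \<tau>(1)]) blast
    have tri: "filled_triangle A T \<epsilon>" if "T \<subseteq> ?W" for T
      by (rule filled_triangle_face[OF A \<tau>(1) that]) (simp add: \<epsilon>_def)
    have "\<exists>!\<rho>. \<rho> \<in> simplices A ?W \<and> (\<forall>v\<in>?W. \<forall>w\<in>?W. v \<noteq> w \<longrightarrow> bdry A ?W {v, w} \<rho> = \<epsilon> {v, w})"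
      by (rule unique_fillingsD[OF E2 W c3 es tri])
    then show ?thesis
      by (rule ex1E) (use \<tau> all in \<open>metis \<epsilon>_def\<close>)
  qed
qed

text \<open>For the vertex \<open>v\<close> itself, the corner path is the edge followed by a constant path.\<close>

lemma homotopic_rel_corner_edge:
  assumes A: "multicomplex A" and \<sigma>: "\<sigma> \<in> simplices A B" and v: "v \<in> B" and e: "e \<in> simplices A {a, v}"
  shows "homotopic_rel {0, 1} \<I> (realization A) (edge_path A a v e)
    (corner_path A B \<sigma> (indicator {v}) (edge_path A a v e) v)"
proof (rule homotopic_relI[where h="\<lambda>z. edge_path A a v e ((1 - fst z) * snd z + fst z * min (3 / 2 * snd z) 1)"])
  have bound: "(1 - \<mu>) * s + \<mu> * min (3 / 2 * s) 1 \<in> {0..1}" if "\<mu> \<in> {0..1}" "s \<in> {0..1}" for \<mu> s :: real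
  proof -
    have "0 \<le> min (3 / 2 * s) 1" "min (3 / 2 * s) 1 \<le> 1"
      using that by auto
    moreover from this have "(1 - \<mu>) * s + \<mu> * min (3 / 2 * s) 1 \<le> 1"
      using that by (intro convex_bound_le) auto
    ultimately show ?thesis
      using that by auto
  qed
  have "continuous_map (top_of_set ({0..1} \<times> {0..1})) (realization A)
      (\<lambda>z. edge_path A a v e ((1 - fst z) * snd z + fst z * min (3 / 2 * snd z) 1))"
    by (rule continuous_map_on_compose[OF continuous_map_edge_path[OF e]])
      (use bound in \<open>auto intro!: continuous_intros\<close>)
  then show "continuous_map (prod_topology \<I> \<I>) (realization A)
      (\<lambda>z. edge_path A a v e ((1 - fst z) * snd z + fst z * min (3 / 2 * snd z) 1))"
    by simp
  have end1: "pt A B \<sigma> (indicator {v}) = edge_path A a v e 1"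
    using vertex_point_of_simplex[OF A \<sigma> v] edge_path_ends[OF A e] by simp
  show "edge_path A a v e ((1 - fst (1, s)) * snd (1, s) + fst (1, s) * min (3 / 2 * snd (1, s)) 1) =
      corner_path A B \<sigma> (indicator {v}) (edge_path A a v e) v s" for s
  proof (cases "s \<le> 2 / 3")
    case True
    then have "min (3 / 2 * s) 1 = 3 / 2 * s"
      by simp
    then show ?thesis
      using True by (simp add: corner_path_def)
  next
    case False
    then have "min (3 / 2 * s) 1 = 1"
      by simp
    then show ?thesis
      using False end1 by (simp add: corner_path_def)
  qed
  show "edge_path A a v e ((1 - fst (\<mu>, s)) * snd (\<mu>, s) + fst (\<mu>, s) * min (3 / 2 * snd (\<mu>, s)) 1) =
      edge_path A a v e s" if "s \<in> {0, 1}" for \<mu> s :: real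
    using that by auto
qed auto

text \<open>The edge \<open>e\<close> serves as the path \<open>\<beta>\<close>; the edges to the other
  vertices are those homotopic to the corner paths that follow \<open>e\<close>.\<close>

lemma cone_simplex_over_edge:
  assumes A: "multicomplex A" and E1: "unique_edges A" and E2: "unique_fillings A"
    and \<sigma>: "\<sigma> \<in> simplices A B" and v: "v \<in> B" and a: "a \<notin> B" and e: "e \<in> simplices A {a, v}"
  shows "\<exists>\<tau>\<in>simplices A (insert a B). bdry A (insert a B) B \<tau> = \<sigma> \<and> bdry A (insert a B) {a, v} \<tau> = e"
proof -
  let ?X = "realization A" and ?\<beta> = "edge_path A a v e" and ?t = "indicator {v} :: 'a \<Rightarrow> real"
  have t: "?t \<in> affine_simplex B"
    by (rule indicator_in_affine_simplex[OF v simplex_finite[OF A \<sigma>]])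
  have aV: "a \<in> verts A"
    using simplex_verts[OF A e] by blast
  have \<beta>: "continuous_map \<I> ?X ?\<beta>" "?\<beta> 1 = pt A B \<sigma> ?t"
    using continuous_map_edge_path[OF e] edge_path_ends[OF A e] vertex_point_of_simplex[OF A \<sigma> v] by auto
  have "\<exists>\<epsilon>. \<epsilon> \<in> simplices A {a, w} \<and> homotopic_rel {0, 1} \<I> ?X (edge_path A a w \<epsilon>) (corner_path A B \<sigma> ?t ?\<beta> w)"
    if w: "w \<in> B" for w
  proof -
    note c = corner_path[OF A \<sigma> t \<beta> w]
    have "w \<in> verts A" "a \<noteq> w"
      using simplex_verts[OF A \<sigma>] w a by auto
    moreover have "corner_path A B \<sigma> ?t ?\<beta> w 0 = vertex_point A a"
      unfolding c(2) by (rule edge_path_ends(1)[OF A e])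
    ultimately have "\<exists>!\<epsilon>. \<epsilon> \<in> simplices A {a, w} \<and>
        homotopic_rel {0, 1} \<I> ?X (corner_path A B \<sigma> ?t ?\<beta> w) (edge_path A a w \<epsilon>)"
      using unique_edgesD[OF E1 aV _ _ c(1) _ c(3)] by blast
    then show ?thesis
      by (elim ex1E) (blast intro: homotopic_rel_sym)
  qed
  then obtain e' where e': "\<And>w. w \<in> B \<Longrightarrow> e' w \<in> simplices A {a, w}"
    "\<And>w. w \<in> B \<Longrightarrow> homotopic_rel {0, 1} \<I> ?X (edge_path A a w (e' w)) (corner_path A B \<sigma> ?t ?\<beta> w)"
    by metis
  define e'' where "e'' = e'(v := e)"
  have "\<exists>\<tau>\<in>simplices A (insert a B). bdry A (insert a B) B \<tau> = \<sigma> \<and>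
      (\<forall>w\<in>B. bdry A (insert a B) {a, w} \<tau> = e'' w)"
  proof (rule cone_simplex_exists[OF A E2 \<sigma> t \<beta> a aV])
    show "e'' w \<in> simplices A {a, w}" if "w \<in> B" for w
      using e e'(1)[OF that] by (simp add: e''_def)
    show "homotopic_rel {0, 1} \<I> ?X (edge_path A a w (e'' w)) (corner_path A B \<sigma> ?t ?\<beta> w)" if "w \<in> B" for w
      using homotopic_rel_corner_edge[OF A \<sigma> v e] e'(2)[OF that] by (cases "w = v") (simp_all add: e''_def)
  qed
  then show ?thesis
    using v by (auto simp: e''_def)
qed

text \<open>Local sections of the projection that forgets the vertex \<open>a\<close>: over the open star of \<open>v\<close> they are
  indexed by the edges from \<open>a\<close> to \<open>v\<close>; the parameter \<open>s\<close> is the barycentric coordinate of \<open>a\<close>.\<close>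

definition cone_section ::
  "('v, 's) premulticomplex \<Rightarrow> 'v \<Rightarrow> 'v \<Rightarrow> 's \<Rightarrow> real \<Rightarrow> ('v, 's) cell_point set \<Rightarrow> ('v, 's) cell_point set" where
  "cone_section A a v e s p = pt A (insert a (supp (coord p)))
     (THE \<tau>. \<tau> \<in> simplices A (insert a (supp (coord p))) \<and>
        bdry A (insert a (supp (coord p))) (supp (coord p)) \<tau> = carrier_simplex A p \<and>
        bdry A (insert a (supp (coord p))) {a, v} \<tau> = e)
     (seg s (coord p) (indicator {a}))"

lemma cone_section_eq:
  assumes A: "multicomplex A" and E1: "unique_edges A" and E2: "unique_fillings A"
    and \<tau>: "\<tau> \<in> simplices A (insert a (supp (coord p)))"
    and face: "bdry A (insert a (supp (coord p))) (supp (coord p)) \<tau> = carrier_simplex A p"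
    and edge: "bdry A (insert a (supp (coord p))) {a, v} \<tau> = e"
    and a: "a \<notin> supp (coord p)" and v: "v \<in> supp (coord p)"
  shows "cone_section A a v e s p = pt A (insert a (supp (coord p))) \<tau> (seg s (coord p) (indicator {a}))"
proof -
  have "(THE \<tau>. \<tau> \<in> simplices A (insert a (supp (coord p))) \<and>
        bdry A (insert a (supp (coord p))) (supp (coord p)) \<tau> = carrier_simplex A p \<and>
        bdry A (insert a (supp (coord p))) {a, v} \<tau> = e) = \<tau>"
  proof (rule the_equality)
    fix \<rho> assume "\<rho> \<in> simplices A (insert a (supp (coord p))) \<and>
        bdry A (insert a (supp (coord p))) (supp (coord p)) \<rho> = carrier_simplex A p \<and>
        bdry A (insert a (supp (coord p))) {a, v} \<rho> = e"
    then show "\<rho> = \<tau>"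
      using cone_simplex_unique[OF A E1 E2 _ \<tau> a v] face edge by simp
  qed (use \<tau> face edge in blast)
  then show ?thesis
    by (simp add: cone_section_def)
qed

text \<open>Over the cell of a simplex that contains \<open>v\<close>, the cones over its faces with the
  edge \<open>e\<close> are all faces of one cone, by uniqueness. There the section is an affine
  map into a single cell.\<close>

lemma continuous_map_cone_section:
  assumes A: "multicomplex A" and E1: "unique_edges A" and E2: "unique_fillings A"
    and av: "a \<noteq> v" and e: "e \<in> simplices A {a, v}"
  shows "continuous_map
    (prod_topology \<I> (subtopology (realization A) (star A v \<inter> {p \<in> topspace (realization A). coord p a = 0})))
    (realization A) (\<lambda>(s, p). cone_section A a v e s p)"
proof (rule continuous_map_prod_from_realization)
  let ?X = "realization A"
  let ?Z = "star A v \<inter> {p \<in> topspace ?X. coord p a = 0}"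
  show "locally_compact_space \<I>" "Hausdorff_space \<I>"
    by (simp_all add: Hausdorff_space_subtopology compact_imp_locally_compact_space compact_space_subtopology)
  show "openin ?X (star A v)"
    unfolding star_def by (rule openin_star(1)[OF A])
  show "closedin ?X {p \<in> topspace ?X. coord p a = 0}"
    by (rule openin_star(2)[OF A])
  fix B \<sigma> assume \<sigma>: "\<sigma> \<in> simplices A B"
  let ?T = "{t \<in> affine_simplex B. pt A B \<sigma> t \<in> ?Z}"
  let ?g = "\<lambda>(z, t). (case (z, pt A B \<sigma> t) of (s, p) \<Rightarrow> cone_section A a v e s p)"
  have T: "t \<in> affine_simplex B" "0 < t v" "t a = 0" if "t \<in> ?T" for t
    using that by (auto simp: star_def A)
  show "continuous_map (prod_topology \<I> (top_of_set ?T)) ?X ?g"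
  proof (cases "v \<in> B")
    case False
    have empty: "?T = {}"
    proof (rule equals0I)
      fix t assume "t \<in> ?T"
      then show False
        using T[of t] affine_simplex_outside[OF _ False, of t] by simp
    qed
    show ?thesis
      unfolding empty by (simp add: continuous_map_def)
  next
    case True
    let ?B = "B - {a}"
    let ?\<sigma> = "bdry A B ?B \<sigma>"
    have BB: "?B \<subseteq> B"
      by blast
    have fB: "finite B"
      by (rule simplex_finite[OF A \<sigma>])
    have \<sigma>': "?\<sigma> \<in> simplices A ?B"
      by (rule bdry_simplex[OF A \<sigma> BB])
    have vB: "v \<in> ?B" and aB: "a \<notin> ?B"
      using True av by auto
    obtain \<tau> where \<tau>: "\<tau> \<in> simplices A (insert a ?B)" "bdry A (insert a ?B) ?B \<tau> = ?\<sigma>"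
      "bdry A (insert a ?B) {a, v} \<tau> = e"
      using cone_simplex_over_edge[OF A E1 E2 \<sigma>' vB aB e] by (elim bexE conjE) (rule that)
    have T': "t \<in> affine_simplex ?B" if "t \<in> ?T" for t
      using affine_simplex_restrict_iff[OF BB fB, of t] T[OF that] by auto
    have ia: "indicator {a} \<in> affine_simplex (insert a C)" if "finite C" for C
      using that by (intro indicator_in_affine_simplex) auto
    have eq: "cone_section A a v e s (pt A B \<sigma> t) = pt A (insert a ?B) \<tau> (seg s t (indicator {a}))"
      if t: "t \<in> ?T" and s: "s \<in> {0..1}" for s t
    proof -
      let ?C = "supp t" and ?p = "pt A B \<sigma> t"
      have CB: "?C \<subseteq> ?B"
        by (rule supp_subset[OF T'[OF t]])
      have vC: "v \<in> ?C" and aC: "a \<notin> ?C"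
        using T[OF t] by (auto simp: supp_def)
      have C: "coord ?p = t" "carrier_simplex A ?p = bdry A B ?C \<sigma>"
        using A by (simp_all add: carrier_simplex_pt)
      have sub: "insert a ?C \<subseteq> insert a ?B" "?C \<subseteq> insert a ?C" "?B \<subseteq> insert a ?B" "{a, v} \<subseteq> insert a ?C"
        using CB vC by auto
      let ?\<rho> = "bdry A (insert a ?B) (insert a ?C) \<tau>"
      have \<rho>: "?\<rho> \<in> simplices A (insert a ?C)"
        by (rule bdry_simplex[OF A \<tau>(1) sub(1)])
      have "bdry A (insert a ?C) ?C ?\<rho> = bdry A (insert a ?B) ?C \<tau>"
        by (rule bdry_bdry[OF A \<tau>(1) sub(1,2)])
      also have "\<dots> = bdry A ?B ?C ?\<sigma>"
        using bdry_bdry[OF A \<tau>(1) sub(3) CB] \<tau>(2) by simp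
      also have "\<dots> = bdry A B ?C \<sigma>"
        by (rule bdry_bdry[OF A \<sigma> BB CB])
      finally have face: "bdry A (insert a ?C) ?C ?\<rho> = carrier_simplex A ?p"
        using C by simp
      have edge: "bdry A (insert a ?C) {a, v} ?\<rho> = e"
        using bdry_bdry[OF A \<tau>(1) sub(1,4)] \<tau>(3) by simp
      have "cone_section A a v e s ?p = pt A (insert a (supp (coord ?p))) ?\<rho> (seg s (coord ?p) (indicator {a}))"
        by (rule cone_section_eq[OF A E1 E2]) (simp_all only: C(1) \<rho> face edge aC vC not_False_eq_True)
      also have "\<dots> = pt A (insert a ?C) ?\<rho> (seg s t (indicator {a}))"
        by (simp only: C(1))
      also have "\<dots> = pt A (insert a ?B) \<tau> (seg s t (indicator {a}))"
      proof (rule pt_face[OF \<tau>(1) sub(1), symmetric])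
        have "t \<in> affine_simplex (insert a ?C)"
          using affine_simplex_supp[OF T(1)[OF t]] finite_supp[OF T(1)[OF t]] by blast
        then show "seg s t (indicator {a}) \<in> affine_simplex (insert a ?C)"
          using s ia finite_supp[OF T(1)[OF t]] by (intro seg_in_affine_simplex) auto
      qed
      finally show ?thesis .
    qed
    have aff: "affine_simplex ?B \<subseteq> affine_simplex (insert a ?B)"
      using fB by (intro affine_simplex_mono) auto
    have "continuous_map (top_of_set ({0..1} \<times> ?T)) ?X (\<lambda>z. pt A (insert a ?B) \<tau> (seg (fst z) (snd z) (indicator {a})))"
    proof (rule continuous_map_on_compose[OF continuous_map_cell[OF \<tau>(1)]])
      show "continuous_on ({0..1} \<times> ?T) (\<lambda>z. seg (fst z) (snd z) (indicator {a}))"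
        by (intro continuous_on_seg continuous_on_fst continuous_on_snd continuous_on_id continuous_on_const)
      show "seg (fst z) (snd z) (indicator {a}) \<in> affine_simplex (insert a ?B)" if "z \<in> {0..1} \<times> ?T" for z
      proof -
        have z: "fst z \<in> {0..1}" "snd z \<in> ?T"
          using that by auto
        have "snd z \<in> affine_simplex (insert a ?B)"
          using T'[OF z(2)] aff by blast
        moreover have "indicator {a} \<in> affine_simplex (insert a ?B)"
          using fB by (intro ia) simp
        ultimately show ?thesis
          using z(1) by (intro seg_in_affine_simplex) auto
      qed
    qed
    then have "continuous_map (top_of_set ({0..1} \<times> ?T)) ?X ?g"
    proof (rule continuous_map_eq)
      fix z assume "z \<in> topspace (top_of_set ({0..1::real} \<times> ?T))"
      then have z: "fst z \<in> {0..1}" "snd z \<in> ?T"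
        by auto
      show "pt A (insert a ?B) \<tau> (seg (fst z) (snd z) (indicator {a})) = ?g z"
        using eq[OF z(2,1)] by (simp add: case_prod_unfold)
    qed
    then show ?thesis
      by simp
  qed
qed

section \<open>Lifting maps of cubes to cones\<close>

text \<open>The path along \<open>\<beta>\<close> to \<open>p\<close> and then inside the carrier of
  \<open>p\<close> to \<open>v\<close>.\<close>

definition approach_path ::
  "('v, 's) premulticomplex \<Rightarrow> (real \<Rightarrow> ('v, 's) cell_point set) \<Rightarrow> ('v, 's) cell_point set \<Rightarrow> 'v \<Rightarrow>
    real \<Rightarrow> ('v, 's) cell_point set" where
  "approach_path A \<beta> p v = corner_path A (supp (coord p)) (carrier_simplex A p) (coord p) \<beta> v"

lemma approach_path_eq:
  "approach_path A \<beta> p v s = (if s \<le> 2 / 3 then \<beta> (3 / 2 * s) else slide A v p (3 * s - 2))"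
  by (simp add: approach_path_def corner_path_def slide_def)

lemma slide_ends:
  assumes A: "multicomplex A" and p: "p \<in> star A v"
  shows "slide A v p 0 = p" "slide A v p 1 = vertex_point A v"
proof -
  have pX: "p \<in> topspace (realization A)" and v: "v \<in> supp (coord p)"
    using p by (auto simp: star_def supp_def)
  show "slide A v p 0 = p"
    using carrier_of_point(3)[OF A pX] by (simp add: slide_def)
  show "slide A v p 1 = vertex_point A v"
    using vertex_point_of_simplex[OF A carrier_of_point(1)[OF A pX] v] by (simp add: slide_def)
qed

text \<open>The slide depends continuously on the point where it starts as long as this point stays in the
  open star of \<open>v\<close>.\<close>

lemma approach_path_homotopic:
  fixes b :: "real \<Rightarrow> real \<Rightarrow> ('v, 's) cell_point set"
  assumes A: "multicomplex A"
    and b: "continuous_map (top_of_set ({0..1} \<times> {0..1})) (realization A) (\<lambda>z. b (fst z) (snd z))"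
    and start: "\<And>\<mu>. \<mu> \<in> {0..1} \<Longrightarrow> b \<mu> 0 = p0"
    and ends: "\<And>\<mu>. \<mu> \<in> {0..1} \<Longrightarrow> b \<mu> 1 \<in> star A v"
  shows "homotopic_rel {0, 1} \<I> (realization A) (approach_path A (b 0) (b 0 1) v) (approach_path A (b 1) (b 1 1) v)"
proof (rule homotopic_relI[where h="\<lambda>z. approach_path A (b (fst z)) (b (fst z) 1) v (snd z)"])
  let ?X = "realization A" and ?S = "{0..1::real} \<times> {0..1::real}"
  have "continuous_map (top_of_set ?S) ?X (\<lambda>z. if snd z \<le> 2 / 3 then b (fst z) (3 / 2 * snd z)
      else slide A v (b (fst z) 1) (3 * snd z - 2))"
  proof (rule continuous_map_split)
    have "continuous_map (top_of_set (?S \<inter> {z. snd z \<le> 2 / 3})) ?X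
        (\<lambda>z. (\<lambda>z. b (fst z) (snd z)) (fst z, 3 / 2 * snd z))"
      by (rule continuous_map_on_compose[OF b]) (auto intro!: continuous_intros)
    then show "continuous_map (top_of_set (?S \<inter> {z. snd z \<le> 2 / 3})) ?X (\<lambda>z. b (fst z) (3 / 2 * snd z))"
      by simp
    let ?U = "?S \<inter> {z. 2 / 3 \<le> snd z}"
    have "continuous_map (top_of_set ?U) ?X (\<lambda>z. (\<lambda>z. b (fst z) (snd z)) (fst z, 1))"
      by (rule continuous_map_on_compose[OF b]) (auto intro!: continuous_intros)
    then have 1: "continuous_map (top_of_set ?U) (subtopology ?X (star A v)) (\<lambda>z. b (fst z) 1)"
      using ends by (intro continuous_map_into_subtopology) auto
    have 2: "continuous_map (top_of_set ?U) \<I> (\<lambda>z. 3 * snd z - 2)"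
      by (auto intro!: continuous_intros)
    from continuous_map_compose[OF continuous_map_pairedI[OF 2 1] continuous_map_slide[OF A]]
    show "continuous_map (top_of_set ?U) ?X (\<lambda>z. slide A v (b (fst z) 1) (3 * snd z - 2))"
      by (simp add: o_def)
    show "b (fst z) (3 / 2 * snd z) = slide A v (b (fst z) 1) (3 * snd z - 2)"
      if "z \<in> ?S" "snd z = 2 / 3" for z
    proof -
      have "fst z \<in> {0..1}"
        using that by auto
      then show ?thesis
        using slide_ends(1)[OF A ends] by (simp add: that(2))
    qed
  qed (intro continuous_on_snd continuous_on_id)
  then show "continuous_map (prod_topology \<I> \<I>) ?X (\<lambda>z. approach_path A (b (fst z)) (b (fst z) 1) v (snd z))"
    by (simp add: approach_path_eq)
  show "approach_path A (b (fst (\<mu>, s))) (b (fst (\<mu>, s)) 1) v (snd (\<mu>, s)) = approach_path A (b 0) (b 0 1) v s"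
    if "0 \<le> \<mu>" "\<mu> \<le> 1" "s \<in> {0, 1}" for \<mu> s
  proof -
    have \<mu>: "\<mu> \<in> {0..1}" and z: "(0::real) \<in> {0..1}"
      using that by auto
    show ?thesis
      using that(3) start[OF \<mu>] start[OF z] slide_ends(2)[OF A ends[OF \<mu>]] slide_ends(2)[OF A ends[OF z]]
      by (auto simp: approach_path_eq)
  qed
qed auto

definition ray_path :: "(real \<Rightarrow> 'a) \<Rightarrow> ('b \<Rightarrow> 'a) \<Rightarrow> (real \<Rightarrow> 'b) \<Rightarrow> real \<Rightarrow> 'a" where
  "ray_path \<alpha> f \<zeta> r = (if r \<le> 1 / 2 then \<alpha> (2 * r) else f (\<zeta> (2 * r - 1)))"

lemma ray_path_family:
  fixes \<zeta> :: "real \<Rightarrow> real \<Rightarrow> nat \<Rightarrow> real"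
  assumes A: "multicomplex A" and f: "continuous_map (top_of_set D) (realization A) f"
    and \<alpha>: "continuous_map \<I> (realization A) \<alpha>" "\<alpha> 1 = f c"
    and \<zeta>: "continuous_on ({0..1} \<times> {0..1}) (\<lambda>z. \<zeta> (fst z) (snd z))"
      "\<And>\<mu> r. \<mu> \<in> {0..1} \<Longrightarrow> r \<in> {0..1} \<Longrightarrow> \<zeta> \<mu> r \<in> D" "\<And>\<mu>. \<mu> \<in> {0..1} \<Longrightarrow> \<zeta> \<mu> 0 = c"
    and ends: "\<And>\<mu>. \<mu> \<in> {0..1} \<Longrightarrow> f (\<zeta> \<mu> 1) \<in> star A v"
  shows "homotopic_rel {0, 1} \<I> (realization A)
    (approach_path A (ray_path \<alpha> f (\<zeta> 0)) (f (\<zeta> 0 1)) v) (approach_path A (ray_path \<alpha> f (\<zeta> 1)) (f (\<zeta> 1 1)) v)"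
proof -
  let ?S = "{0..1::real} \<times> {0..1::real}"
  have "homotopic_rel {0, 1} \<I> (realization A)
    (approach_path A (ray_path \<alpha> f (\<zeta> 0)) (ray_path \<alpha> f (\<zeta> 0) 1) v)
    (approach_path A (ray_path \<alpha> f (\<zeta> 1)) (ray_path \<alpha> f (\<zeta> 1) 1) v)"
  proof (rule approach_path_homotopic[OF A])
    show "continuous_map (top_of_set ?S) (realization A) (\<lambda>z. ray_path \<alpha> f (\<zeta> (fst z)) (snd z))"
      unfolding ray_path_def
    proof (rule continuous_map_split)
      show "continuous_map (top_of_set (?S \<inter> {z. snd z \<le> 1 / 2})) (realization A) (\<lambda>z. \<alpha> (2 * snd z))"
        by (rule continuous_map_on_compose[OF \<alpha>(1)]) (auto intro!: continuous_intros)
      have "continuous_on (?S \<inter> {z. 1 / 2 \<le> snd z}) (\<lambda>z. (\<lambda>z. \<zeta> (fst z) (snd z)) (fst z, 2 * snd z - 1))"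
        by (rule continuous_on_compose2[OF \<zeta>(1)]) (auto intro!: continuous_intros)
      then have "continuous_on (?S \<inter> {z. 1 / 2 \<le> snd z}) (\<lambda>z. \<zeta> (fst z) (2 * snd z - 1))"
        by simp
      then show "continuous_map (top_of_set (?S \<inter> {z. 1 / 2 \<le> snd z})) (realization A) (\<lambda>z. f (\<zeta> (fst z) (2 * snd z - 1)))"
        by (rule continuous_map_on_compose[OF f]) (auto intro!: \<zeta>(2))
      show "\<alpha> (2 * snd z) = f (\<zeta> (fst z) (2 * snd z - 1))" if "z \<in> ?S" "snd z = 1 / 2" for z
      proof -
        have "fst z \<in> {0..1}"
          using that by auto
        then show ?thesis
          using \<alpha>(2) \<zeta>(3) by (simp add: that(2))
      qed
    qed (intro continuous_on_snd continuous_on_id)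
    show "ray_path \<alpha> f (\<zeta> \<mu>) 0 = \<alpha> 0" for \<mu>
      by (simp add: ray_path_def)
    show "ray_path \<alpha> f (\<zeta> \<mu>) 1 \<in> star A v" if "\<mu> \<in> {0..1}" for \<mu>
      using ends[OF that] by (simp add: ray_path_def)
  qed
  then show ?thesis
    by (simp add: ray_path_def)
qed

text \<open>The edge of the cone over the carrier of \<open>f u\<close>: it is homotopic to the path from
  \<open>a\<close> along \<open>\<alpha>\<close>, then along the image of the segment from the
  origin to \<open>u\<close>, and then to \<open>v\<close>. The origin serves as base point
  because it lies on the boundary of the cube.\<close>

definition cone_edge ::
  "('v, 's) premulticomplex \<Rightarrow> 'v \<Rightarrow> (real \<Rightarrow> ('v, 's) cell_point set) \<Rightarrow>
    ((nat \<Rightarrow> real) \<Rightarrow> ('v, 's) cell_point set) \<Rightarrow> 'v \<Rightarrow> (nat \<Rightarrow> real) \<Rightarrow> 's" where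
  "cone_edge A a \<alpha> f v u = (THE \<epsilon>. \<epsilon> \<in> simplices A {a, v} \<and> homotopic_rel {0, 1} \<I> (realization A)
     (approach_path A (ray_path \<alpha> f (\<lambda>r. seg r (\<lambda>_. 0) u)) (f u) v) (edge_path A a v \<epsilon>))"

text \<open>The choice of the vertex \<open>v\<close> is immaterial, because the edges to all vertices of
  the carrier belong to the same cone.\<close>

definition cone_homotopy ::
  "('v, 's) premulticomplex \<Rightarrow> 'v \<Rightarrow> (real \<Rightarrow> ('v, 's) cell_point set) \<Rightarrow>
    ((nat \<Rightarrow> real) \<Rightarrow> ('v, 's) cell_point set) \<Rightarrow> real \<Rightarrow> (nat \<Rightarrow> real) \<Rightarrow> ('v, 's) cell_point set" where
  "cone_homotopy A a \<alpha> f s u = (let v = SOME v. v \<in> supp (coord (f u)) in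
     cone_section A a v (cone_edge A a \<alpha> f v u) s (f u))"

lemma cone_edge_cong:
  assumes "homotopic_rel {0, 1} \<I> (realization A)
     (approach_path A (ray_path \<alpha> f (\<lambda>r. seg r (\<lambda>_. 0) u)) (f u) v)
     (approach_path A (ray_path \<alpha> g (\<lambda>r. seg r (\<lambda>_. 0) w)) (g w) v)"
  shows "cone_edge A a \<alpha> f v u = cone_edge A a \<alpha> g v w"
proof -
  have "homotopic_rel {0, 1} \<I> (realization A) (approach_path A (ray_path \<alpha> f (\<lambda>r. seg r (\<lambda>_. 0) u)) (f u) v) k \<longleftrightarrow>
      homotopic_rel {0, 1} \<I> (realization A) (approach_path A (ray_path \<alpha> g (\<lambda>r. seg r (\<lambda>_. 0) w)) (g w) v) k" for k
    using homotopic_rel_trans[OF assms] homotopic_rel_trans[OF homotopic_rel_sym[OF assms]] by blast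
  then show ?thesis
    by (simp add: cone_edge_def)
qed

lemma zero_in_cube: "(\<lambda>_. 0) \<in> cube m"
  by (simp add: cube_def)

context
  fixes A :: "('v, 's) premulticomplex" and a :: 'v and \<alpha> :: "real \<Rightarrow> ('v, 's) cell_point set"
    and f :: "(nat \<Rightarrow> real) \<Rightarrow> ('v, 's) cell_point set" and m :: nat
  assumes A: "multicomplex A" and E1: "unique_edges A" and E2: "unique_fillings A"
    and a: "a \<in> verts A" and f: "continuous_map (top_of_set (cube m)) (realization A) f"
    and avoid: "\<And>u. u \<in> cube m \<Longrightarrow> coord (f u) a = 0"
    and \<alpha>: "continuous_map \<I> (realization A) \<alpha>" "\<alpha> 0 = vertex_point A a" "\<alpha> 1 = f (\<lambda>_. 0)"
begin

lemma cube_image: "u \<in> cube m \<Longrightarrow> f u \<in> topspace (realization A)"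
  using continuous_map_funspace[OF f] by auto

lemma star_iff_supp: "u \<in> cube m \<Longrightarrow> f u \<in> star A v \<longleftrightarrow> v \<in> supp (coord (f u))"
  using affine_simplex_nonneg[OF carrier_of_point(2)[OF A cube_image], of u v] cube_image[of u]
  by (auto simp: star_def supp_def less_le)

lemma ray_continuous:
  "u \<in> cube m \<Longrightarrow> continuous_map \<I> (realization A) (ray_path \<alpha> f (\<lambda>r. seg r (\<lambda>_. 0) u))"
  unfolding ray_path_def
proof (rule continuous_map_split)
  assume u: "u \<in> cube m"
  show "continuous_map (top_of_set ({0..1} \<inter> {r. r \<le> 1 / 2})) (realization A) (\<lambda>r. \<alpha> (2 * r))"
    by (rule continuous_map_on_compose[OF \<alpha>(1)]) (auto intro!: continuous_intros)
  show "continuous_map (top_of_set ({0..1} \<inter> {r. 1 / 2 \<le> r})) (realization A) (\<lambda>r. f (seg (2 * r - 1) (\<lambda>_. 0) u))"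
    by (rule continuous_map_on_compose[OF f])
      (use u zero_in_cube in \<open>auto intro!: seg_in_cube continuous_on_seg continuous_intros\<close>)
  show "\<alpha> (2 * r) = f (seg (2 * r - 1) (\<lambda>_. 0) u)" if "r = 1 / 2" for r
    using \<alpha>(3) by (simp add: that)
qed (intro continuous_on_id)

lemma cone_edge:
  assumes u: "u \<in> cube m" and v: "v \<in> supp (coord (f u))"
  shows "a \<noteq> v" "cone_edge A a \<alpha> f v u \<in> simplices A {a, v}"
    "homotopic_rel {0, 1} \<I> (realization A) (edge_path A a v (cone_edge A a \<alpha> f v u))
      (approach_path A (ray_path \<alpha> f (\<lambda>r. seg r (\<lambda>_. 0) u)) (f u) v)"
proof -
  note c = carrier_of_point[OF A cube_image[OF u]]
  show av: "a \<noteq> v"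
    using avoid[OF u] v by (auto simp: supp_def)
  have vV: "v \<in> verts A"
    using simplex_verts[OF A c(1)] v by blast
  have end1: "ray_path \<alpha> f (\<lambda>r. seg r (\<lambda>_. 0) u) 1 = pt A (supp (coord (f u))) (carrier_simplex A (f u)) (coord (f u))"
    using c(3) by (simp add: ray_path_def)
  note cp = corner_path[OF A c(1,2) ray_continuous[OF u] end1 v, folded approach_path_def]
  have "approach_path A (ray_path \<alpha> f (\<lambda>r. seg r (\<lambda>_. 0) u)) (f u) v 0 = vertex_point A a"
    using cp(2) \<alpha>(2) by (simp add: ray_path_def)
  from theI'[OF unique_edgesD[OF E1 a vV av cp(1) this cp(3)], folded cone_edge_def]
  show "cone_edge A a \<alpha> f v u \<in> simplices A {a, v}"
    "homotopic_rel {0, 1} \<I> (realization A) (edge_path A a v (cone_edge A a \<alpha> f v u))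
      (approach_path A (ray_path \<alpha> f (\<lambda>r. seg r (\<lambda>_. 0) u)) (f u) v)"
    using homotopic_rel_sym by blast+
qed

text \<open>The approach paths to the vertices of the carrier share the ray to \<open>f u\<close>, so the
  edges form a cone.\<close>

lemma cone_simplex:
  assumes u: "u \<in> cube m"
  obtains \<tau> where "\<tau> \<in> simplices A (insert a (supp (coord (f u))))"
    and "bdry A (insert a (supp (coord (f u)))) (supp (coord (f u))) \<tau> = carrier_simplex A (f u)"
    and "\<And>v s. v \<in> supp (coord (f u)) \<Longrightarrow> cone_section A a v (cone_edge A a \<alpha> f v u) s (f u) =
      pt A (insert a (supp (coord (f u)))) \<tau> (seg s (coord (f u)) (indicator {a}))"
proof -
  let ?C = "supp (coord (f u))"
  note c = carrier_of_point[OF A cube_image[OF u]]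
  have aC: "a \<notin> ?C"
    using avoid[OF u] by (simp add: supp_def)
  have end1: "ray_path \<alpha> f (\<lambda>r. seg r (\<lambda>_. 0) u) 1 = pt A ?C (carrier_simplex A (f u)) (coord (f u))"
    using c(3) by (simp add: ray_path_def)
  have "\<exists>\<tau>\<in>simplices A (insert a ?C). bdry A (insert a ?C) ?C \<tau> = carrier_simplex A (f u) \<and>
      (\<forall>v\<in>?C. bdry A (insert a ?C) {a, v} \<tau> = cone_edge A a \<alpha> f v u)"
    by (rule cone_simplex_exists[OF A E2 c(1,2) ray_continuous[OF u] end1 aC a])
      (use cone_edge[OF u] in \<open>simp_all add: approach_path_def\<close>)
  then obtain \<tau> where \<tau>: "\<tau> \<in> simplices A (insert a ?C)" "bdry A (insert a ?C) ?C \<tau> = carrier_simplex A (f u)"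
    and e: "\<And>v. v \<in> ?C \<Longrightarrow> bdry A (insert a ?C) {a, v} \<tau> = cone_edge A a \<alpha> f v u"
    by blast
  show ?thesis
    by (rule that[OF \<tau>]) (rule cone_section_eq[OF A E1 E2 \<tau> e aC])
qed

lemma cone_homotopy_eq:
  assumes u: "u \<in> cube m" and v: "v \<in> supp (coord (f u))"
  shows "cone_homotopy A a \<alpha> f s u = cone_section A a v (cone_edge A a \<alpha> f v u) s (f u)"
proof -
  have w: "(SOME v. v \<in> supp (coord (f u))) \<in> supp (coord (f u))"
    using v by (rule someI)
  show ?thesis
    unfolding cone_homotopy_def Let_def
    by (rule cone_simplex[OF u]) (simp only: v w)
qed

lemma cone_homotopy_ends:
  assumes u: "u \<in> cube m"
  shows "cone_homotopy A a \<alpha> f 0 u = f u" "cone_homotopy A a \<alpha> f 1 u = vertex_point A a"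
proof -
  let ?C = "supp (coord (f u))"
  note c = carrier_of_point[OF A cube_image[OF u]]
  obtain v where v: "v \<in> ?C"
    using supp_nonempty[OF c(2)] by blast
  obtain \<tau> where \<tau>: "\<tau> \<in> simplices A (insert a ?C)" "bdry A (insert a ?C) ?C \<tau> = carrier_simplex A (f u)"
    and eq: "\<And>v s. v \<in> ?C \<Longrightarrow> cone_section A a v (cone_edge A a \<alpha> f v u) s (f u) =
      pt A (insert a ?C) \<tau> (seg s (coord (f u)) (indicator {a}))"
    by (rule cone_simplex[OF u]) (rule that)
  have "cone_homotopy A a \<alpha> f 0 u = pt A (insert a ?C) \<tau> (coord (f u))"
    by (simp add: cone_homotopy_eq[OF u v] eq[OF v])
  also have "\<dots> = pt A ?C (carrier_simplex A (f u)) (coord (f u))"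
    using pt_face[OF \<tau>(1) _ c(2)] \<tau>(2) by auto
  also have "\<dots> = f u"
    by (rule c(3))
  finally show "cone_homotopy A a \<alpha> f 0 u = f u" .
  show "cone_homotopy A a \<alpha> f 1 u = vertex_point A a"
    using vertex_point_of_simplex[OF A \<tau>(1)] by (simp add: cone_homotopy_eq[OF u v] eq[OF v])
qed

text \<open>Nearby points have homotopic approach paths, by sweeping the ray along the segment between
  them; so the edge to a fixed vertex of the carrier is locally constant.\<close>

lemma cone_edge_locally_constant:
  assumes u: "u \<in> cube m" and v: "v \<in> supp (coord (f u))"
  obtains N where "openin (top_of_set (cube m)) N" "u \<in> N"
    "\<And>w. w \<in> N \<Longrightarrow> v \<in> supp (coord (f w)) \<and> cone_edge A a \<alpha> f v w = cone_edge A a \<alpha> f v u"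
proof -
  let ?D = "top_of_set (cube m)"
  let ?O = "{w \<in> cube m. f w \<in> star A v}"
  have "openin ?D {w \<in> topspace ?D. f w \<in> star A v}"
    using openin_star(1)[OF A, of v] by (intro openin_continuous_map_preimage[OF f]) (simp add: star_def)
  then have O: "openin ?D ?O"
    by simp
  let ?q = "\<lambda>z. seg (fst z) u (snd z)"
  have "continuous_on ({0..1} \<times> cube m) ?q"
    by (intro continuous_on_seg continuous_on_fst continuous_on_snd continuous_on_id continuous_on_const)
  moreover have "?q z \<in> cube m" if "z \<in> {0..1} \<times> cube m" for z
    using that u by (intro seg_in_cube) auto
  ultimately have q: "continuous_map (prod_topology \<I> ?D) ?D ?q"
    by auto
  have W: "openin (prod_topology \<I> ?D) {z \<in> topspace (prod_topology \<I> ?D). ?q z \<in> ?O}"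
    by (rule openin_continuous_map_preimage[OF q O])
  have "compactin \<I> {0..1}"
    by (simp add: compactin_subtopology)
  moreover have "{0..1} \<times> {u} \<subseteq> {z \<in> topspace (prod_topology \<I> ?D). ?q z \<in> ?O}"
    using u v star_iff_supp[OF u] by auto
  ultimately obtain U N where UN: "openin ?D N" "{0..1} \<subseteq> U" "u \<in> N"
    "U \<times> N \<subseteq> {z \<in> topspace (prod_topology \<I> ?D). ?q z \<in> ?O}"
    using tube_lemma_left[OF W, of "{0..1}" u] u by auto
  have NC: "N \<subseteq> cube m"
    using openin_subset[OF UN(1)] by simp
  have q': "f (seg \<mu> u w) \<in> star A v" if "\<mu> \<in> {0..1}" "w \<in> N" for \<mu> w
  proof -
    have "(\<mu>, w) \<in> U \<times> N"
      using UN(2) that by blast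
    then show ?thesis
      using UN(4) by auto
  qed
  have "v \<in> supp (coord (f w)) \<and> cone_edge A a \<alpha> f v w = cone_edge A a \<alpha> f v u" if w: "w \<in> N" for w
  proof
    have wC: "w \<in> cube m"
      using NC w by blast
    show "v \<in> supp (coord (f w))"
      using q'[of 1 w] w star_iff_supp[OF wC] by simp
    let ?\<zeta> = "\<lambda>\<mu> r. seg r (\<lambda>_. 0) (seg \<mu> u w)"
    have "homotopic_rel {0, 1} \<I> (realization A)
        (approach_path A (ray_path \<alpha> f (?\<zeta> 0)) (f (?\<zeta> 0 1)) v) (approach_path A (ray_path \<alpha> f (?\<zeta> 1)) (f (?\<zeta> 1 1)) v)"
    proof (rule ray_path_family[OF A f \<alpha>(1,3)])
      show "continuous_on ({0..1} \<times> {0..1}) (\<lambda>z. ?\<zeta> (fst z) (snd z))"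
        by (intro continuous_on_seg continuous_on_fst continuous_on_snd continuous_on_id continuous_on_const)
      show "?\<zeta> \<mu> r \<in> cube m" if "\<mu> \<in> {0..1}" "r \<in> {0..1}" for \<mu> r
        using that u wC zero_in_cube by (intro seg_in_cube) auto
      show "f (?\<zeta> \<mu> 1) \<in> star A v" if "\<mu> \<in> {0..1}" for \<mu>
        using q'[OF that w] by simp
    qed simp
    then show "cone_edge A a \<alpha> f v w = cone_edge A a \<alpha> f v u"
      using cone_edge_cong[of A \<alpha> f u v f w a] by simp
  qed
  then show ?thesis
    by (rule that[OF UN(1,3)])
qed

text \<open>Near \<open>u\<close> the edge to a fixed vertex of the carrier does not change, so the homotopy
  is the composite of \<open>f\<close> with one cone section.\<close>

lemma continuous_map_cone_homotopy:
  "continuous_map (prod_topology \<I> (top_of_set (cube m))) (realization A) (\<lambda>(s, u). cone_homotopy A a \<alpha> f s u)"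
proof -
  let ?D = "top_of_set (cube m)" and ?X = "realization A"
  have "\<forall>u\<in>cube m. \<exists>v. v \<in> supp (coord (f u))"
    using supp_nonempty[OF carrier_of_point(2)[OF A cube_image]] by blast
  from bchoice[OF this] obtain v where v': "\<forall>u\<in>cube m. v u \<in> supp (coord (f u))"
    by (elim exE) (rule that)
  have v: "v u \<in> supp (coord (f u))" if "u \<in> cube m" for u
    using v' that by (rule bspec)
  have "\<forall>u\<in>cube m. \<exists>N. openin ?D N \<and> u \<in> N \<and>
      (\<forall>w\<in>N. v u \<in> supp (coord (f w)) \<and> cone_edge A a \<alpha> f (v u) w = cone_edge A a \<alpha> f (v u) u)"
  proof
    fix u assume u: "u \<in> cube m"
    show "\<exists>N. openin ?D N \<and> u \<in> N \<and>
      (\<forall>w\<in>N. v u \<in> supp (coord (f w)) \<and> cone_edge A a \<alpha> f (v u) w = cone_edge A a \<alpha> f (v u) u)"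
      by (rule cone_edge_locally_constant[OF u v[OF u]]) blast
  qed
  from bchoice[OF this] obtain N where N': "\<forall>u\<in>cube m. openin ?D (N u) \<and> u \<in> N u \<and>
      (\<forall>w\<in>N u. v u \<in> supp (coord (f w)) \<and> cone_edge A a \<alpha> f (v u) w = cone_edge A a \<alpha> f (v u) u)"
    by (elim exE) (rule that)
  note N = conjunct1[OF bspec[OF N']] conjunct1[OF conjunct2[OF bspec[OF N']]]
  note Nv = conjunct1[OF bspec[OF conjunct2[OF conjunct2[OF bspec[OF N']]]]]
    conjunct2[OF bspec[OF conjunct2[OF conjunct2[OF bspec[OF N']]]]]
  have NC: "N u \<subseteq> cube m" if "u \<in> cube m" for u
    using openin_subset[OF N(1)[OF that]] by simp
  show ?thesis
  proof (rule pasting_lemma[where I="cube m" and T="\<lambda>u. topspace \<I> \<times> N u"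
        and f="\<lambda>u. \<lambda>(s, w). cone_homotopy A a \<alpha> f s w"])
    fix u assume u: "u \<in> cube m"
    show "openin (prod_topology \<I> ?D) (topspace \<I> \<times> N u)"
      using N(1)[OF u] by (simp only: openin_prod_Times_iff openin_topspace simp_thms)
    let ?e = "cone_edge A a \<alpha> f (v u) u"
    let ?Z = "star A (v u) \<inter> {p \<in> topspace ?X. coord p a = 0}"
    have fN: "f w \<in> ?Z" if "w \<in> N u" for w
    proof -
      have w: "w \<in> cube m"
        using NC[OF u] that by blast
      show ?thesis
        using star_iff_supp[OF w] Nv(1)[OF u that] avoid[OF w] cube_image[OF w] by blast
    qed
    have sub: "subtopology (prod_topology \<I> ?D) (topspace \<I> \<times> N u) = prod_topology \<I> (subtopology ?D (N u))"
      by (simp only: subtopology_Times subtopology_topspace)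
    have "continuous_map (subtopology ?D (N u)) ?X f"
      by (rule continuous_map_from_subtopology[OF f])
    then have "continuous_map (subtopology ?D (N u)) (subtopology ?X ?Z) f"
      by (rule continuous_map_into_subtopology) (use fN in auto)
    then have "continuous_map (prod_topology \<I> (subtopology ?D (N u))) (prod_topology \<I> (subtopology ?X ?Z))
        (\<lambda>z. (fst z, f (snd z)))"
      by (intro continuous_map_pairedI continuous_map_fst continuous_map_compose[OF continuous_map_snd, unfolded o_def])
    from continuous_map_compose[OF this continuous_map_cone_section[OF A E1 E2 cone_edge(1,2)[OF u v[OF u]]]]
    have "continuous_map (prod_topology \<I> (subtopology ?D (N u))) ?X (\<lambda>z. cone_section A a (v u) ?e (fst z) (f (snd z)))"
      by (simp add: o_def)
    then have "continuous_map (prod_topology \<I> (subtopology ?D (N u))) ?X (\<lambda>(s, w). cone_homotopy A a \<alpha> f s w)"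
    proof (rule continuous_map_eq)
      fix z assume z: "z \<in> topspace (prod_topology \<I> (subtopology ?D (N u)))"
      then have w: "snd z \<in> N u" "snd z \<in> cube m"
        by auto
      show "cone_section A a (v u) ?e (fst z) (f (snd z)) = (\<lambda>(s, w). cone_homotopy A a \<alpha> f s w) z"
        using cone_homotopy_eq[OF w(2) Nv(1)[OF u w(1)]] Nv(2)[OF u w(1)] by (simp add: case_prod_unfold)
    qed
    then show "continuous_map (subtopology (prod_topology \<I> ?D) (topspace \<I> \<times> N u)) ?X (\<lambda>(s, w). cone_homotopy A a \<alpha> f s w)"
      by (simp only: sub)
  next
    fix z assume "z \<in> topspace (prod_topology \<I> ?D)"
    then have "fst z \<in> topspace \<I>" "snd z \<in> cube m"
      by auto
    then show "\<exists>j. j \<in> cube m \<and> z \<in> topspace \<I> \<times> N j \<and>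
        (\<lambda>(s, u). cone_homotopy A a \<alpha> f s u) z = (\<lambda>(s, w). cone_homotopy A a \<alpha> f s w) z"
      using N(2)[of "snd z"] by (intro exI[of _ "snd z"]) (simp add: mem_Times_iff)
  qed simp
qed

end

text \<open>A boundary point is joined to the origin by a broken line inside the boundary: first to the
  point with a single nonzero coordinate, then within a facet.\<close>

lemma cube_boundary_path:
  assumes m: "m \<ge> 2" and y: "y \<in> cube_boundary m"
  obtains \<delta> where "continuous_on {0..1} \<delta>" "\<And>r. r \<in> {0..1} \<Longrightarrow> \<delta> r \<in> cube_boundary m"
    "\<delta> 0 = (\<lambda>_. 0)" "\<delta> (1::real) = y"
proof -
  obtain i where i: "i < m" "y i = 0 \<or> y i = 1" and yC: "y \<in> cube m"
    using y by (auto simp: cube_boundary_def)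
  define j where "j = (if i = 0 then 1 else 0 :: nat)"
  have j: "j < m" "j \<noteq> i"
    using m by (auto simp: j_def)
  define z where "z = (\<lambda>k. if k = i then y i else 0)"
  have zC: "z \<in> cube m"
    using yC i by (auto simp: z_def cube_def)
  define \<delta> where "\<delta> = (\<lambda>r. if r \<le> 1 / 2 then seg (2 * r) (\<lambda>_. 0) z else seg (2 * r - 1) z y)"
  have "continuous_map (top_of_set {0..1}) (top_of_set UNIV) \<delta>"
    unfolding \<delta>_def
  proof (rule continuous_map_split)
    show "seg (2 * r) (\<lambda>_. 0) z = seg (2 * r - 1) z y" if "r = 1 / 2" for r
      unfolding that by simp
  qed (auto intro!: continuous_on_seg continuous_intros)
  moreover have "\<delta> r \<in> cube_boundary m" if r: "r \<in> {0..1}" for r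
  proof (cases "r \<le> 1 / 2")
    case True
    then have "\<delta> r \<in> cube m"
      using r zC zero_in_cube by (simp add: \<delta>_def seg_in_cube)
    moreover have "\<delta> r j = 0"
      using True j by (simp add: \<delta>_def seg_def z_def)
    ultimately show ?thesis
      using j by (auto simp: cube_boundary_def)
  next
    case False
    then have "\<delta> r \<in> cube m"
      using r zC yC by (simp add: \<delta>_def seg_in_cube)
    moreover have "\<delta> r i = y i"
      using False by (simp add: \<delta>_def seg_def z_def algebra_simps)
    ultimately show ?thesis
      using i by (auto simp: cube_boundary_def)
  qed
  ultimately show ?thesis
    by (intro that[of \<delta>]) (simp_all add: \<delta>_def)
qed

section \<open>Contracting cubes\<close>

text \<open>The cube is convex, so the segment from the origin to \<open>y\<close> can be deformed to
  \<open>\<delta>\<close>.\<close>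

lemma cone_edge_boundary:
  assumes A: "multicomplex A" and m: "m \<ge> 2"
    and f: "continuous_map (top_of_set (cube m)) (realization A) f"
    and \<alpha>: "continuous_map \<I> (realization A) \<alpha>" "\<alpha> 1 = f (\<lambda>_. 0)"
    and \<delta>: "continuous_on {0..1} \<delta>" "\<And>r. r \<in> {0..1} \<Longrightarrow> \<delta> r \<in> cube m" "\<delta> 0 = (\<lambda>_. 0)" "\<delta> 1 = y"
    and y: "y \<in> cube m" "f y \<in> star A v"
  shows "homotopic_rel {0, 1} \<I> (realization A) (approach_path A (ray_path \<alpha> f (\<lambda>r. seg r (\<lambda>_. 0) y)) (f y) v)
    (approach_path A (ray_path \<alpha> f \<delta>) (f y) v)"
proof -
  let ?\<zeta> = "\<lambda>\<mu> r. seg \<mu> (seg r (\<lambda>_. 0) y) (\<delta> r)"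
  have "homotopic_rel {0, 1} \<I> (realization A)
      (approach_path A (ray_path \<alpha> f (?\<zeta> 0)) (f (?\<zeta> 0 1)) v) (approach_path A (ray_path \<alpha> f (?\<zeta> 1)) (f (?\<zeta> 1 1)) v)"
  proof (rule ray_path_family[OF A f \<alpha>])
    have "continuous_on ({0..1::real} \<times> {0..1}) (\<lambda>z. \<delta> (snd z))"
      by (rule continuous_on_compose2[OF \<delta>(1)]) (auto intro!: continuous_intros)
    then show "continuous_on ({0..1} \<times> {0..1}) (\<lambda>z. ?\<zeta> (fst z) (snd z))"
      by (intro continuous_on_seg continuous_on_fst continuous_on_snd continuous_on_id continuous_on_const)
    show "?\<zeta> \<mu> r \<in> cube m" if "\<mu> \<in> {0..1}" "r \<in> {0..1}" for \<mu> r
      using that \<delta>(2)[OF that(2)] y(1) zero_in_cube by (intro seg_in_cube) auto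
    show "?\<zeta> \<mu> 0 = (\<lambda>_. 0)" for \<mu>
      by (simp add: \<delta>(3))
    show "f (?\<zeta> \<mu> 1) \<in> star A v" for \<mu>
      using y(2) by (simp add: \<delta>(4))
  qed
  then show ?thesis
    by (simp add: \<delta>(4))
qed

text \<open>Replace the segment from the origin to \<open>y\<close> by a path in the boundary, where
  \<open>f\<close> and \<open>g\<close> agree; this determines the same edges for both. For
  \<open>m = 1\<close> there would be no such path.\<close>

lemma cone_homotopy_boundary:
  assumes A: "multicomplex A" and m: "m \<ge> 2"
    and f: "continuous_map (top_of_set (cube m)) (realization A) f"
    and g: "continuous_map (top_of_set (cube m)) (realization A) g"
    and fg: "\<And>u. u \<in> cube_boundary m \<Longrightarrow> f u = g u"
    and \<alpha>: "continuous_map \<I> (realization A) \<alpha>" "\<alpha> 1 = f (\<lambda>_. 0)"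
    and y: "y \<in> cube_boundary m"
  shows "cone_homotopy A a \<alpha> f s y = cone_homotopy A a \<alpha> g s y"
proof -
  have yC: "y \<in> cube m"
    using y cube_boundary_subset by blast
  have gy: "g y = f y"
    using fg[OF y] by simp
  have fyX: "f y \<in> topspace (realization A)"
    using continuous_map_funspace[OF f] yC by auto
  note c = carrier_of_point[OF A fyX]
  define v where "v = (SOME v. v \<in> supp (coord (f y)))"
  have v: "v \<in> supp (coord (f y))"
    unfolding v_def using supp_nonempty[OF c(2)] by (metis all_not_in_conv someI)
  have st: "f y \<in> star A v"
    using v fyX affine_simplex_nonneg[OF c(2), of v] by (auto simp: star_def supp_def less_le)
  obtain \<delta> where \<delta>: "continuous_on {0..1} \<delta>" "\<And>r. r \<in> {0..1} \<Longrightarrow> \<delta> r \<in> cube_boundary m"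
    "\<delta> 0 = (\<lambda>_. 0)" "\<delta> (1::real) = y"
    by (rule cube_boundary_path[OF m y]) (rule that)
  have \<delta>C: "\<delta> r \<in> cube m" if "r \<in> {0..1}" for r
    using \<delta>(2)[OF that] cube_boundary_subset by blast
  have z: "(\<lambda>_. 0) \<in> cube_boundary m"
    using \<delta>(2)[of 0] \<delta>(3) by simp
  have \<alpha>g: "\<alpha> 1 = g (\<lambda>_. 0)"
    using \<alpha>(2) fg[OF z] by simp
  have hf: "homotopic_rel {0, 1} \<I> (realization A) (approach_path A (ray_path \<alpha> f (\<lambda>r. seg r (\<lambda>_. 0) y)) (f y) v)
    (approach_path A (ray_path \<alpha> f \<delta>) (f y) v)"
    by (rule cone_edge_boundary[OF A m f \<alpha> \<delta>(1) \<delta>C \<delta>(3,4) yC st])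
  have hg: "homotopic_rel {0, 1} \<I> (realization A) (approach_path A (ray_path \<alpha> g (\<lambda>r. seg r (\<lambda>_. 0) y)) (g y) v)
    (approach_path A (ray_path \<alpha> g \<delta>) (g y) v)"
    by (rule cone_edge_boundary[OF A m g \<alpha>(1) \<alpha>g \<delta>(1) \<delta>C \<delta>(3,4) yC st[folded gy]])
  have ray: "ray_path \<alpha> f \<delta> r = ray_path \<alpha> g \<delta> r" if "r \<in> {0..1}" for r
  proof (cases "r \<le> 1 / 2")
    case False
    then have "2 * r - 1 \<in> {0..1}"
      using that by simp
    then show ?thesis
      using fg[OF \<delta>(2)] False by (simp add: ray_path_def)
  qed (simp add: ray_path_def)
  have eq: "approach_path A (ray_path \<alpha> g \<delta>) (g y) v r = approach_path A (ray_path \<alpha> f \<delta>) (f y) v r"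
    if "r \<in> {0..1}" for r
    using ray[of "3 / 2 * r"] that by (simp add: approach_path_eq gy)
  have "homotopic_rel {0, 1} \<I> (realization A) (approach_path A (ray_path \<alpha> g (\<lambda>r. seg r (\<lambda>_. 0) y)) (g y) v)
    (approach_path A (ray_path \<alpha> f \<delta>) (f y) v)"
    by (rule homotopic_rel_cong[OF hg]) (use eq in auto)
  from homotopic_rel_trans[OF hf homotopic_rel_sym[OF this]]
  have "cone_edge A a \<alpha> f v y = cone_edge A a \<alpha> g v y"
    by (rule cone_edge_cong)
  then show ?thesis
    unfolding cone_homotopy_def gy v_def[symmetric] Let_def by simp
qed

lemma large_imp_infinite_vertices:
  assumes "large A" "x \<in> topspace (realization A)"
  shows "infinite (verts A)"
proof -
  let ?C = "connected_component_of_set (realization A) x"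
  have "?C \<in> connected_components_of (realization A)"
    using assms(2) by (simp add: connected_components_of_def)
  then have "infinite {v \<in> verts A. vertex_point A v \<in> ?C}"
    using assms(1) unfolding large_def by blast
  then show ?thesis
    using finite_subset[of "{v \<in> verts A. vertex_point A v \<in> ?C}" "verts A"] by blast
qed

lemma vertex_point_in_topspace:
  "multicomplex A \<Longrightarrow> v \<in> verts A \<Longrightarrow> vertex_point A v \<in> topspace (realization A)"
  unfolding vertex_point_eq
  by (intro pt_in_topspace vertex_simplex) (auto intro: indicator_in_affine_simplex)

text \<open>Squeeze \<open>f\<close> into the inner half of the cube by following the contraction
  \<open>H\<close> on the inner half and its trace on the boundary in the outer half. The
  resulting map involves only the final stage of \<open>H\<close> and its values on the
  boundary.\<close>

lemma homotopic_rel_to_cone: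
  assumes m: "m \<ge> 1" and H: "continuous_map (prod_topology \<I> (top_of_set (cube m))) X (\<lambda>(s, u). H s u)"
    and H0: "\<And>u. u \<in> cube m \<Longrightarrow> H 0 u = f u"
  shows "homotopic_rel (cube_boundary m) (top_of_set (cube m)) X f
    (\<lambda>u. H (1 - max 0 (2 * cube_norm m u - 1)) (rescale m (1 / max (cube_norm m u) (1 / 2)) u))"
proof -
  let ?N = "cube_norm m" and ?D = "top_of_set (cube m)"
  let ?k = "\<lambda>\<rho>::real. 1 / max \<rho> (1 / 2)"
  let ?s = "\<lambda>u. rescale m (?k (?N u)) u"
  have N0: "0 \<le> ?N u" for u
    by (rule cube_norm_nonneg[OF m])
  have N1: "?N u \<le> 1" if "u \<in> cube m" for u
    by (rule cube_norm_le_1[OF m that])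
  have k: "0 \<le> ?k \<rho> \<and> ?k \<rho> * \<rho> \<le> 1" if "0 \<le> \<rho>" for \<rho>
    using that by (auto simp: max_def)
  have sC: "?s u \<in> cube m" if "u \<in> cube m" for u
    using k[OF N0] by (intro rescale_in_cube[OF m]) auto
  have f: "continuous_map ?D X f"
  proof -
    have "continuous_map ?D (prod_topology \<I> ?D) (\<lambda>u. (0, u))"
      by (intro continuous_map_pairedI) auto
    from continuous_map_compose[OF this H] have "continuous_map ?D X (\<lambda>u. H 0 u)"
      by (simp add: o_def)
    then show ?thesis
      by (rule continuous_map_eq) (simp add: H0)
  qed
  have 1: "homotopic_rel (cube_boundary m) ?D X f (\<lambda>u. f (?s u))"
  proof (rule homotopic_rel_stretch[OF m f])
    show "continuous_on {0..1} ?k"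
      by (intro continuous_on_divide continuous_on_const continuous_on_max continuous_on_id) (simp add: max_def)
  qed (use k in auto)
  have 2: "homotopic_rel (cube_boundary m) ?D X (\<lambda>u. f (?s u)) (\<lambda>u. H (1 - max 0 (2 * ?N u - 1)) (?s u))"
  proof (rule homotopic_relI[where h="\<lambda>z. H (min (fst z) (1 - max 0 (2 * ?N (snd z) - 1))) (?s (snd z))"])
    let ?S = "{0..1::real} \<times> cube m"
    let ?j = "\<lambda>z. (min (fst z) (1 - max 0 (2 * ?N (snd z) - 1)), ?s (snd z))"
    have cN: "continuous_on ?S (\<lambda>z. ?N (snd z))"
      by (intro continuous_on_cube_norm[OF m] continuous_on_snd continuous_on_id)
    have c1: "continuous_on ?S (\<lambda>z. min (fst z) (1 - max 0 (2 * ?N (snd z) - 1)))"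
      by (intro continuous_on_min continuous_on_diff continuous_on_max continuous_on_mult continuous_on_const
          continuous_on_fst continuous_on_id cN)
    have ck: "continuous_on ?S (\<lambda>z. ?k (?N (snd z)))"
      by (intro continuous_on_divide continuous_on_const continuous_on_max cN) (simp add: max_def)
    have c2: "continuous_on ?S (\<lambda>z. ?s (snd z))"
      by (intro continuous_on_rescale ck continuous_on_snd continuous_on_id)
    have jS: "?j z \<in> ?S" if "z \<in> ?S" for z
    proof -
      have z: "fst z \<in> {0..1}" "snd z \<in> cube m"
        using that by auto
      have "0 \<le> min (fst z) (1 - max 0 (2 * ?N (snd z) - 1))" "min (fst z) (1 - max 0 (2 * ?N (snd z) - 1)) \<le> 1"
        using z(1) N1[OF z(2)] by auto
      then show ?thesis
        using sC[OF z(2)] by simp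
    qed
    have H': "continuous_map (top_of_set ?S) X (\<lambda>(s, u). H s u)"
      using H by simp
    have "continuous_map (top_of_set ?S) X (\<lambda>z. (\<lambda>(s, u). H s u) (?j z))"
      by (rule continuous_map_on_compose[OF H' continuous_on_Pair[OF c1 c2] jS])
    then show "continuous_map (prod_topology \<I> ?D) X (\<lambda>z. H (min (fst z) (1 - max 0 (2 * ?N (snd z) - 1))) (?s (snd z)))"
      by simp
    show "cube_boundary m \<subseteq> topspace ?D"
      using cube_boundary_subset[of m] by simp
    show "H (min (fst (0, u)) (1 - max 0 (2 * ?N (snd (0, u)) - 1))) (?s (snd (0, u))) = f (?s u)"
      if "u \<in> topspace ?D" for u
    proof -
      have u: "u \<in> cube m"
        using that by simp
      then have "min 0 (1 - max 0 (2 * ?N u - 1)) = 0"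
        using N1[OF u] by simp
      then show ?thesis
        using H0[OF sC[OF u]] by simp
    qed
    show "H (min (fst (1, u)) (1 - max 0 (2 * ?N (snd (1, u)) - 1))) (?s (snd (1, u))) =
        H (1 - max 0 (2 * ?N u - 1)) (?s u)" for u
    proof -
      have "min 1 (1 - max 0 (2 * ?N u - 1)) = 1 - max 0 (2 * ?N u - 1)"
        by simp
      then show ?thesis
        by simp
    qed
    show "H (min (fst (s, u)) (1 - max 0 (2 * ?N (snd (s, u)) - 1))) (?s (snd (s, u))) = f (?s u)"
      if s: "0 \<le> s" "s \<le> 1" and u: "u \<in> cube_boundary m" for s u
    proof -
      have uC: "u \<in> cube m"
        using u cube_boundary_subset by blast
      have "?N u = 1"
        using cube_boundary_iff_norm[OF m uC] u by simp
      then have "min s (1 - max 0 (2 * ?N u - 1)) = 0"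
        using s by simp
      then show ?thesis
        using H0[OF sC[OF uC]] by simp
    qed
  qed
  from 1 2 show ?thesis
    by (rule homotopic_rel_trans)
qed

text \<open>The contractions of both maps towards the same vertex \<open>a\<close> agree on the boundary and
  end at \<open>a\<close>, so both maps are homotopic to the same map.\<close>

lemma unique_cube_filling_if_unique_edges_fillings:
  assumes A: "multicomplex A" and large: "large A" and conn: "connected_space (realization A)"
    and E1: "unique_edges A" and E2: "unique_fillings A" and m: "m \<ge> 2"
  shows "unique_cube_filling (realization A) m"
  unfolding unique_cube_filling_def
proof (intro allI impI)
  let ?X = "realization A" and ?D = "top_of_set (cube m)" and ?N = "cube_norm m"
  fix f g
  assume f: "continuous_map ?D ?X f" and g: "continuous_map ?D ?X g"
    and fg': "\<forall>u\<in>cube_boundary m. f u = g u"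
  have fg: "f u = g u" if "u \<in> cube_boundary m" for u
    using fg' that by (rule bspec)
  have m1: "m \<ge> 1"
    using m by simp
  have "compact (cube m)"
  proof -
    have "cube m = {t. \<forall>v. 0 \<le> t v \<and> t v \<le> 1} \<inter> (\<Inter>i\<in>{m..}. {t. t i = 0})"
      by (auto simp: cube_def)
    then show ?thesis
      using compact_box by (auto intro!: compact_Int_closed closed_INT closed_Collect_eq
          continuous_on_const continuous_on_product_coordinates)
  qed
  then have D: "compactin ?D (cube m)"
    by (simp add: compactin_subtopology)
  have fin: "finite ((\<Union>p\<in>f ` cube m. supp (coord p)) \<union> (\<Union>p\<in>g ` cube m. supp (coord p)))"
    using finite_support_of_compact[OF A image_compactin[OF D f]]
      finite_support_of_compact[OF A image_compactin[OF D g]] by blast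
  have f0: "f (\<lambda>_. 0) \<in> topspace ?X"
    using continuous_map_funspace[OF f] zero_in_cube by auto
  have "infinite (verts A)"
    by (rule large_imp_infinite_vertices[OF large f0])
  then obtain a where a: "a \<in> verts A"
    and a': "a \<notin> (\<Union>p\<in>f ` cube m. supp (coord p)) \<union> (\<Union>p\<in>g ` cube m. supp (coord p))"
    using finite_subset[OF _ fin] by blast
  have af: "coord (f u) a = 0" if "u \<in> cube m" for u
    using a' that by (auto simp: supp_def)
  have ag: "coord (g u) a = 0" if "u \<in> cube m" for u
    using a' that by (auto simp: supp_def)
  have "\<exists>\<alpha>. pathin ?X \<alpha> \<and> \<alpha> 0 = vertex_point A a \<and> \<alpha> 1 = f (\<lambda>_. 0)"
    using path_connected_realization[OF conn] vertex_point_in_topspace[OF A a] f0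
    unfolding path_connected_space_def by blast
  then obtain \<alpha> where \<alpha>: "continuous_map \<I> ?X \<alpha>" "\<alpha> 0 = vertex_point A a" "\<alpha> 1 = f (\<lambda>_. 0)"
    unfolding pathin_def by blast
  have "(\<lambda>_. 0) \<in> cube_boundary m"
    using m1 zero_in_cube by (auto simp: cube_boundary_def intro!: exI[of _ 0])
  then have \<alpha>g: "\<alpha> 1 = g (\<lambda>_. 0)"
    using \<alpha>(3) fg by simp
  let ?Hf = "cone_homotopy A a \<alpha> f" and ?Hg = "cone_homotopy A a \<alpha> g"
  note cf = A E1 E2 a f af \<alpha>
  note cg = A E1 E2 a g ag \<alpha>(1,2) \<alpha>g
  have contf: "continuous_map (prod_topology \<I> ?D) ?X (\<lambda>(s, u). ?Hf s u)"
    by (rule continuous_map_cone_homotopy[OF cf])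
  have contg: "continuous_map (prod_topology \<I> ?D) ?X (\<lambda>(s, u). ?Hg s u)"
    by (rule continuous_map_cone_homotopy[OF cg])
  have f0: "?Hf 0 u = f u" if "u \<in> cube m" for u
    by (rule cone_homotopy_ends(1)[OF cf that])
  have g0: "?Hg 0 u = g u" if "u \<in> cube m" for u
    by (rule cone_homotopy_ends(1)[OF cg that])
  have f1: "?Hf 1 u = vertex_point A a" if "u \<in> cube m" for u
    by (rule cone_homotopy_ends(2)[OF cf that])
  have g1: "?Hg 1 u = vertex_point A a" if "u \<in> cube m" for u
    by (rule cone_homotopy_ends(2)[OF cg that])
  let ?r = "\<lambda>u. 1 - max 0 (2 * ?N u - 1)" and ?s = "\<lambda>u. rescale m (1 / max (?N u) (1 / 2)) u"
  have hf: "homotopic_rel (cube_boundary m) ?D ?X f (\<lambda>u. ?Hf (?r u) (?s u))"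
    by (rule homotopic_rel_to_cone[OF m1 contf f0])
  have hg: "homotopic_rel (cube_boundary m) ?D ?X g (\<lambda>u. ?Hg (?r u) (?s u))"
    by (rule homotopic_rel_to_cone[OF m1 contg g0])
  have eq: "?Hg (?r u) (?s u) = ?Hf (?r u) (?s u)" if u: "u \<in> cube m" for u
  proof (cases "?N u \<le> 1 / 2")
    case True
    then have r: "?r u = 1"
      by simp
    have "0 \<le> 1 / max (?N u) (1 / 2)" "1 / max (?N u) (1 / 2) * ?N u \<le> 1"
      using True cube_norm_nonneg[OF m1, of u] by (auto simp: max_def)
    then have "?s u \<in> cube m"
      by (rule rescale_in_cube[OF m1])
    then show ?thesis
      unfolding r by (simp only: f1 g1)
  next
    case False
    then have "cube_norm m (?s u) = 1" "?s u \<in> cube m"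
      using m1 by (auto simp: cube_norm_rescale max_def intro!: rescale_in_cube)
    then have "?s u \<in> cube_boundary m"
      using cube_boundary_iff_norm[OF m1] by blast
    then show ?thesis
      using cone_homotopy_boundary[OF A m f g fg \<alpha>(1,3)] by simp
  qed
  have "homotopic_rel (cube_boundary m) ?D ?X g (\<lambda>u. ?Hf (?r u) (?s u))"
    by (rule homotopic_rel_cong[OF hg]) (use eq cube_boundary_subset[of m] in auto)
  with hf show "homotopic_rel (cube_boundary m) ?D ?X f g"
    using homotopic_rel_trans homotopic_rel_sym by blast
qed

section \<open>Simplices with prescribed faces\<close>

lemma ex1_eqD: "\<exists>!x. P x \<Longrightarrow> P a \<Longrightarrow> P b \<Longrightarrow> a = b"
  by blast

lemma extends_facesD:
  assumes "extends_faces A W \<theta> F" "B \<subset> W" "t \<in> affine_simplex B"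
  shows "F t = pt A B (\<theta> B) t"
  using assms unfolding extends_faces_def by (elim conjE allE[of _ B]) simp

lemma face_systemD:
  assumes "face_system A W \<theta>" "B \<subset> W"
  shows "\<theta> B \<in> simplices A B" "C \<subseteq> B \<Longrightarrow> bdry A B C (\<theta> B) = \<theta> C"
  using assms unfolding face_system_def by (elim allE[of _ B], simp)+

lemma supp_barycentre: "finite B \<Longrightarrow> supp (barycentre B) = B"
  by (auto simp: supp_def barycentre_def)

lemma agree_on_frontier_if_faces:
  assumes "finite W" "\<sigma> \<in> simplices A W" "extends_faces A W \<theta> F"
    and faces: "\<And>B. B \<subset> W \<Longrightarrow> B \<noteq> {} \<Longrightarrow> bdry A W B \<sigma> = \<theta> B" and t: "t \<in> simplex_frontier W"
  shows "F t = pt A W \<sigma> t"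
proof -
  obtain B where B: "B \<subset> W" "t \<in> affine_simplex B"
    using t simplex_frontier_iff[OF assms(1)] by blast
  then have "B \<noteq> {}"
    by auto
  then show ?thesis
    using extends_facesD[OF assms(3) B] pt_face[OF assms(2) _ B(2)] faces[OF B(1)] B(1) by auto
qed

text \<open>The carrier of an interior point of a face recovers the face.\<close>

lemma straightened_faces:
  assumes A: "multicomplex A" and W: "finite W" and S: "straightened A W F \<sigma>"
    and fs: "face_system A W \<theta>" and F: "extends_faces A W \<theta> F" and B: "B \<subset> W" "B \<noteq> {}"
  shows "bdry A W B \<sigma> = \<theta> B"
proof -
  let ?b = "barycentre B"
  have fB: "finite B"
    using B(1) W finite_subset by blast
  have b: "?b \<in> affine_simplex B"
    by (rule barycentre_in_affine_simplex[OF fB B(2)])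
  have bW: "?b \<in> simplex_frontier W"
    using b B(1) simplex_frontier_iff[OF W] by blast
  have bA: "?b \<in> affine_simplex W"
    using bW simplex_frontier_subset by blast
  have \<sigma>: "\<sigma> \<in> simplices A W"
    and hr: "homotopic_rel (simplex_frontier W) (top_of_set (affine_simplex W)) (realization A) F (pt A W \<sigma>)"
    using S by (auto simp: straightened_def)
  note \<theta>B = face_systemD(1)[OF fs B(1)]
  have "pt A W \<sigma> ?b = pt A B (\<theta> B) ?b"
    using homotopic_rel_agree[OF hr bW] extends_facesD[OF F B(1) b] by simp
  then have "bdry A W (supp ?b) \<sigma> = bdry A B (supp ?b) (\<theta> B)"
    using pt_eq_iff[OF A \<sigma> \<theta>B bA b] by simp
  then show ?thesis
    using bdry_self[OF A \<theta>B] by (simp add: supp_barycentre[OF fB])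
qed

text \<open>A simplex with the prescribed faces has the prescribed frontier values, and those determine the
  map up to homotopy.\<close>

lemma straightened_if_faces:
  assumes filling: "unique_simplex_filling (realization A) W" and W: "finite W"
    and \<sigma>: "\<sigma> \<in> simplices A W" and F: "extends_faces A W \<theta> F"
    and faces: "\<And>B. B \<subset> W \<Longrightarrow> B \<noteq> {} \<Longrightarrow> bdry A W B \<sigma> = \<theta> B"
  shows "straightened A W F \<sigma>"
proof -
  have "continuous_map (top_of_set (affine_simplex W)) (realization A) F"
    using F by (simp add: extends_faces_def)
  then have "homotopic_rel (simplex_frontier W) (top_of_set (affine_simplex W)) (realization A) F (pt A W \<sigma>)"
    using filling continuous_map_cell[OF \<sigma>] agree_on_frontier_if_faces[OF W \<sigma> F faces]
    unfolding unique_simplex_filling_def by blast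
  then show ?thesis
    using \<sigma> by (simp add: straightened_def)
qed

text \<open>A path is a map of the affine simplex with two vertices.\<close>

lemma straightened_edge_iff:
  assumes vw: "v \<noteq> w"
  shows "straightened A {v, w} F \<epsilon> \<longleftrightarrow> \<epsilon> \<in> simplices A {v, w} \<and>
    homotopic_rel {0, 1} \<I> (realization A) (\<lambda>s. F (seg s (indicator {v}) (indicator {w}))) (edge_path A v w \<epsilon>)"
proof -
  let ?k = "\<lambda>s. seg s (indicator {v}) (indicator {w} :: 'a \<Rightarrow> real)"
  have i: "indicator {v} \<in> affine_simplex {v, w}" "indicator {w} \<in> affine_simplex {v, w}"
    by (auto intro: indicator_in_affine_simplex)
  have fr: "indicator {v} \<in> simplex_frontier {v, w}" "indicator {w} \<in> simplex_frontier {v, w}"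
    using vw by (auto intro: indicator_in_frontier)
  have k: "continuous_map \<I> (top_of_set (affine_simplex {v, w})) ?k"
    using i by (auto intro!: continuous_on_seg continuous_intros seg_in_affine_simplex)
  have param: "?k (t w) = t" if "t \<in> affine_simplex {v, w}" for t
    using affine_simplex_edge[OF that vw] by simp
  have c: "continuous_map (top_of_set (affine_simplex {v, w})) \<I> (\<lambda>t. t w)"
    using affine_simplex_nonneg affine_simplex_le_1
    by (auto intro!: continuous_on_subset[OF continuous_on_product_coordinates])
  have ends: "t w \<in> {0, 1}" if "t \<in> simplex_frontier {v, w}" for t
  proof -
    have "t v + t w = 1" "t v = 0 \<or> t w = 0"
      using that vw by (auto simp: simplex_frontier_def affine_simplex_def)
    then show ?thesis
      by auto
  qed
  show ?thesis
    unfolding straightened_def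
  proof (intro conj_cong refl iffI)
    assume "homotopic_rel (simplex_frontier {v, w}) (top_of_set (affine_simplex {v, w})) (realization A) F (pt A {v, w} \<epsilon>)"
    then show "homotopic_rel {0, 1} \<I> (realization A) (\<lambda>s. F (?k s)) (edge_path A v w \<epsilon>)"
      by (rule homotopic_rel_compose_right[OF _ k]) (use fr in \<open>auto simp: edge_path_def\<close>)
  next
    assume "homotopic_rel {0, 1} \<I> (realization A) (\<lambda>s. F (?k s)) (edge_path A v w \<epsilon>)"
    then show "homotopic_rel (simplex_frontier {v, w}) (top_of_set (affine_simplex {v, w})) (realization A) F (pt A {v, w} \<epsilon>)"
      by (rule homotopic_rel_compose_right[OF _ c])
        (use ends param simplex_frontier_subset[of "{v, w}"] in \<open>auto simp: edge_path_def\<close>)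
  qed
qed

text \<open>Evaluating a point in its carrier makes the maps on the facets agree on overlaps, so they can be
  pasted along the finitely many closed facets.\<close>

lemma continuous_map_frontier_faces:
  assumes A: "multicomplex A" and W: "finite W" and fs: "face_system A W \<theta>"
  shows "continuous_map (top_of_set (simplex_frontier W)) (realization A) (\<lambda>t. pt A (supp t) (\<theta> (supp t)) t)"
    and "\<And>B t. B \<subset> W \<Longrightarrow> t \<in> affine_simplex B \<Longrightarrow> pt A (supp t) (\<theta> (supp t)) t = pt A B (\<theta> B) t"
proof -
  show eq: "pt A (supp t) (\<theta> (supp t)) t = pt A B (\<theta> B) t" if B: "B \<subset> W" and t: "t \<in> affine_simplex B" for B t
    using pt_face[OF face_systemD(1)[OF fs B] supp_subset[OF t] affine_simplex_self_supp[OF t]]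
      face_systemD(2)[OF fs B supp_subset[OF t]] by simp
  let ?T = "\<lambda>v. {t \<in> simplex_frontier W. t v = 0}"
  have T: "?T v = affine_simplex (W - {v})" if "v \<in> W" for v
    using affine_simplex_restrict_iff[of "W - {v}" W] that W by (auto simp: simplex_frontier_def)
  show "continuous_map (top_of_set (simplex_frontier W)) (realization A) (\<lambda>t. pt A (supp t) (\<theta> (supp t)) t)"
  proof (rule pasting_lemma_closed[where I=W and T="?T" and f="\<lambda>v t. pt A (supp t) (\<theta> (supp t)) t"])
    fix v assume v: "v \<in> W"
    have "closed {t :: 'a \<Rightarrow> real. t v = 0}"
      by (intro closed_Collect_eq continuous_on_const continuous_on_product_coordinates)
    then have "closedin (top_of_set (simplex_frontier W)) (simplex_frontier W \<inter> {t. t v = 0})"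
      by (rule closedin_closed_Int)
    then show "closedin (top_of_set (simplex_frontier W)) (?T v)"
      by (simp add: Int_def)
    have Wv: "W - {v} \<subset> W"
      using v by blast
    have "?T v \<subseteq> simplex_frontier W"
      by blast
    then have sub: "subtopology (top_of_set (simplex_frontier W)) (?T v) = top_of_set (affine_simplex (W - {v}))"
      by (simp only: subtopology_subtopology Int_absorb1 T[OF v])
    have "continuous_map (top_of_set (affine_simplex (W - {v}))) (realization A) (pt A (W - {v}) (\<theta> (W - {v})))"
      by (rule continuous_map_cell[OF face_systemD(1)[OF fs Wv]])
    then show "continuous_map (subtopology (top_of_set (simplex_frontier W)) (?T v)) (realization A)
        (\<lambda>t. pt A (supp t) (\<theta> (supp t)) t)"
      unfolding sub by (rule continuous_map_eq) (use eq[OF Wv] in simp)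
  next
    fix t assume "t \<in> topspace (top_of_set (simplex_frontier W))"
    then show "\<exists>j. j \<in> W \<and> t \<in> ?T j \<and> pt A (supp t) (\<theta> (supp t)) t = pt A (supp t) (\<theta> (supp t)) t"
      by (auto simp: simplex_frontier_def)
  qed (use W in simp_all)
qed

section \<open>From straightening to the combinatorial conditions\<close>

text \<open>The simplex on the empty set below a point does not change within a cell, hence not at all if
  the space is connected. This is what makes two vertices a system of faces of an edge.\<close>

lemma empty_face_constant:
  assumes A: "multicomplex A" and conn: "connected_space (realization A)" and v: "v \<in> verts A" and w: "w \<in> verts A"
  shows "bdry A {w} {} (the_elem (simplices A {w})) = bdry A {v} {} (the_elem (simplices A {v}))"
proof -
  define P where "P = (\<lambda>p. bdry A (supp (coord p)) {} (carrier_simplex A p) = bdry A {v} {} (the_elem (simplices A {v})))"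
  have cell: "P (pt A B \<sigma> t) \<longleftrightarrow> bdry A B {} \<sigma> = bdry A {v} {} (the_elem (simplices A {v}))"
    if "\<sigma> \<in> simplices A B" "t \<in> affine_simplex B" for B \<sigma> t
    using bdry_bdry[OF A that(1) supp_subset[OF that(2)], of "{}"] A by (simp add: P_def carrier_simplex_pt)
  have ind: "indicator {x} \<in> affine_simplex {x}" for x :: 'a
    by (rule indicator_in_affine_simplex) auto
  have "P (vertex_point A w)"
  proof (rule connected_realization_cellwise_constant[OF conn, where p="vertex_point A v"])
    show "P (pt A B \<sigma> u)" if "\<sigma> \<in> simplices A B" "t \<in> affine_simplex B" "u \<in> affine_simplex B" "P (pt A B \<sigma> t)" for B \<sigma> t u
      using that cell by simp
    show "P (vertex_point A v)"
      unfolding vertex_point_eq using cell[OF vertex_simplex[OF A v] ind] by simp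
  qed (use vertex_point_in_topspace[OF A] v w in auto)
  then show ?thesis
    unfolding vertex_point_eq using cell[OF vertex_simplex[OF A w] ind] by simp
qed

lemma unique_edges_if_straightening:
  assumes A: "multicomplex A" and conn: "connected_space (realization A)"
    and S: "\<And>W \<theta> F. finite W \<Longrightarrow> card W \<ge> 2 \<Longrightarrow> W \<subseteq> verts A \<Longrightarrow> face_system A W \<theta> \<Longrightarrow>
      extends_faces A W \<theta> F \<Longrightarrow> \<exists>!\<sigma>. straightened A W F \<sigma>"
  shows "unique_edges A"
  unfolding unique_edges_def
proof (intro ballI allI impI, elim conjE)
  let ?x = "\<lambda>v. the_elem (simplices A {v})"
  fix v w \<gamma>
  assume v: "v \<in> verts A" and w: "w \<in> verts A" and vw: "v \<noteq> w" and \<gamma>: "pathin (realization A) \<gamma>"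
    and ends: "\<gamma> 0 = vertex_point A v" "\<gamma> 1 = vertex_point A w"
  let ?W = "{v, w}"
  define \<theta> where "\<theta> = (\<lambda>B. if B = {} then bdry A {v} {} (?x v) else the_elem (simplices A B))"
  define F where "F = (\<lambda>t :: 'a \<Rightarrow> real. \<gamma> (t w))"
  have proper: "B = {} \<or> B = {v} \<or> B = {w}" if "B \<subset> ?W" for B
    using that by blast
  have mem: "\<theta> B \<in> simplices A B" if "B \<subset> ?W" for B
    using proper[OF that] vertex_simplex[OF A v] vertex_simplex[OF A w] bdry_simplex[OF A vertex_simplex[OF A v], of "{}"]
    by (auto simp: \<theta>_def)
  have fs: "face_system A ?W \<theta>"
    unfolding face_system_def
  proof (intro allI impI conjI)
    fix B C assume B: "B \<subset> ?W" and C: "C \<subseteq> B"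
    show "bdry A B C (\<theta> B) = \<theta> C"
    proof (cases "C = B")
      case True
      then show ?thesis
        using bdry_self[OF A mem[OF B]] by simp
    next
      case False
      then have "C = {}" "B = {v} \<or> B = {w}"
        using proper[OF B] C by auto
      then show ?thesis
        using empty_face_constant[OF A conn v w] by (auto simp: \<theta>_def)
    qed
  qed (rule mem)
  have c: "continuous_map (top_of_set (affine_simplex ?W)) \<I> (\<lambda>t. t w)"
    using affine_simplex_nonneg affine_simplex_le_1
    by (auto intro!: continuous_on_subset[OF continuous_on_product_coordinates])
  have "continuous_map (top_of_set (affine_simplex ?W)) (realization A) F"
    using continuous_map_compose[OF c] \<gamma> by (simp add: pathin_def F_def o_def)
  moreover have "F t = pt A B (\<theta> B) t" if B: "B \<subset> ?W" and t: "t \<in> affine_simplex B" for B t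
  proof -
    have "B \<noteq> {}"
      using t by auto
    then consider "B = {v}" "t = indicator {v}" | "B = {w}" "t = indicator {w}"
      using proper[OF B] t affine_simplex_singleton by fastforce
    then show ?thesis
      by cases (use vw ends in \<open>simp_all add: F_def \<theta>_def vertex_point_eq\<close>)
  qed
  ultimately have F: "extends_faces A ?W \<theta> F"
    by (simp add: extends_faces_def)
  have "seg s (indicator {v}) (indicator {w}) w = s" for s
    using vw by (simp add: seg_def)
  then have \<gamma>': "(\<lambda>s. F (seg s (indicator {v}) (indicator {w}))) = \<gamma>"
    by (simp add: F_def)
  have "\<exists>!\<sigma>. straightened A ?W F \<sigma>"
    by (rule S[OF _ _ _ fs F]) (use v w vw in auto)
  then show "\<exists>!\<epsilon>. \<epsilon> \<in> simplices A {v, w} \<and> homotopic_rel {0, 1} \<I> (realization A) \<gamma> (edge_path A v w \<epsilon>)"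
    unfolding straightened_edge_iff[OF vw] \<gamma>' .
qed

lemma low_faces_edge: "v \<noteq> w \<Longrightarrow> low_faces A a \<epsilon> {v, w} = \<epsilon> {v, w}"
  by (auto simp: low_faces_def is_singleton_def doubleton_eq_iff)

text \<open>The induction hypothesis provides the proper faces with at least three vertices, and the edges
  provide the smaller ones. The frontier map they define extends: for a triangle this is the
  hypothesis, otherwise the facets have dimension at least 2 and their fillings are unique up to
  homotopy. The extension is straightened to the simplex sought.\<close>

lemma unique_filling_step:
  assumes A: "multicomplex A"
    and S: "\<And>W \<theta> F. finite W \<Longrightarrow> card W \<ge> 2 \<Longrightarrow> W \<subseteq> verts A \<Longrightarrow> face_system A W \<theta> \<Longrightarrow>
      extends_faces A W \<theta> F \<Longrightarrow> \<exists>!\<sigma>. straightened A W F \<sigma>"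
    and filling: "\<And>B :: 'v set. finite B \<Longrightarrow> card B \<ge> 3 \<Longrightarrow> unique_simplex_filling (realization A) B"
    and W: "finite W" "W \<subseteq> verts A" "card W \<ge> 3" and \<epsilon>: "edge_system A W \<epsilon>"
    and tri: "\<And>T. T \<subseteq> W \<Longrightarrow> card T = 3 \<Longrightarrow> filled_triangle A T \<epsilon>"
    and IH: "\<And>B. B \<subset> W \<Longrightarrow> card B \<ge> 3 \<Longrightarrow>
      \<exists>!\<sigma>. \<sigma> \<in> simplices A B \<and> (\<forall>v\<in>B. \<forall>w\<in>B. v \<noteq> w \<longrightarrow> bdry A B {v, w} \<sigma> = \<epsilon> {v, w})"
  shows "\<exists>!\<sigma>. \<sigma> \<in> simplices A (W :: 'v set) \<and> (\<forall>v\<in>W. \<forall>w\<in>W. v \<noteq> w \<longrightarrow> bdry A W {v, w} \<sigma> = \<epsilon> {v, w})"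
proof -
  let ?Q = "\<lambda>B \<sigma>. \<sigma> \<in> simplices A B \<and> (\<forall>v\<in>B. \<forall>w\<in>B. v \<noteq> w \<longrightarrow> bdry A B {v, w} \<sigma> = \<epsilon> {v, w})"
  obtain a where a: "a \<in> W"
    using W(3) by fastforce
  define \<theta> where "\<theta> = (\<lambda>B. if card B \<le> 2 then low_faces A a \<epsilon> B else (THE \<sigma>. ?Q B \<sigma>))"
  have fin: "finite B" if "B \<subseteq> W" for B
    using that W(1) finite_subset by blast
  have small: "\<theta> B \<in> simplices A B" "C \<subseteq> B \<Longrightarrow> bdry A B C (\<theta> B) = \<theta> C" if B: "B \<subseteq> W" "card B \<le> 2" for B C
  proof -
    show "\<theta> B \<in> simplices A B"
      using low_faces_system(1)[OF A W(2) a \<epsilon> B(1) fin[OF B(1)] B(2)] B(2) by (simp add: \<theta>_def)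
    assume C: "C \<subseteq> B"
    then have "card C \<le> 2"
      using card_mono[OF fin[OF B(1)] C] B(2) by simp
    then show "bdry A B C (\<theta> B) = \<theta> C"
      using low_faces_system(2)[OF A W(2) a \<epsilon> B(1) fin[OF B(1)] B(2) C] B(2) by (simp add: \<theta>_def)
  qed
  have edge: "\<theta> {v, w} = \<epsilon> {v, w}" if "v \<noteq> w" for v w
    using that low_faces_edge[OF that] by (simp add: \<theta>_def)
  have big: "?Q B (\<theta> B)" if "B \<subset> W" "card B \<ge> 3" for B
    using theI'[OF IH[OF that]] that(2) by (simp add: \<theta>_def)
  have cover: "\<exists>v w. v \<noteq> w \<and> C \<subseteq> {v, w} \<and> {v, w} \<subseteq> E" if CE: "C \<subseteq> E" "E \<subseteq> W" "card C \<le> 2" "card E \<ge> 3" for C E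
  proof -
    have "2 \<le> card E"
      using CE(4) by simp
    from exists_subset_between[OF CE(3) this CE(1) fin[OF CE(2)]]
    obtain D where D: "C \<subseteq> D" "D \<subseteq> E" "card D = 2"
      by (elim exE conjE) (rule that)
    obtain v w where vw: "D = {v, w}" "v \<noteq> w"
      using D(3) by (auto simp: card_2_iff)
    show ?thesis
      using D(1,2) vw(2) unfolding vw(1) by blast
  qed
  \<comment> \<open>Faces with at least three vertices are unique by the induction hypothesis, and the others lie in an edge.\<close>
  have faces: "bdry A E C \<rho> = \<theta> C" if \<rho>: "?Q E \<rho>" and E: "E \<subseteq> W" "card E \<ge> 3" and C: "C \<subseteq> E" "C \<subset> W" for E C \<rho>
  proof (cases "card C \<le> 2")
    case True
    obtain v w where vw: "v \<noteq> w" "C \<subseteq> {v, w}" "{v, w} \<subseteq> E"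
      using cover[OF C(1) E(1) True E(2)] by blast
    have "bdry A E C \<rho> = bdry A {v, w} C (bdry A E {v, w} \<rho>)"
      using bdry_bdry[OF A conjunct1[OF \<rho>] vw(3,2)] by simp
    also have "bdry A E {v, w} \<rho> = \<theta> {v, w}"
      using \<rho> vw edge[OF vw(1)] by simp
    also have "bdry A {v, w} C (\<theta> {v, w}) = \<theta> C"
    proof (rule small(2)[OF _ _ vw(2)])
      show "{v, w} \<subseteq> W"
        using vw(3) E(1) by (rule order_trans)
    qed (simp add: card_insert_if)
    finally show ?thesis .
  next
    case False
    then have c3: "card C \<ge> 3"
      by simp
    have "?Q C (bdry A E C \<rho>)"
    proof (intro conjI ballI impI)
      show "bdry A E C \<rho> \<in> simplices A C"
        by (rule bdry_simplex[OF A conjunct1[OF \<rho>] C(1)])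
      fix v w assume vw: "v \<in> C" "w \<in> C" "v \<noteq> w"
      have "bdry A C {v, w} (bdry A E C \<rho>) = bdry A E {v, w} \<rho>"
        by (rule bdry_bdry[OF A conjunct1[OF \<rho>] C(1)]) (use vw in blast)
      moreover have "v \<in> E" "w \<in> E"
        using vw C(1) by auto
      ultimately show "bdry A C {v, w} (bdry A E C \<rho>) = \<epsilon> {v, w}"
        using \<rho> vw(3) by simp
    qed
    then show ?thesis
      by (rule ex1_eqD[OF IH[OF C(2) c3] _ big[OF C(2) c3]])
  qed
  have fs: "face_system A W \<theta>"
    unfolding face_system_def
  proof (intro allI impI conjI)
    fix B assume B: "B \<subset> W"
    show "\<theta> B \<in> simplices A B"
      using small(1)[of B] big[OF B] B by (cases "card B \<le> 2") auto
    fix C assume C: "C \<subseteq> B"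
    show "bdry A B C (\<theta> B) = \<theta> C"
    proof (cases "card B \<le> 2")
      case True
      then show ?thesis
        using small(2)[OF _ True C] B by blast
    next
      case False
      then have B3: "card B \<ge> 3"
        by simp
      show ?thesis
        by (rule faces[OF big[OF B B3] _ B3 C]) (use B C in auto)
    qed
  qed
  have "\<exists>F. extends_faces A W \<theta> F"
  proof (cases "card W = 3")
    case True
    obtain G where G: "continuous_map (top_of_set (affine_simplex W)) (realization A) G"
      and Ge: "\<And>v w t. v \<in> W \<Longrightarrow> w \<in> W \<Longrightarrow> v \<noteq> w \<Longrightarrow> t \<in> affine_simplex {v, w} \<Longrightarrow> G t = pt A {v, w} (\<epsilon> {v, w}) t"
      by (rule filled_triangleE[OF tri[OF order_refl True]]) (rule that)
    have "G t = pt A B (\<theta> B) t" if B: "B \<subset> W" and t: "t \<in> affine_simplex B" for B t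
    proof -
      have "card B \<le> 2"
        using psubset_card_mono[OF W(1) B] True by simp
      then obtain v w where vw: "v \<noteq> w" "B \<subseteq> {v, w}" "{v, w} \<subseteq> W"
        using cover[of B W] B W(3) by blast
      have c2: "card {v, w} \<le> 2"
        by (simp add: card_insert_if)
      have "t \<in> affine_simplex {v, w}"
        using affine_simplex_mono[OF vw(2)] t by auto
      then have "G t = pt A {v, w} (\<theta> {v, w}) t"
        using Ge vw edge[OF vw(1)] by simp
      also have "\<dots> = pt A B (\<theta> B) t"
        using pt_face[OF small(1)[OF vw(3) c2] vw(2) t] small(2)[OF vw(3) c2 vw(2)] by simp
      finally show ?thesis .
    qed
    then have "extends_faces A W \<theta> G"
      using G by (simp add: extends_faces_def)
    then show ?thesis
      by blast
  next
    case False
    note \<phi> = continuous_map_frontier_faces[OF A W(1) fs]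
    have aW: "insert a (W - {a}) = W"
      using a by blast
    have c: "card (W - {a}) \<ge> 3"
      using False W a by simp
    then have ne: "W - {a} \<noteq> {}"
      by (metis card.empty not_numeral_le_zero)
    have fW: "finite (W - {a})"
      using W(1) by simp
    have na: "a \<notin> W - {a}"
      by simp
    have \<phi>W: "continuous_map (top_of_set (simplex_frontier (insert a (W - {a})))) (realization A)
        (\<lambda>t. pt A (supp t) (\<theta> (supp t)) t)"
      unfolding aW by (rule \<phi>(1))
    obtain G where G: "continuous_map (top_of_set (affine_simplex W)) (realization A) G"
      and Ge: "\<And>t. t \<in> simplex_frontier W \<Longrightarrow> G t = pt A (supp t) (\<theta> (supp t)) t"
      by (rule frontier_extension[OF filling[OF fW c] fW ne na \<phi>W, unfolded aW]) (rule that)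
    have "G t = pt A B (\<theta> B) t" if B: "B \<subset> W" and t: "t \<in> affine_simplex B" for B t
    proof -
      have "t \<in> simplex_frontier W"
        using B t simplex_frontier_iff[OF W(1)] by blast
      then show ?thesis
        using Ge \<phi>(2)[OF B t] by simp
    qed
    then have "extends_faces A W \<theta> G"
      using G by (simp add: extends_faces_def)
    then show ?thesis
      by blast
  qed
  then obtain F where F: "extends_faces A W \<theta> F"
    by blast
  have "card W \<ge> 2"
    using W(3) by simp
  note S1 = S[OF W(1) this W(2) fs F]
  obtain \<sigma> where \<sigma>: "straightened A W F \<sigma>"
    using S1 by blast
  show ?thesis
  proof (rule ex1I[of _ \<sigma>])
    have "bdry A W {v, w} \<sigma> = \<epsilon> {v, w}" if vw: "v \<in> W" "w \<in> W" "v \<noteq> w" for v w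
    proof -
      have "card {v, w} < card W"
        using W(3) by (simp add: card_insert_if)
      then have "{v, w} \<noteq> W"
        by auto
      then have "{v, w} \<subset> W"
        using vw by blast
      then show ?thesis
        using straightened_faces[OF A W(1) \<sigma> fs F, of "{v, w}"] edge[OF vw(3)] by simp
    qed
    then show "?Q W \<sigma>"
      using \<sigma> by (simp add: straightened_def)
    fix \<rho> assume \<rho>: "?Q W \<rho>"
    have "straightened A W F \<rho>"
      by (rule straightened_if_faces[OF filling[OF W(1,3)] W(1) conjunct1[OF \<rho>] F])
        (use faces[OF \<rho> order_refl W(3)] in blast)
    then show "\<rho> = \<sigma>"
      by (rule ex1_eqD[OF S1 _ \<sigma>])
  qed
qed

lemma unique_fillings_if_straightening:
  assumes A: "multicomplex A"
    and S: "\<And>W \<theta> F. finite W \<Longrightarrow> card W \<ge> 2 \<Longrightarrow> W \<subseteq> verts A \<Longrightarrow> face_system A W \<theta> \<Longrightarrow>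
      extends_faces A W \<theta> F \<Longrightarrow> \<exists>!\<sigma>. straightened A W F \<sigma>"
    and filling: "\<And>B :: 'v set. finite B \<Longrightarrow> card B \<ge> 3 \<Longrightarrow> unique_simplex_filling (realization A) B"
  shows "unique_fillings (A :: ('v, 's) premulticomplex)"
proof -
  have ex: "\<exists>!\<sigma>. \<sigma> \<in> simplices A W \<and> (\<forall>v\<in>W. \<forall>w\<in>W. v \<noteq> w \<longrightarrow> bdry A W {v, w} \<sigma> = \<epsilon> {v, w})"
    if "finite W" "W \<subseteq> verts A" "card W \<ge> 3" "edge_system A W \<epsilon>"
      "\<And>T. T \<subseteq> W \<Longrightarrow> card T = 3 \<Longrightarrow> filled_triangle A T \<epsilon>" for W \<epsilon>
    using that
  proof (induction "card W" arbitrary: W rule: less_induct)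
    case less
    show ?case
    proof (rule unique_filling_step[OF A S filling less.prems])
      fix B assume B: "B \<subset> W" "card B \<ge> 3"
      show "\<exists>!\<sigma>. \<sigma> \<in> simplices A B \<and> (\<forall>v\<in>B. \<forall>w\<in>B. v \<noteq> w \<longrightarrow> bdry A B {v, w} \<sigma> = \<epsilon> {v, w})"
      proof (rule less.hyps)
        show "card B < card W"
          by (rule psubset_card_mono[OF less.prems(1) B(1)])
        show "finite B" "B \<subseteq> verts A"
          using less.prems(1,2) B(1) finite_subset by blast+
        show "edge_system A B \<epsilon>"
          using less.prems(4) B(1) unfolding edge_system_def by blast
        show "filled_triangle A T \<epsilon>" if "T \<subseteq> B" "card T = 3" for T
          by (rule less.prems(5)) (use that B(1) in auto)
      qed (rule B(2))
    qed
  qed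
  show ?thesis
    unfolding unique_fillings_def
  proof (intro allI impI, elim conjE)
    fix W \<epsilon>
    assume h: "finite W" "W \<subseteq> verts A" "card W \<ge> 3" "edge_system A W \<epsilon>"
      "\<forall>T. T \<subseteq> W \<and> card T = 3 \<longrightarrow> filled_triangle A T \<epsilon>"
    show "\<exists>!\<sigma>. \<sigma> \<in> simplices A W \<and> (\<forall>v\<in>W. \<forall>w\<in>W. v \<noteq> w \<longrightarrow> bdry A W {v, w} \<sigma> = \<epsilon> {v, w})"
      by (rule ex[OF h(1-4)]) (rule mp[OF spec[OF h(5)]], rule conjI)
  qed
qed

section \<open>From the combinatorial conditions to straightening\<close>

text \<open>Two vertices are the case of condition (1). For three or more, a simplex with the prescribed
  faces has the prescribed edges, so the only candidate is the simplex that fills these edges.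
  Its faces are the prescribed ones, again by uniqueness, and uniqueness of fillings up to
  homotopy does the rest.\<close>

lemma straightening_if_unique_edges_fillings:
  assumes A: "multicomplex A" and E1: "unique_edges A" and E2: "unique_fillings A"
    and filling: "\<And>B :: 'v set. finite B \<Longrightarrow> card B \<ge> 3 \<Longrightarrow> unique_simplex_filling (realization A) B"
    and W: "finite W" "card W \<ge> 2" "W \<subseteq> verts A" and fs: "face_system A W \<theta>" and F: "extends_faces A W \<theta> F"
  shows "\<exists>!\<sigma>. straightened (A :: ('v, 's) premulticomplex) W F \<sigma>"
proof (cases "card W = 2")
  case True
  then obtain v w where vw: "W = {v, w}" "v \<noteq> w"
    by (auto simp: card_2_iff)
  have Fc: "continuous_map (top_of_set (affine_simplex {v, w})) (realization A) F"
    using F by (simp add: extends_faces_def vw)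
  have "continuous_map \<I> (top_of_set (affine_simplex {v, w})) (\<lambda>s. seg s (indicator {v}) (indicator {w}))"
    by (auto intro!: continuous_on_seg continuous_intros seg_in_affine_simplex indicator_in_affine_simplex)
  from continuous_map_compose[OF this Fc]
  have c: "continuous_map \<I> (realization A) (\<lambda>s. F (seg s (indicator {v}) (indicator {w})))"
    by (simp add: o_def)
  have end_v: "F (indicator {x}) = vertex_point A x" if "x \<in> {v, w}" for x
  proof -
    have x: "{x} \<subset> W"
      using that vw by auto
    have "indicator {x} \<in> affine_simplex {x}"
      by (rule indicator_in_affine_simplex) auto
    then show ?thesis
      using extends_facesD[OF F x] vertex_simplex_unique[OF A face_systemD(1)[OF fs x]] by (simp add: vertex_point_eq)
  qed
  have "\<exists>!\<epsilon>. \<epsilon> \<in> simplices A {v, w} \<and> homotopic_rel {0, 1} \<I> (realization A)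
      (\<lambda>s. F (seg s (indicator {v}) (indicator {w}))) (edge_path A v w \<epsilon>)"
    by (rule unique_edgesD[OF E1 _ _ vw(2) c]) (use W(3) vw end_v in auto)
  then show ?thesis
    unfolding vw(1) straightened_edge_iff[OF vw(2)] .
next
  case False
  then have c3: "card W \<ge> 3"
    using W(2) by simp
  have pair: "{v, w} \<subset> W" if "v \<in> W" "w \<in> W" for v w
  proof -
    have "card {v, w} < card W"
      using c3 by (simp add: card_insert_if)
    then have "{v, w} \<noteq> W"
      by auto
    then show ?thesis
      using that by blast
  qed
  have es: "edge_system A W \<theta>"
    unfolding edge_system_def using face_systemD(1)[OF fs pair] by blast
  have Fe: "F t = pt A {v, w} (\<theta> {v, w}) t" if "v \<in> W" "w \<in> W" "t \<in> affine_simplex {v, w}" for v w t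
    by (rule extends_facesD[OF F pair[OF that(1,2)] that(3)])
  have tri: "filled_triangle A T \<theta>" if T: "T \<subseteq> W" for T
    unfolding filled_triangle_def
  proof (intro exI conjI ballI impI)
    have "continuous_map (top_of_set (affine_simplex W)) (realization A) F"
      using F by (simp add: extends_faces_def)
    then show "continuous_map (top_of_set (affine_simplex T)) (realization A) F"
      by (rule continuous_map_from_subtopology_mono[OF _ affine_simplex_mono[OF T W(1)]])
    show "F t = pt A {v, w} (\<theta> {v, w}) t" if "v \<in> T" "w \<in> T" "t \<in> affine_simplex {v, w}" for v w t
      using that T by (intro Fe) auto
  qed
  have ex1: "\<exists>!\<sigma>. \<sigma> \<in> simplices A B \<and> (\<forall>v\<in>B. \<forall>w\<in>B. v \<noteq> w \<longrightarrow> bdry A B {v, w} \<sigma> = \<theta> {v, w})"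
    if B: "B \<subseteq> W" "card B \<ge> 3" for B
  proof (rule unique_fillingsD[OF E2])
    show "finite B" "B \<subseteq> verts A"
      using B(1) W finite_subset by blast+
    show "edge_system A B \<theta>"
      using es B(1) unfolding edge_system_def by blast
    show "filled_triangle A T \<theta>" if "T \<subseteq> B" for T
      using that B(1) by (intro tri) blast
  qed (rule B(2))
  obtain \<sigma> where \<sigma>: "\<sigma> \<in> simplices A W"
    and \<sigma>e: "\<forall>v\<in>W. \<forall>w\<in>W. v \<noteq> w \<longrightarrow> bdry A W {v, w} \<sigma> = \<theta> {v, w}"
    using ex1_implies_ex[OF ex1[OF order_refl c3]] by (elim exE conjE) (rule that)
  have faces: "bdry A W B \<sigma> = \<theta> B" if B: "B \<subset> W" "B \<noteq> {}" for B
  proof -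
    have BW: "B \<subseteq> W" and fB: "finite B"
      using B(1) W(1) finite_subset by auto
    have b: "bdry A W B \<sigma> \<in> simplices A B"
      by (rule bdry_simplex[OF A \<sigma> BW])
    have "card B = 1 \<or> card B = 2 \<or> card B \<ge> 3"
      using B(2) fB by (cases "card B") auto
    then consider v where "B = {v}" | v w where "B = {v, w}" "v \<noteq> w" | "card B \<ge> 3"
      by (auto simp: card_1_singleton_iff card_2_iff)
    then show ?thesis
    proof cases
      case 1
      then show ?thesis
        using vertex_simplex_unique[OF A] b face_systemD(1)[OF fs B(1)] by metis
    next
      case 2
      then show ?thesis
        using \<sigma>e BW by simp
    next
      case 3
      have "bdry A B {v, w} (bdry A W B \<sigma>) = \<theta> {v, w}" if "v \<in> B" "w \<in> B" "v \<noteq> w" for v w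
      proof -
        have "bdry A B {v, w} (bdry A W B \<sigma>) = bdry A W {v, w} \<sigma>"
          by (rule bdry_bdry[OF A \<sigma> BW]) (use that in blast)
        then show ?thesis
          using \<sigma>e that BW by auto
      qed
      moreover have "bdry A B {v, w} (\<theta> B) = \<theta> {v, w}" if "v \<in> B" "w \<in> B" for v w
        by (rule face_systemD(2)[OF fs B(1)]) (use that in blast)
      ultimately show ?thesis
        using b face_systemD(1)[OF fs B(1)] by (intro ex1_eqD[OF ex1[OF BW 3]]) blast+
    qed
  qed
  show ?thesis
  proof (rule ex1I[of _ \<sigma>])
    show "straightened A W F \<sigma>"
      by (rule straightened_if_faces[OF filling[OF W(1) c3] W(1) \<sigma> F faces])
    fix \<rho> assume \<rho>: "straightened A W F \<rho>"
    have "bdry A W {v, w} \<rho> = \<theta> {v, w}" if "v \<in> W" "w \<in> W" for v w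
      by (rule straightened_faces[OF A W(1) \<rho> fs F pair[OF that]]) simp
    moreover have "\<rho> \<in> simplices A W"
      using \<rho> by (simp add: straightened_def)
    ultimately show "\<rho> = \<sigma>"
      using \<sigma> \<sigma>e by (intro ex1_eqD[OF ex1[OF order_refl c3]]) blast+
  qed
qed

section \<open>Asphericity and the theorem\<close>

lemma spheroid_class_eq_iff:
  assumes "f \<in> spheroids X x m" "g \<in> spheroids X x m"
  shows "spheroid_class X m f = spheroid_class X m g \<longleftrightarrow>
    homotopic_rel (cube_boundary m) (top_of_set (cube m)) X f g"
proof -
  have top: "cube_topology m = top_of_set (cube m)"
    by (simp add: euclidean_product_topology)
  have g: "continuous_map (top_of_set (cube m)) X g"
    using assms(2) by (simp add: spheroids_def top)
  show ?thesis
  proof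
    assume "spheroid_class X m f = spheroid_class X m g"
    then have "g \<in> spheroid_class X m f"
      using homotopic_rel_refl[OF g] by (simp add: spheroid_class_def top)
    then show "homotopic_rel (cube_boundary m) (top_of_set (cube m)) X f g"
      by (simp add: spheroid_class_def top)
  next
    assume fg: "homotopic_rel (cube_boundary m) (top_of_set (cube m)) X f g"
    show "spheroid_class X m f = spheroid_class X m g"
      using homotopic_rel_trans[OF fg] homotopic_rel_trans[OF homotopic_rel_sym[OF fg]]
      by (auto simp: spheroid_class_def top)
  qed
qed

lemma const_spheroid: "x \<in> topspace X \<Longrightarrow> (\<lambda>_. x) \<in> spheroids X x m"
  by (simp add: spheroids_def)

text \<open>Higher homotopy groups are trivial at every base point, which means that all spheroids contract.\<close>

lemma unique_cube_filling_if_aspherical: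
  assumes "aspherical A" "m \<ge> 2"
  shows "unique_cube_filling (realization A) m"
proof (rule unique_cube_filling_if_spheroids_trivial)
  let ?X = "realization A"
  fix x S assume x: "x \<in> topspace ?X" and S: "S \<in> spheroids ?X x m"
  have "carrier (homotopy_group ?X x m) = {one (homotopy_group ?X x m)}"
    using assms x unfolding aspherical_def eilenberg_maclane_def by auto
  then have "spheroid_class ?X m ` spheroids ?X x m = {spheroid_class ?X m (\<lambda>_. x)}"
    by (simp add: homotopy_group_def)
  then have "spheroid_class ?X m S = spheroid_class ?X m (\<lambda>_. x)"
    using S by blast
  then show "homotopic_rel (cube_boundary m) (top_of_set (cube m)) ?X S (\<lambda>_. x)"
    using spheroid_class_eq_iff[OF S const_spheroid[OF x]] by simp
qed (use assms in simp)

lemma aspherical_if_unique_cube_filling: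
  assumes path: "path_connected_space (realization A)"
    and filling: "\<And>m. m \<ge> 2 \<Longrightarrow> unique_cube_filling (realization A) m"
  shows "aspherical A"
  unfolding aspherical_def eilenberg_maclane_def
proof (intro ballI conjI allI impI)
  let ?X = "realization A"
  fix x assume x: "x \<in> topspace ?X"
  then show "x \<in> topspace ?X" .
  show "path_connected_space ?X"
    by (rule path)
  show "homotopy_group ?X x 1 \<cong> homotopy_group ?X x 1"
    by (rule iso_refl)
  fix m :: nat assume "m \<ge> 1" "m \<noteq> 1"
  then have m: "m \<ge> 2"
    by simp
  have "spheroid_class ?X m S = spheroid_class ?X m (\<lambda>_. x)" if S: "S \<in> spheroids ?X x m" for S
  proof -
    have "continuous_map (top_of_set (cube m)) ?X S" "\<forall>u\<in>cube_boundary m. S u = x"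
      using S by (simp_all add: spheroids_def euclidean_product_topology)
    then have "homotopic_rel (cube_boundary m) (top_of_set (cube m)) ?X S (\<lambda>_. x)"
      using filling[OF m] x unfolding unique_cube_filling_def by simp
    then show ?thesis
      using spheroid_class_eq_iff[OF S const_spheroid[OF x]] by simp
  qed
  then have "spheroid_class ?X m ` spheroids ?X x m = {spheroid_class ?X m (\<lambda>_. x)}"
    using const_spheroid[OF x, of m] by blast
  then show "carrier (homotopy_group ?X x m) = {one (homotopy_group ?X x m)}"
    by (simp add: homotopy_group_def)
qed

lemma complete_minimal_iff_straightening:
  assumes "multicomplex A"
  shows "complete_multicomplex A \<and> minimal_multicomplex A \<longleftrightarrow>
    (\<forall>W \<theta> F. finite W \<and> card W \<ge> 2 \<and> W \<subseteq> verts A \<and> face_system A W \<theta> \<and> extends_faces A W \<theta> F \<longrightarrow>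
      (\<exists>!\<sigma>. straightened A W F \<sigma>))"
  unfolding complete_multicomplex_iff[OF assms] minimal_multicomplex_iff[OF assms] ex1_iff_ex_Uniq
  by blast

theorem proposition3p5p2:
  fixes A :: "('v, 's) premulticomplex"
  assumes "multicomplex A" and "large A" and "connected_space (realization A)"
  shows "complete_multicomplex A \<and> minimal_multicomplex A \<and> aspherical A \<longleftrightarrow>
    (\<forall>v\<^sub>0\<in>verts A. \<forall>v\<^sub>1\<in>verts A. \<forall>\<gamma>.
        v\<^sub>0 \<noteq> v\<^sub>1 \<and> pathin (realization A) \<gamma> \<and>
        \<gamma> 0 = vertex_point A v\<^sub>0 \<and> \<gamma> 1 = vertex_point A v\<^sub>1 \<longrightarrow>
        (\<exists>!\<gamma>'. simplicial_embedding (\<Delta> 1) A \<gamma>' \<and>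
           homotopic_rel {0, 1} (top_of_set {0..1}) (realization A)
             \<gamma> (realization_map A \<gamma>' \<circ> edge_param))) \<and>
    (\<forall>n\<ge>2. \<forall>f.
        simplicial_embedding (skeleton 1 (\<Delta> n)) A f \<and>
        (\<forall>T. T \<subseteq> {..n} \<and> card T = 3 \<longrightarrow>
           null_homotopic (realization (simplex_boundary T)) (realization A)
             (realization_map A f \<circ>
              realization_map (skeleton 1 (\<Delta> n)) (inclusion (simplex_boundary T)))) \<longrightarrow>
        (\<exists>!f'. simplicial_embedding (\<Delta> n) A f' \<and> extends_smap (skeleton 1 (\<Delta> n)) f f'))"
proof -
  note A = assms(1)
  have filling: "unique_simplex_filling (realization A) (B :: 'v set)"
    if cube: "\<And>m. m \<ge> 2 \<Longrightarrow> unique_cube_filling (realization A) m" and B: "finite B" "card B \<ge> 3" for B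
  proof (rule unique_simplex_filling_if_cube[OF cube])
    show "2 \<le> card B - 1" "1 \<le> card B - 1" "card B = Suc (card B - 1)"
      using B(2) by auto
  qed (rule B(1))
  have "complete_multicomplex A \<and> minimal_multicomplex A \<and> aspherical A \<longleftrightarrow> unique_edges A \<and> unique_fillings A"
  proof
    assume cma: "complete_multicomplex A \<and> minimal_multicomplex A \<and> aspherical A"
    then have "complete_multicomplex A \<and> minimal_multicomplex A" and asph: "aspherical A"
      by blast+
    note S' = this(1)[unfolded complete_minimal_iff_straightening[OF A]]
    have S: "\<exists>!\<sigma>. straightened A W F \<sigma>"
      if "finite W" "card W \<ge> 2" "W \<subseteq> verts A" "face_system A W \<theta>" "extends_faces A W \<theta> F" for W \<theta> F
      by (rule S'[THEN spec[of _ W], THEN spec[of _ \<theta>], THEN spec[of _ F], THEN mp]) (intro conjI that)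
    have fill: "unique_simplex_filling (realization A) B" if "finite B" "card B \<ge> 3" for B :: "'v set"
      by (rule filling[OF unique_cube_filling_if_aspherical[OF asph] that])
    show "unique_edges A \<and> unique_fillings A"
    proof
      show "unique_edges A"
        by (rule unique_edges_if_straightening[OF A assms(3) S])
      show "unique_fillings A"
        by (rule unique_fillings_if_straightening[OF A S fill])
    qed
  next
    assume E: "unique_edges A \<and> unique_fillings A"
    have cube: "unique_cube_filling (realization A) m" if "m \<ge> 2" for m
      by (rule unique_cube_filling_if_unique_edges_fillings[OF assms conjunct1[OF E] conjunct2[OF E] that])
    have str: "\<exists>!\<sigma>. straightened A W F \<sigma>"
      if "finite W" "card W \<ge> 2" "W \<subseteq> verts A" "face_system A W \<theta>" "extends_faces A W \<theta> F" for W \<theta> F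
      by (rule straightening_if_unique_edges_fillings[OF A conjunct1[OF E] conjunct2[OF E] filling[OF cube] that])
    have "complete_multicomplex A \<and> minimal_multicomplex A"
      unfolding complete_minimal_iff_straightening[OF A] by (intro allI impI, elim conjE) (rule str)
    moreover have "aspherical A"
      by (rule aspherical_if_unique_cube_filling[OF path_connected_realization[OF assms(3)] cube])
    ultimately show "complete_multicomplex A \<and> minimal_multicomplex A \<and> aspherical A"
      by blast
  qed
  then show ?thesis
    unfolding unique_edges_iff[OF A] unique_fillings_iff[OF A] .
qed

end
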